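(* Let $(U,A)$ be a left bialgebroid which is left Hopf, and let $M$ be a stable anti Yetter-Drinfel'd contramodule over $U$ with contraaction $\gamma$. Then $\operatorname{Hom}_U(-,M)$ yields a trace functor $U\text{-}\mathbf{Mod}\to k\text{-}\mathbf{Mod}$, which in particular implies an isomorphism $$\operatorname{Hom}_U(X\otimes_A Y,M)\simeq\operatorname{Hom}_U(Y\otimes_A X,M)$$ for any $X,Y\in U\text{-}\mathbf{Mod}$. Its explicit form, $(\operatorname{tr}_{X,Y}f)(y\otimes_A x)=\gamma\big(u\mapsto f(x\otimes_A uy)\big)$, induces (through the isomorphisms $\theta,\eta,\chi$ recorded in the context, i.e. $\boldsymbol\tau=\theta\circ\chi\circ\operatorname{tr}\circ\eta^{-1}\circ\theta^{-1}$) the cocyclic operator $$(\boldsymbol\tau f)(u^1,\ldots,u^q)=\gamma\Big(v\mapsto\big((u^1_{(2)}\cdots u^{q-1}_{(2)}u^q)\cdot f\big)(v,u^1_{(1)},\ldots,u^{q-1}_{(1)})\Big)$$ on the cochain complex $C^\bullet(U,M)=\operatorname{Hom}_{A^{\mathrm{op}}}(U^{\otimes_{A^{\mathrm{op}}}\bullet},M)$, where $(u\cdot f)(v^1,v^2,\ldots,v^q):=u_+f(u_-v^1,v^2,\ldots,v^q)$. If $U_{\triangleleft}$ is projective over $A$, this complex computes $\operatorname{Ext}^\bullet_U(A,M)$.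
   Context: **Bialgebroids.** Let $k$ be a commutative ring and $A$ an associative unital $k$-algebra. A left bialgebroid $(U,A)$ consists of a $k$-algebra $U$, an algebra homomorphism $s:A\to U$ (source) and an algebra antihomomorphism $t:A\to U$ (target) with commuting images, inducing four commuting $A$-actions on $U$: $a\triangleright u=s(a)u$, $u\triangleleft a=t(a)u$, $a\blacktriangleright u=ut(a)$, $u\blacktriangleleft a=us(a)$, together with a comultiplication $\Delta:U\to U_{\triangleleft}\otimes_A{}_{\triangleright}U$, $u\mapsto u_{(1)}\otimes_A u_{(2)}$ (here $t(a)u\otimes_A v=u\otimes_A s(a)v$) and a counit $\varepsilon:U\to A$ making $U$ an $A$-coring with respect to $\triangleright,\triangleleft$, such that $\Delta(u)$ satisfies $u_{(1)}t(a)\otimes_A u_{(2)}=u_{(1)}\otimes_A u_{(2)}s(a)$ for all $a\in A$, $\Delta$ is unital and multiplicative, $\varepsilon(1)=1$, and $\varepsilon(uv)=\varepsilon(us(\varepsilon(v)))=\varepsilon(ut(\varepsilon(v)))$. **Left Hopf.** $(U,A)$ is left Hopf if $\alpha_\ell:{}_{\blacktriangleright}U\otimes_{A^{\mathrm{op}}}U_{\triangleleft}\to U_{\triangleleft}\otimes_A{}_{\triangleright}U$, $u\otimes_{A^{\mathrm{op}}}v\mapsto u_{(1)}\otimes_A u_{(2)}v$, is bijective (in the source $ut(a)\otimes v=u\otimes t(a)v$). Write $u_+\otimes_{A^{\mathrm{op}}}u_-:=\alpha_\ell^{-1}(u\otimes_A 1)$. **Modules.** A left $U$-module $M$ is an $A$-bimodule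 by $a\triangleright m\triangleleft b=s(a)t(b)m$. $U\text{-}\mathbf{Mod}$ is (strict) monoidal: $N\otimes_A M$ carries the action $u(n\otimes_A m)=u_{(1)}n\otimes_A u_{(2)}m$, the unit is $A$ with $u\cdot a=\varepsilon(us(a))$. $\operatorname{Hom}_{A^{\mathrm{op}}}$ denotes right $A$-linear maps. **Contramodules.** A right $U$-contramodule is a right $A$-module $M$ with a map $\gamma:\operatorname{Hom}_{A^{\mathrm{op}}}(U_{\triangleleft},M)\to M$ (contraaction) such that $\gamma(f(s(a)\,\cdot))=\gamma(f)a$; $\gamma(u\mapsto\gamma(v\mapsto g(u\otimes_A v)))=\gamma(u\mapsto g(u_{(1)}\otimes_A u_{(2)}))$ for $g\in\operatorname{Hom}_{A^{\mathrm{op}}}(U_\triangleleft\otimes_A{}_\triangleright U,M)$; and $\gamma(u\mapsto m\varepsilon(u))=m$. It has an induced left $A$-action $am:=\gamma(u\mapsto m\varepsilon(us(a)))$. An anti Yetter-Drinfel'd (aYD) contramodule over a left Hopf algebroid is a left $U$-module and right $U$-contramodule $M$ such that the two $A$-bimodule structures coincide and $u(\gamma(f))=\gamma\big(v\mapsto u_{+(2)}f(u_-vu_{+(1)})\big)$ for all $u\in U$, $f\in\operatorname{Hom}_{A^{\mathrm{op}}}(U,M)$. It is stable if $\gamma(u\mapsto um)=m$ for all $m\in M$. **Trace functors.** For a (contravariant) functor $T$ on a monoidal category $\mathcal C$, a weak trace functor structure is a family of isomorphisms $\operatorname{tr}_{X,Y}:T(X\otimes Y)\to T(Y\otimes X)$,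 functorial in $X,Y$, such that, up to the isomorphisms induced by associativity constraints, $\operatorname{tr}_{Z,X\otimes Y}=\operatorname{tr}_{Y\otimes Z,X}\circ\operatorname{tr}_{Z\otimes X,Y}$ for all $X,Y,Z$. It is unital, and then called a trace functor, if $\operatorname{tr}_{\mathbb 1,X}$ becomes the identity of $T(X)$ under the isomorphisms $T(\mathbb 1\otimes X)\simeq T(X)\simeq T(X\otimes\mathbb 1)$ induced by the unit constraints. **The complex.** In $U^{\otimes_{A^{\mathrm{op}}}q}$ (elements written $(u^1,\ldots,u^q)$) one has $(\ldots,u^it(a),u^{i+1},\ldots)=(\ldots,u^i,t(a)u^{i+1},\ldots)$; its right $A$-action is $\triangleleft$ on the first factor; $U^{\otimes_{A^{\mathrm{op}}}0}=A$. Cofaces and codegeneracies of $C^q(U,M)$: $(\delta_0f)(u^1,\ldots,u^{q+1})=u^1f(u^2,\ldots,u^{q+1})$, $(\delta_if)(u^1,\ldots,u^{q+1})=f(u^1,\ldots,u^iu^{i+1},\ldots,u^{q+1})$ for $1\le i\le q$, $(\delta_{q+1}f)(u^1,\ldots,u^{q+1})=f(u^1,\ldots,u^qt(\varepsilon(u^{q+1})))$, $(\sigma_jf)(u^1,\ldots,u^{q-1})=f(u^1,\ldots,u^j,1,u^{j+1},\ldots,u^{q-1})$ for $0\le j\le q-1$. In degree $0$ the operator $\boldsymbol\tau$ is the identity. "Cocyclic operator" means that these data form a cocyclic $k$-module. **The isomorphisms.** $\mathrm{Bar}_q(U)=U^{\otimes_{A^{\mathrm{op}}}q+1}$ is a left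 $U$-module by left multiplication on the first factor. $\theta:\operatorname{Hom}_U(\mathrm{Bar}_q(U),M)\to\operatorname{Hom}_{A^{\mathrm{op}}}(U^{\otimes_{A^{\mathrm{op}}}q},M)$, $\theta(g)=g(1,\cdot)$, with inverse $f\mapsto\{(u^0,\ldots,u^q)\mapsto u^0f(u^1,\ldots,u^q)\}$. $\eta:\operatorname{Hom}_U(U\otimes_A U^{\otimes_{A^{\mathrm{op}}}q},M)\to\operatorname{Hom}_U(\mathrm{Bar}_q(U),M)$, $(\eta f)(v,u^1,\ldots,u^q)=f(v_{(1)}\otimes_A(v_{(2)}u^1,u^2,\ldots,u^q))$, with inverse $(\eta^{-1}g)(v\otimes_A(u^1,\ldots,u^q))=g(v_+,v_-u^1,u^2,\ldots,u^q)$. $\chi:\operatorname{Hom}_U(U^{\otimes_{A^{\mathrm{op}}}q}\otimes_A U,M)\to\operatorname{Hom}_U(\mathrm{Bar}_q(U),M)$, $(\chi f)(u^1,\ldots,u^q,v)=f((u^1_{(1)},\ldots,u^q_{(1)})\otimes_A u^1_{(2)}\cdots u^q_{(2)}v)$, with inverse $(\chi^{-1}g)((u^1,\ldots,u^q)\otimes_A v)=g(u^1_+,\ldots,u^q_+,u^q_-\cdots u^1_-v)$. Here $U^{\otimes_{A^{\mathrm{op}}}q}$ is a left $U$-module by left multiplication on the first factor and $\otimes_A$ is the monoidal product of $U\text{-}\mathbf{Mod}$; the relevant trace map is $\operatorname{tr}:\operatorname{Hom}_U(U\otimes_A U^{\otimes_{A^{\mathrm{op}}}q},M)\to\operatorname{Hom}_U(U^{\otimes_{A^{\mathrm{op}}}q}\otimes_A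 U,M)$. *)

theory Defs
  imports
    "HOL-Library.Infinite_Typeclass"
    "HOL-Algebra.Free_Abelian_Groups"
    "HOL-Algebra.AbelCoset"
    "HOL-Algebra.Module"
begin

text \<open>
  The infinite type \<open>'w\<close> plays the role of the universe of sets: the algebras \<open>A\<close>, \<open>U\<close> and all
  modules have their carriers in \<open>'w\<close>. Tensor products are quotients of free abelian groups on sets
  of pairs and are transported back into \<open>'w\<close> along an injection that exists because \<open>'w\<close> is
  infinite. Thus the modules over a ring with carrier in \<open>'w\<close> form one category closed under
  tensor products. Maps between carriers are extensional functions, so that equality of morphisms
  is equality of functions.
\<close>

section \<open>Modules, algebras, linear maps\<close>

locale k_algebra = Module.module K R + Alg: ring R for K and R +
  assumes smult_mult_left:
      "\<lbrakk>c \<in> carrier K; x \<in> carrier R; y \<in> carrier R\<rbrakk>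
        \<Longrightarrow> (c \<odot>\<^bsub>R\<^esub> x) \<otimes>\<^bsub>R\<^esub> y = c \<odot>\<^bsub>R\<^esub> (x \<otimes>\<^bsub>R\<^esub> y)"
    and smult_mult_right:
      "\<lbrakk>c \<in> carrier K; x \<in> carrier R; y \<in> carrier R\<rbrakk>
        \<Longrightarrow> x \<otimes>\<^bsub>R\<^esub> (c \<odot>\<^bsub>R\<^esub> y) = c \<odot>\<^bsub>R\<^esub> (x \<otimes>\<^bsub>R\<^esub> y)"

text \<open>Left modules over a not necessarily commutative ring (\<^locale>\<open>Module.module\<close> demands a commutative one).\<close>

locale lmodule = R: ring R + X: abelian_group X for R and X +
  assumes lsmult_closed:
      "\<lbrakk>a \<in> carrier R; x \<in> carrier X\<rbrakk> \<Longrightarrow> a \<odot>\<^bsub>X\<^esub> x \<in> carrier X"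
    and lsmult_l_distr:
      "\<lbrakk>a \<in> carrier R; b \<in> carrier R; x \<in> carrier X\<rbrakk>
        \<Longrightarrow> (a \<oplus>\<^bsub>R\<^esub> b) \<odot>\<^bsub>X\<^esub> x = a \<odot>\<^bsub>X\<^esub> x \<oplus>\<^bsub>X\<^esub> b \<odot>\<^bsub>X\<^esub> x"
    and lsmult_r_distr:
      "\<lbrakk>a \<in> carrier R; x \<in> carrier X; y \<in> carrier X\<rbrakk>
        \<Longrightarrow> a \<odot>\<^bsub>X\<^esub> (x \<oplus>\<^bsub>X\<^esub> y) = a \<odot>\<^bsub>X\<^esub> x \<oplus>\<^bsub>X\<^esub> a \<odot>\<^bsub>X\<^esub> y"
    and lsmult_assoc:
      "\<lbrakk>a \<in> carrier R; b \<in> carrier R; x \<in> carrier X\<rbrakk>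
        \<Longrightarrow> (a \<otimes>\<^bsub>R\<^esub> b) \<odot>\<^bsub>X\<^esub> x = a \<odot>\<^bsub>X\<^esub> (b \<odot>\<^bsub>X\<^esub> x)"
    and lsmult_one:
      "x \<in> carrier X \<Longrightarrow> \<one>\<^bsub>R\<^esub> \<odot>\<^bsub>X\<^esub> x = x"

definition is_linear ::
  "('r, 'a) ring_scheme \<Rightarrow> ('r, 'x, 'b) module_scheme \<Rightarrow> ('r, 'y, 'c) module_scheme \<Rightarrow> ('x \<Rightarrow> 'y) \<Rightarrow> bool"
  where "is_linear R X Y f \<longleftrightarrow>
    f \<in> hom (add_monoid X) (add_monoid Y) \<and>
    (\<forall>r\<in>carrier R. \<forall>x\<in>carrier X. f (r \<odot>\<^bsub>X\<^esub> x) = r \<odot>\<^bsub>Y\<^esub> f x)"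

definition lin_maps ::
  "('r, 'a) ring_scheme \<Rightarrow> ('r, 'x, 'b) module_scheme \<Rightarrow> ('r, 'y, 'c) module_scheme \<Rightarrow> ('x \<Rightarrow> 'y) set"
  where "lin_maps R X Y = {f \<in> extensional (carrier X). is_linear R X Y f}"

definition is_linear_iso ::
  "('r, 'a) ring_scheme \<Rightarrow> ('r, 'x, 'b) module_scheme \<Rightarrow> ('r, 'y, 'c) module_scheme \<Rightarrow> ('x \<Rightarrow> 'y) \<Rightarrow> bool"
  where "is_linear_iso R X Y f \<longleftrightarrow> is_linear R X Y f \<and> bij_betw f (carrier X) (carrier Y)"

definition modules_isomorphic ::
  "('r, 'a) ring_scheme \<Rightarrow> ('r, 'x, 'b) module_scheme \<Rightarrow> ('r, 'y, 'c) module_scheme \<Rightarrow> bool"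
  where "modules_isomorphic R X Y \<longleftrightarrow> (\<exists>f. is_linear_iso R X Y f)"

text \<open>The test modules range over the universe \<open>'w\<close>. This is no restriction when \<open>'w\<close> is infinite:
  the free \<open>R\<close>-module on the carrier of \<open>P\<close> then has an isomorphic copy in \<open>'w\<close>, and \<open>P\<close> is a direct
  summand of it as soon as identity maps lift.\<close>

definition projective :: "('w, 'a) ring_scheme \<Rightarrow> ('w, 'w) module \<Rightarrow> bool"
  where "projective R P \<longleftrightarrow> lmodule R P \<and>
    (\<forall>(X :: ('w, 'w) module) (Y :: ('w, 'w) module) p f.
       lmodule R X \<and> lmodule R Y \<and> p \<in> lin_maps R X Y \<and> p ` carrier X = carrier Y
         \<and> f \<in> lin_maps R P Y \<longrightarrow>
       (\<exists>g\<in>lin_maps R P X. \<forall>x\<in>carrier P. p (g x) = f x))"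

definition op_ring :: "('a, 'm) ring_scheme \<Rightarrow> ('a, 'm) ring_scheme"
  where "op_ring R = R\<lparr>mult := (\<lambda>x y. y \<otimes>\<^bsub>R\<^esub> x)\<rparr>"


section \<open>Tensor products inside the universe\<close>

definition enc :: "('w::infinite \<times> 'w \<Rightarrow>\<^sub>0 int) \<Rightarrow> 'w"
  where "enc = (SOME f. inj f)"

definition dec :: "'w::infinite \<Rightarrow> ('w \<times> 'w \<Rightarrow>\<^sub>0 int)"
  where "dec = inv_into UNIV enc"

lemma inj_enc: "inj (enc :: ('w::infinite \<times> 'w \<Rightarrow>\<^sub>0 int) \<Rightarrow> 'w)"
proof -
  have inf: "infinite (UNIV :: 'w set)"
    by (rule infinite_UNIV)
  have "(UNIV :: ('w \<times> 'w \<Rightarrow>\<^sub>0 int) set) = carrier (free_Abelian_group UNIV)"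
    by (auto simp: free_Abelian_group_def)
  also have "\<dots> \<approx> (UNIV :: ('w \<times> 'w) set)"
    by (rule eqpoll_free_Abelian_group_infinite) (use inf in \<open>simp add: finite_prod\<close>)
  finally have 1: "(UNIV :: ('w \<times> 'w \<Rightarrow>\<^sub>0 int) set) \<approx> (UNIV :: ('w \<times> 'w) set)" .
  have "|(UNIV :: 'w set) \<times> (UNIV :: 'w set)| =o |UNIV :: 'w set|"
    by (rule card_of_Times_same_infinite) (use inf in simp)
  then have "(UNIV :: ('w \<times> 'w) set) \<approx> (UNIV :: 'w set)"
    by (simp add: eqpoll_iff_card_of_ordIso)
  with 1 have "(UNIV :: ('w \<times> 'w \<Rightarrow>\<^sub>0 int) set) \<approx> (UNIV :: 'w set)"
    by (rule eqpoll_trans)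
  then have "\<exists>f :: ('w \<times> 'w \<Rightarrow>\<^sub>0 int) \<Rightarrow> 'w. inj f"
    by (auto simp: eqpoll_def bij_betw_def)
  then show ?thesis
    unfolding enc_def by (rule someI_ex)
qed

lemma dec_enc: "dec (enc z) = z"
  by (simp add: dec_def inj_enc)

text \<open>Relators of the tensor product of \<open>X\<close> and \<open>Y\<close> that is balanced by \<open>p a x \<otimes> y = x \<otimes> q a y\<close>
  for \<open>a \<in> I\<close>.\<close>

definition tensor_relators ::
  "'i set \<Rightarrow> ('i \<Rightarrow> 'x \<Rightarrow> 'x) \<Rightarrow> ('i \<Rightarrow> 'y \<Rightarrow> 'y)
     \<Rightarrow> ('x, 'a) ring_scheme \<Rightarrow> ('y, 'b) ring_scheme \<Rightarrow> ('x \<times> 'y \<Rightarrow>\<^sub>0 int) set"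
  where "tensor_relators I p q X Y =
    {frag_of (x \<oplus>\<^bsub>X\<^esub> x', y) - frag_of (x, y) - frag_of (x', y) | x x' y.
       x \<in> carrier X \<and> x' \<in> carrier X \<and> y \<in> carrier Y} \<union>
    {frag_of (x, y \<oplus>\<^bsub>Y\<^esub> y') - frag_of (x, y) - frag_of (x, y') | x y y'.
       x \<in> carrier X \<and> y \<in> carrier Y \<and> y' \<in> carrier Y} \<union>
    {frag_of (p a x, y) - frag_of (x, q a y) | a x y.
       a \<in> I \<and> x \<in> carrier X \<and> y \<in> carrier Y}"

text \<open>The code in \<open>'w\<close> of the class of a formal sum of pairs: an encoded representative of its coset.\<close>

definition tensor_class ::
  "'i set \<Rightarrow> ('i \<Rightarrow> 'w \<Rightarrow> 'w) \<Rightarrow> ('i \<Rightarrow> 'w \<Rightarrow> 'w)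
     \<Rightarrow> ('w::infinite, 'a) ring_scheme \<Rightarrow> ('w, 'b) ring_scheme \<Rightarrow> ('w \<times> 'w \<Rightarrow>\<^sub>0 int) \<Rightarrow> 'w"
  where "tensor_class I p q X Y z =
    (let F = free_Abelian_group (carrier X \<times> carrier Y)
     in enc (SOME z'. z' \<in> generate F (tensor_relators I p q X Y) #>\<^bsub>F\<^esub> z))"

definition tensor_group ::
  "'i set \<Rightarrow> ('i \<Rightarrow> 'w \<Rightarrow> 'w) \<Rightarrow> ('i \<Rightarrow> 'w \<Rightarrow> 'w)
     \<Rightarrow> ('w::infinite, 'a) ring_scheme \<Rightarrow> ('w, 'b) ring_scheme \<Rightarrow> 'w ring"
  where "tensor_group I p q X Y =
    \<lparr>carrier = tensor_class I p q X Y ` carrier (free_Abelian_group (carrier X \<times> carrier Y)),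
     mult = undefined, one = undefined,
     zero = tensor_class I p q X Y 0,
     add = (\<lambda>v w. tensor_class I p q X Y (dec v + dec w))\<rparr>"

text \<open>Sweedler-style evaluation: if \<open>w\<close> is the element \<open>\<Sum>\<^sub>i x\<^sub>i \<otimes> y\<^sub>i\<close> of a tensor product, then
  \<open>sw Z \<beta> w = \<Sum>\<^sub>i \<beta> x\<^sub>i y\<^sub>i\<close>, computed in \<open>Z\<close>. It is evaluated on the chosen representative of \<open>w\<close>, and
  is independent of it whenever \<open>\<beta>\<close> is biadditive and balanced. In nested sums only the total
  expression has to be balanced.\<close>

definition sw :: "('z, 'a) ring_scheme \<Rightarrow> ('w::infinite \<Rightarrow> 'w \<Rightarrow> 'z) \<Rightarrow> 'w \<Rightarrow> 'z"
  where "sw Z \<beta> w =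
    (\<Oplus>\<^bsub>Z\<^esub>p\<in>Poly_Mapping.keys (dec w). add_pow Z (Poly_Mapping.lookup (dec w) p) (\<beta> (fst p) (snd p)))"


section \<open>Left bialgebroids\<close>

record ('k, 'w) bialgebroid =
  Base :: "('k, 'w) module"
  Tot :: "('k, 'w) module"
  src :: "'w \<Rightarrow> 'w"
  tgt :: "'w \<Rightarrow> 'w"
  comul :: "'w \<Rightarrow> 'w"
  counit :: "'w \<Rightarrow> 'w"

definition regular_module :: "('k, 'w) bialgebroid \<Rightarrow> ('w, 'w) module"
  where "regular_module H =
    \<lparr>carrier = carrier (Tot H), mult = mult (Tot H), one = one (Tot H), zero = zero (Tot H),
     add = add (Tot H), smult = mult (Tot H)\<rparr>"

definition unit_module :: "('k, 'w) bialgebroid \<Rightarrow> ('w, 'w) module"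
  where "unit_module H =
    \<lparr>carrier = carrier (Base H), mult = mult (Base H), one = one (Base H), zero = zero (Base H),
     add = add (Base H), smult = (\<lambda>u a. counit H (u \<otimes>\<^bsub>Tot H\<^esub> src H a))\<rparr>"

text \<open>Right \<open>A\<close>-linear (that is, \<open>A\<^sup>o\<^sup>p\<close>-linear) maps from a \<open>U\<close>-module \<open>X\<close>, with \<open>x \<triangleleft> a = t(a)x\<close>, to an
  abelian group \<open>M\<close> with right \<open>A\<close>-action \<open>ra\<close>.\<close>

definition AopHom ::
  "('k, 'w) bialgebroid \<Rightarrow> ('w, 'w) module \<Rightarrow> ('w, 'b) ring_scheme \<Rightarrow> ('w \<Rightarrow> 'w \<Rightarrow> 'w) \<Rightarrow> ('w \<Rightarrow> 'w) set"
  where "AopHom H X M ra =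
    {f \<in> extensional (carrier X). f \<in> hom (add_monoid X) (add_monoid M) \<and>
       (\<forall>a\<in>carrier (Base H). \<forall>x\<in>carrier X. f (tgt H a \<odot>\<^bsub>X\<^esub> x) = ra (f x) a)}"

subsection \<open>The monoidal product over \<open>A\<close>\<close>

definition tclsA ::
  "('k, 'w::infinite) bialgebroid \<Rightarrow> ('w, 'w) module \<Rightarrow> ('w, 'w) module \<Rightarrow> ('w \<times> 'w \<Rightarrow>\<^sub>0 int) \<Rightarrow> 'w"
  where "tclsA H X Y = tensor_class (carrier (Base H))
     (\<lambda>a x. tgt H a \<odot>\<^bsub>X\<^esub> x) (\<lambda>a y. src H a \<odot>\<^bsub>Y\<^esub> y) X Y"

definition tgrpA ::
  "('k, 'w::infinite) bialgebroid \<Rightarrow> ('w, 'w) module \<Rightarrow> ('w, 'w) module \<Rightarrow> 'w ring"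
  where "tgrpA H X Y = tensor_group (carrier (Base H))
     (\<lambda>a x. tgt H a \<odot>\<^bsub>X\<^esub> x) (\<lambda>a y. src H a \<odot>\<^bsub>Y\<^esub> y) X Y"

definition tpA ::
  "('k, 'w::infinite) bialgebroid \<Rightarrow> ('w, 'w) module \<Rightarrow> ('w, 'w) module \<Rightarrow> 'w \<Rightarrow> 'w \<Rightarrow> 'w"
  where "tpA H X Y x y = tclsA H X Y (frag_of (x, y))"

definition tensA ::
  "('k, 'w::infinite) bialgebroid \<Rightarrow> ('w, 'w) module \<Rightarrow> ('w, 'w) module \<Rightarrow> ('w, 'w) module"
  where "tensA H X Y =
    \<lparr>carrier = carrier (tgrpA H X Y), mult = mult (tgrpA H X Y), one = one (tgrpA H X Y),
     zero = zero (tgrpA H X Y), add = add (tgrpA H X Y),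
     smult = (\<lambda>u. sw (tgrpA H X Y) (\<lambda>x y.
       sw (tgrpA H X Y) (\<lambda>u1 u2. tpA H X Y (u1 \<odot>\<^bsub>X\<^esub> x) (u2 \<odot>\<^bsub>Y\<^esub> y)) (comul H u)))\<rparr>"

definition tens_mapA ::
  "('k, 'w::infinite) bialgebroid \<Rightarrow> ('w, 'w) module \<Rightarrow> ('w, 'w) module \<Rightarrow> ('w, 'w) module \<Rightarrow> ('w, 'w) module
     \<Rightarrow> ('w \<Rightarrow> 'w) \<Rightarrow> ('w \<Rightarrow> 'w) \<Rightarrow> 'w \<Rightarrow> 'w"
  where "tens_mapA H X X' Y Y' f g =
    (\<lambda>w\<in>carrier (tensA H X Y). sw (tensA H X' Y') (\<lambda>x y. tpA H X' Y' (f x) (g y)) w)"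

definition associatorA ::
  "('k, 'w::infinite) bialgebroid \<Rightarrow> ('w, 'w) module \<Rightarrow> ('w, 'w) module \<Rightarrow> ('w, 'w) module \<Rightarrow> 'w \<Rightarrow> 'w"
  where "associatorA H X Y Z =
    (\<lambda>w\<in>carrier (tensA H (tensA H X Y) Z).
      sw (tensA H X (tensA H Y Z)) (\<lambda>p z.
        sw (tensA H X (tensA H Y Z)) (\<lambda>x y. tpA H X (tensA H Y Z) x (tpA H Y Z y z)) p) w)"

definition lunitA :: "('k, 'w::infinite) bialgebroid \<Rightarrow> ('w, 'w) module \<Rightarrow> 'w \<Rightarrow> 'w"
  where "lunitA H X = (\<lambda>w\<in>carrier (tensA H (unit_module H) X). sw X (\<lambda>a x. src H a \<odot>\<^bsub>X\<^esub> x) w)"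

definition runitA :: "('k, 'w::infinite) bialgebroid \<Rightarrow> ('w, 'w) module \<Rightarrow> 'w \<Rightarrow> 'w"
  where "runitA H X = (\<lambda>w\<in>carrier (tensA H X (unit_module H)). sw X (\<lambda>x a. tgt H a \<odot>\<^bsub>X\<^esub> x) w)"

subsection \<open>Axioms\<close>

text \<open>\<open>UU\<close> is the codomain of the comultiplication, in which \<open>t(a)u \<otimes> v = u \<otimes> s(a)v\<close>.\<close>

abbreviation UU :: "('k, 'w::infinite) bialgebroid \<Rightarrow> ('w, 'w) module"
  where "UU H \<equiv> tensA H (regular_module H) (regular_module H)"

abbreviation UUU :: "('k, 'w::infinite) bialgebroid \<Rightarrow> ('w, 'w) module"
  where "UUU H \<equiv> tensA H (regular_module H) (UU H)"

abbreviation tpU :: "('k, 'w::infinite) bialgebroid \<Rightarrow> 'w \<Rightarrow> 'w \<Rightarrow> 'w"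
  where "tpU H \<equiv> tpA H (regular_module H) (regular_module H)"

locale left_bialgebroid =
  fixes K :: "'k ring" and H :: "('k, 'w::infinite) bialgebroid"
  fixes A U s t \<Delta> \<epsilon>
  defines "A \<equiv> Base H" and "U \<equiv> Tot H" and "s \<equiv> src H" and "t \<equiv> tgt H"
    and "\<Delta> \<equiv> comul H" and "\<epsilon> \<equiv> counit H"
  assumes base_algebra: "k_algebra K A"
    and total_algebra: "k_algebra K U"
    and src_hom: "s \<in> ring_hom A U"
    and src_klinear: "\<lbrakk>c \<in> carrier K; a \<in> carrier A\<rbrakk> \<Longrightarrow> s (c \<odot>\<^bsub>A\<^esub> a) = c \<odot>\<^bsub>U\<^esub> s a"
    and tgt_antihom: "t \<in> ring_hom (op_ring A) U"
    and tgt_klinear: "\<lbrakk>c \<in> carrier K; a \<in> carrier A\<rbrakk> \<Longrightarrow> t (c \<odot>\<^bsub>A\<^esub> a) = c \<odot>\<^bsub>U\<^esub> t a"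
    and src_tgt_commute:
      "\<lbrakk>a \<in> carrier A; b \<in> carrier A\<rbrakk> \<Longrightarrow> s a \<otimes>\<^bsub>U\<^esub> t b = t b \<otimes>\<^bsub>U\<^esub> s a"
    and comul_hom: "\<Delta> \<in> hom (add_monoid U) (add_monoid (UU H))"
    and comul_src: "\<lbrakk>a \<in> carrier A; u \<in> carrier U\<rbrakk> \<Longrightarrow>
      \<Delta> (s a \<otimes>\<^bsub>U\<^esub> u) = sw (UU H) (\<lambda>x y. tpU H (s a \<otimes>\<^bsub>U\<^esub> x) y) (\<Delta> u)"
    and comul_tgt: "\<lbrakk>a \<in> carrier A; u \<in> carrier U\<rbrakk> \<Longrightarrow>
      \<Delta> (t a \<otimes>\<^bsub>U\<^esub> u) = sw (UU H) (\<lambda>x y. tpU H x (t a \<otimes>\<^bsub>U\<^esub> y)) (\<Delta> u)"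
    and coassoc: "u \<in> carrier U \<Longrightarrow>
      sw (UUU H) (\<lambda>x y. sw (UUU H) (\<lambda>x1 x2.
          tpA H (regular_module H) (UU H) x1 (tpU H x2 y)) (\<Delta> x)) (\<Delta> u) =
      sw (UUU H) (\<lambda>x y. tpA H (regular_module H) (UU H) x (\<Delta> y)) (\<Delta> u)"
    and counit_hom: "\<epsilon> \<in> hom (add_monoid U) (add_monoid A)"
    and counit_src: "\<lbrakk>a \<in> carrier A; u \<in> carrier U\<rbrakk> \<Longrightarrow> \<epsilon> (s a \<otimes>\<^bsub>U\<^esub> u) = a \<otimes>\<^bsub>A\<^esub> \<epsilon> u"
    and counit_tgt: "\<lbrakk>a \<in> carrier A; u \<in> carrier U\<rbrakk> \<Longrightarrow> \<epsilon> (t a \<otimes>\<^bsub>U\<^esub> u) = \<epsilon> u \<otimes>\<^bsub>A\<^esub> a"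
    and counit_left: "u \<in> carrier U \<Longrightarrow> sw U (\<lambda>x y. s (\<epsilon> x) \<otimes>\<^bsub>U\<^esub> y) (\<Delta> u) = u"
    and counit_right: "u \<in> carrier U \<Longrightarrow> sw U (\<lambda>x y. t (\<epsilon> y) \<otimes>\<^bsub>U\<^esub> x) (\<Delta> u) = u"
    and takeuchi: "\<lbrakk>a \<in> carrier A; u \<in> carrier U\<rbrakk> \<Longrightarrow>
      sw (UU H) (\<lambda>x y. tpU H (x \<otimes>\<^bsub>U\<^esub> t a) y) (\<Delta> u) =
      sw (UU H) (\<lambda>x y. tpU H x (y \<otimes>\<^bsub>U\<^esub> s a)) (\<Delta> u)"
    and comul_one: "\<Delta> \<one>\<^bsub>U\<^esub> = tpU H \<one>\<^bsub>U\<^esub> \<one>\<^bsub>U\<^esub>"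
    and comul_mult: "\<lbrakk>u \<in> carrier U; v \<in> carrier U\<rbrakk> \<Longrightarrow>
      \<Delta> (u \<otimes>\<^bsub>U\<^esub> v) = sw (UU H) (\<lambda>v1 v2. sw (UU H) (\<lambda>u1 u2.
          tpU H (u1 \<otimes>\<^bsub>U\<^esub> v1) (u2 \<otimes>\<^bsub>U\<^esub> v2)) (\<Delta> u)) (\<Delta> v)"
    and counit_one: "\<epsilon> \<one>\<^bsub>U\<^esub> = \<one>\<^bsub>A\<^esub>"
    and counit_mult_src: "\<lbrakk>u \<in> carrier U; v \<in> carrier U\<rbrakk> \<Longrightarrow> \<epsilon> (u \<otimes>\<^bsub>U\<^esub> v) = \<epsilon> (u \<otimes>\<^bsub>U\<^esub> s (\<epsilon> v))"
    and counit_mult_tgt: "\<lbrakk>u \<in> carrier U; v \<in> carrier U\<rbrakk> \<Longrightarrow> \<epsilon> (u \<otimes>\<^bsub>U\<^esub> v) = \<epsilon> (u \<otimes>\<^bsub>U\<^esub> t (\<epsilon> v))"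


section \<open>Tensor products over \<open>A\<^sup>o\<^sup>p\<close> and the left Hopf condition\<close>

text \<open>\<open>tensAop H Y\<close> is \<open>U \<otimes>\<^sub>A\<^sub>o\<^sub>p Y\<close> with \<open>ut(a) \<otimes> y = u \<otimes> t(a)y\<close>, a \<open>U\<close>-module through the first factor.\<close>

definition tclsAop ::
  "('k, 'w::infinite) bialgebroid \<Rightarrow> ('w, 'w) module \<Rightarrow> ('w \<times> 'w \<Rightarrow>\<^sub>0 int) \<Rightarrow> 'w"
  where "tclsAop H Y = tensor_class (carrier (Base H))
     (\<lambda>a u. u \<otimes>\<^bsub>Tot H\<^esub> tgt H a) (\<lambda>a y. tgt H a \<odot>\<^bsub>Y\<^esub> y) (regular_module H) Y"

definition tgrpAop :: "('k, 'w::infinite) bialgebroid \<Rightarrow> ('w, 'w) module \<Rightarrow> 'w ring"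
  where "tgrpAop H Y = tensor_group (carrier (Base H))
     (\<lambda>a u. u \<otimes>\<^bsub>Tot H\<^esub> tgt H a) (\<lambda>a y. tgt H a \<odot>\<^bsub>Y\<^esub> y) (regular_module H) Y"

definition tpAop :: "('k, 'w::infinite) bialgebroid \<Rightarrow> ('w, 'w) module \<Rightarrow> 'w \<Rightarrow> 'w \<Rightarrow> 'w"
  where "tpAop H Y u y = tclsAop H Y (frag_of (u, y))"

definition tensAop :: "('k, 'w::infinite) bialgebroid \<Rightarrow> ('w, 'w) module \<Rightarrow> ('w, 'w) module"
  where "tensAop H Y =
    \<lparr>carrier = carrier (tgrpAop H Y), mult = mult (tgrpAop H Y), one = one (tgrpAop H Y),
     zero = zero (tgrpAop H Y), add = add (tgrpAop H Y),
     smult = (\<lambda>u. sw (tgrpAop H Y) (\<lambda>v y. tpAop H Y (u \<otimes>\<^bsub>Tot H\<^esub> v) y))\<rparr>"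

definition hopf_galois :: "('k, 'w::infinite) bialgebroid \<Rightarrow> 'w \<Rightarrow> 'w"
  where "hopf_galois H =
    sw (UU H) (\<lambda>u v. sw (UU H) (\<lambda>u1 u2. tpU H u1 (u2 \<otimes>\<^bsub>Tot H\<^esub> v)) (comul H u))"

definition left_hopf :: "('k, 'w::infinite) bialgebroid \<Rightarrow> bool"
  where "left_hopf H \<longleftrightarrow>
    bij_betw (hopf_galois H) (carrier (tensAop H (regular_module H))) (carrier (UU H))"

text \<open>\<open>translation H u\<close> is \<open>u\<^sub>+ \<otimes>\<^sub>A\<^sub>o\<^sub>p u\<^sub>-\<close>.\<close>

definition translation :: "('k, 'w::infinite) bialgebroid \<Rightarrow> 'w \<Rightarrow> 'w"
  where "translation H u =
    the_inv_into (carrier (tensAop H (regular_module H))) (hopf_galois H) (tpU H u \<one>\<^bsub>Tot H\<^esub>)"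


section \<open>Contramodules\<close>

definition contramodule ::
  "('k, 'w::infinite) bialgebroid \<Rightarrow> ('w, 'b) ring_scheme \<Rightarrow> ('w \<Rightarrow> 'w \<Rightarrow> 'w) \<Rightarrow> (('w \<Rightarrow> 'w) \<Rightarrow> 'w) \<Rightarrow> bool"
  where "contramodule H M ra \<gamma> \<longleftrightarrow>
    (let A = Base H; U = Tot H; Ur = regular_module H in
      \<comment> \<open>a right \<open>A\<close>-module is a left \<open>A\<^sup>o\<^sup>p\<close>-module\<close>
      lmodule (op_ring A)
        \<lparr>carrier = carrier M, mult = mult M, one = one M, zero = zero M, add = add M,
         smult = (\<lambda>a m. ra m a)\<rparr> \<and>
      \<comment> \<open>the contraaction is understood to be additive\<close>
      (\<forall>f\<in>AopHom H Ur M ra. \<gamma> f \<in> carrier M) \<and>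
      (\<forall>f\<in>AopHom H Ur M ra. \<forall>g\<in>AopHom H Ur M ra.
         \<gamma> (\<lambda>u\<in>carrier U. f u \<oplus>\<^bsub>M\<^esub> g u) = \<gamma> f \<oplus>\<^bsub>M\<^esub> \<gamma> g) \<and>
      (\<forall>f\<in>AopHom H Ur M ra. \<forall>a\<in>carrier A.
         \<gamma> (\<lambda>u\<in>carrier U. f (src H a \<otimes>\<^bsub>U\<^esub> u)) = ra (\<gamma> f) a) \<and>
      (\<forall>g\<in>AopHom H (UU H) M ra.
         \<gamma> (\<lambda>u\<in>carrier U. \<gamma> (\<lambda>v\<in>carrier U. g (tpU H u v))) =
         \<gamma> (\<lambda>u\<in>carrier U. g (comul H u))) \<and>
      (\<forall>m\<in>carrier M. \<gamma> (\<lambda>u\<in>carrier U. ra m (counit H u)) = m))"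

text \<open>
  In the condition on \<open>u(\<gamma>(f))\<close> the element \<open>u\<^sub>+\<^sub>(\<^sub>1\<^sub>) \<otimes> u\<^sub>+\<^sub>(\<^sub>2\<^sub>) \<otimes> u\<^sub>-\<close> occurs, which equals
  \<open>u\<^sub>(\<^sub>1\<^sub>) \<otimes> u\<^sub>(\<^sub>2\<^sub>)\<^sub>+ \<otimes> u\<^sub>(\<^sub>2\<^sub>)\<^sub>-\<close> in every left Hopf algebroid (apply \<open>id \<otimes> \<alpha>\<close>). For an arbitrary
  representative of it, the map \<open>v \<mapsto> u\<^sub>+\<^sub>(\<^sub>2\<^sub>) f(u\<^sub>- v u\<^sub>+\<^sub>(\<^sub>1\<^sub>))\<close> need not be right \<open>A\<close>-linear, and it is
  representative-independent only after applying \<open>\<gamma>\<close>. In the grouping by \<open>u\<^sub>(\<^sub>1\<^sub>)\<close> below, \<open>\<gamma>\<close> is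
  applied to right \<open>A\<close>-linear maps only, and the outer sum is balanced.
\<close>

definition aYD_contramodule ::
  "('k, 'w::infinite) bialgebroid \<Rightarrow> ('w, 'w) module \<Rightarrow> (('w \<Rightarrow> 'w) \<Rightarrow> 'w) \<Rightarrow> bool"
  where "aYD_contramodule H M \<gamma> \<longleftrightarrow>
    (let A = Base H; U = Tot H; ra = (\<lambda>m a. tgt H a \<odot>\<^bsub>M\<^esub> m) in
      lmodule U M \<and>
      \<comment> \<open>the right \<open>A\<close>-actions coincide: the contramodule uses \<open>ma = t(a)m\<close>\<close>
      contramodule H M ra \<gamma> \<and>
      \<comment> \<open>the left \<open>A\<close>-actions coincide\<close>
      (\<forall>a\<in>carrier A. \<forall>m\<in>carrier M.
         \<gamma> (\<lambda>u\<in>carrier U. ra m (counit H (u \<otimes>\<^bsub>U\<^esub> src H a))) = src H a \<odot>\<^bsub>M\<^esub> m) \<and>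
      (\<forall>u\<in>carrier U. \<forall>f\<in>AopHom H (regular_module H) M ra.
         u \<odot>\<^bsub>M\<^esub> \<gamma> f =
         sw M (\<lambda>u1 u2. \<gamma> (\<lambda>v\<in>carrier U.
           sw M (\<lambda>up um. up \<odot>\<^bsub>M\<^esub> f (um \<otimes>\<^bsub>U\<^esub> v \<otimes>\<^bsub>U\<^esub> u1)) (translation H u2))) (comul H u)))"

definition stable_contramodule :: "('k, 'w) bialgebroid \<Rightarrow> ('w, 'w) module \<Rightarrow> (('w \<Rightarrow> 'w) \<Rightarrow> 'w) \<Rightarrow> bool"
  where "stable_contramodule H M \<gamma> \<longleftrightarrow>
    (\<forall>m\<in>carrier M. \<gamma> (\<lambda>u\<in>carrier (Tot H). u \<odot>\<^bsub>M\<^esub> m) = m)"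


section \<open>Monoidal categories and trace functors\<close>

record ('o, 'm) moncat =
  Obj :: "'o set"
  Mor :: "'o \<Rightarrow> 'o \<Rightarrow> 'm set"
  Idn :: "'o \<Rightarrow> 'm"
  Cmp :: "'o \<Rightarrow> 'o \<Rightarrow> 'o \<Rightarrow> 'm \<Rightarrow> 'm \<Rightarrow> 'm"
    \<comment> \<open>\<open>Cmp X Y Z g f\<close> is the composite of \<open>f : X \<rightarrow> Y\<close> and \<open>g : Y \<rightarrow> Z\<close>\<close>
  TO :: "'o \<Rightarrow> 'o \<Rightarrow> 'o"
  TM :: "'o \<Rightarrow> 'o \<Rightarrow> 'o \<Rightarrow> 'o \<Rightarrow> 'm \<Rightarrow> 'm \<Rightarrow> 'm"
    \<comment> \<open>\<open>TM X X' Y Y' f g\<close> is the tensor product of \<open>f : X \<rightarrow> X'\<close> and \<open>g : Y \<rightarrow> Y'\<close>\<close>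
  Unt :: 'o
  Asc :: "'o \<Rightarrow> 'o \<Rightarrow> 'o \<Rightarrow> 'm"
    \<comment> \<open>from \<open>(X \<otimes> Y) \<otimes> Z\<close> to \<open>X \<otimes> (Y \<otimes> Z)\<close>\<close>
  LUn :: "'o \<Rightarrow> 'm"
  RUn :: "'o \<Rightarrow> 'm"

definition iso_mor :: "('o, 'm) moncat \<Rightarrow> 'o \<Rightarrow> 'o \<Rightarrow> 'm \<Rightarrow> bool"
  where "iso_mor C X Y f \<longleftrightarrow> f \<in> Mor C X Y \<and>
    (\<exists>g\<in>Mor C Y X. Cmp C X Y X g f = Idn C X \<and> Cmp C Y X Y f g = Idn C Y)"

locale monoidal_category =
  fixes C :: "('o, 'm) moncat"
  assumes Idn_mor: "X \<in> Obj C \<Longrightarrow> Idn C X \<in> Mor C X X"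
    and Cmp_mor: "\<lbrakk>X \<in> Obj C; Y \<in> Obj C; Z \<in> Obj C; f \<in> Mor C X Y; g \<in> Mor C Y Z\<rbrakk>
      \<Longrightarrow> Cmp C X Y Z g f \<in> Mor C X Z"
    and Cmp_Idn_right: "\<lbrakk>X \<in> Obj C; Y \<in> Obj C; f \<in> Mor C X Y\<rbrakk> \<Longrightarrow> Cmp C X X Y f (Idn C X) = f"
    and Cmp_Idn_left: "\<lbrakk>X \<in> Obj C; Y \<in> Obj C; f \<in> Mor C X Y\<rbrakk> \<Longrightarrow> Cmp C X Y Y (Idn C Y) f = f"
    and Cmp_assoc: "\<lbrakk>W \<in> Obj C; X \<in> Obj C; Y \<in> Obj C; Z \<in> Obj C;
        f \<in> Mor C W X; g \<in> Mor C X Y; h \<in> Mor C Y Z\<rbrakk>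
      \<Longrightarrow> Cmp C W Y Z h (Cmp C W X Y g f) = Cmp C W X Z (Cmp C X Y Z h g) f"
    and TO_obj: "\<lbrakk>X \<in> Obj C; Y \<in> Obj C\<rbrakk> \<Longrightarrow> TO C X Y \<in> Obj C"
    and Unt_obj: "Unt C \<in> Obj C"
    and TM_mor: "\<lbrakk>X \<in> Obj C; X' \<in> Obj C; Y \<in> Obj C; Y' \<in> Obj C; f \<in> Mor C X X'; g \<in> Mor C Y Y'\<rbrakk>
      \<Longrightarrow> TM C X X' Y Y' f g \<in> Mor C (TO C X Y) (TO C X' Y')"
    and TM_Idn: "\<lbrakk>X \<in> Obj C; Y \<in> Obj C\<rbrakk>
      \<Longrightarrow> TM C X X Y Y (Idn C X) (Idn C Y) = Idn C (TO C X Y)"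
    and TM_Cmp: "\<lbrakk>X \<in> Obj C; X' \<in> Obj C; X'' \<in> Obj C; Y \<in> Obj C; Y' \<in> Obj C; Y'' \<in> Obj C;
        f \<in> Mor C X X'; f' \<in> Mor C X' X''; g \<in> Mor C Y Y'; g' \<in> Mor C Y' Y''\<rbrakk>
      \<Longrightarrow> TM C X X'' Y Y'' (Cmp C X X' X'' f' f) (Cmp C Y Y' Y'' g' g) =
          Cmp C (TO C X Y) (TO C X' Y') (TO C X'' Y'') (TM C X' X'' Y' Y'' f' g') (TM C X X' Y Y' f g)"
    and Asc_iso: "\<lbrakk>X \<in> Obj C; Y \<in> Obj C; Z \<in> Obj C\<rbrakk>
      \<Longrightarrow> iso_mor C (TO C (TO C X Y) Z) (TO C X (TO C Y Z)) (Asc C X Y Z)"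
    and Asc_natural: "\<lbrakk>X \<in> Obj C; X' \<in> Obj C; Y \<in> Obj C; Y' \<in> Obj C; Z \<in> Obj C; Z' \<in> Obj C;
        f \<in> Mor C X X'; g \<in> Mor C Y Y'; h \<in> Mor C Z Z'\<rbrakk>
      \<Longrightarrow> Cmp C (TO C (TO C X Y) Z) (TO C (TO C X' Y') Z') (TO C X' (TO C Y' Z'))
            (Asc C X' Y' Z') (TM C (TO C X Y) (TO C X' Y') Z Z' (TM C X X' Y Y' f g) h) =
          Cmp C (TO C (TO C X Y) Z) (TO C X (TO C Y Z)) (TO C X' (TO C Y' Z'))
            (TM C X X' (TO C Y Z) (TO C Y' Z') f (TM C Y Y' Z Z' g h)) (Asc C X Y Z)"
    and LUn_iso: "X \<in> Obj C \<Longrightarrow> iso_mor C (TO C (Unt C) X) X (LUn C X)"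
    and RUn_iso: "X \<in> Obj C \<Longrightarrow> iso_mor C (TO C X (Unt C)) X (RUn C X)"
    and LUn_natural: "\<lbrakk>X \<in> Obj C; Y \<in> Obj C; f \<in> Mor C X Y\<rbrakk>
      \<Longrightarrow> Cmp C (TO C (Unt C) X) X Y f (LUn C X) =
          Cmp C (TO C (Unt C) X) (TO C (Unt C) Y) Y (LUn C Y)
            (TM C (Unt C) (Unt C) X Y (Idn C (Unt C)) f)"
    and RUn_natural: "\<lbrakk>X \<in> Obj C; Y \<in> Obj C; f \<in> Mor C X Y\<rbrakk>
      \<Longrightarrow> Cmp C (TO C X (Unt C)) X Y f (RUn C X) =
          Cmp C (TO C X (Unt C)) (TO C Y (Unt C)) Y (RUn C Y)
            (TM C X Y (Unt C) (Unt C) f (Idn C (Unt C)))"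
    and pentagon: "\<lbrakk>W \<in> Obj C; X \<in> Obj C; Y \<in> Obj C; Z \<in> Obj C\<rbrakk>
      \<Longrightarrow> Cmp C (TO C (TO C (TO C W X) Y) Z) (TO C (TO C W X) (TO C Y Z)) (TO C W (TO C X (TO C Y Z)))
            (Asc C W X (TO C Y Z)) (Asc C (TO C W X) Y Z) =
          Cmp C (TO C (TO C (TO C W X) Y) Z) (TO C W (TO C (TO C X Y) Z)) (TO C W (TO C X (TO C Y Z)))
            (TM C W W (TO C (TO C X Y) Z) (TO C X (TO C Y Z)) (Idn C W) (Asc C X Y Z))
            (Cmp C (TO C (TO C (TO C W X) Y) Z) (TO C (TO C W (TO C X Y)) Z) (TO C W (TO C (TO C X Y) Z))
              (Asc C W (TO C X Y) Z)
              (TM C (TO C (TO C W X) Y) (TO C W (TO C X Y)) Z Z (Asc C W X Y) (Idn C Z)))"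
    and triangle: "\<lbrakk>X \<in> Obj C; Y \<in> Obj C\<rbrakk>
      \<Longrightarrow> Cmp C (TO C (TO C X (Unt C)) Y) (TO C X (TO C (Unt C) Y)) (TO C X Y)
            (TM C X X (TO C (Unt C) Y) Y (Idn C X) (LUn C Y)) (Asc C X (Unt C) Y) =
          TM C (TO C X (Unt C)) X Y Y (RUn C X) (Idn C Y)"

text \<open>\<open>T\<close> and \<open>Tm\<close> are the action on objects and on morphisms; \<open>Tm X Y f\<close> is a map from \<open>T Y\<close> to \<open>T X\<close>
  for \<open>f : X \<rightarrow> Y\<close>.\<close>

definition contravariant_functor ::
  "'k ring \<Rightarrow> ('o, 'm) moncat \<Rightarrow> ('o \<Rightarrow> ('k, 'v) module) \<Rightarrow> ('o \<Rightarrow> 'o \<Rightarrow> 'm \<Rightarrow> 'v \<Rightarrow> 'v) \<Rightarrow> bool"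
  where "contravariant_functor K C T Tm \<longleftrightarrow>
    (\<forall>X\<in>Obj C. Module.module K (T X)) \<and>
    (\<forall>X\<in>Obj C. \<forall>Y\<in>Obj C. \<forall>f\<in>Mor C X Y. is_linear K (T Y) (T X) (Tm X Y f)) \<and>
    (\<forall>X\<in>Obj C. \<forall>\<phi>\<in>carrier (T X). Tm X X (Idn C X) \<phi> = \<phi>) \<and>
    (\<forall>X\<in>Obj C. \<forall>Y\<in>Obj C. \<forall>Z\<in>Obj C. \<forall>f\<in>Mor C X Y. \<forall>g\<in>Mor C Y Z. \<forall>\<phi>\<in>carrier (T Z).
       Tm X Z (Cmp C X Y Z g f) \<phi> = Tm X Y f (Tm Y Z g \<phi>))"

definition weak_trace_functor ::
  "'k ring \<Rightarrow> ('o, 'm) moncat \<Rightarrow> ('o \<Rightarrow> ('k, 'v) module) \<Rightarrow> ('o \<Rightarrow> 'o \<Rightarrow> 'm \<Rightarrow> 'v \<Rightarrow> 'v)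
     \<Rightarrow> ('o \<Rightarrow> 'o \<Rightarrow> 'v \<Rightarrow> 'v) \<Rightarrow> bool"
  where "weak_trace_functor K C T Tm tr \<longleftrightarrow>
    monoidal_category C \<and> contravariant_functor K C T Tm \<and>
    (\<forall>X\<in>Obj C. \<forall>Y\<in>Obj C. is_linear_iso K (T (TO C X Y)) (T (TO C Y X)) (tr X Y)) \<and>
    (\<forall>X\<in>Obj C. \<forall>X'\<in>Obj C. \<forall>Y\<in>Obj C. \<forall>Y'\<in>Obj C. \<forall>f\<in>Mor C X X'. \<forall>g\<in>Mor C Y Y'.
       \<forall>\<phi>\<in>carrier (T (TO C X' Y')).
         tr X Y (Tm (TO C X Y) (TO C X' Y') (TM C X X' Y Y' f g) \<phi>) =
         Tm (TO C Y X) (TO C Y' X') (TM C Y Y' X X' g f) (tr X' Y' \<phi>)) \<and>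
    (\<forall>X\<in>Obj C. \<forall>Y\<in>Obj C. \<forall>Z\<in>Obj C. \<forall>\<phi>\<in>carrier (T (TO C Z (TO C X Y))).
       tr Z (TO C X Y) \<phi> =
         Tm (TO C (TO C X Y) Z) (TO C X (TO C Y Z)) (Asc C X Y Z)
           (tr (TO C Y Z) X
             (Tm (TO C (TO C Y Z) X) (TO C Y (TO C Z X)) (Asc C Y Z X)
               (tr (TO C Z X) Y
                 (Tm (TO C (TO C Z X) Y) (TO C Z (TO C X Y)) (Asc C Z X Y) \<phi>)))))"

definition trace_functor ::
  "'k ring \<Rightarrow> ('o, 'm) moncat \<Rightarrow> ('o \<Rightarrow> ('k, 'v) module) \<Rightarrow> ('o \<Rightarrow> 'o \<Rightarrow> 'm \<Rightarrow> 'v \<Rightarrow> 'v)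
     \<Rightarrow> ('o \<Rightarrow> 'o \<Rightarrow> 'v \<Rightarrow> 'v) \<Rightarrow> bool"
  where "trace_functor K C T Tm tr \<longleftrightarrow>
    weak_trace_functor K C T Tm tr \<and>
    (\<forall>X\<in>Obj C. \<forall>\<phi>\<in>carrier (T X).
       tr (Unt C) X (Tm (TO C (Unt C) X) X (LUn C X) \<phi>) = Tm (TO C X (Unt C)) X (RUn C X) \<phi>)"


section \<open>The category of \<open>U\<close>-modules and the functor \<open>Hom\<^sub>U(-, M)\<close>\<close>

definition UMod :: "('k, 'w::infinite) bialgebroid \<Rightarrow> (('w, 'w) module, 'w \<Rightarrow> 'w) moncat"
  where "UMod H =
    \<lparr>Obj = {X. lmodule (Tot H) X},
     Mor = lin_maps (Tot H),
     Idn = (\<lambda>X. \<lambda>x\<in>carrier X. x),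
     Cmp = (\<lambda>X Y Z g f. compose (carrier X) g f),
     TO = tensA H, TM = tens_mapA H, Unt = unit_module H,
     Asc = associatorA H, LUn = lunitA H, RUn = runitA H\<rparr>"

text \<open>A set of extensional functions from \<open>X\<close> to the \<open>U\<close>-module \<open>M\<close> as a \<open>k\<close>-module, pointwise;
  \<open>c \<in> k\<close> acts on \<open>M\<close> through \<open>c \<cdot> 1\<^sub>U\<close>.\<close>

definition fun_module ::
  "('k, 'w) bialgebroid \<Rightarrow> ('w, 'w) module \<Rightarrow> ('w, 'w) module \<Rightarrow> ('w \<Rightarrow> 'w) set \<Rightarrow> ('k, 'w \<Rightarrow> 'w) module"
  where "fun_module H X M S =
    \<lparr>carrier = S, mult = undefined, one = undefined,
     zero = (\<lambda>x\<in>carrier X. \<zero>\<^bsub>M\<^esub>),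
     add = (\<lambda>f g. \<lambda>x\<in>carrier X. f x \<oplus>\<^bsub>M\<^esub> g x),
     smult = (\<lambda>c f. \<lambda>x\<in>carrier X. (c \<odot>\<^bsub>Tot H\<^esub> \<one>\<^bsub>Tot H\<^esub>) \<odot>\<^bsub>M\<^esub> f x)\<rparr>"

definition HomU ::
  "('k, 'w) bialgebroid \<Rightarrow> ('w, 'w) module \<Rightarrow> ('w, 'w) module \<Rightarrow> ('k, 'w \<Rightarrow> 'w) module"
  where "HomU H M X = fun_module H X M (lin_maps (Tot H) X M)"

definition precomp ::
  "('w, 'w) module \<Rightarrow> ('w, 'w) module \<Rightarrow> ('w \<Rightarrow> 'w) \<Rightarrow> ('w \<Rightarrow> 'w) \<Rightarrow> 'w \<Rightarrow> 'w"
  where "precomp X Y f \<phi> = compose (carrier X) \<phi> f"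

definition trace_map ::
  "('k, 'w::infinite) bialgebroid \<Rightarrow> ('w, 'w) module \<Rightarrow> (('w \<Rightarrow> 'w) \<Rightarrow> 'w)
     \<Rightarrow> ('w, 'w) module \<Rightarrow> ('w, 'w) module \<Rightarrow> ('w \<Rightarrow> 'w) \<Rightarrow> 'w \<Rightarrow> 'w"
  where "trace_map H M \<gamma> X Y f =
    (\<lambda>w\<in>carrier (tensA H Y X).
      sw M (\<lambda>y x. \<gamma> (\<lambda>u\<in>carrier (Tot H). f (tpA H X Y x (u \<odot>\<^bsub>Y\<^esub> y)))) w)"


section \<open>The cochain complex\<close>

text \<open>\<open>Upow H q\<close> is the \<open>q\<close>-fold tensor power of \<open>U\<close> over \<open>A\<^sup>o\<^sup>p\<close>, bracketed to the right, with its
  \<open>U\<close>-action; for \<open>q = 0\<close> it is \<open>A\<close>. The element \<open>(u\<^sup>1, \<dots>, u\<^sup>q)\<close> is \<open>word H [u\<^sup>1, \<dots>, u\<^sup>q]\<close>, the empty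
  word being \<open>1 \<in> A\<close>. Thus \<open>Bar\<^sub>q(U)\<close> is \<open>Upow H (q + 1)\<close>.\<close>

fun Upow :: "('k, 'w::infinite) bialgebroid \<Rightarrow> nat \<Rightarrow> ('w, 'w) module"
  where
    "Upow H 0 = unit_module H"
  | "Upow H (Suc 0) = regular_module H"
  | "Upow H (Suc (Suc n)) = tensAop H (Upow H (Suc n))"

fun word :: "('k, 'w::infinite) bialgebroid \<Rightarrow> 'w list \<Rightarrow> 'w"
  where
    "word H [] = \<one>\<^bsub>Base H\<^esub>"
  | "word H [u] = u"
  | "word H (u # v # vs) = tpAop H (Upow H (length (v # vs))) u (word H (v # vs))"

definition words :: "('k, 'w) bialgebroid \<Rightarrow> nat \<Rightarrow> 'w list set"
  where "words H q = {us. length us = q \<and> set us \<subseteq> carrier (Tot H)}"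

text \<open>The element of \<open>S\<close>, a set of linear maps on \<open>Upow H q\<close>, with prescribed values on words.\<close>

definition extend_words ::
  "('k, 'w::infinite) bialgebroid \<Rightarrow> ('w \<Rightarrow> 'w) set \<Rightarrow> nat \<Rightarrow> ('w list \<Rightarrow> 'w) \<Rightarrow> 'w \<Rightarrow> 'w"
  where "extend_words H S q F = (THE g. g \<in> S \<and> (\<forall>us\<in>words H q. g (word H us) = F us))"

text \<open>\<open>sw_list H Z us G\<close> is the sum of \<open>G [u\<^sup>1\<^sub>(\<^sub>1\<^sub>), \<dots>, u\<^sup>n\<^sub>(\<^sub>1\<^sub>)] [u\<^sup>1\<^sub>(\<^sub>2\<^sub>), \<dots>, u\<^sup>n\<^sub>(\<^sub>2\<^sub>)]\<close> for \<open>us = [u\<^sup>1, \<dots>, u\<^sup>n]\<close>.\<close>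

fun sw_list ::
  "('k, 'w::infinite) bialgebroid \<Rightarrow> ('z, 'a) ring_scheme \<Rightarrow> 'w list \<Rightarrow> ('w list \<Rightarrow> 'w list \<Rightarrow> 'z) \<Rightarrow> 'z"
  where
    "sw_list H Z [] G = G [] []"
  | "sw_list H Z (u # us) G =
       sw Z (\<lambda>x y. sw_list H Z us (\<lambda>xs ys. G (x # xs) (y # ys))) (comul H u)"

definition cochains :: "('k, 'w::infinite) bialgebroid \<Rightarrow> ('w, 'w) module \<Rightarrow> nat \<Rightarrow> ('k, 'w \<Rightarrow> 'w) module"
  where "cochains H M q =
    fun_module H (Upow H q) M (AopHom H (Upow H q) M (\<lambda>m a. tgt H a \<odot>\<^bsub>M\<^esub> m))"

text \<open>For \<open>q = 0\<close> the last coface is read through \<open>U\<^sup>\<otimes>\<^sup>0 = A\<close>, that is, \<open>(\<delta>\<^sub>1 f)(u) = f(\<epsilon>(u))\<close>.\<close>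

definition coface ::
  "('k, 'w::infinite) bialgebroid \<Rightarrow> ('w, 'w) module \<Rightarrow> nat \<Rightarrow> nat \<Rightarrow> ('w \<Rightarrow> 'w) \<Rightarrow> 'w \<Rightarrow> 'w"
  where "coface H M q i f = extend_words H (carrier (cochains H M (q + 1))) (q + 1) (\<lambda>us.
    if i = 0 then hd us \<odot>\<^bsub>M\<^esub> f (word H (tl us))
    else if i \<le> q then
      f (word H (take (i - 1) us @ [us ! (i - 1) \<otimes>\<^bsub>Tot H\<^esub> us ! i] @ drop (i + 1) us))
    else if q = 0 then f (counit H (us ! 0))
    else f (word H (take (q - 1) us @ [us ! (q - 1) \<otimes>\<^bsub>Tot H\<^esub> tgt H (counit H (us ! q))])))"

text \<open>\<open>codegen H M q j\<close> is \<open>\<sigma>\<^sub>j\<close> from degree \<open>q + 1\<close> to degree \<open>q\<close>.\<close>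

definition codegen ::
  "('k, 'w::infinite) bialgebroid \<Rightarrow> ('w, 'w) module \<Rightarrow> nat \<Rightarrow> nat \<Rightarrow> ('w \<Rightarrow> 'w) \<Rightarrow> 'w \<Rightarrow> 'w"
  where "codegen H M q j f = extend_words H (carrier (cochains H M q)) q (\<lambda>us.
    f (word H (take j us @ [\<one>\<^bsub>Tot H\<^esub>] @ drop j us)))"

text \<open>\<open>(w \<cdot> f)(v\<^sup>1, \<dots>, v\<^sup>q) = w\<^sub>+ f(w\<^sub>- v\<^sup>1, v\<^sup>2, \<dots>, v\<^sup>q)\<close> for \<open>q \<ge> 1\<close>.\<close>

definition dot_act ::
  "('k, 'w::infinite) bialgebroid \<Rightarrow> ('w, 'w) module \<Rightarrow> 'w \<Rightarrow> ('w \<Rightarrow> 'w) \<Rightarrow> 'w list \<Rightarrow> 'w"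
  where "dot_act H M w f vs =
    sw M (\<lambda>wp wm. wp \<odot>\<^bsub>M\<^esub> f (word H ((wm \<otimes>\<^bsub>Tot H\<^esub> hd vs) # tl vs))) (translation H w)"

text \<open>The value of \<open>\<tau> f\<close> on \<open>(u\<^sup>1, \<dots>, u\<^sup>q)\<close>, \<open>q \<ge> 1\<close>. Since \<open>\<gamma>\<close> is additive, the Sweedler sum over
  \<open>u\<^sup>1, \<dots>, u\<^sup>q\<^sup>-\<^sup>1\<close> may be taken outside of \<open>\<gamma>\<close>, where it is balanced.\<close>

definition tau_value ::
  "('k, 'w::infinite) bialgebroid \<Rightarrow> ('w, 'w) module \<Rightarrow> (('w \<Rightarrow> 'w) \<Rightarrow> 'w) \<Rightarrow> ('w \<Rightarrow> 'w) \<Rightarrow> 'w list \<Rightarrow> 'w"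
  where "tau_value H M \<gamma> f us =
    sw_list H M (butlast us) (\<lambda>xs ys.
      \<gamma> (\<lambda>v\<in>carrier (Tot H). dot_act H M (foldr (mult (Tot H)) ys (last us)) f (v # xs)))"

definition cyclic_op ::
  "('k, 'w::infinite) bialgebroid \<Rightarrow> ('w, 'w) module \<Rightarrow> (('w \<Rightarrow> 'w) \<Rightarrow> 'w) \<Rightarrow> nat \<Rightarrow> ('w \<Rightarrow> 'w) \<Rightarrow> 'w \<Rightarrow> 'w"
  where "cyclic_op H M \<gamma> q f =
    (if q = 0 then f else extend_words H (carrier (cochains H M q)) q (tau_value H M \<gamma> f))"

subsection \<open>The isomorphisms \<open>\<theta>\<close>, \<open>\<eta>\<close>, \<open>\<chi>\<close> in degrees \<open>q \<ge> 1\<close>\<close>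

definition theta ::
  "('k, 'w::infinite) bialgebroid \<Rightarrow> ('w, 'w) module \<Rightarrow> nat \<Rightarrow> ('w \<Rightarrow> 'w) \<Rightarrow> 'w \<Rightarrow> 'w"
  where "theta H M q g = extend_words H (carrier (cochains H M q)) q (\<lambda>us. g (word H (\<one>\<^bsub>Tot H\<^esub> # us)))"

definition eta ::
  "('k, 'w::infinite) bialgebroid \<Rightarrow> ('w, 'w) module \<Rightarrow> nat \<Rightarrow> ('w \<Rightarrow> 'w) \<Rightarrow> 'w \<Rightarrow> 'w"
  where "eta H M q f = extend_words H (carrier (HomU H M (Upow H (q + 1)))) (q + 1) (\<lambda>us.
    sw M (\<lambda>v1 v2. f (tpA H (regular_module H) (Upow H q) v1
                        (word H ((v2 \<otimes>\<^bsub>Tot H\<^esub> us ! 1) # drop 2 us)))) (comul H (us ! 0)))"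

definition chi ::
  "('k, 'w::infinite) bialgebroid \<Rightarrow> ('w, 'w) module \<Rightarrow> nat \<Rightarrow> ('w \<Rightarrow> 'w) \<Rightarrow> 'w \<Rightarrow> 'w"
  where "chi H M q f = extend_words H (carrier (HomU H M (Upow H (q + 1)))) (q + 1) (\<lambda>us.
    sw_list H M (butlast us) (\<lambda>xs ys.
      f (tpA H (Upow H q) (regular_module H) (word H xs) (foldr (mult (Tot H)) ys (last us)))))"

definition theta_inv ::
  "('k, 'w::infinite) bialgebroid \<Rightarrow> ('w, 'w) module \<Rightarrow> nat \<Rightarrow> ('w \<Rightarrow> 'w) \<Rightarrow> 'w \<Rightarrow> 'w"
  where "theta_inv H M q =
    the_inv_into (carrier (HomU H M (Upow H (q + 1)))) (theta H M q)"

definition eta_inv ::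
  "('k, 'w::infinite) bialgebroid \<Rightarrow> ('w, 'w) module \<Rightarrow> nat \<Rightarrow> ('w \<Rightarrow> 'w) \<Rightarrow> 'w \<Rightarrow> 'w"
  where "eta_inv H M q =
    the_inv_into (carrier (HomU H M (tensA H (regular_module H) (Upow H q)))) (eta H M q)"

subsection \<open>Cocyclic modules\<close>

text \<open>\<open>\<delta> q i\<close> maps degree \<open>q\<close> to degree \<open>q + 1\<close>, \<open>\<sigma> q j\<close> maps degree \<open>q + 1\<close> to degree \<open>q\<close>.\<close>

definition cosimplicial_module ::
  "'k ring \<Rightarrow> (nat \<Rightarrow> ('k, 'v) module) \<Rightarrow> (nat \<Rightarrow> nat \<Rightarrow> 'v \<Rightarrow> 'v) \<Rightarrow> (nat \<Rightarrow> nat \<Rightarrow> 'v \<Rightarrow> 'v) \<Rightarrow> bool"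
  where "cosimplicial_module K C \<delta> \<sigma> \<longleftrightarrow>
    (\<forall>q. Module.module K (C q)) \<and>
    (\<forall>q. \<forall>i\<le>q + 1. is_linear K (C q) (C (q + 1)) (\<delta> q i)) \<and>
    (\<forall>q. \<forall>j\<le>q. is_linear K (C (q + 1)) (C q) (\<sigma> q j)) \<and>
    (\<forall>q i j. i < j \<and> j \<le> q + 2 \<longrightarrow>
       (\<forall>f\<in>carrier (C q). \<delta> (q + 1) j (\<delta> q i f) = \<delta> (q + 1) i (\<delta> q (j - 1) f))) \<and>
    (\<forall>q i j. i \<le> j \<and> j \<le> q \<longrightarrow>
       (\<forall>f\<in>carrier (C (q + 2)). \<sigma> q j (\<sigma> (q + 1) i f) = \<sigma> q i (\<sigma> (q + 1) (j + 1) f))) \<and>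
    (\<forall>q i j. j \<le> q \<and> (i = j \<or> i = j + 1) \<longrightarrow>
       (\<forall>f\<in>carrier (C q). \<sigma> q j (\<delta> q i f) = f)) \<and>
    (\<forall>q i j. i < j \<and> j \<le> q + 1 \<longrightarrow>
       (\<forall>f\<in>carrier (C (q + 1)). \<sigma> (q + 1) j (\<delta> (q + 1) i f) = \<delta> q i (\<sigma> q (j - 1) f))) \<and>
    (\<forall>q i j. j + 1 < i \<and> i \<le> q + 2 \<longrightarrow>
       (\<forall>f\<in>carrier (C (q + 1)). \<sigma> (q + 1) j (\<delta> (q + 1) i f) = \<delta> q (i - 1) (\<sigma> q j f)))"

definition cocyclic_module ::
  "'k ring \<Rightarrow> (nat \<Rightarrow> ('k, 'v) module) \<Rightarrow> (nat \<Rightarrow> nat \<Rightarrow> 'v \<Rightarrow> 'v) \<Rightarrow> (nat \<Rightarrow> nat \<Rightarrow> 'v \<Rightarrow> 'v)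
     \<Rightarrow> (nat \<Rightarrow> 'v \<Rightarrow> 'v) \<Rightarrow> bool"
  where "cocyclic_module K C \<delta> \<sigma> \<tau> \<longleftrightarrow>
    cosimplicial_module K C \<delta> \<sigma> \<and>
    (\<forall>q. is_linear K (C q) (C q) (\<tau> q)) \<and>
    (\<forall>q. \<forall>f\<in>carrier (C q). \<tau> (q + 1) (\<delta> q 0 f) = \<delta> q (q + 1) f) \<and>
    (\<forall>q i. 1 \<le> i \<and> i \<le> q + 1 \<longrightarrow>
       (\<forall>f\<in>carrier (C q). \<tau> (q + 1) (\<delta> q i f) = \<delta> q (i - 1) (\<tau> q f))) \<and>
    (\<forall>q. \<forall>f\<in>carrier (C (q + 1)). \<tau> q (\<sigma> q 0 f) = \<sigma> q q (\<tau> (q + 1) (\<tau> (q + 1) f))) \<and>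
    (\<forall>q i. 1 \<le> i \<and> i \<le> q \<longrightarrow>
       (\<forall>f\<in>carrier (C (q + 1)). \<tau> q (\<sigma> q i f) = \<sigma> q (i - 1) (\<tau> (q + 1) f))) \<and>
    (\<forall>q. \<forall>f\<in>carrier (C q). (\<tau> q ^^ (q + 1)) f = f)"


section \<open>Cohomology and Ext\<close>

definition quotient_module :: "('k, 'v) module \<Rightarrow> 'v set \<Rightarrow> 'v set \<Rightarrow> ('k, 'v set) module"
  where "quotient_module X Z B =
    \<lparr>carrier = (\<lambda>z. B +>\<^bsub>X\<^esub> z) ` Z, mult = undefined, one = undefined, zero = B,
     add = (\<lambda>S S'. S <+>\<^bsub>X\<^esub> S'),
     smult = (\<lambda>c S. \<Union>z\<in>S. B +>\<^bsub>X\<^esub> (c \<odot>\<^bsub>X\<^esub> z))\<rparr>"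

definition cohomology ::
  "(nat \<Rightarrow> ('k, 'v) module) \<Rightarrow> (nat \<Rightarrow> 'v \<Rightarrow> 'v) \<Rightarrow> nat \<Rightarrow> ('k, 'v set) module"
  where "cohomology C d n = quotient_module (C n) (a_kernel (C n) (C (Suc n)) (d n))
    (case n of 0 \<Rightarrow> {\<zero>\<^bsub>C 0\<^esub>} | Suc m \<Rightarrow> d m ` carrier (C m))"

definition cosimplicial_differential ::
  "(nat \<Rightarrow> ('k, 'v) module) \<Rightarrow> (nat \<Rightarrow> nat \<Rightarrow> 'v \<Rightarrow> 'v) \<Rightarrow> nat \<Rightarrow> 'v \<Rightarrow> 'v"
  where "cosimplicial_differential C \<delta> q f =
    (\<Oplus>\<^bsub>C (q + 1)\<^esub>i\<in>{..q + 1}. add_pow (C (q + 1)) ((- 1) ^ i :: int) (\<delta> q i f))"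

definition projective_resolution ::
  "('w, 'a) ring_scheme \<Rightarrow> ('w, 'w) module \<Rightarrow> (nat \<Rightarrow> ('w, 'w) module) \<Rightarrow> (nat \<Rightarrow> 'w \<Rightarrow> 'w)
     \<Rightarrow> ('w \<Rightarrow> 'w) \<Rightarrow> bool"
  where "projective_resolution R N P d e \<longleftrightarrow>
    (\<forall>n. projective R (P n)) \<and>
    (\<forall>n. d n \<in> lin_maps R (P (Suc n)) (P n)) \<and>
    e \<in> lin_maps R (P 0) N \<and>
    e ` carrier (P 0) = carrier N \<and>
    a_kernel (P 0) N e = d 0 ` carrier (P (Suc 0)) \<and>
    (\<forall>n. a_kernel (P (Suc n)) (P n) (d n) = d (Suc n) ` carrier (P (Suc (Suc n))))"

text \<open>\<open>Ext\<^sub>U(N, M)\<close>, computed from some projective resolution of \<open>N\<close> in the category of \<open>U\<close>-modules.\<close>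

definition ExtU ::
  "('k, 'w) bialgebroid \<Rightarrow> ('w, 'w) module \<Rightarrow> ('w, 'w) module \<Rightarrow> nat \<Rightarrow> ('k, ('w \<Rightarrow> 'w) set) module"
  where "ExtU H N M n =
    (let (P, d, e) = (SOME (P, d, e). projective_resolution (Tot H) N P d e)
     in cohomology (\<lambda>m. HomU H M (P m)) (\<lambda>m. precomp (P (Suc m)) (P m) (d m)) n)"

text \<open>\<open>U\<^sub>\<triangleleft>\<close> as a right \<open>A\<close>-module, that is, a left \<open>A\<^sup>o\<^sup>p\<close>-module.\<close>

definition U_right_A :: "('k, 'w) bialgebroid \<Rightarrow> ('w, 'w) module"
  where "U_right_A H =
    \<lparr>carrier = carrier (Tot H), mult = mult (Tot H), one = one (Tot H), zero = zero (Tot H),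
     add = add (Tot H), smult = (\<lambda>a u. tgt H a \<otimes>\<^bsub>Tot H\<^esub> u)\<rparr>"

end

theory Submission
  imports Defs
begin

text \<open>
  The trace of \<open>f : X \<otimes>\<^sub>A Y \<rightarrow> M\<close> evaluates \<open>f\<close> on \<open>x \<otimes> uy\<close> and applies the contraaction in \<open>u\<close>. That it
  is balanced comes from the coincidence of the two bimodule structures on \<open>M\<close>; that it is \<open>U\<close>-linear is
  the anti Yetter-Drinfel'd condition, in which \<open>p \<otimes> m = u\<^sub>+ \<otimes> u\<^sub>-\<close> cancels against the diagonal action by
  \<open>translation_cancel\<close>. Applying the trace twice gives a contraaction of the diagonal action, which
  stability turns into the identity (\<open>trace_trace\<close>), and the same computation gives the hexagon
  (\<open>trace_hexagon\<close>). Linear maps out of a tensor product that agree on pure tensors are equal; this proves the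
  coherence of the monoidal category and most other identities between morphisms.

  For the cochain complex, the bar resolution \<open>U \<otimes>\<^sub>A\<^sub>o\<^sub>p \<dots> \<otimes>\<^sub>A\<^sub>o\<^sub>p U\<close> is replaced by the tower
  \<open>U \<otimes>\<^sub>A \<dots> \<otimes>\<^sub>A U\<close> with the diagonal action (\<open>DD\<close>), to which it is isomorphic by iterated Galois maps
  (\<open>mu\<close>). On the tower the faces apply the counit to one tensor factor, the degeneracies apply the
  comultiplication to one factor, and the trace moves the first factor to the end. So the cyclic operator \<open>tau\<close>
  just rotates the letters of a tensor, up to the contraaction, and the cocyclic identities become
  identities between rotations of words (\<open>tower_cocyclic\<close>). The isomorphism \<open>Psi\<close> of linear maps on
  the tower with the cochains turns rotation into the stated formula for the cyclic operator: splitting off the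
  last letter of a bar word leaves the second coproduct components of the others behind (\<open>split_last_bw\<close>), and the
  factor \<open>w\<^sub>+ f(w\<^sub>- \<dots>)\<close> is what \<open>translation_cancel\<close> removes. The maps \<open>\<theta>\<close>, \<open>\<eta>\<close> and \<open>\<chi>\<close> are \<open>mu\<close>, the Galois
  map and the splitting of the last factor in other coordinates.

  For the last claim, inserting \<open>1\<close> in front is a contracting homotopy of the augmented tower, so the tower
  resolves \<open>A\<close>. A dual basis of \<open>U\<close> over \<open>A\<^sup>o\<^sup>p\<close> makes every stage of the tower projective over \<open>A\<^sup>o\<^sup>p\<close>, and
  by the Galois isomorphism the next stage is induced from it, hence projective over \<open>U\<close>
  (\<open>tower_resolution\<close>). Any two projective resolutions give the same cohomology (\<open>Ext_comparison\<close>).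
\<close>

section \<open>Formal sums\<close>

abbreviation ahom :: "('x, 'a) ring_scheme \<Rightarrow> ('y, 'b) ring_scheme \<Rightarrow> ('x \<Rightarrow> 'y) set"
  where "ahom X Y \<equiv> hom (add_monoid X) (add_monoid Y)"

lemma ahom_closed: "[|f \<in> ahom X Y; x \<in> carrier X|] ==> f x \<in> carrier Y"
  by (auto simp: hom_def)

lemma ahom_add:
  "[|f \<in> ahom X Y; x \<in> carrier X; y \<in> carrier X|] ==> f (x \<oplus>\<^bsub>X\<^esub> y) = f x \<oplus>\<^bsub>Y\<^esub> f y"
  by (auto simp: hom_def)

lemma ahomI:
  assumes "\<And>x. x \<in> carrier X ==> f x \<in> carrier Y"
    "\<And>x y. x \<in> carrier X ==> y \<in> carrier X ==> f (x \<oplus>\<^bsub>X\<^esub> y) = f x \<oplus>\<^bsub>Y\<^esub> f y"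
  shows "f \<in> ahom X Y"
  using assms by (auto simp: hom_def)

lemma ahom_zero:
  assumes "abelian_group X" "abelian_group Y" "f \<in> ahom X Y"
  shows "f \<zero>\<^bsub>X\<^esub> = \<zero>\<^bsub>Y\<^esub>"
proof -
  interpret X: abelian_group X by fact
  interpret Y: abelian_group Y by fact
  have "f \<zero>\<^bsub>X\<^esub> \<oplus>\<^bsub>Y\<^esub> f \<zero>\<^bsub>X\<^esub> = f \<zero>\<^bsub>X\<^esub>"
    using ahom_add[OF assms(3), of "\<zero>\<^bsub>X\<^esub>" "\<zero>\<^bsub>X\<^esub>"] by simp
  then show ?thesis
    using Y.add.r_cancel_one ahom_closed[OF assms(3)] by auto
qed

lemma ahom_minus:
  assumes "abelian_group X" "abelian_group Y" "f \<in> ahom X Y" "x \<in> carrier X" "y \<in> carrier X"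
  shows "f (x \<ominus>\<^bsub>X\<^esub> y) = f x \<ominus>\<^bsub>Y\<^esub> f y"
proof -
  interpret X: abelian_group X by fact
  interpret Y: abelian_group Y by fact
  have "f (x \<ominus>\<^bsub>X\<^esub> y) \<oplus>\<^bsub>Y\<^esub> f y = f ((x \<ominus>\<^bsub>X\<^esub> y) \<oplus>\<^bsub>X\<^esub> y)"
    using assms by (simp add: ahom_add)
  also have "(x \<ominus>\<^bsub>X\<^esub> y) \<oplus>\<^bsub>X\<^esub> y = x"
    using assms by (simp add: a_minus_def X.add.m_assoc X.l_neg)
  finally show ?thesis
    using assms ahom_closed[OF assms(3)] by (metis X.minus_closed Y.minus_eq Y.add.inv_solve_right)
qed

lemma ahom_compose: "[|f \<in> ahom X Y; g \<in> ahom Y Z|] ==> (\<lambda>x. g (f x)) \<in> ahom X Z"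
  by (auto simp: hom_def Pi_def)

lemma ahom_cong: "[|f \<in> ahom X Y; \<And>x. x \<in> carrier X ==> f x = g x; abelian_group X|] ==> g \<in> ahom X Y"
  by (rule ahomI) (metis ahom_closed, metis ahom_add abelian_groupE(1))

lemma ahom_restrict: "[|f \<in> ahom X Y; abelian_group X|] ==> restrict f (carrier X) \<in> ahom X Y"
  by (rule ahom_cong) auto

text \<open>Additive extension of \<open>\<beta>\<close> to formal sums. Sweedler evaluation is this extension on the chosen representative.\<close>

definition fsum :: "('z, 'a) ring_scheme \<Rightarrow> ('p \<Rightarrow> 'z) \<Rightarrow> ('p \<Rightarrow>\<^sub>0 int) \<Rightarrow> 'z"
  where "fsum Z \<beta> z = (\<Oplus>\<^bsub>Z\<^esub>p\<in>Poly_Mapping.keys z. add_pow Z (Poly_Mapping.lookup z p) (\<beta> p))"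

lemma sw_fsum: "sw Z \<beta> w = fsum Z (\<lambda>p. \<beta> (fst p) (snd p)) (dec w)"
  by (simp add: sw_def fsum_def)

context abelian_group
begin

lemma sum_minus_both:
  assumes "b \<in> carrier G" "c \<in> carrier G"
  shows "b \<oplus> c \<ominus> b \<ominus> c = \<zero>"
proof -
  have "b \<oplus> c \<ominus> b \<ominus> c = (b \<oplus> \<ominus> b) \<oplus> (c \<oplus> \<ominus> c)"
    using assms by (simp add: minus_eq a_ac)
  then show ?thesis using assms by (simp add: r_neg)
qed

lemma fsum_superset:
  assumes "finite S" "Poly_Mapping.keys z \<subseteq> S" "\<And>p. p \<in> S ==> \<beta> p \<in> carrier G"
  shows "fsum G \<beta> z = (\<Oplus>\<^bsub>G\<^esub>p\<in>S. add_pow G (Poly_Mapping.lookup z p) (\<beta> p))"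
  unfolding fsum_def
proof (rule add.finprod_mono_neutral_cong_left)
  show "add_pow G (Poly_Mapping.lookup z i) (\<beta> i) = \<zero>" if "i \<in> S - Poly_Mapping.keys z" for i
    using that by (simp add: in_keys_iff add_pow_def int_pow_def)
qed (use assms in \<open>auto intro!: add.int_pow_closed\<close>)

lemma fsum_cong:
  assumes "\<And>p. p \<in> Poly_Mapping.keys z ==> \<beta> p = \<beta>' p" "\<And>p. p \<in> Poly_Mapping.keys z ==> \<beta>' p \<in> carrier G"
  shows "fsum G \<beta> z = fsum G \<beta>' z"
  unfolding fsum_def using assms
  by (intro add.finprod_cong') (auto intro!: add.int_pow_closed)

lemma fsum_closed:
  assumes "\<And>p. p \<in> Poly_Mapping.keys z ==> \<beta> p \<in> carrier G"
  shows "fsum G \<beta> z \<in> carrier G"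
  unfolding fsum_def using assms by (auto intro!: finsum_closed add.int_pow_closed)

lemma fsum_zero [simp]: "fsum G \<beta> 0 = \<zero>"
  by (simp add: fsum_def)

lemma fsum_frag_of: "\<beta> p \<in> carrier G ==> fsum G \<beta> (frag_of p) = \<beta> p"
  by (subst fsum_superset[where S = "{p}"]) auto

lemma fsum_add:
  assumes "\<And>p. p \<in> S ==> \<beta> p \<in> carrier G" "Poly_Mapping.keys y \<subseteq> S" "Poly_Mapping.keys z \<subseteq> S"
  shows "fsum G \<beta> (y + z) = fsum G \<beta> y \<oplus> fsum G \<beta> z"
proof -
  let ?T = "Poly_Mapping.keys y \<union> Poly_Mapping.keys z"
  have T: "finite ?T" "\<And>p. p \<in> ?T ==> \<beta> p \<in> carrier G"
    using assms by auto
  have "fsum G \<beta> (y + z) = (\<Oplus>p\<in>?T. add_pow G (Poly_Mapping.lookup y p) (\<beta> p) \<oplus> add_pow G (Poly_Mapping.lookup z p) (\<beta> p))"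
  proof (subst fsum_superset[of ?T])
    show "(\<Oplus>p\<in>?T. add_pow G (Poly_Mapping.lookup (y + z) p) (\<beta> p)) =
        (\<Oplus>p\<in>?T. add_pow G (Poly_Mapping.lookup y p) (\<beta> p) \<oplus> add_pow G (Poly_Mapping.lookup z p) (\<beta> p))"
      by (rule finsum_cong') (use T in \<open>auto simp: lookup_add add.int_pow_mult add.int_pow_closed\<close>)
  qed (use T keys_add[of y z] in auto)
  also have "\<dots> = fsum G \<beta> y \<oplus> fsum G \<beta> z"
  proof -
    have "fsum G \<beta> y = (\<Oplus>p\<in>?T. add_pow G (Poly_Mapping.lookup y p) (\<beta> p))"
      "fsum G \<beta> z = (\<Oplus>p\<in>?T. add_pow G (Poly_Mapping.lookup z p) (\<beta> p))"
      by (rule fsum_superset; use T in auto)+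
    then show ?thesis
      using T by (subst finsum_addf) (auto simp: add.int_pow_closed)
  qed
  finally show ?thesis .
qed

lemma fsum_diff:
  assumes "\<And>p. p \<in> S ==> \<beta> p \<in> carrier G" "Poly_Mapping.keys y \<subseteq> S" "Poly_Mapping.keys z \<subseteq> S"
  shows "fsum G \<beta> (y - z) = fsum G \<beta> y \<ominus> fsum G \<beta> z"
proof -
  have "Poly_Mapping.keys (y - z) \<subseteq> S"
    using keys_diff[of y z] assms by blast
  then have "fsum G \<beta> (y - z) \<oplus> fsum G \<beta> z = fsum G \<beta> (y - z + z)"
    by (intro fsum_add[symmetric, of S]) (use assms in auto)
  moreover have "fsum G \<beta> (y - z) \<in> carrier G" "fsum G \<beta> z \<in> carrier G" "fsum G \<beta> y \<in> carrier G"
    using assms \<open>Poly_Mapping.keys (y - z) \<subseteq> S\<close> by (auto intro!: fsum_closed)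
  ultimately show ?thesis
    by (simp add: minus_eq) (metis add.inv_solve_right)
qed

end

lemma fsum_hom:
  assumes "abelian_group Z" "abelian_group Z'" "h \<in> ahom Z Z'"
    "\<And>p. p \<in> Poly_Mapping.keys z ==> \<beta> p \<in> carrier Z"
  shows "h (fsum Z \<beta> z) = fsum Z' (\<lambda>p. h (\<beta> p)) z"
proof -
  interpret Z: abelian_group Z by fact
  interpret Z': abelian_group Z' by fact
  define S where "S = Poly_Mapping.keys z"
  have S: "\<And>p. p \<in> S ==> \<beta> p \<in> carrier Z" "\<And>p. p \<in> S ==> h (\<beta> p) \<in> carrier Z'"
    using assms by (auto simp: S_def intro: ahom_closed)
  have "Poly_Mapping.keys z \<subseteq> S"
    by (simp add: S_def)
  then have "Poly_Mapping.keys z \<subseteq> S \<and> h (fsum Z \<beta> z) = fsum Z' (\<lambda>p. h (\<beta> p)) z"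
  proof (induction z rule: frag_induction)
    case zero
    show ?case using assms by (simp add: ahom_zero)
  next
    case (one p)
    then show ?case using S by (simp add: Z.fsum_frag_of Z'.fsum_frag_of)
  next
    case (diff y z)
    then show ?case
      using S assms keys_diff[of y z]
      by (auto simp: Z.fsum_diff[of S] Z'.fsum_diff[of S] ahom_minus Z.fsum_closed subset_iff)
  qed
  then show ?thesis by blast
qed

lemma fsum_in_ahom:
  assumes "abelian_group Z" "\<And>p. p \<in> S ==> \<beta> p \<in> ahom X Z" "abelian_group X" "Poly_Mapping.keys z \<subseteq> S"
  shows "(\<lambda>x. fsum Z (\<lambda>p. \<beta> p x) z) \<in> ahom X Z"
proof -
  interpret Z: abelian_group Z by fact
  interpret X: abelian_group X by fact
  have cl: "\<And>p x. p \<in> S ==> x \<in> carrier X ==> \<beta> p x \<in> carrier Z"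
    using assms by (auto intro: ahom_closed)
  from assms(4) have "Poly_Mapping.keys z \<subseteq> S \<and> (\<lambda>x. fsum Z (\<lambda>p. \<beta> p x) z) \<in> ahom X Z"
  proof (induction z rule: frag_induction)
    case zero
    show ?case by (auto intro!: ahomI)
  next
    case (one p)
    have "(\<lambda>x. fsum Z (\<lambda>p. \<beta> p x) (frag_of p)) \<in> ahom X Z"
      by (rule ahom_cong[OF assms(2)[OF one]]) (use one cl in \<open>auto simp: Z.fsum_frag_of assms\<close>)
    with one show ?case by auto
  next
    case (diff y z)
    have k: "Poly_Mapping.keys (y - z) \<subseteq> S" using diff keys_diff[of y z] by blast
    have "(\<lambda>x. fsum Z (\<lambda>p. \<beta> p x) (y - z)) \<in> ahom X Z"
    proof (rule ahomI)
      fix x x' assume x: "x \<in> carrier X" "x' \<in> carrier X"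
      show "fsum Z (\<lambda>p. \<beta> p x) (y - z) \<in> carrier Z"
        using k x cl by (intro Z.fsum_closed) auto
      have c: "fsum Z (\<lambda>p. \<beta> p x) y \<in> carrier Z" "fsum Z (\<lambda>p. \<beta> p x') y \<in> carrier Z"
        "fsum Z (\<lambda>p. \<beta> p x) z \<in> carrier Z" "fsum Z (\<lambda>p. \<beta> p x') z \<in> carrier Z"
        using diff x cl by (auto intro!: Z.fsum_closed)
      have "fsum Z (\<lambda>p. \<beta> p (x \<oplus>\<^bsub>X\<^esub> x')) (y - z) =
          (fsum Z (\<lambda>p. \<beta> p x) y \<oplus>\<^bsub>Z\<^esub> fsum Z (\<lambda>p. \<beta> p x') y) \<ominus>\<^bsub>Z\<^esub> (fsum Z (\<lambda>p. \<beta> p x) z \<oplus>\<^bsub>Z\<^esub> fsum Z (\<lambda>p. \<beta> p x') z)"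
        using x diff cl ahom_add[of "\<lambda>x. fsum Z (\<lambda>p. \<beta> p x) y" X Z x x'] ahom_add[of "\<lambda>x. fsum Z (\<lambda>p. \<beta> p x) z" X Z x x']
        by (subst Z.fsum_diff[of S]) auto
      also have "\<dots> = (fsum Z (\<lambda>p. \<beta> p x) y \<ominus>\<^bsub>Z\<^esub> fsum Z (\<lambda>p. \<beta> p x) z) \<oplus>\<^bsub>Z\<^esub> (fsum Z (\<lambda>p. \<beta> p x') y \<ominus>\<^bsub>Z\<^esub> fsum Z (\<lambda>p. \<beta> p x') z)"
        using c by (simp add: Z.minus_eq Z.minus_add Z.a_ac)
      also have "\<dots> = fsum Z (\<lambda>p. \<beta> p x) (y - z) \<oplus>\<^bsub>Z\<^esub> fsum Z (\<lambda>p. \<beta> p x') (y - z)"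
        using x diff cl by (simp add: Z.fsum_diff[of S])
      finally show "fsum Z (\<lambda>p. \<beta> p (x \<oplus>\<^bsub>X\<^esub> x')) (y - z) = fsum Z (\<lambda>p. \<beta> p x) (y - z) \<oplus>\<^bsub>Z\<^esub> fsum Z (\<lambda>p. \<beta> p x') (y - z)" .
    qed
    with k show ?case by blast
  qed
  then show ?thesis by blast
qed

text \<open>Formal sums in two independent variables may be evaluated in either order: the evaluation in one
  variable is additive in the values.\<close>

lemma fsum_swap:
  assumes Z: "abelian_group Z"
    and "\<And>p p'. p \<in> Poly_Mapping.keys z ==> p' \<in> Poly_Mapping.keys z' ==> \<beta> p p' \<in> carrier Z"
  shows "fsum Z (\<lambda>p. fsum Z (\<lambda>p'. \<beta> p p') z') z = fsum Z (\<lambda>p'. fsum Z (\<lambda>p. \<beta> p p') z) z'"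
proof -
  interpret Z: abelian_group Z by fact
  define S where "S = Poly_Mapping.keys z"
  define S' where "S' = Poly_Mapping.keys z'"
  have S: "\<And>p p'. p \<in> S ==> p' \<in> S' ==> \<beta> p p' \<in> carrier Z"
    using assms by (auto simp: S_def S'_def)
  have c: "\<And>p. p \<in> S ==> fsum Z (\<lambda>p'. \<beta> p p') z' \<in> carrier Z"
    using S by (intro Z.fsum_closed) (auto simp: S'_def)
  have "Poly_Mapping.keys z \<subseteq> S"
    by (simp add: S_def)
  then have "Poly_Mapping.keys z \<subseteq> S \<and>
      fsum Z (\<lambda>p. fsum Z (\<lambda>p'. \<beta> p p') z') z = fsum Z (\<lambda>p'. fsum Z (\<lambda>p. \<beta> p p') z) z'"
  proof (induction z rule: frag_induction)
    case zero
    have "fsum Z (\<lambda>p'. \<zero>\<^bsub>Z\<^esub>) z' = \<zero>\<^bsub>Z\<^esub>"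
      unfolding fsum_def by (intro Z.add.finprod_one_eqI) simp
    then show ?case by simp
  next
    case (one p)
    then show ?case
      using S c by (auto simp: Z.fsum_frag_of S'_def intro!: Z.fsum_cong)
  next
    case (diff y z)
    have k: "Poly_Mapping.keys (y - z) \<subseteq> S" using diff keys_diff[of y z] by blast
    let ?f = "\<lambda>z p'. fsum Z (\<lambda>p. \<beta> p p') z"
    have cl: "\<And>z p'. Poly_Mapping.keys z \<subseteq> S ==> p' \<in> S' ==> ?f z p' \<in> carrier Z"
      using S by (intro Z.fsum_closed) auto
    have "fsum Z (?f (y - z)) z' \<oplus>\<^bsub>Z\<^esub> fsum Z (?f z) z' =
        (\<Oplus>\<^bsub>Z\<^esub>p'\<in>S'. add_pow Z (Poly_Mapping.lookup z' p') (?f (y - z) p') \<oplus>\<^bsub>Z\<^esub> add_pow Z (Poly_Mapping.lookup z' p') (?f z p'))"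
      unfolding fsum_def[of Z "?f _"] S'_def[symmetric]
      by (subst Z.finsum_addf) (use k diff cl in \<open>auto intro!: Z.add.int_pow_closed\<close>)
    also have "\<dots> = (\<Oplus>\<^bsub>Z\<^esub>p'\<in>S'. add_pow Z (Poly_Mapping.lookup z' p') (?f y p'))"
    proof (rule Z.finsum_cong', safe)
      fix p' assume p': "p' \<in> S'"
      have "?f (y - z) p' \<oplus>\<^bsub>Z\<^esub> ?f z p' = ?f y p'"
        using Z.fsum_add[of S "\<lambda>p. \<beta> p p'" "y - z" z] S p' k diff by auto
      then show "add_pow Z (Poly_Mapping.lookup z' p') (?f (y - z) p') \<oplus>\<^bsub>Z\<^esub> add_pow Z (Poly_Mapping.lookup z' p') (?f z p')
          = add_pow Z (Poly_Mapping.lookup z' p') (?f y p')"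
        using Z.add.int_pow_distrib[of "?f (y - z) p'" "?f z p'" "Poly_Mapping.lookup z' p'"] cl k diff p' by simp
    qed (use cl diff in \<open>auto intro!: Z.add.int_pow_closed\<close>)
    also have "\<dots> = fsum Z (?f y) z'"
      by (simp add: fsum_def[of Z "?f _"] S'_def)
    finally have "fsum Z (?f (y - z)) z' = fsum Z (?f y) z' \<ominus>\<^bsub>Z\<^esub> fsum Z (?f z) z'"
      using cl k diff by (simp add: Z.minus_eq) (smt (verit) S'_def Z.add.inv_solve_right Z.fsum_closed)
    moreover have "fsum Z (\<lambda>p. fsum Z (\<lambda>p'. \<beta> p p') z') (y - z) =
        fsum Z (\<lambda>p. fsum Z (\<lambda>p'. \<beta> p p') z') y \<ominus>\<^bsub>Z\<^esub> fsum Z (\<lambda>p. fsum Z (\<lambda>p'. \<beta> p p') z') z"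
      using diff c by (intro Z.fsum_diff[of S]) auto
    ultimately show ?case using k diff by simp
  qed
  then show ?thesis by blast
qed


section \<open>Balanced maps and the universal property\<close>

definition balanced ::
  "'i set \<Rightarrow> ('i \<Rightarrow> 'x \<Rightarrow> 'x) \<Rightarrow> ('i \<Rightarrow> 'y \<Rightarrow> 'y) \<Rightarrow> ('x, 'a) ring_scheme \<Rightarrow> ('y, 'b) ring_scheme
     \<Rightarrow> ('z, 'c) ring_scheme \<Rightarrow> ('x \<Rightarrow> 'y \<Rightarrow> 'z) \<Rightarrow> bool"
  where "balanced I p q X Y Z \<beta> \<longleftrightarrow>
    (\<forall>x\<in>carrier X. \<beta> x \<in> ahom Y Z) \<and> (\<forall>y\<in>carrier Y. (\<lambda>x. \<beta> x y) \<in> ahom X Z) \<and>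
    (\<forall>a\<in>I. \<forall>x\<in>carrier X. \<forall>y\<in>carrier Y. \<beta> (p a x) y = \<beta> x (q a y))"

lemma balancedD:
  assumes "balanced I p q X Y Z \<beta>"
  shows "[|x \<in> carrier X; y \<in> carrier Y|] ==> \<beta> x y \<in> carrier Z"
    and "x \<in> carrier X ==> \<beta> x \<in> ahom Y Z" and "y \<in> carrier Y ==> (\<lambda>x. \<beta> x y) \<in> ahom X Z"
    and "[|x \<in> carrier X; y \<in> carrier Y; y' \<in> carrier Y|] ==> \<beta> x (y \<oplus>\<^bsub>Y\<^esub> y') = \<beta> x y \<oplus>\<^bsub>Z\<^esub> \<beta> x y'"
    and "[|x \<in> carrier X; x' \<in> carrier X; y \<in> carrier Y|] ==> \<beta> (x \<oplus>\<^bsub>X\<^esub> x') y = \<beta> x y \<oplus>\<^bsub>Z\<^esub> \<beta> x' y"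
    and "[|a \<in> I; x \<in> carrier X; y \<in> carrier Y|] ==> \<beta> (p a x) y = \<beta> x (q a y)"
  using assms unfolding balanced_def by (auto simp: hom_def Pi_def)

lemma balancedI:
  assumes "\<And>x y. [|x \<in> carrier X; y \<in> carrier Y|] ==> \<beta> x y \<in> carrier Z"
    and "\<And>x y y'. [|x \<in> carrier X; y \<in> carrier Y; y' \<in> carrier Y|] ==> \<beta> x (y \<oplus>\<^bsub>Y\<^esub> y') = \<beta> x y \<oplus>\<^bsub>Z\<^esub> \<beta> x y'"
    and "\<And>x x' y. [|x \<in> carrier X; x' \<in> carrier X; y \<in> carrier Y|] ==> \<beta> (x \<oplus>\<^bsub>X\<^esub> x') y = \<beta> x y \<oplus>\<^bsub>Z\<^esub> \<beta> x' y"
    and "\<And>a x y. [|a \<in> I; x \<in> carrier X; y \<in> carrier Y|] ==> \<beta> (p a x) y = \<beta> x (q a y)"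
  shows "balanced I p q X Y Z \<beta>"
  using assms unfolding balanced_def by (auto simp: hom_def Pi_def)

locale tensor_product = X: abelian_group X + Y: abelian_group Y
  for X :: "('w::infinite, 'a) ring_scheme" and Y :: "('w, 'b) ring_scheme" +
  fixes I :: "'i set" and p :: "'i \<Rightarrow> 'w \<Rightarrow> 'w" and q :: "'i \<Rightarrow> 'w \<Rightarrow> 'w"
  assumes p_closed: "[|a \<in> I; x \<in> carrier X|] ==> p a x \<in> carrier X"
    and q_closed: "[|a \<in> I; y \<in> carrier Y|] ==> q a y \<in> carrier Y"
begin

abbreviation (input) "F \<equiv> free_Abelian_group (carrier X \<times> carrier Y)"
abbreviation (input) "Rel \<equiv> generate F (tensor_relators I p q X Y)"
abbreviation (input) "cls \<equiv> tensor_class I p q X Y"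
abbreviation (input) "T \<equiv> tensor_group I p q X Y"
abbreviation (input) "tp x y \<equiv> tensor_class I p q X Y (frag_of (x, y))"

lemma relators_closed: "tensor_relators I p q X Y \<subseteq> carrier F"
proof
  fix z assume "z \<in> tensor_relators I p q X Y"
  then have "\<exists>S. Poly_Mapping.keys z \<subseteq> S \<and> S \<subseteq> carrier X \<times> carrier Y"
    unfolding tensor_relators_def
    apply (elim UnE CollectE exE conjE)
    subgoal for x x' y
      by (rule exI[of _ "{(x \<oplus>\<^bsub>X\<^esub> x', y), (x, y), (x', y)}"]) (auto dest!: subsetD[OF keys_diff])
    subgoal for x y y'
      by (rule exI[of _ "{(x, y \<oplus>\<^bsub>Y\<^esub> y'), (x, y), (x, y')}"]) (auto dest!: subsetD[OF keys_diff])
    subgoal for a x y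
      by (rule exI[of _ "{(p a x, y), (x, q a y)}"]) (auto dest!: subsetD[OF keys_diff] simp: p_closed q_closed)
    done
  then show "z \<in> carrier F" by auto
qed

lemma Rel_subgroup: "subgroup Rel F"
  using relators_closed by (intro group.generate_is_subgroup) auto

lemma Rel_closed: "n \<in> Rel ==> n \<in> carrier F"
  using subgroup.subset[OF Rel_subgroup] by blast

lemma Rel_minus:
  assumes "n \<in> Rel" shows "- n \<in> Rel"
  using subgroup.m_inv_closed[OF Rel_subgroup assms] Rel_closed[OF assms] by simp

lemma Rel_add: "n \<in> Rel ==> n' \<in> Rel ==> n + n' \<in> Rel"
  using subgroup.m_closed[OF Rel_subgroup, of n n'] by simp

lemma Rel_zero: "0 \<in> Rel"
  using subgroup.one_closed[OF Rel_subgroup] by simp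

lemma coset_Rel: "Rel #>\<^bsub>F\<^esub> z = {n + z | n. n \<in> Rel}"
  by (auto simp: r_coset_def)

lemma F_add: "z \<in> carrier F ==> z' \<in> carrier F ==> z + z' \<in> carrier F"
  and F_diff: "z \<in> carrier F ==> z' \<in> carrier F ==> z - z' \<in> carrier F"
  using keys_add[of z z'] keys_diff[of z z'] by auto

lemma dec_cls: "dec (cls z) - z \<in> Rel"
proof -
  have "\<exists>z'. z' \<in> Rel #>\<^bsub>F\<^esub> z"
    using Rel_zero unfolding coset_Rel by blast
  then have "(SOME z'. z' \<in> Rel #>\<^bsub>F\<^esub> z) \<in> Rel #>\<^bsub>F\<^esub> z"
    by (rule someI_ex)
  then show ?thesis
    by (auto simp: tensor_class_def dec_enc coset_Rel Let_def)
qed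

lemma cls_eq: "z - z' \<in> Rel ==> cls z = cls z'"
proof -
  assume n: "z - z' \<in> Rel"
  have "{n + z | n. n \<in> Rel} = {n + z' | n. n \<in> Rel}"
  proof (intro equalityI subsetI; clarsimp)
    fix m assume m: "m \<in> Rel"
    show "\<exists>n. m + z = n + z' \<and> n \<in> Rel"
      by (rule exI[of _ "m + (z - z')"]) (simp add: Rel_add m n)
    have "z' - z \<in> Rel"
      using Rel_minus[OF n] by simp
    then show "\<exists>n. m + z' = n + z \<and> n \<in> Rel"
      by (intro exI[of _ "m + (z' - z)"]) (simp add: Rel_add m)
  qed
  then show ?thesis
    by (simp add: tensor_class_def coset_Rel)
qed

lemma T_carrier: "carrier T = cls ` carrier F"
  by (simp add: tensor_group_def)

lemma cls_closed: "z \<in> carrier F ==> cls z \<in> carrier T"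
  by (simp add: T_carrier)

lemma cls_dec: "w \<in> carrier T ==> cls (dec w) = w"
  using dec_cls cls_eq by (auto simp: T_carrier)

lemma dec_cls_closed:
  assumes "z \<in> carrier F" shows "dec (cls z) \<in> carrier F"
  using F_add[OF Rel_closed[OF dec_cls[of z]] assms] by simp

lemma dec_closed: "w \<in> carrier T ==> dec w \<in> carrier F"
  unfolding T_carrier using dec_cls_closed by blast

lemma keys_dec: "w \<in> carrier T ==> Poly_Mapping.keys (dec w) \<subseteq> carrier X \<times> carrier Y"
  using dec_closed by simp

lemma cls_add: "cls z \<oplus>\<^bsub>T\<^esub> cls z' = cls (z + z')"
proof -
  have "dec (cls z) + dec (cls z') - (z + z') = (dec (cls z) - z) + (dec (cls z') - z')"
    by simp
  then have "cls (dec (cls z) + dec (cls z')) = cls (z + z')"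
    by (intro cls_eq) (metis Rel_add dec_cls)
  then show ?thesis
    by (simp add: tensor_group_def)
qed

lemma T_zero: "\<zero>\<^bsub>T\<^esub> = cls 0"
  by (simp add: tensor_group_def)

lemma T_group: "abelian_group T"
proof (rule abelian_groupI)
  show "\<And>x y. x \<in> carrier T ==> y \<in> carrier T ==> x \<oplus>\<^bsub>T\<^esub> y \<in> carrier T"
    by (metis F_add cls_add cls_closed cls_dec dec_closed)
  show "\<zero>\<^bsub>T\<^esub> \<in> carrier T"
    by (auto simp: T_zero intro!: cls_closed)
  show "\<And>x. x \<in> carrier T ==> \<exists>y\<in>carrier T. y \<oplus>\<^bsub>T\<^esub> x = \<zero>\<^bsub>T\<^esub>"
  proof -
    fix x assume "x \<in> carrier T"
    then obtain z where "z \<in> carrier F" "x = cls z" by (auto simp: T_carrier)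
    then show "\<exists>y\<in>carrier T. y \<oplus>\<^bsub>T\<^esub> x = \<zero>\<^bsub>T\<^esub>"
      by (intro bexI[of _ "cls (- z)"]) (auto simp: cls_add T_zero intro!: cls_closed)
  qed
qed (auto simp: T_carrier cls_add T_zero ac_simps)

lemma cls_diff:
  assumes "z \<in> carrier F" "z' \<in> carrier F"
  shows "cls (z - z') = cls z \<ominus>\<^bsub>T\<^esub> cls z'"
proof -
  interpret T: abelian_group T by (rule T_group)
  have "cls (z - z') \<oplus>\<^bsub>T\<^esub> cls z' = cls z"
    by (simp add: cls_add)
  then show ?thesis
    using assms by (metis F_diff T.minus_eq T.add.inv_solve_right cls_closed)
qed

lemma tp_closed: "[|x \<in> carrier X; y \<in> carrier Y|] ==> tp x y \<in> carrier T"
  by (rule cls_closed) simp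

lemma relator_cls:
  assumes "z1 - z2 \<in> tensor_relators I p q X Y" shows "cls z1 = cls z2"
  by (rule cls_eq) (rule generate.incl[OF assms])

lemma tp_balanced: "balanced I p q X Y T (\<lambda>x y. tp x y)"
proof (rule balancedI)
  fix x x' y assume "x \<in> carrier X" "x' \<in> carrier X" "y \<in> carrier Y"
  then have "frag_of (x \<oplus>\<^bsub>X\<^esub> x', y) - (frag_of (x, y) + frag_of (x', y)) \<in> tensor_relators I p q X Y"
    unfolding tensor_relators_def diff_diff_eq[symmetric] by blast
  then show "tp (x \<oplus>\<^bsub>X\<^esub> x') y = tp x y \<oplus>\<^bsub>T\<^esub> tp x' y"
    unfolding cls_add by (rule relator_cls)
next
  fix x y y' assume "x \<in> carrier X" "y \<in> carrier Y" "y' \<in> carrier Y"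
  then have "frag_of (x, y \<oplus>\<^bsub>Y\<^esub> y') - (frag_of (x, y) + frag_of (x, y')) \<in> tensor_relators I p q X Y"
    unfolding tensor_relators_def diff_diff_eq[symmetric] by blast
  then show "tp x (y \<oplus>\<^bsub>Y\<^esub> y') = tp x y \<oplus>\<^bsub>T\<^esub> tp x y'"
    unfolding cls_add by (rule relator_cls)
next
  fix a x y assume "a \<in> I" "x \<in> carrier X" "y \<in> carrier Y"
  then show "tp (p a x) y = tp x (q a y)"
    by (intro relator_cls) (auto simp: tensor_relators_def)
qed (rule tp_closed)

lemma T_induct:
  assumes "w \<in> carrier T"
    and tp: "\<And>x y. [|x \<in> carrier X; y \<in> carrier Y|] ==> P (tp x y)"
    and diff: "\<And>v w. [|v \<in> carrier T; w \<in> carrier T; P v; P w|] ==> P (v \<ominus>\<^bsub>T\<^esub> w)"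
  shows "P w"
proof -
  interpret T: abelian_group T by (rule T_group)
  from assms(1) obtain z where z: "Poly_Mapping.keys z \<subseteq> carrier X \<times> carrier Y" "w = cls z"
    by (auto simp: T_carrier)
  from z(1) have "Poly_Mapping.keys z \<subseteq> carrier X \<times> carrier Y \<and> P (cls z)"
  proof (induction z rule: frag_induction)
    case zero
    let ?o = "tp \<zero>\<^bsub>X\<^esub> \<zero>\<^bsub>Y\<^esub>"
    have "P (?o \<ominus>\<^bsub>T\<^esub> ?o)"
      by (intro diff tp tp_closed) auto
    then show ?case
      using tp_closed[of "\<zero>\<^bsub>X\<^esub>" "\<zero>\<^bsub>Y\<^esub>"] by (simp add: T.r_neg T.minus_eq flip: T_zero)
  next
    case (one pr)
    then show ?case using tp by (cases pr) auto
  next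
    case (diff y z)
    then show ?case
      using keys_diff[of y z] cls_diff[of y z] assms(3)[of "cls y" "cls z"] cls_closed[of y] cls_closed[of z]
      by auto
  qed
  then show ?thesis using z by blast
qed

lemma T_ext:
  assumes "abelian_group Z" "f \<in> ahom T Z" "g \<in> ahom T Z" "w \<in> carrier T"
    "\<And>x y. [|x \<in> carrier X; y \<in> carrier Y|] ==> f (tp x y) = g (tp x y)"
  shows "f w = g w"
  using assms(4)
  by (induction rule: T_induct) (use assms in \<open>auto simp: ahom_minus[OF T_group]\<close>)

lemma fsum_Rel:
  assumes "abelian_group Z" and b: "balanced I p q X Y Z \<beta>" and "n \<in> Rel"
  shows "fsum Z (\<lambda>p. \<beta> (fst p) (snd p)) n = \<zero>\<^bsub>Z\<^esub>"
proof -
  interpret Z: abelian_group Z by fact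
  let ?S = "carrier X \<times> carrier Y" and ?\<beta> = "\<lambda>p. \<beta> (fst p) (snd p)"
  have S: "\<And>pr. pr \<in> ?S ==> ?\<beta> pr \<in> carrier Z" using balancedD(1)[OF b] by auto
  have k2: "fsum Z ?\<beta> (frag_of u - frag_of v) = ?\<beta> u \<ominus>\<^bsub>Z\<^esub> ?\<beta> v" if "u \<in> ?S" "v \<in> ?S" for u v
    using that S by (subst Z.fsum_diff[of ?S]) (auto simp: Z.fsum_frag_of)
  have k: "fsum Z ?\<beta> (frag_of u - frag_of v - frag_of v') = ?\<beta> u \<ominus>\<^bsub>Z\<^esub> ?\<beta> v \<ominus>\<^bsub>Z\<^esub> ?\<beta> v'"
    if "u \<in> ?S" "v \<in> ?S" "v' \<in> ?S" for u v v'
    using that S subset_trans[OF keys_diff[of "frag_of u" "frag_of v"], of ?S]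
    by (subst Z.fsum_diff[of ?S]) (auto simp: k2 Z.fsum_frag_of)
  have rel: "fsum Z ?\<beta> n = \<zero>\<^bsub>Z\<^esub>" if "n \<in> tensor_relators I p q X Y" for n
    using that unfolding tensor_relators_def
    apply (elim UnE CollectE exE conjE)
    subgoal for x x' y
      using k[of "(x \<oplus>\<^bsub>X\<^esub> x', y)" "(x, y)" "(x', y)"] by (simp add: balancedD[OF b] Z.sum_minus_both)
    subgoal for x y y'
      using k[of "(x, y \<oplus>\<^bsub>Y\<^esub> y')" "(x, y)" "(x, y')"] by (simp add: balancedD[OF b] Z.sum_minus_both)
    subgoal for a x y
      using k2[of "(p a x, y)" "(x, q a y)"]
      by (simp add: balancedD(6)[OF b] balancedD(1)[OF b] p_closed q_closed Z.minus_eq Z.r_neg)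
    done
  from assms(3) show ?thesis
  proof (induction rule: generate.induct)
    case one then show ?case by simp
  next
    case (incl h) then show ?case by (rule rel)
  next
    case (inv h)
    then have "h \<in> carrier F" using relators_closed by blast
    then have "Poly_Mapping.keys h \<subseteq> ?S" by simp
    then show ?case
      using Z.fsum_diff[of ?S ?\<beta> 0 h] rel[OF inv] S by (simp add: Z.minus_eq)
  next
    case (eng h h')
    then show ?case
      using Z.fsum_add[of ?S ?\<beta> h h'] S Rel_closed[of h] Rel_closed[of h'] by auto
  qed
qed

lemma sw_cls:
  assumes Z: "abelian_group Z" and b: "balanced I p q X Y Z \<beta>" and z: "z \<in> carrier F"
  shows "sw Z \<beta> (cls z) = fsum Z (\<lambda>p. \<beta> (fst p) (snd p)) z"
proof -
  interpret Z: abelian_group Z by fact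
  let ?S = "carrier X \<times> carrier Y" and ?\<beta> = "\<lambda>p. \<beta> (fst p) (snd p)"
  have S: "\<And>pr. pr \<in> ?S ==> ?\<beta> pr \<in> carrier Z" using balancedD(1)[OF b] by auto
  have "fsum Z ?\<beta> ((dec (cls z) - z) + z) = fsum Z ?\<beta> (dec (cls z) - z) \<oplus>\<^bsub>Z\<^esub> fsum Z ?\<beta> z"
    using z Rel_closed[OF dec_cls[of z]] S by (intro Z.fsum_add) auto
  also have "\<dots> = fsum Z ?\<beta> z"
    using z S by (subst fsum_Rel[OF Z b dec_cls]) (auto intro!: Z.l_zero Z.fsum_closed)
  finally show ?thesis by (simp add: sw_fsum)
qed

lemma sw_tp:
  assumes "abelian_group Z" "balanced I p q X Y Z \<beta>" "x \<in> carrier X" "y \<in> carrier Y"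
  shows "sw Z \<beta> (tp x y) = \<beta> x y"
  using assms by (simp add: sw_cls abelian_group.fsum_frag_of balancedD)

lemma sw_hom:
  assumes Z: "abelian_group Z" and b: "balanced I p q X Y Z \<beta>"
  shows "sw Z \<beta> \<in> ahom T Z"
proof (rule ahomI)
  interpret Z: abelian_group Z by fact
  let ?S = "carrier X \<times> carrier Y" and ?\<beta> = "\<lambda>p. \<beta> (fst p) (snd p)"
  have S: "\<And>pr. pr \<in> ?S ==> ?\<beta> pr \<in> carrier Z" using balancedD(1)[OF b] by auto
  fix v w assume "v \<in> carrier T" "w \<in> carrier T"
  then obtain y z where yz: "y \<in> carrier F" "v = cls y" "z \<in> carrier F" "w = cls z"
    by (auto simp: T_carrier)
  show "sw Z \<beta> v \<in> carrier Z"
    unfolding yz(2) sw_cls[OF Z b yz(1)] using yz(1) S by (intro Z.fsum_closed) auto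
  show "sw Z \<beta> (v \<oplus>\<^bsub>T\<^esub> w) = sw Z \<beta> v \<oplus>\<^bsub>Z\<^esub> sw Z \<beta> w"
    using yz S F_add[of y z] by (simp add: cls_add sw_cls[OF Z b] Z.fsum_add[of ?S])
qed

lemma sw_closed:
  assumes "abelian_group Z" "w \<in> carrier T" "\<And>x y. [|x \<in> carrier X; y \<in> carrier Y|] ==> \<beta> x y \<in> carrier Z"
  shows "sw Z \<beta> w \<in> carrier Z"
  unfolding sw_fsum using assms keys_dec[of w]
  by (intro abelian_group.fsum_closed) auto

lemma sw_cong:
  assumes "abelian_group Z" "w \<in> carrier T" "\<And>x y. [|x \<in> carrier X; y \<in> carrier Y|] ==> \<beta> x y = \<beta>' x y"
    "\<And>x y. [|x \<in> carrier X; y \<in> carrier Y|] ==> \<beta>' x y \<in> carrier Z"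
  shows "sw Z \<beta> w = sw Z \<beta>' w"
  unfolding sw_fsum using assms keys_dec[of w]
  by (intro abelian_group.fsum_cong) auto

lemma hom_sw:
  assumes "abelian_group Z" "abelian_group Z'" "h \<in> ahom Z Z'" "w \<in> carrier T"
    "\<And>x y. [|x \<in> carrier X; y \<in> carrier Y|] ==> \<beta> x y \<in> carrier Z"
  shows "h (sw Z \<beta> w) = sw Z' (\<lambda>x y. h (\<beta> x y)) w"
  unfolding sw_fsum using assms keys_dec[of w]
  by (intro fsum_hom) auto

lemma sw_in_ahom:
  assumes "abelian_group Z" "abelian_group V" "w \<in> carrier T"
    "\<And>x y. [|x \<in> carrier X; y \<in> carrier Y|] ==> \<beta> x y \<in> ahom V Z"
  shows "(\<lambda>v. sw Z (\<lambda>x y. \<beta> x y v) w) \<in> ahom V Z"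
  unfolding sw_fsum using assms keys_dec[of w]
  by (intro fsum_in_ahom[of _ "carrier X \<times> carrier Y"]) auto

end

text \<open>Two Sweedler sums are finite sums over chosen representatives, so they may be interchanged.\<close>

lemma sw_swap:
  assumes "tensor_product X Y I p q" "tensor_product X' Y' I' p' q'" "abelian_group Z"
    and "w \<in> carrier (tensor_group I p q X Y)" "w' \<in> carrier (tensor_group I' p' q' X' Y')"
    and "\<And>x y x' y'. [|x \<in> carrier X; y \<in> carrier Y; x' \<in> carrier X'; y' \<in> carrier Y'|] ==> \<beta> x y x' y' \<in> carrier Z"
  shows "sw Z (\<lambda>x y. sw Z (\<lambda>x' y'. \<beta> x y x' y') w') w = sw Z (\<lambda>x' y'. sw Z (\<lambda>x y. \<beta> x y x' y') w) w'"
  unfolding sw_fsum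
proof (rule fsum_swap[OF assms(3)])
  fix p p' assume "p \<in> Poly_Mapping.keys (dec w)" "p' \<in> Poly_Mapping.keys (dec w')"
  then have "p \<in> carrier X \<times> carrier Y" "p' \<in> carrier X' \<times> carrier Y'"
    using tensor_product.keys_dec[OF assms(1,4)] tensor_product.keys_dec[OF assms(2,5)] by blast+
  then show "\<beta> (fst p) (snd p) (fst p') (snd p') \<in> carrier Z"
    by (auto intro!: assms(6))
qed

text \<open>Sums and additive maps see only the additive structure.\<close>

lemma
  assumes "carrier X = carrier Y" "add X = add Y" "zero X = zero Y"
  shows sw_additive_cong: "sw X \<beta> w = sw Y \<beta> w"
    and abelian_group_additive_cong: "abelian_group X ==> abelian_group Y"
    and a_minus_additive_cong: "a_minus X = a_minus Y"
proof -
  show "sw X \<beta> w = sw Y \<beta> w"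
    using assms by (simp add: sw_def finsum_def finprod_def add_pow_def int_pow_def nat_pow_def m_inv_def Let_def cong: if_cong)
  show "a_minus X = a_minus Y"
    using assms by (auto simp: fun_eq_iff a_minus_def a_inv_def m_inv_def)
  assume X: "abelian_group X"
  show "abelian_group Y"
    using assms abelian_groupE[OF X] by (intro abelian_groupI) simp_all
qed

lemma ahom_additive_cong:
  assumes "carrier X = carrier X'" "add X = add X'" "carrier Y = carrier Y'" "add Y = add Y'"
  shows "ahom X Y = ahom X' Y'"
  using assms by (simp add: hom_def)

section \<open>Modules over a left bialgebroid\<close>

lemma lmodule_group: "lmodule R X ==> abelian_group X"
  by (simp add: lmodule_def)

lemma smult_closed: "[|lmodule R X; u \<in> carrier R; x \<in> carrier X|] ==> u \<odot>\<^bsub>X\<^esub> x \<in> carrier X"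
  by (rule lmodule.lsmult_closed)

lemma add_closed: "[|abelian_group X; x \<in> carrier X; y \<in> carrier X|] ==> x \<oplus>\<^bsub>X\<^esub> y \<in> carrier X"
  by (rule abelian_groupE)

lemma smult_ahom: "[|lmodule R X; u \<in> carrier R|] ==> (\<lambda>x. u \<odot>\<^bsub>X\<^esub> x) \<in> ahom X X"
  by (rule ahomI) (auto simp: lmodule.lsmult_closed lmodule.lsmult_r_distr)

lemma smult_ahom_left: "[|lmodule R X; x \<in> carrier X|] ==> (\<lambda>u. u \<odot>\<^bsub>X\<^esub> x) \<in> ahom R X"
  by (rule ahomI) (auto simp: lmodule.lsmult_closed lmodule.lsmult_l_distr)

lemma lmoduleI:
  assumes "ring R" "abelian_group X"
    "\<And>a x. [|a \<in> carrier R; x \<in> carrier X|] ==> a \<odot>\<^bsub>X\<^esub> x \<in> carrier X"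
    "\<And>a b x. [|a \<in> carrier R; b \<in> carrier R; x \<in> carrier X|]
        ==> (a \<oplus>\<^bsub>R\<^esub> b) \<odot>\<^bsub>X\<^esub> x = a \<odot>\<^bsub>X\<^esub> x \<oplus>\<^bsub>X\<^esub> b \<odot>\<^bsub>X\<^esub> x"
    "\<And>a x y. [|a \<in> carrier R; x \<in> carrier X; y \<in> carrier X|]
        ==> a \<odot>\<^bsub>X\<^esub> (x \<oplus>\<^bsub>X\<^esub> y) = a \<odot>\<^bsub>X\<^esub> x \<oplus>\<^bsub>X\<^esub> a \<odot>\<^bsub>X\<^esub> y"
    "\<And>a b x. [|a \<in> carrier R; b \<in> carrier R; x \<in> carrier X|]
        ==> (a \<otimes>\<^bsub>R\<^esub> b) \<odot>\<^bsub>X\<^esub> x = a \<odot>\<^bsub>X\<^esub> (b \<odot>\<^bsub>X\<^esub> x)"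
    "\<And>x. x \<in> carrier X ==> \<one>\<^bsub>R\<^esub> \<odot>\<^bsub>X\<^esub> x = x"
  shows "lmodule R X"
  using assms by (simp add: lmodule_def lmodule_axioms_def)

lemma lin_mapsD:
  assumes "f \<in> lin_maps R X Y"
  shows "f \<in> ahom X Y" "x \<in> carrier X ==> f x \<in> carrier Y" "f \<in> extensional (carrier X)"
    "[|u \<in> carrier R; x \<in> carrier X|] ==> f (u \<odot>\<^bsub>X\<^esub> x) = u \<odot>\<^bsub>Y\<^esub> f x"
    "[|x \<in> carrier X; y \<in> carrier X|] ==> f (x \<oplus>\<^bsub>X\<^esub> y) = f x \<oplus>\<^bsub>Y\<^esub> f y"
  using assms by (auto simp: lin_maps_def is_linear_def ahom_closed ahom_add)

lemma lin_mapsI: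
  assumes "f \<in> ahom X Y" "f \<in> extensional (carrier X)"
    "\<And>u x. [|u \<in> carrier R; x \<in> carrier X|] ==> f (u \<odot>\<^bsub>X\<^esub> x) = u \<odot>\<^bsub>Y\<^esub> f x"
  shows "f \<in> lin_maps R X Y"
  using assms by (auto simp: lin_maps_def is_linear_def)

lemma lin_maps_compose:
  assumes "f \<in> lin_maps R X Y" "g \<in> lin_maps R Y Z" "lmodule R X"
  shows "compose (carrier X) g f \<in> lin_maps R X Z"
proof (rule lin_mapsI)
  show "compose (carrier X) g f \<in> ahom X Z"
    by (rule ahom_cong[OF ahom_compose[OF lin_mapsD(1)[OF assms(1)] lin_mapsD(1)[OF assms(2)]]])
      (use assms lmodule_group in \<open>auto simp: compose_eq\<close>)
qed (use assms in \<open>auto simp: compose_eq lin_mapsD smult_closed compose_extensional\<close>)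

lemma lin_maps_id: "lmodule R X ==> (\<lambda>x\<in>carrier X. x) \<in> lin_maps R X X"
  by (rule lin_mapsI) (auto simp: smult_closed add_closed lmodule_group intro!: ahomI)

lemma lin_maps_eqI:
  assumes "f \<in> lin_maps R X Y" "g \<in> lin_maps R X Y" "\<And>x. x \<in> carrier X ==> f x = g x"
  shows "f = g"
  using assms by (intro extensionalityI[of f "carrier X" g]) (auto simp: lin_mapsD)

lemma lin_maps_inverse:
  assumes f: "f \<in> lin_maps R X Y" and b: "bij_betw f (carrier X) (carrier Y)"
    and X: "lmodule R X" and Y: "lmodule R Y"
  shows "restrict (the_inv_into (carrier X) f) (carrier Y) \<in> lin_maps R Y X"
proof (rule lin_mapsI)
  let ?g = "the_inv_into (carrier X) f"
  have inj: "inj_on f (carrier X)" and im: "f ` carrier X = carrier Y"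
    using b by (auto simp: bij_betw_def)
  have g: "\<And>y. y \<in> carrier Y ==> ?g y \<in> carrier X" "\<And>y. y \<in> carrier Y ==> f (?g y) = y"
    using the_inv_into_into[OF inj, of _ "carrier X"] f_the_inv_into_f[OF inj] im by auto
  have u: "\<And>x y. x \<in> carrier X ==> f x = y ==> ?g y = x"
    using the_inv_into_f_f[OF inj] by auto
  show "restrict ?g (carrier Y) \<in> ahom Y X"
    using f X Y by (intro ahomI) (auto simp: g add_closed lmodule_group lin_mapsD intro!: u)
  show "restrict ?g (carrier Y) (u \<odot>\<^bsub>Y\<^esub> y) = u \<odot>\<^bsub>X\<^esub> restrict ?g (carrier Y) y"
    if "u \<in> carrier R" "y \<in> carrier Y" for u y
    using that f X Y by (auto simp: g smult_closed lin_mapsD intro!: u)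
qed auto

text \<open>The tensor product over \<open>A\<close> of two \<open>U\<close>-modules is balanced by \<open>t(a)x \<otimes> y = x \<otimes> s(a)y\<close>.\<close>

definition balA ::
  "('k, 'w) bialgebroid \<Rightarrow> ('w, 'w) module \<Rightarrow> ('w, 'w) module \<Rightarrow> ('z, 'c) ring_scheme \<Rightarrow> ('w \<Rightarrow> 'w \<Rightarrow> 'z) \<Rightarrow> bool"
  where "balA H X Y Z \<beta> \<longleftrightarrow> balanced (carrier (Base H)) (\<lambda>a x. tgt H a \<odot>\<^bsub>X\<^esub> x) (\<lambda>a y. src H a \<odot>\<^bsub>Y\<^esub> y) X Y Z \<beta>"

definition balAop ::
  "('k, 'w) bialgebroid \<Rightarrow> ('w, 'w) module \<Rightarrow> ('z, 'c) ring_scheme \<Rightarrow> ('w \<Rightarrow> 'w \<Rightarrow> 'z) \<Rightarrow> bool"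
  where "balAop H Y Z \<beta> \<longleftrightarrow> balanced (carrier (Base H)) (\<lambda>a u. u \<otimes>\<^bsub>Tot H\<^esub> tgt H a) (\<lambda>a y. tgt H a \<odot>\<^bsub>Y\<^esub> y) (regular_module H) Y Z \<beta>"

lemma balAI:
  assumes "\<And>x y. [|x \<in> carrier X; y \<in> carrier Y|] ==> \<beta> x y \<in> carrier Z"
    and "\<And>x y y'. [|x \<in> carrier X; y \<in> carrier Y; y' \<in> carrier Y|] ==> \<beta> x (y \<oplus>\<^bsub>Y\<^esub> y') = \<beta> x y \<oplus>\<^bsub>Z\<^esub> \<beta> x y'"
    and "\<And>x x' y. [|x \<in> carrier X; x' \<in> carrier X; y \<in> carrier Y|] ==> \<beta> (x \<oplus>\<^bsub>X\<^esub> x') y = \<beta> x y \<oplus>\<^bsub>Z\<^esub> \<beta> x' y"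
    and "\<And>a x y. [|a \<in> carrier (Base H); x \<in> carrier X; y \<in> carrier Y|] ==> \<beta> (tgt H a \<odot>\<^bsub>X\<^esub> x) y = \<beta> x (src H a \<odot>\<^bsub>Y\<^esub> y)"
  shows "balA H X Y Z \<beta>"
  unfolding balA_def using assms by (rule balancedI)

lemma balAD:
  assumes "balA H X Y Z \<beta>"
  shows "[|x \<in> carrier X; y \<in> carrier Y|] ==> \<beta> x y \<in> carrier Z"
    and "x \<in> carrier X ==> \<beta> x \<in> ahom Y Z" and "y \<in> carrier Y ==> (\<lambda>x. \<beta> x y) \<in> ahom X Z"
    and "[|x \<in> carrier X; y \<in> carrier Y; y' \<in> carrier Y|] ==> \<beta> x (y \<oplus>\<^bsub>Y\<^esub> y') = \<beta> x y \<oplus>\<^bsub>Z\<^esub> \<beta> x y'"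
    and "[|x \<in> carrier X; x' \<in> carrier X; y \<in> carrier Y|] ==> \<beta> (x \<oplus>\<^bsub>X\<^esub> x') y = \<beta> x y \<oplus>\<^bsub>Z\<^esub> \<beta> x' y"
    and "[|a \<in> carrier (Base H); x \<in> carrier X; y \<in> carrier Y|] ==> \<beta> (tgt H a \<odot>\<^bsub>X\<^esub> x) y = \<beta> x (src H a \<odot>\<^bsub>Y\<^esub> y)"
  using balancedD[OF assms[unfolded balA_def]] by auto

lemma balAopI:
  assumes "\<And>u y. [|u \<in> carrier (Tot H); y \<in> carrier Y|] ==> \<beta> u y \<in> carrier Z"
    and "\<And>u y y'. [|u \<in> carrier (Tot H); y \<in> carrier Y; y' \<in> carrier Y|] ==> \<beta> u (y \<oplus>\<^bsub>Y\<^esub> y') = \<beta> u y \<oplus>\<^bsub>Z\<^esub> \<beta> u y'"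
    and "\<And>u u' y. [|u \<in> carrier (Tot H); u' \<in> carrier (Tot H); y \<in> carrier Y|] ==> \<beta> (u \<oplus>\<^bsub>Tot H\<^esub> u') y = \<beta> u y \<oplus>\<^bsub>Z\<^esub> \<beta> u' y"
    and "\<And>a u y. [|a \<in> carrier (Base H); u \<in> carrier (Tot H); y \<in> carrier Y|] ==> \<beta> (u \<otimes>\<^bsub>Tot H\<^esub> tgt H a) y = \<beta> u (tgt H a \<odot>\<^bsub>Y\<^esub> y)"
  shows "balAop H Y Z \<beta>"
  unfolding balAop_def using assms by (intro balancedI) (auto simp: regular_module_def)

lemma balAopD:
  assumes "balAop H Y Z \<beta>"
  shows "[|x \<in> carrier (Tot H); y \<in> carrier Y|] ==> \<beta> x y \<in> carrier Z"
    and "x \<in> carrier (Tot H) ==> \<beta> x \<in> ahom Y Z" and "y \<in> carrier Y ==> (\<lambda>x. \<beta> x y) \<in> ahom (Tot H) Z"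
    and "[|x \<in> carrier (Tot H); y \<in> carrier Y; y' \<in> carrier Y|] ==> \<beta> x (y \<oplus>\<^bsub>Y\<^esub> y') = \<beta> x y \<oplus>\<^bsub>Z\<^esub> \<beta> x y'"
    and "[|x \<in> carrier (Tot H); x' \<in> carrier (Tot H); y \<in> carrier Y|] ==> \<beta> (x \<oplus>\<^bsub>Tot H\<^esub> x') y = \<beta> x y \<oplus>\<^bsub>Z\<^esub> \<beta> x' y"
    and "[|a \<in> carrier (Base H); x \<in> carrier (Tot H); y \<in> carrier Y|] ==> \<beta> (x \<otimes>\<^bsub>Tot H\<^esub> tgt H a) y = \<beta> x (tgt H a \<odot>\<^bsub>Y\<^esub> y)"
  using balancedD[OF assms[unfolded balAop_def]] by (simp_all add: regular_module_def hom_def)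

locale bialgebroid_setting =
  fixes K :: "'k ring" and H :: "('k, 'w::infinite) bialgebroid"
  assumes bialgebroid: "left_bialgebroid K H"
begin

abbreviation "A \<equiv> Base H"
abbreviation "U \<equiv> Tot H"
abbreviation "s \<equiv> src H"
abbreviation "t \<equiv> tgt H"
abbreviation "\<Delta> \<equiv> comul H"
abbreviation "\<epsilon> \<equiv> counit H"
abbreviation "UM \<equiv> regular_module H"
abbreviation "AM \<equiv> unit_module H"
abbreviation "umod \<equiv> lmodule (Tot H)"
abbreviation "lin \<equiv> lin_maps (Tot H)"
abbreviation "TA \<equiv> tensA H"
abbreviation "tp \<equiv> tpA H"
abbreviation total_mult (infixl "\<cdot>" 70) where "u \<cdot> v \<equiv> u \<otimes>\<^bsub>U\<^esub> v"
abbreviation total_one ("\<one>\<^sub>U") where "\<one>\<^sub>U \<equiv> \<one>\<^bsub>U\<^esub>"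
abbreviation "bal \<equiv> balA H"

sublocale U: ring U
  using left_bialgebroid.total_algebra[OF bialgebroid] by (simp add: k_algebra_def)

sublocale A: ring A
  using left_bialgebroid.base_algebra[OF bialgebroid] by (simp add: k_algebra_def)

lemma s_closed [simp]: "a \<in> carrier A ==> s a \<in> carrier U"
  and s_add: "[|a \<in> carrier A; b \<in> carrier A|] ==> s (a \<oplus>\<^bsub>A\<^esub> b) = s a \<oplus>\<^bsub>U\<^esub> s b"
  and s_mult: "[|a \<in> carrier A; b \<in> carrier A|] ==> s (a \<otimes>\<^bsub>A\<^esub> b) = s a \<cdot> s b"
  and s_one [simp]: "s \<one>\<^bsub>A\<^esub> = \<one>\<^sub>U"
  using left_bialgebroid.src_hom[OF bialgebroid] by (auto simp: ring_hom_def)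

lemma t_closed [simp]: "a \<in> carrier A ==> t a \<in> carrier U"
  and t_add: "[|a \<in> carrier A; b \<in> carrier A|] ==> t (a \<oplus>\<^bsub>A\<^esub> b) = t a \<oplus>\<^bsub>U\<^esub> t b"
  and t_mult: "[|a \<in> carrier A; b \<in> carrier A|] ==> t (a \<otimes>\<^bsub>A\<^esub> b) = t b \<cdot> t a"
  and t_one [simp]: "t \<one>\<^bsub>A\<^esub> = \<one>\<^sub>U"
  using left_bialgebroid.tgt_antihom[OF bialgebroid] by (auto simp: ring_hom_def op_ring_def)

lemma st_commute: "[|a \<in> carrier A; b \<in> carrier A|] ==> s a \<cdot> t b = t b \<cdot> s a"
  by (rule left_bialgebroid.src_tgt_commute[OF bialgebroid])

lemma counit_ahom: "\<epsilon> \<in> ahom U A"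
  by (rule left_bialgebroid.counit_hom[OF bialgebroid])

lemma counit_closed [simp]: "u \<in> carrier U ==> \<epsilon> u \<in> carrier A"
  by (rule ahom_closed[OF counit_ahom])

lemmas counit_add = ahom_add[OF counit_ahom]
lemmas counit_src = left_bialgebroid.counit_src[OF bialgebroid]
lemmas counit_tgt = left_bialgebroid.counit_tgt[OF bialgebroid]
lemmas counit_one [simp] = left_bialgebroid.counit_one[OF bialgebroid]
lemmas counit_mult_src = left_bialgebroid.counit_mult_src[OF bialgebroid]
lemmas counit_mult_tgt = left_bialgebroid.counit_mult_tgt[OF bialgebroid]
lemmas comul_one = left_bialgebroid.comul_one[OF bialgebroid]
lemmas comul_mult = left_bialgebroid.comul_mult[OF bialgebroid]

lemma counit_s [simp]: "a \<in> carrier A ==> \<epsilon> (s a) = a"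
  using counit_src[of a "\<one>\<^sub>U"] by simp

lemma counit_t [simp]: "a \<in> carrier A ==> \<epsilon> (t a) = a"
  using counit_tgt[of a "\<one>\<^sub>U"] by simp

lemma comul_ahom: "\<Delta> \<in> ahom U (UU H)"
  by (rule left_bialgebroid.comul_hom[OF bialgebroid])

lemma comul_closed [simp]: "u \<in> carrier U ==> \<Delta> u \<in> carrier (UU H)"
  by (rule ahom_closed[OF comul_ahom])

lemma UM_simps [simp]:
  "carrier UM = carrier U" "mult UM = mult U" "one UM = one U" "zero UM = zero U" "add UM = add U"
  "smult UM = mult U"
  by (simp_all add: regular_module_def)

lemma AM_simps [simp]:
  "carrier AM = carrier A" "mult AM = mult A" "one AM = one A" "zero AM = zero A" "add AM = add A"
  "smult AM u a = \<epsilon> (u \<cdot> s a)"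
  by (simp_all add: unit_module_def)

lemma UM_group: "abelian_group UM"
  using U.abelian_group_axioms by (rule abelian_group_additive_cong[rotated 3]) simp_all

lemma umod_UM [simp]: "umod UM"
  by (rule lmoduleI) (auto simp: U.ring_axioms UM_group U.l_distr U.r_distr U.m_assoc)

lemma smult_one [simp]: "umod X ==> x \<in> carrier X ==> \<one>\<^sub>U \<odot>\<^bsub>X\<^esub> x = x"
  by (rule lmodule.lsmult_one)

lemma smult_mult:
  "[|umod X; u \<in> carrier U; v \<in> carrier U; x \<in> carrier X|] ==> (u \<cdot> v) \<odot>\<^bsub>X\<^esub> x = u \<odot>\<^bsub>X\<^esub> (v \<odot>\<^bsub>X\<^esub> x)"
  by (rule lmodule.lsmult_assoc)

lemmas umod_closed [simp] = smult_closed[of U]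
lemmas umod_group [simp] = lmodule_group[of U]
declare add_closed [simp]
lemmas smult_l_distr = lmodule.lsmult_l_distr[of U]
lemmas smult_r_distr = lmodule.lsmult_r_distr[of U]

subsection \<open>The monoidal product\<close>

lemma tensor_productA:
  "[|umod X; umod Y|] ==> tensor_product X Y (carrier A) (\<lambda>a x. t a \<odot>\<^bsub>X\<^esub> x) (\<lambda>a y. s a \<odot>\<^bsub>Y\<^esub> y)"
  by (simp add: tensor_product_def tensor_product_axioms_def)

lemma TA_simps: "carrier (TA X Y) = carrier (tgrpA H X Y)" "add (TA X Y) = add (tgrpA H X Y)" "zero (TA X Y) = zero (tgrpA H X Y)"
  by (simp_all add: tensA_def)

lemma sw_TA: "sw (TA X Y) \<beta> w = sw (tgrpA H X Y) \<beta> w"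
  by (rule sw_additive_cong) (simp_all add: TA_simps)

lemma TA_hom: "ahom (TA X Y) Z = ahom (tgrpA H X Y) Z" "ahom Z (TA X Y) = ahom Z (tgrpA H X Y)"
  by (rule ahom_additive_cong; simp add: TA_simps)+

lemma TA_group [simp]: "[|umod X; umod Y|] ==> abelian_group (TA X Y)"
  using tensor_product.T_group[OF tensor_productA]
  by (rule abelian_group_additive_cong[rotated 3]) (simp_all add: TA_simps tgrpA_def)

context
  fixes X Y :: "('w, 'w) module"
  assumes X: "umod X" and Y: "umod Y"
begin

interpretation T: tensor_product X Y "carrier A" "\<lambda>a x. t a \<odot>\<^bsub>X\<^esub> x" "\<lambda>a y. s a \<odot>\<^bsub>Y\<^esub> y"
  by (rule tensor_productA[OF X Y])

lemma tp_closed [simp]: "[|x \<in> carrier X; y \<in> carrier Y|] ==> tp X Y x y \<in> carrier (TA X Y)"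
  using T.tp_closed by (simp add: tpA_def tclsA_def TA_simps tgrpA_def)

lemma tp_bal: "bal X Y (TA X Y) (tp X Y)"
  using T.tp_balanced unfolding balA_def balanced_def TA_hom tpA_def tclsA_def tgrpA_def by simp

lemmas tp_add = balAD(4,5)[OF tp_bal]
lemmas tp_balance = balAD(6)[OF tp_bal]

lemma TA_ext:
  assumes "abelian_group Z" "f \<in> ahom (TA X Y) Z" "g \<in> ahom (TA X Y) Z" "w \<in> carrier (TA X Y)"
    "\<And>x y. [|x \<in> carrier X; y \<in> carrier Y|] ==> f (tp X Y x y) = g (tp X Y x y)"
  shows "f w = g w"
  using T.T_ext[of Z f g w] assms unfolding TA_hom by (simp add: TA_simps tgrpA_def tpA_def tclsA_def)

lemma sw_tp: "[|abelian_group Z; bal X Y Z \<beta>; x \<in> carrier X; y \<in> carrier Y|] ==> sw Z \<beta> (tp X Y x y) = \<beta> x y"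
  using T.sw_tp by (simp add: tpA_def tclsA_def balA_def)

lemma sw_ahom: "[|abelian_group Z; bal X Y Z \<beta>|] ==> sw Z \<beta> \<in> ahom (TA X Y) Z"
  using T.sw_hom unfolding TA_hom by (simp add: tgrpA_def balA_def)

lemma sw_closed:
  assumes "abelian_group Z" "w \<in> carrier (TA X Y)" "\<And>x y. [|x \<in> carrier X; y \<in> carrier Y|] ==> \<beta> x y \<in> carrier Z"
  shows "sw Z \<beta> w \<in> carrier Z"
  using T.sw_closed[of Z w \<beta>] assms by (simp add: TA_simps tgrpA_def)

lemma sw_cong:
  assumes "abelian_group Z" "w \<in> carrier (TA X Y)" "\<And>x y. [|x \<in> carrier X; y \<in> carrier Y|] ==> \<beta> x y = \<beta>' x y"
    "\<And>x y. [|x \<in> carrier X; y \<in> carrier Y|] ==> \<beta>' x y \<in> carrier Z"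
  shows "sw Z \<beta> w = sw Z \<beta>' w"
  using T.sw_cong[of Z w \<beta> \<beta>'] assms by (simp add: TA_simps tgrpA_def)

lemma hom_sw:
  assumes "abelian_group Z" "abelian_group Z'" "h \<in> ahom Z Z'" "w \<in> carrier (TA X Y)"
    "\<And>x y. [|x \<in> carrier X; y \<in> carrier Y|] ==> \<beta> x y \<in> carrier Z"
  shows "h (sw Z \<beta> w) = sw Z' (\<lambda>x y. h (\<beta> x y)) w"
  using T.hom_sw[of Z Z' h w \<beta>] assms by (simp add: TA_simps tgrpA_def)

lemma sw_in_ahom:
  assumes "abelian_group Z" "abelian_group V" "w \<in> carrier (TA X Y)"
    "\<And>x y. [|x \<in> carrier X; y \<in> carrier Y|] ==> \<beta> x y \<in> ahom V Z"
  shows "(\<lambda>v. sw Z (\<lambda>x y. \<beta> x y v) w) \<in> ahom V Z"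
  using T.sw_in_ahom[of Z V w \<beta>] assms by (simp add: TA_simps tgrpA_def)

end

lemma UU_bal_act:
  assumes "umod X" "umod Y" "abelian_group Z" "bal X Y Z \<beta>" "x \<in> carrier X" "y \<in> carrier Y"
  shows "bal UM UM Z (\<lambda>u1 u2. \<beta> (u1 \<odot>\<^bsub>X\<^esub> x) (u2 \<odot>\<^bsub>Y\<^esub> y))"
  using assms
  by (intro balAI) (auto simp: balAD smult_l_distr smult_mult)

text \<open>Any identity between elements of \<open>U \<otimes>\<^sub>A U\<close> may be evaluated in balanced expressions.\<close>

lemma comul_eval_mult:
  assumes "abelian_group Z" "bal UM UM Z \<beta>" "u \<in> carrier U" "v \<in> carrier U"
  shows "sw Z \<beta> (\<Delta> (u \<cdot> v)) =
    sw Z (\<lambda>v1 v2. sw Z (\<lambda>u1 u2. \<beta> (u1 \<cdot> v1) (u2 \<cdot> v2)) (\<Delta> u)) (\<Delta> v)"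
proof -
  note h = sw_ahom[OF umod_UM umod_UM assms(1,2)]
  show ?thesis
    unfolding comul_mult[OF assms(3,4)]
    apply (subst hom_sw[OF umod_UM umod_UM _ assms(1) h])
       apply (use assms in \<open>auto intro!: sw_closed[OF umod_UM umod_UM]\<close>)[3]
    apply (rule sw_cong[OF umod_UM umod_UM assms(1)])
      apply (use assms in simp)
     apply (subst hom_sw[OF umod_UM umod_UM _ assms(1) h])
        apply (use assms in simp_all)
     apply (rule sw_cong[OF umod_UM umod_UM assms(1)])
       apply (use assms in \<open>auto intro!: sw_closed[OF umod_UM umod_UM] simp: balAD sw_tp\<close>)
    done
qed

lemma comul_eval_takeuchi:
  assumes "abelian_group Z" "bal UM UM Z \<beta>" "u \<in> carrier U" "a \<in> carrier A"
  shows "sw Z (\<lambda>x y. \<beta> (x \<cdot> t a) y) (\<Delta> u) = sw Z (\<lambda>x y. \<beta> x (y \<cdot> s a)) (\<Delta> u)"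
proof -
  note h = sw_ahom[OF umod_UM umod_UM assms(1,2)]
  have "sw Z \<beta> (sw (UU H) (\<lambda>x y. tpU H (f x) (g y)) (\<Delta> u)) = sw Z (\<lambda>x y. \<beta> (f x) (g y)) (\<Delta> u)"
    if "f \<in> carrier U \<rightarrow> carrier U" "g \<in> carrier U \<rightarrow> carrier U" for f g
    using that assms
    apply (subst hom_sw[OF umod_UM umod_UM _ assms(1) h])
       apply (auto simp: Pi_def)[3]
    apply (rule sw_cong[OF umod_UM umod_UM assms(1)])
      apply (auto simp: sw_tp balAD Pi_def)
    done
  from this[of "\<lambda>x. x \<cdot> t a" "\<lambda>y. y"] this[of "\<lambda>x. x" "\<lambda>y. y \<cdot> s a"] show ?thesis
    using left_bialgebroid.takeuchi[OF bialgebroid assms(4,3)] assms by (simp add: Pi_def)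
qed

lemmas tpU_closed [simp] = tp_closed[OF umod_UM umod_UM, simplified]
lemmas tpU_add = tp_add[OF umod_UM umod_UM, simplified]
lemmas tpU_balance = tp_balance[OF umod_UM umod_UM, simplified]
lemmas UU_group [simp] = TA_group[OF umod_UM umod_UM]
lemmas swU_tp = sw_tp[OF umod_UM umod_UM, simplified]
lemmas swU_ahom = sw_ahom[OF umod_UM umod_UM, simplified]
lemmas swU_closed = sw_closed[OF umod_UM umod_UM, simplified]
lemmas swU_cong = sw_cong[OF umod_UM umod_UM, simplified]
lemmas hom_swU = hom_sw[OF umod_UM umod_UM, simplified]
lemmas swU_in_ahom = sw_in_ahom[OF umod_UM umod_UM, simplified]
lemmas UU_ext = TA_ext[OF umod_UM umod_UM, simplified]

lemma balUI:
  assumes "\<And>x y. [|x \<in> carrier U; y \<in> carrier U|] ==> \<beta> x y \<in> carrier Z"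
    and "\<And>x y y'. [|x \<in> carrier U; y \<in> carrier U; y' \<in> carrier U|] ==> \<beta> x (y \<oplus>\<^bsub>U\<^esub> y') = \<beta> x y \<oplus>\<^bsub>Z\<^esub> \<beta> x y'"
    and "\<And>x x' y. [|x \<in> carrier U; x' \<in> carrier U; y \<in> carrier U|] ==> \<beta> (x \<oplus>\<^bsub>U\<^esub> x') y = \<beta> x y \<oplus>\<^bsub>Z\<^esub> \<beta> x' y"
    and "\<And>a x y. [|a \<in> carrier A; x \<in> carrier U; y \<in> carrier U|] ==> \<beta> (t a \<cdot> x) y = \<beta> x (s a \<cdot> y)"
  shows "bal UM UM Z \<beta>"
  using assms by (intro balAI) auto

lemma balUD:
  assumes "bal UM UM Z \<beta>"
  shows "[|x \<in> carrier U; y \<in> carrier U|] ==> \<beta> x y \<in> carrier Z"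
    and "x \<in> carrier U ==> \<beta> x \<in> ahom U Z" and "y \<in> carrier U ==> (\<lambda>x. \<beta> x y) \<in> ahom U Z"
    and "[|x \<in> carrier U; y \<in> carrier U; y' \<in> carrier U|] ==> \<beta> x (y \<oplus>\<^bsub>U\<^esub> y') = \<beta> x y \<oplus>\<^bsub>Z\<^esub> \<beta> x y'"
    and "[|x \<in> carrier U; x' \<in> carrier U; y \<in> carrier U|] ==> \<beta> (x \<oplus>\<^bsub>U\<^esub> x') y = \<beta> x y \<oplus>\<^bsub>Z\<^esub> \<beta> x' y"
    and "[|a \<in> carrier A; x \<in> carrier U; y \<in> carrier U|] ==> \<beta> (t a \<cdot> x) y = \<beta> x (s a \<cdot> y)"
  using balAD[OF assms] by (simp_all add: hom_def)

lemma comul_s: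
  assumes a: "a \<in> carrier A" shows "\<Delta> (s a) = tpU H (s a) \<one>\<^sub>U"
proof -
  have "bal UM UM (UU H) (\<lambda>x y. tpU H (s a \<cdot> x) y)"
    using a by (intro balUI) (simp_all add: tpU_add U.r_distr flip: tpU_balance U.m_assoc st_commute)
  then show ?thesis
    using left_bialgebroid.comul_src[OF bialgebroid a, of "\<one>\<^sub>U"] a by (simp add: comul_one swU_tp)
qed

lemma comul_t:
  assumes a: "a \<in> carrier A" shows "\<Delta> (t a) = tpU H \<one>\<^sub>U (t a)"
proof -
  have "bal UM UM (UU H) (\<lambda>x y. tpU H x (t a \<cdot> y))"
    using a by (intro balUI) (simp_all add: tpU_add tpU_balance U.r_distr flip: U.m_assoc, simp add: st_commute)
  then show ?thesis
    using left_bialgebroid.comul_tgt[OF bialgebroid a, of "\<one>\<^sub>U"] a by (simp add: comul_one swU_tp)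
qed

end

context bialgebroid_setting
begin

context
  fixes X Y :: "('w, 'w) module"
  assumes X [simp]: "umod X" and Y [simp]: "umod Y"
begin

private abbreviation "diag u x y \<equiv> sw (TA X Y) (\<lambda>u1 u2. tp X Y (u1 \<odot>\<^bsub>X\<^esub> x) (u2 \<odot>\<^bsub>Y\<^esub> y)) (\<Delta> u)"

lemma diag_closed: "[|u \<in> carrier U; x \<in> carrier X; y \<in> carrier Y|] ==> diag u x y \<in> carrier (TA X Y)"
  by (auto intro!: swU_closed)

lemmas UU_bal_tp = UU_bal_act[OF X Y TA_group[OF X Y] tp_bal[OF X Y]]

text \<open>The diagonal action is balanced because \<open>u\<^sub>(\<^sub>1\<^sub>)t(a) \<otimes> u\<^sub>(\<^sub>2\<^sub>) = u\<^sub>(\<^sub>1\<^sub>) \<otimes> u\<^sub>(\<^sub>2\<^sub>)s(a)\<close>.\<close>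

lemma diag_bal:
  assumes u: "u \<in> carrier U" shows "bal X Y (TA X Y) (diag u)"
proof (rule balAI)
  fix x y y' assume "x \<in> carrier X" "y \<in> carrier Y" "y' \<in> carrier Y"
  then show "diag u x (y \<oplus>\<^bsub>Y\<^esub> y') = diag u x y \<oplus>\<^bsub>TA X Y\<^esub> diag u x y'"
    using u by (intro ahom_add[of "diag u x" Y] swU_in_ahom) (auto intro!: ahomI simp: tp_add smult_r_distr)
next
  fix x x' y assume "x \<in> carrier X" "x' \<in> carrier X" "y \<in> carrier Y"
  then show "diag u (x \<oplus>\<^bsub>X\<^esub> x') y = diag u x y \<oplus>\<^bsub>TA X Y\<^esub> diag u x' y"
    using u by (intro ahom_add[of "\<lambda>x. diag u x y" X] swU_in_ahom) (auto intro!: ahomI simp: tp_add smult_r_distr)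
next
  fix a x y assume h: "a \<in> carrier A" "x \<in> carrier X" "y \<in> carrier Y"
  have "diag u (t a \<odot>\<^bsub>X\<^esub> x) y = sw (TA X Y) (\<lambda>u1 u2. tp X Y ((u1 \<cdot> t a) \<odot>\<^bsub>X\<^esub> x) (u2 \<odot>\<^bsub>Y\<^esub> y)) (\<Delta> u)"
    using h u by (intro swU_cong) (simp_all add: smult_mult)
  also have "\<dots> = sw (TA X Y) (\<lambda>u1 u2. tp X Y (u1 \<odot>\<^bsub>X\<^esub> x) ((u2 \<cdot> s a) \<odot>\<^bsub>Y\<^esub> y)) (\<Delta> u)"
    by (rule comul_eval_takeuchi[OF _ UU_bal_tp[OF h(2,3)] u h(1)]) simp
  also have "\<dots> = diag u x (s a \<odot>\<^bsub>Y\<^esub> y)"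
    using h u by (intro swU_cong) (simp_all add: smult_mult)
  finally show "diag u (t a \<odot>\<^bsub>X\<^esub> x) y = diag u x (s a \<odot>\<^bsub>Y\<^esub> y)" .
qed (use u in \<open>simp add: diag_closed\<close>)

lemma TA_smult: "u \<odot>\<^bsub>TA X Y\<^esub> w = sw (TA X Y) (diag u) w"
  unfolding sw_TA by (simp add: tensA_def)

lemma TA_smult_tp:
  "[|u \<in> carrier U; x \<in> carrier X; y \<in> carrier Y|] ==> u \<odot>\<^bsub>TA X Y\<^esub> tp X Y x y = diag u x y"
  by (simp add: TA_smult sw_tp diag_bal)

lemma TA_smult_ahom: "u \<in> carrier U ==> (\<lambda>w. u \<odot>\<^bsub>TA X Y\<^esub> w) \<in> ahom (TA X Y) (TA X Y)"
  by (simp add: TA_smult sw_ahom diag_bal)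

lemma s_tp: "[|a \<in> carrier A; x \<in> carrier X; y \<in> carrier Y|] ==> s a \<odot>\<^bsub>TA X Y\<^esub> tp X Y x y = tp X Y (s a \<odot>\<^bsub>X\<^esub> x) y"
  by (simp add: TA_smult_tp comul_s swU_tp UU_bal_tp)

lemma t_tp: "[|a \<in> carrier A; x \<in> carrier X; y \<in> carrier Y|] ==> t a \<odot>\<^bsub>TA X Y\<^esub> tp X Y x y = tp X Y x (t a \<odot>\<^bsub>Y\<^esub> y)"
  by (simp add: TA_smult_tp comul_t swU_tp UU_bal_tp)

lemma umod_TA [simp]: "umod (TA X Y)"
proof (rule lmoduleI)
  fix u w assume u: "u \<in> carrier U" and w: "w \<in> carrier (TA X Y)"
  show "u \<odot>\<^bsub>TA X Y\<^esub> w \<in> carrier (TA X Y)"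
    using u w by (rule ahom_closed[OF TA_smult_ahom])
  fix w' assume "w' \<in> carrier (TA X Y)"
  then show "u \<odot>\<^bsub>TA X Y\<^esub> (w \<oplus>\<^bsub>TA X Y\<^esub> w') = u \<odot>\<^bsub>TA X Y\<^esub> w \<oplus>\<^bsub>TA X Y\<^esub> u \<odot>\<^bsub>TA X Y\<^esub> w'"
    using u w by (intro ahom_add[OF TA_smult_ahom])
next
  fix u v w assume uv: "u \<in> carrier U" "v \<in> carrier U" and w: "w \<in> carrier (TA X Y)"
  note h = ahomI[of "TA X Y" "\<lambda>w. u \<odot>\<^bsub>TA X Y\<^esub> w \<oplus>\<^bsub>TA X Y\<^esub> v \<odot>\<^bsub>TA X Y\<^esub> w" "TA X Y"]
  interpret T: abelian_group "TA X Y" by simp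
  have cl: "u \<odot>\<^bsub>TA X Y\<^esub> w \<in> carrier (TA X Y)" if "u \<in> carrier U" "w \<in> carrier (TA X Y)" for u w
    using that by (rule ahom_closed[OF TA_smult_ahom])
  show "(u \<oplus>\<^bsub>U\<^esub> v) \<odot>\<^bsub>TA X Y\<^esub> w = u \<odot>\<^bsub>TA X Y\<^esub> w \<oplus>\<^bsub>TA X Y\<^esub> v \<odot>\<^bsub>TA X Y\<^esub> w"
  proof (rule TA_ext[OF X Y, where f = "\<lambda>w. (u \<oplus>\<^bsub>U\<^esub> v) \<odot>\<^bsub>TA X Y\<^esub> w" and Z = "TA X Y"])
    show "(\<lambda>w. u \<odot>\<^bsub>TA X Y\<^esub> w \<oplus>\<^bsub>TA X Y\<^esub> v \<odot>\<^bsub>TA X Y\<^esub> w) \<in> ahom (TA X Y) (TA X Y)"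
      using uv by (intro ahomI) (simp_all add: cl ahom_add[OF TA_smult_ahom] T.a_ac)
    show "(u \<oplus>\<^bsub>U\<^esub> v) \<odot>\<^bsub>TA X Y\<^esub> tp X Y x y = u \<odot>\<^bsub>TA X Y\<^esub> tp X Y x y \<oplus>\<^bsub>TA X Y\<^esub> v \<odot>\<^bsub>TA X Y\<^esub> tp X Y x y"
      if "x \<in> carrier X" "y \<in> carrier Y" for x y
      using that uv by (simp add: TA_smult_tp ahom_add[OF comul_ahom] ahom_add[OF swU_ahom[OF _ UU_bal_tp]])
  qed (use uv w in \<open>simp_all add: TA_smult_ahom\<close>)
  show "(u \<cdot> v) \<odot>\<^bsub>TA X Y\<^esub> w = u \<odot>\<^bsub>TA X Y\<^esub> (v \<odot>\<^bsub>TA X Y\<^esub> w)"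
  proof (rule TA_ext[OF X Y, where f = "\<lambda>w. (u \<cdot> v) \<odot>\<^bsub>TA X Y\<^esub> w" and Z = "TA X Y"])
    show "(\<lambda>w. u \<odot>\<^bsub>TA X Y\<^esub> (v \<odot>\<^bsub>TA X Y\<^esub> w)) \<in> ahom (TA X Y) (TA X Y)"
      using ahom_compose[OF TA_smult_ahom[OF uv(2)] TA_smult_ahom[OF uv(1)]] .
    fix x y assume xy: "x \<in> carrier X" "y \<in> carrier Y"
    have "u \<odot>\<^bsub>TA X Y\<^esub> (v \<odot>\<^bsub>TA X Y\<^esub> tp X Y x y) = sw (TA X Y) (\<lambda>v1 v2. u \<odot>\<^bsub>TA X Y\<^esub> tp X Y (v1 \<odot>\<^bsub>X\<^esub> x) (v2 \<odot>\<^bsub>Y\<^esub> y)) (\<Delta> v)"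
      using xy uv by (simp add: TA_smult_tp[of v]) (rule hom_swU[OF _ _ TA_smult_ahom], simp_all)
    also have "\<dots> = sw (TA X Y) (\<lambda>v1 v2. sw (TA X Y) (\<lambda>u1 u2.
        tp X Y ((u1 \<cdot> v1) \<odot>\<^bsub>X\<^esub> x) ((u2 \<cdot> v2) \<odot>\<^bsub>Y\<^esub> y)) (\<Delta> u)) (\<Delta> v)"
    proof (intro swU_cong)
      fix v1 v2 assume "v1 \<in> carrier U" "v2 \<in> carrier U"
      then show "u \<odot>\<^bsub>TA X Y\<^esub> tp X Y (v1 \<odot>\<^bsub>X\<^esub> x) (v2 \<odot>\<^bsub>Y\<^esub> y) =
          sw (TA X Y) (\<lambda>u1 u2. tp X Y ((u1 \<cdot> v1) \<odot>\<^bsub>X\<^esub> x) ((u2 \<cdot> v2) \<odot>\<^bsub>Y\<^esub> y)) (\<Delta> u)"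
        using xy uv by (simp add: TA_smult_tp) (intro swU_cong, simp_all add: smult_mult)
    qed (use xy uv in \<open>auto intro!: swU_closed\<close>)
    also have "\<dots> = (u \<cdot> v) \<odot>\<^bsub>TA X Y\<^esub> tp X Y x y"
      using xy uv by (simp add: TA_smult_tp comul_eval_mult[OF _ UU_bal_tp])
    finally show "(u \<cdot> v) \<odot>\<^bsub>TA X Y\<^esub> tp X Y x y = u \<odot>\<^bsub>TA X Y\<^esub> (v \<odot>\<^bsub>TA X Y\<^esub> tp X Y x y)" ..
  qed (use uv w in \<open>simp_all add: TA_smult_ahom\<close>)
next
  fix w assume w: "w \<in> carrier (TA X Y)"
  show "\<one>\<^sub>U \<odot>\<^bsub>TA X Y\<^esub> w = w"
    by (rule TA_ext[OF X Y, where f = "\<lambda>w. \<one>\<^sub>U \<odot>\<^bsub>TA X Y\<^esub> w" and g = "\<lambda>w. w" and Z = "TA X Y"])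
      (use w in \<open>auto intro!: ahomI simp: TA_smult_ahom TA_smult_tp comul_one swU_tp UU_bal_tp ahom_closed[OF TA_smult_ahom] ahom_add[OF TA_smult_ahom]\<close>)
qed (simp_all add: U.ring_axioms)

text \<open>A map out of \<open>X \<otimes>\<^sub>A Y\<close> given on pure tensors is linear as soon as it is so on pure tensors.\<close>

lemma lift_lin:
  assumes Z: "umod Z" and b: "bal X Y Z \<beta>"
    and e: "\<And>u x y. [|u \<in> carrier U; x \<in> carrier X; y \<in> carrier Y|] ==>
      sw Z (\<lambda>u1 u2. \<beta> (u1 \<odot>\<^bsub>X\<^esub> x) (u2 \<odot>\<^bsub>Y\<^esub> y)) (\<Delta> u) = u \<odot>\<^bsub>Z\<^esub> \<beta> x y"
  shows "(\<lambda>w\<in>carrier (TA X Y). sw Z \<beta> w) \<in> lin (TA X Y) Z"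
proof (rule lin_mapsI)
  note [simp] = Z
  show "(\<lambda>w\<in>carrier (TA X Y). sw Z \<beta> w) \<in> ahom (TA X Y) Z"
    by (rule ahom_restrict[OF sw_ahom]) (use b in simp_all)
  fix u w assume u: "u \<in> carrier U" and w: "w \<in> carrier (TA X Y)"
  have "sw Z \<beta> (u \<odot>\<^bsub>TA X Y\<^esub> w) = u \<odot>\<^bsub>Z\<^esub> sw Z \<beta> w"
  proof (rule TA_ext[OF X Y, where f = "\<lambda>w. sw Z \<beta> (u \<odot>\<^bsub>TA X Y\<^esub> w)" and g = "\<lambda>w. u \<odot>\<^bsub>Z\<^esub> sw Z \<beta> w" and Z = Z])
    show "(\<lambda>w. sw Z \<beta> (u \<odot>\<^bsub>TA X Y\<^esub> w)) \<in> ahom (TA X Y) Z" "(\<lambda>w. u \<odot>\<^bsub>Z\<^esub> sw Z \<beta> w) \<in> ahom (TA X Y) Z"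
      using ahom_compose[OF TA_smult_ahom[OF u] sw_ahom[OF X Y _ b]] ahom_compose[OF sw_ahom[OF X Y _ b] smult_ahom[OF Z u]]
      by simp_all
    fix x y assume xy: "x \<in> carrier X" "y \<in> carrier Y"
    have "sw Z \<beta> (u \<odot>\<^bsub>TA X Y\<^esub> tp X Y x y) = sw Z (\<lambda>u1 u2. sw Z \<beta> (tp X Y (u1 \<odot>\<^bsub>X\<^esub> x) (u2 \<odot>\<^bsub>Y\<^esub> y))) (\<Delta> u)"
      using xy u b by (simp add: TA_smult_tp) (rule hom_swU[OF _ _ sw_ahom[OF X Y]], simp_all)
    also have "\<dots> = sw Z (\<lambda>u1 u2. \<beta> (u1 \<odot>\<^bsub>X\<^esub> x) (u2 \<odot>\<^bsub>Y\<^esub> y)) (\<Delta> u)"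
      using xy u b by (intro swU_cong) (simp_all add: sw_tp balAD[OF b])
    also have "\<dots> = u \<odot>\<^bsub>Z\<^esub> sw Z \<beta> (tp X Y x y)"
      using xy u b by (simp add: e sw_tp)
    finally show "sw Z \<beta> (u \<odot>\<^bsub>TA X Y\<^esub> tp X Y x y) = u \<odot>\<^bsub>Z\<^esub> sw Z \<beta> (tp X Y x y)" .
  qed (use w in simp_all)
  then show "(\<lambda>w\<in>carrier (TA X Y). sw Z \<beta> w) (u \<odot>\<^bsub>TA X Y\<^esub> w) = u \<odot>\<^bsub>Z\<^esub> (\<lambda>w\<in>carrier (TA X Y). sw Z \<beta> w) w"
    using u w ahom_closed[OF TA_smult_ahom] by simp
qed auto

lemma lin_TA_ext:
  assumes "f \<in> lin (TA X Y) Z" "g \<in> lin (TA X Y) Z" "umod Z"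
    "\<And>x y. [|x \<in> carrier X; y \<in> carrier Y|] ==> f (tp X Y x y) = g (tp X Y x y)"
  shows "f = g"
  by (rule lin_maps_eqI[OF assms(1,2)], rule TA_ext[OF X Y _ lin_mapsD(1)[OF assms(1)] lin_mapsD(1)[OF assms(2)]])
    (use assms in auto)

end

lemma tp_diag:
  assumes "umod X" "umod Y" "umod Z" "f \<in> lin (TA X Y) Z" "u \<in> carrier U" "x \<in> carrier X" "y \<in> carrier Y"
  shows "u \<odot>\<^bsub>Z\<^esub> f (tp X Y x y) = sw Z (\<lambda>u1 u2. f (tp X Y (u1 \<odot>\<^bsub>X\<^esub> x) (u2 \<odot>\<^bsub>Y\<^esub> y))) (\<Delta> u)"
proof -
  have "u \<odot>\<^bsub>Z\<^esub> f (tp X Y x y) = f (u \<odot>\<^bsub>TA X Y\<^esub> tp X Y x y)"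
    using assms by (simp add: lin_mapsD(4)[OF assms(4)])
  also have "\<dots> = sw Z (\<lambda>u1 u2. f (tp X Y (u1 \<odot>\<^bsub>X\<^esub> x) (u2 \<odot>\<^bsub>Y\<^esub> y))) (\<Delta> u)"
    unfolding TA_smult_tp[OF assms(1,2,5-7)]
    by (rule hom_swU[OF _ _ lin_mapsD(1)[OF assms(4)]]) (use assms in simp_all)
  finally show ?thesis .
qed

lemma tens_map_lin:
  assumes [simp]: "umod X" "umod X'" "umod Y" "umod Y'" and f: "f \<in> lin X X'" and g: "g \<in> lin Y Y'"
  shows "tens_mapA H X X' Y Y' f g \<in> lin (TA X Y) (TA X' Y')"
    and "[|x \<in> carrier X; y \<in> carrier Y|] ==> tens_mapA H X X' Y Y' f g (tp X Y x y) = tp X' Y' (f x) (g y)"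
proof -
  note [simp] = lin_mapsD(2)[OF f] lin_mapsD(2)[OF g]
  have b: "bal X Y (TA X' Y') (\<lambda>x y. tp X' Y' (f x) (g y))"
    by (rule balAI) (auto simp: lin_mapsD(4,5)[OF f] lin_mapsD(4,5)[OF g] tp_add tp_balance)
  show "tens_mapA H X X' Y Y' f g \<in> lin (TA X Y) (TA X' Y')"
    unfolding tens_mapA_def
  proof (rule lift_lin[OF _ _ _ b])
    fix u x y assume h: "u \<in> carrier U" "x \<in> carrier X" "y \<in> carrier Y"
    then show "sw (TA X' Y') (\<lambda>u1 u2. tp X' Y' (f (u1 \<odot>\<^bsub>X\<^esub> x)) (g (u2 \<odot>\<^bsub>Y\<^esub> y))) (\<Delta> u) = u \<odot>\<^bsub>TA X' Y'\<^esub> tp X' Y' (f x) (g y)"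
      by (simp add: TA_smult_tp) (intro swU_cong, simp_all add: lin_mapsD(4)[OF f] lin_mapsD(4)[OF g])
  qed simp_all
  show "tens_mapA H X X' Y Y' f g (tp X Y x y) = tp X' Y' (f x) (g y)" if "x \<in> carrier X" "y \<in> carrier Y"
    using that by (simp add: tens_mapA_def sw_tp[OF _ _ _ b])
qed

subsection \<open>Evaluation of iterated coproducts\<close>

definition bal3 :: "('z, 'c) ring_scheme \<Rightarrow> ('w \<Rightarrow> 'w \<Rightarrow> 'w \<Rightarrow> 'z) \<Rightarrow> bool"
  where "bal3 Z \<beta> \<longleftrightarrow> (\<forall>x\<in>carrier U. bal UM UM Z (\<beta> x)) \<and>
    (\<forall>y\<in>carrier U. \<forall>z\<in>carrier U. (\<lambda>x. \<beta> x y z) \<in> ahom U Z) \<and>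
    (\<forall>a\<in>carrier A. \<forall>x\<in>carrier U. \<forall>y\<in>carrier U. \<forall>z\<in>carrier U. \<beta> (t a \<cdot> x) y z = \<beta> x (s a \<cdot> y) z)"

lemma comul_eval_coassoc:
  assumes Z: "abelian_group Z" and b: "bal3 Z \<beta>" and u: "u \<in> carrier U"
  shows "sw Z (\<lambda>x y. sw Z (\<lambda>x1 x2. \<beta> x1 x2 y) (\<Delta> x)) (\<Delta> u) = sw Z (\<lambda>x y. sw Z (\<lambda>y1 y2. \<beta> x y1 y2) (\<Delta> y)) (\<Delta> u)"
proof -
  have b1: "bal UM UM Z (\<beta> x)" if "x \<in> carrier U" for x
    using b that by (simp add: bal3_def)
  have b2: "bal UM (UU H) Z (\<lambda>x q. sw Z (\<beta> x) q)"
  proof (rule balAI; simp)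
    fix x q q' assume "x \<in> carrier U" "q \<in> carrier (UU H)" "q' \<in> carrier (UU H)"
    then show "sw Z (\<beta> x) (q \<oplus>\<^bsub>UU H\<^esub> q') = sw Z (\<beta> x) q \<oplus>\<^bsub>Z\<^esub> sw Z (\<beta> x) q'" "sw Z (\<beta> x) q \<in> carrier Z"
      using ahom_add[OF swU_ahom[OF Z b1]] ahom_closed[OF swU_ahom[OF Z b1]] by auto
  next
    fix x x' q assume h: "x \<in> carrier U" "x' \<in> carrier U" "q \<in> carrier (UU H)"
    then show "sw Z (\<beta> (x \<oplus>\<^bsub>U\<^esub> x')) q = sw Z (\<beta> x) q \<oplus>\<^bsub>Z\<^esub> sw Z (\<beta> x') q"
      using b by (intro ahom_add[of "\<lambda>x. sw Z (\<beta> x) q" U] swU_in_ahom) (auto simp: Z bal3_def U.abelian_group_axioms)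
  next
    fix a x q assume h: "a \<in> carrier A" "x \<in> carrier U" "q \<in> carrier (UU H)"
    show "sw Z (\<beta> (t a \<cdot> x)) q = sw Z (\<beta> x) (s a \<odot>\<^bsub>UU H\<^esub> q)"
    proof (rule UU_ext[where Z = Z and f = "sw Z (\<beta> (t a \<cdot> x))" and g = "\<lambda>q. sw Z (\<beta> x) (s a \<odot>\<^bsub>UU H\<^esub> q)"])
      show "(\<lambda>q. sw Z (\<beta> x) (s a \<odot>\<^bsub>UU H\<^esub> q)) \<in> ahom (UU H) Z"
        using h by (intro ahom_compose[OF smult_ahom[of U] swU_ahom]) (auto simp: b1 Z)
      show "sw Z (\<beta> (t a \<cdot> x)) (tpU H y z) = sw Z (\<beta> x) (s a \<odot>\<^bsub>UU H\<^esub> tpU H y z)"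
        if "y \<in> carrier U" "z \<in> carrier U" for y z
        using h b that by (simp add: s_tp swU_tp b1 Z) (simp add: bal3_def)
    qed (use h in \<open>simp_all add: Z swU_ahom b1\<close>)
  qed
  let ?\<Phi> = "sw Z (\<lambda>x q. sw Z (\<beta> x) q)"
  have h: "?\<Phi> \<in> ahom (UUU H) Z"
    by (rule sw_ahom) (use Z b2 in simp_all)
  have ev: "?\<Phi> (tpA H UM (UU H) x q) = sw Z (\<beta> x) q" if "x \<in> carrier U" "q \<in> carrier (UU H)" for x q
    using that by (subst sw_tp[OF _ _ Z b2]) auto
  have c: "sw Z (\<beta> x) q \<in> carrier Z" if "x \<in> carrier U" "q \<in> carrier (UU H)" for x q
    using that by (intro ahom_closed[OF swU_ahom]) (simp_all add: Z b1)
  have b0: "\<beta> x y z \<in> carrier Z" if "x \<in> carrier U" "y \<in> carrier U" "z \<in> carrier U" for x y z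
    using balUD(1)[OF b1] that by auto
  have "?\<Phi> (sw (UUU H) (\<lambda>x y. sw (UUU H) (\<lambda>x1 x2. tpA H UM (UU H) x1 (tpU H x2 y)) (\<Delta> x)) (\<Delta> u))
      = sw Z (\<lambda>x y. sw Z (\<lambda>x1 x2. \<beta> x1 x2 y) (\<Delta> x)) (\<Delta> u)"
    apply (subst hom_swU[OF _ Z h])
       apply (use u in \<open>auto intro!: swU_closed\<close>)[3]
    apply (intro swU_cong)
       apply (use u Z in \<open>auto intro!: swU_closed simp: b0\<close>)[2]
     apply (subst hom_swU[OF _ Z h])
        apply (use u in \<open>auto intro!: swU_closed\<close>)[3]
     apply (intro swU_cong)
        apply (use u Z in \<open>auto intro!: swU_closed simp: b0 ev swU_tp b1\<close>)
    done
  moreover have "?\<Phi> (sw (UUU H) (\<lambda>x y. tpA H UM (UU H) x (\<Delta> y)) (\<Delta> u)) = sw Z (\<lambda>x y. sw Z (\<lambda>y1 y2. \<beta> x y1 y2) (\<Delta> y)) (\<Delta> u)"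
    apply (subst hom_swU[OF _ Z h])
       apply (use u in \<open>auto\<close>)[3]
    apply (intro swU_cong)
       apply (use u Z in \<open>auto simp: ev c\<close>)
    done
  ultimately show ?thesis
    using left_bialgebroid.coassoc[OF bialgebroid u] by simp
qed

end

section \<open>The monoidal category of modules\<close>

lemma lin_maps_inverseI:
  assumes f: "f \<in> lin_maps R X Y" and X: "lmodule R X" and Y: "lmodule R Y"
    and g: "\<And>y. y \<in> carrier Y ==> g y \<in> carrier X" "g \<in> extensional (carrier Y)"
    and gf: "\<And>x. x \<in> carrier X ==> g (f x) = x" and fg: "\<And>y. y \<in> carrier Y ==> f (g y) = y"
  shows "g \<in> lin_maps R Y X"
proof (rule lin_mapsI)
  show "g \<in> ahom Y X"
  proof (rule ahomI)
    fix y y' assume "y \<in> carrier Y" "y' \<in> carrier Y"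
    then show "g (y \<oplus>\<^bsub>Y\<^esub> y') = g y \<oplus>\<^bsub>X\<^esub> g y'"
      using gf[of "g y \<oplus>\<^bsub>X\<^esub> g y'"] X g fg lin_mapsD(5)[OF f, of "g y" "g y'"]
      by (simp add: add_closed lmodule_group)
  qed (rule g)
  fix u y assume "u \<in> carrier R" "y \<in> carrier Y"
  then show "g (u \<odot>\<^bsub>Y\<^esub> y) = u \<odot>\<^bsub>X\<^esub> g y"
    using gf[of "u \<odot>\<^bsub>X\<^esub> g y"] g fg lin_mapsD(4)[OF f, of u "g y"] smult_closed[OF X] by simp
qed (rule g)

context bialgebroid_setting
begin

lemma tp_ahom_left: "[|umod X; umod Y; y \<in> carrier Y|] ==> (\<lambda>x. tp X Y x y) \<in> ahom X (TA X Y)"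
  by (rule balAD(3)[OF tp_bal])

lemma tp_ahom_right: "[|umod X; umod Y; x \<in> carrier X|] ==> tp X Y x \<in> ahom Y (TA X Y)"
  by (rule balAD(2)[OF tp_bal])

lemma TA_ext_left:
  assumes "umod X" "umod Y" "umod Z" "abelian_group W" "f \<in> ahom (TA (TA X Y) Z) W" "g \<in> ahom (TA (TA X Y) Z) W"
    "w \<in> carrier (TA (TA X Y) Z)"
    "\<And>x y z. [|x \<in> carrier X; y \<in> carrier Y; z \<in> carrier Z|] ==>
      f (tp (TA X Y) Z (tp X Y x y) z) = g (tp (TA X Y) Z (tp X Y x y) z)"
  shows "f w = g w"
proof (rule TA_ext[OF _ _ assms(4-7)])
  fix p z assume p: "p \<in> carrier (TA X Y)" and z: "z \<in> carrier Z"
  show "f (tp (TA X Y) Z p z) = g (tp (TA X Y) Z p z)"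
    by (rule TA_ext[OF assms(1,2,4) ahom_compose[OF tp_ahom_left assms(5)] ahom_compose[OF tp_ahom_left assms(6)] p])
      (use assms z in auto)
qed (use assms in auto)

lemma TA_ext_right:
  assumes "umod X" "umod Y" "umod Z" "abelian_group W" "f \<in> ahom (TA X (TA Y Z)) W" "g \<in> ahom (TA X (TA Y Z)) W"
    "w \<in> carrier (TA X (TA Y Z))"
    "\<And>x y z. [|x \<in> carrier X; y \<in> carrier Y; z \<in> carrier Z|] ==>
      f (tp X (TA Y Z) x (tp Y Z y z)) = g (tp X (TA Y Z) x (tp Y Z y z))"
  shows "f w = g w"
proof (rule TA_ext[OF _ _ assms(4-7)])
  fix p x assume p: "p \<in> carrier (TA Y Z)" and x: "x \<in> carrier X"
  show "f (tp X (TA Y Z) x p) = g (tp X (TA Y Z) x p)"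
    by (rule TA_ext[OF assms(2,3,4) ahom_compose[OF tp_ahom_right assms(5)] ahom_compose[OF tp_ahom_right assms(6)] p])
      (use assms x in auto)
qed (use assms in auto)

subsection \<open>Associativity\<close>

definition assoc_inv :: "('w, 'w) module \<Rightarrow> ('w, 'w) module \<Rightarrow> ('w, 'w) module \<Rightarrow> 'w \<Rightarrow> 'w"
  where "assoc_inv X Y Z =
    (\<lambda>w\<in>carrier (TA X (TA Y Z)).
      sw (TA (TA X Y) Z) (\<lambda>x q.
        sw (TA (TA X Y) Z) (\<lambda>y z. tp (TA X Y) Z (tp X Y x y) z) q) w)"

context
  fixes X Y Z :: "('w, 'w) module"
  assumes X [simp]: "umod X" and Y [simp]: "umod Y" and Z [simp]: "umod Z"
begin

private abbreviation "L \<equiv> TA (TA X Y) Z"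
private abbreviation "R \<equiv> TA X (TA Y Z)"

lemma assoc_bal1: "z \<in> carrier Z ==> bal X Y R (\<lambda>x y. tp X (TA Y Z) x (tp Y Z y z))"
  by (rule balAI) (simp_all add: tp_add tp_balance s_tp)

lemma assoc_bal2: "bal (TA X Y) Z R (\<lambda>p z. sw R (\<lambda>x y. tp X (TA Y Z) x (tp Y Z y z)) p)" (is "bal _ _ _ (\<lambda>p z. ?f z p)")
proof -
  have h: "?f z \<in> ahom (TA X Y) R" if "z \<in> carrier Z" for z
    by (rule sw_ahom) (use that assoc_bal1 in simp_all)
  show ?thesis
  proof (rule balAI)
    fix p z z' assume "p \<in> carrier (TA X Y)" "z \<in> carrier Z" "z' \<in> carrier Z"
    then show "?f (z \<oplus>\<^bsub>Z\<^esub> z') p = ?f z p \<oplus>\<^bsub>R\<^esub> ?f z' p"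
      by (intro ahom_add[of "\<lambda>z. ?f z p" Z] sw_in_ahom[OF X Y]) (auto intro!: ahomI simp: tp_add)
  next
    fix a p z assume a: "a \<in> carrier A" "p \<in> carrier (TA X Y)" "z \<in> carrier Z"
    show "?f z (t a \<odot>\<^bsub>TA X Y\<^esub> p) = ?f (s a \<odot>\<^bsub>Z\<^esub> z) p"
      by (rule TA_ext[OF X Y _ ahom_compose[OF smult_ahom[of U] h] h a(2)])
        (use a in \<open>simp_all add: t_tp sw_tp assoc_bal1 tp_balance\<close>)
  qed (simp_all add: ahom_closed[OF h] ahom_add[OF h])
qed

lemma associator_tp:
  "[|x \<in> carrier X; y \<in> carrier Y; z \<in> carrier Z|] ==>
    associatorA H X Y Z (tp (TA X Y) Z (tp X Y x y) z) = tp X (TA Y Z) x (tp Y Z y z)"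
  by (simp add: associatorA_def sw_tp assoc_bal2 assoc_bal1)

lemma associator_lin: "associatorA H X Y Z \<in> lin L R"
  unfolding associatorA_def
proof (rule lift_lin[OF _ _ _ assoc_bal2])
  let ?f = "\<lambda>z. sw R (\<lambda>x y. tp X (TA Y Z) x (tp Y Z y z))"
  have h: "?f z \<in> ahom (TA X Y) R" if "z \<in> carrier Z" for z
    by (rule sw_ahom) (use that assoc_bal1 in simp_all)
  fix u p z assume u: "u \<in> carrier U" and p: "p \<in> carrier (TA X Y)" and z: "z \<in> carrier Z"
  show "sw R (\<lambda>u1 u2. ?f (u2 \<odot>\<^bsub>Z\<^esub> z) (u1 \<odot>\<^bsub>TA X Y\<^esub> p)) (\<Delta> u) = u \<odot>\<^bsub>R\<^esub> ?f z p"
  proof (rule TA_ext[OF X Y, of R "\<lambda>p. sw R (\<lambda>u1 u2. ?f (u2 \<odot>\<^bsub>Z\<^esub> z) (u1 \<odot>\<^bsub>TA X Y\<^esub> p)) (\<Delta> u)" "\<lambda>p. u \<odot>\<^bsub>R\<^esub> ?f z p"])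
    show "(\<lambda>p. sw R (\<lambda>u1 u2. ?f (u2 \<odot>\<^bsub>Z\<^esub> z) (u1 \<odot>\<^bsub>TA X Y\<^esub> p)) (\<Delta> u)) \<in> ahom (TA X Y) R"
      using u z by (intro swU_in_ahom ahom_compose[OF smult_ahom[of U] h]) simp_all
    show "(\<lambda>p. u \<odot>\<^bsub>R\<^esub> ?f z p) \<in> ahom (TA X Y) R"
      by (rule ahom_compose[OF h smult_ahom[of U]]) (use u z in simp_all)
    fix x y assume xy: "x \<in> carrier X" "y \<in> carrier Y"
    let ?b = "\<lambda>u1 u2 u3. tp X (TA Y Z) (u1 \<odot>\<^bsub>X\<^esub> x) (tp Y Z (u2 \<odot>\<^bsub>Y\<^esub> y) (u3 \<odot>\<^bsub>Z\<^esub> z))"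
    have b3: "bal3 R ?b"
      unfolding bal3_def
    proof (intro conjI ballI)
      fix x' assume "x' \<in> carrier U"
      then show "bal UM UM R (?b x')"
        using xy z by (intro balUI) (simp_all add: smult_l_distr smult_mult tp_add tp_balance)
    next
      fix y' z' assume "y' \<in> carrier U" "z' \<in> carrier U"
      then show "(\<lambda>x. ?b x y' z') \<in> ahom U R"
        using xy z by (intro ahomI) (simp_all add: smult_l_distr tp_add)
    next
      fix a x' y' z' assume "a \<in> carrier A" "x' \<in> carrier U" "y' \<in> carrier U" "z' \<in> carrier U"
      then show "?b (t a \<cdot> x') y' z' = ?b x' (s a \<cdot> y') z'"
        using xy z by (simp add: smult_mult tp_balance s_tp)
    qed
    have "sw R (\<lambda>u1 u2. ?f (u2 \<odot>\<^bsub>Z\<^esub> z) (u1 \<odot>\<^bsub>TA X Y\<^esub> tp X Y x y)) (\<Delta> u) =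
        sw R (\<lambda>u1 u2. sw R (\<lambda>u11 u12. ?b u11 u12 u2) (\<Delta> u1)) (\<Delta> u)"
    proof (rule swU_cong)
      fix u1 u2 assume u12: "u1 \<in> carrier U" "u2 \<in> carrier U"
      have "?f (u2 \<odot>\<^bsub>Z\<^esub> z) (u1 \<odot>\<^bsub>TA X Y\<^esub> tp X Y x y) =
          sw R (\<lambda>u11 u12. ?f (u2 \<odot>\<^bsub>Z\<^esub> z) (tp X Y (u11 \<odot>\<^bsub>X\<^esub> x) (u12 \<odot>\<^bsub>Y\<^esub> y))) (\<Delta> u1)"
        unfolding TA_smult_tp[OF X Y u12(1) xy] by (rule hom_swU[OF _ _ h]) (use u12 xy z in simp_all)
      also have "\<dots> = sw R (\<lambda>u11 u12. ?b u11 u12 u2) (\<Delta> u1)"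
        using u12 xy z by (intro swU_cong) (simp_all add: sw_tp assoc_bal1)
      finally show "?f (u2 \<odot>\<^bsub>Z\<^esub> z) (u1 \<odot>\<^bsub>TA X Y\<^esub> tp X Y x y) = sw R (\<lambda>u11 u12. ?b u11 u12 u2) (\<Delta> u1)" .
      show "sw R (\<lambda>u11 u12. ?b u11 u12 u2) (\<Delta> u1) \<in> carrier R"
        using u12 xy z by (intro swU_closed) simp_all
    qed (use u in simp_all)
    also have "\<dots> = sw R (\<lambda>u1 u2. sw R (\<lambda>u21 u22. ?b u1 u21 u22) (\<Delta> u2)) (\<Delta> u)"
      by (rule comul_eval_coassoc[OF _ b3 u]) simp
    also have "\<dots> = sw R (\<lambda>u1 u2. tp X (TA Y Z) (u1 \<odot>\<^bsub>X\<^esub> x) (u2 \<odot>\<^bsub>TA Y Z\<^esub> tp Y Z y z)) (\<Delta> u)"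
    proof (rule swU_cong)
      fix u1 u2 assume u12: "u1 \<in> carrier U" "u2 \<in> carrier U"
      show "sw R (\<lambda>u21 u22. ?b u1 u21 u22) (\<Delta> u2) = tp X (TA Y Z) (u1 \<odot>\<^bsub>X\<^esub> x) (u2 \<odot>\<^bsub>TA Y Z\<^esub> tp Y Z y z)"
        unfolding TA_smult_tp[OF Y Z u12(2) xy(2) z]
        by (rule hom_swU[OF _ _ tp_ahom_right, symmetric]) (use u12 xy z in simp_all)
    qed (use u xy z in simp_all)
    also have "\<dots> = u \<odot>\<^bsub>R\<^esub> ?f z (tp X Y x y)"
      using u xy z by (simp add: sw_tp assoc_bal1 TA_smult_tp[of X "TA Y Z"])
    finally show "sw R (\<lambda>u1 u2. ?f (u2 \<odot>\<^bsub>Z\<^esub> z) (u1 \<odot>\<^bsub>TA X Y\<^esub> tp X Y x y)) (\<Delta> u) = u \<odot>\<^bsub>R\<^esub> ?f z (tp X Y x y)" .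
  qed (use p in simp_all)
qed simp_all

lemma assoc_inv_bal1: "x \<in> carrier X ==> bal Y Z L (\<lambda>y z. tp (TA X Y) Z (tp X Y x y) z)"
  by (rule balAI) (simp_all add: tp_add tp_balance[symmetric] t_tp)

lemma assoc_inv_bal2: "bal X (TA Y Z) L (\<lambda>x q. sw L (\<lambda>y z. tp (TA X Y) Z (tp X Y x y) z) q)" (is "bal _ _ _ ?f")
proof -
  have h: "?f x \<in> ahom (TA Y Z) L" if "x \<in> carrier X" for x
    by (rule sw_ahom) (use that assoc_inv_bal1 in simp_all)
  show ?thesis
  proof (rule balAI)
    fix x x' q assume "x \<in> carrier X" "x' \<in> carrier X" "q \<in> carrier (TA Y Z)"
    then show "?f (x \<oplus>\<^bsub>X\<^esub> x') q = ?f x q \<oplus>\<^bsub>L\<^esub> ?f x' q"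
      by (intro ahom_add[of "\<lambda>x. ?f x q" X] sw_in_ahom[OF Y Z]) (auto intro!: ahomI simp: tp_add)
  next
    fix a x q assume a: "a \<in> carrier A" "x \<in> carrier X" "q \<in> carrier (TA Y Z)"
    show "?f (t a \<odot>\<^bsub>X\<^esub> x) q = ?f x (s a \<odot>\<^bsub>TA Y Z\<^esub> q)"
      by (rule TA_ext[OF Y Z _ h ahom_compose[OF smult_ahom[of U] h] a(3)])
        (use a in \<open>simp_all add: s_tp sw_tp assoc_inv_bal1 tp_balance\<close>)
  qed (simp_all add: ahom_closed[OF h] ahom_add[OF h])
qed

lemma assoc_inv_tp:
  "[|x \<in> carrier X; y \<in> carrier Y; z \<in> carrier Z|] ==>
    assoc_inv X Y Z (tp X (TA Y Z) x (tp Y Z y z)) = tp (TA X Y) Z (tp X Y x y) z"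
  by (simp add: assoc_inv_def sw_tp assoc_inv_bal2 assoc_inv_bal1)

lemma assoc_inv_ahom: "assoc_inv X Y Z \<in> ahom R L"
  unfolding assoc_inv_def by (intro ahom_restrict sw_ahom) (simp_all add: assoc_inv_bal2)

lemma assoc_inv_associator: "w \<in> carrier L ==> assoc_inv X Y Z (associatorA H X Y Z w) = w"
  by (rule TA_ext_left[OF X Y Z _ ahom_compose[OF lin_mapsD(1)[OF associator_lin] assoc_inv_ahom], of "\<lambda>w. w"])
    (auto intro!: ahomI simp: associator_tp assoc_inv_tp)

lemma associator_assoc_inv: "w \<in> carrier R ==> associatorA H X Y Z (assoc_inv X Y Z w) = w"
  by (rule TA_ext_right[OF X Y Z _ ahom_compose[OF assoc_inv_ahom lin_mapsD(1)[OF associator_lin]], of "\<lambda>w. w"])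
    (auto intro!: ahomI simp: associator_tp assoc_inv_tp)

lemma assoc_inv_lin: "assoc_inv X Y Z \<in> lin R L"
  by (rule lin_maps_inverseI[OF associator_lin])
    (simp_all add: ahom_closed[OF assoc_inv_ahom] assoc_inv_associator associator_assoc_inv,
      simp add: assoc_inv_def)

end

subsection \<open>Units\<close>

lemma comul_smult: "[|u \<in> carrier U; v \<in> carrier U|] ==> \<Delta> (u \<cdot> v) = u \<odot>\<^bsub>UU H\<^esub> \<Delta> v"
  by (simp add: comul_mult TA_smult)

lemma umod_AM [simp]: "umod AM"
proof (rule lmoduleI)
  show "abelian_group AM"
    using A.abelian_group_axioms by (rule abelian_group_additive_cong[rotated 3]) simp_all
  fix u v a assume "u \<in> carrier U" "v \<in> carrier U" "a \<in> carrier AM"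
  then show "(u \<cdot> v) \<odot>\<^bsub>AM\<^esub> a = u \<odot>\<^bsub>AM\<^esub> (v \<odot>\<^bsub>AM\<^esub> a)"
    using counit_mult_src[of u "v \<cdot> s a"] by (simp add: U.m_assoc)
qed (simp_all add: U.ring_axioms s_add counit_add U.l_distr U.r_distr)

lemma counit_left_bal: "bal UM UM U (\<lambda>x y. s (\<epsilon> x) \<cdot> y)"
  by (rule balUI) (simp_all add: U.r_distr U.l_distr counit_add s_add counit_tgt s_mult U.m_assoc)

lemma counit_right_bal: "bal UM UM U (\<lambda>x y. t (\<epsilon> y) \<cdot> x)"
  by (rule balUI) (simp_all add: U.r_distr U.l_distr counit_add t_add counit_src t_mult U.m_assoc)

lemma lunit_bal: "umod X ==> bal AM X X (\<lambda>a x. s a \<odot>\<^bsub>X\<^esub> x)"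
  by (rule balAI) (simp_all add: smult_l_distr smult_r_distr s_add counit_src s_mult smult_mult flip: st_commute)

lemma runit_bal: "umod X ==> bal X AM X (\<lambda>x a. t a \<odot>\<^bsub>X\<^esub> x)"
  by (rule balAI) (simp_all add: smult_l_distr smult_r_distr t_add counit_src t_mult smult_mult)

lemma lunit_tp: "[|umod X; a \<in> carrier A; x \<in> carrier X|] ==> lunitA H X (tp AM X a x) = s a \<odot>\<^bsub>X\<^esub> x"
  by (simp add: lunitA_def sw_tp lunit_bal)

lemma runit_tp: "[|umod X; a \<in> carrier A; x \<in> carrier X|] ==> runitA H X (tp X AM x a) = t a \<odot>\<^bsub>X\<^esub> x"
  by (simp add: runitA_def sw_tp runit_bal)

lemma counit_left_s:
  assumes u: "u \<in> carrier U" and a': "a \<in> carrier A"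
  shows "u \<cdot> s a = sw U (\<lambda>u1 u2. s (\<epsilon> (u1 \<cdot> s a)) \<cdot> u2) (\<Delta> u)"
proof -
  have "u \<cdot> s a = sw U (\<lambda>x y. s (\<epsilon> x) \<cdot> y) (u \<odot>\<^bsub>UU H\<^esub> tpU H (s a) \<one>\<^sub>U)"
    using left_bialgebroid.counit_left[OF bialgebroid, of "u \<cdot> s a"] u a' by (simp add: comul_smult comul_s)
  also have "\<dots> = sw U (\<lambda>u1 u2. sw U (\<lambda>x y. s (\<epsilon> x) \<cdot> y) (tpU H (u1 \<cdot> s a) (u2 \<cdot> \<one>\<^sub>U))) (\<Delta> u)"
    using u a' by (simp add: TA_smult_tp)
      (subst hom_swU[OF _ _ swU_ahom[OF _ counit_left_bal]], simp_all add: U.abelian_group_axioms)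
  also have "\<dots> = sw U (\<lambda>u1 u2. s (\<epsilon> (u1 \<cdot> s a)) \<cdot> u2) (\<Delta> u)"
    using u a' by (intro swU_cong) (simp_all add: swU_tp[OF _ counit_left_bal] U.abelian_group_axioms)
  finally show ?thesis .
qed

lemma lunit_lin:
  assumes [simp]: "umod X" shows "lunitA H X \<in> lin (TA AM X) X"
  unfolding lunitA_def
proof (rule lift_lin[OF _ _ _ lunit_bal])
  fix u a x assume u: "u \<in> carrier U" and a: "a \<in> carrier AM" and x: "x \<in> carrier X"
  then have a': "a \<in> carrier A" by simp
  from counit_left_s[OF u a'] have "(u \<cdot> s a) \<odot>\<^bsub>X\<^esub> x = sw U (\<lambda>u1 u2. s (\<epsilon> (u1 \<cdot> s a)) \<cdot> u2) (\<Delta> u) \<odot>\<^bsub>X\<^esub> x" by simp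
  also have "\<dots> = sw X (\<lambda>u1 u2. (s (\<epsilon> (u1 \<cdot> s a)) \<cdot> u2) \<odot>\<^bsub>X\<^esub> x) (\<Delta> u)"
    by (rule hom_swU[OF _ _ smult_ahom_left[of U]]) (use u a' x U.abelian_group_axioms in simp_all)
  also have "\<dots> = sw X (\<lambda>u1 u2. s (u1 \<odot>\<^bsub>AM\<^esub> a) \<odot>\<^bsub>X\<^esub> (u2 \<odot>\<^bsub>X\<^esub> x)) (\<Delta> u)"
    using u a' x by (intro swU_cong) (simp_all add: smult_mult)
  finally show "sw X (\<lambda>u1 u2. s (u1 \<odot>\<^bsub>AM\<^esub> a) \<odot>\<^bsub>X\<^esub> (u2 \<odot>\<^bsub>X\<^esub> x)) (\<Delta> u) = u \<odot>\<^bsub>X\<^esub> (s a \<odot>\<^bsub>X\<^esub> x)"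
    using u a' x by (simp add: smult_mult)
qed simp_all

lemma counit_right_t:
  assumes u: "u \<in> carrier U" and a': "a \<in> carrier A"
  shows "u \<cdot> t a = sw U (\<lambda>u1 u2. t (\<epsilon> (u2 \<cdot> s a)) \<cdot> u1) (\<Delta> u)"
proof -
  have "u \<cdot> t a = sw U (\<lambda>x y. t (\<epsilon> y) \<cdot> x) (u \<odot>\<^bsub>UU H\<^esub> tpU H \<one>\<^sub>U (t a))"
    using left_bialgebroid.counit_right[OF bialgebroid, of "u \<cdot> t a"] u a' by (simp add: comul_smult comul_t)
  also have "\<dots> = sw U (\<lambda>u1 u2. sw U (\<lambda>x y. t (\<epsilon> y) \<cdot> x) (tpU H (u1 \<cdot> \<one>\<^sub>U) (u2 \<cdot> t a))) (\<Delta> u)"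
    using u a' by (simp add: TA_smult_tp)
      (subst hom_swU[OF _ _ swU_ahom[OF _ counit_right_bal]], simp_all add: U.abelian_group_axioms)
  also have "\<dots> = sw U (\<lambda>u1 u2. t (\<epsilon> (u2 \<cdot> s a)) \<cdot> u1) (\<Delta> u)"
    using u a' counit_mult_src[of _ "t a"]
    by (intro swU_cong) (simp_all add: swU_tp[OF _ counit_right_bal] U.abelian_group_axioms)
  finally show ?thesis .
qed

lemma runit_lin:
  assumes [simp]: "umod X" shows "runitA H X \<in> lin (TA X AM) X"
  unfolding runitA_def
proof (rule lift_lin[OF _ _ _ runit_bal])
  fix u a x assume u: "u \<in> carrier U" and a: "a \<in> carrier AM" and x: "x \<in> carrier X"
  then have a': "a \<in> carrier A" by simp
  from counit_right_t[OF u a'] have "(u \<cdot> t a) \<odot>\<^bsub>X\<^esub> x = sw U (\<lambda>u1 u2. t (\<epsilon> (u2 \<cdot> s a)) \<cdot> u1) (\<Delta> u) \<odot>\<^bsub>X\<^esub> x" by simp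
  also have "\<dots> = sw X (\<lambda>u1 u2. (t (\<epsilon> (u2 \<cdot> s a)) \<cdot> u1) \<odot>\<^bsub>X\<^esub> x) (\<Delta> u)"
    by (rule hom_swU[OF _ _ smult_ahom_left[of U]]) (use u a' x U.abelian_group_axioms in simp_all)
  also have "\<dots> = sw X (\<lambda>u1 u2. t (u2 \<odot>\<^bsub>AM\<^esub> a) \<odot>\<^bsub>X\<^esub> (u1 \<odot>\<^bsub>X\<^esub> x)) (\<Delta> u)"
    using u a' x by (intro swU_cong) (simp_all add: smult_mult)
  finally show "sw X (\<lambda>u1 u2. t (u2 \<odot>\<^bsub>AM\<^esub> a) \<odot>\<^bsub>X\<^esub> (u1 \<odot>\<^bsub>X\<^esub> x)) (\<Delta> u) = u \<odot>\<^bsub>X\<^esub> (t a \<odot>\<^bsub>X\<^esub> x)"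
    using u a' x by (simp add: smult_mult)
qed simp_all

subsection \<open>Coherence\<close>

lemma UMod_simps [simp]:
  "Obj (UMod H) = {X. umod X}" "Mor (UMod H) = lin" "Idn (UMod H) X = (\<lambda>x\<in>carrier X. x)"
  "Cmp (UMod H) X Y Z g f = compose (carrier X) g f" "TO (UMod H) = TA" "TM (UMod H) = tens_mapA H"
  "Unt (UMod H) = AM" "Asc (UMod H) = associatorA H" "LUn (UMod H) = lunitA H" "RUn (UMod H) = runitA H"
  by (simp_all add: UMod_def)

lemma iso_morI:
  assumes f: "f \<in> lin X Y" and "umod X" "umod Y"
    and g: "\<And>y. y \<in> carrier Y ==> g y \<in> carrier X"
    and gf: "\<And>x. x \<in> carrier X ==> g (f x) = x" and fg: "\<And>y. y \<in> carrier Y ==> f (g y) = y"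
  shows "iso_mor (UMod H) X Y f"
proof -
  have "restrict g (carrier Y) \<in> lin Y X"
    by (rule lin_maps_inverseI[OF f assms(2,3)]) (use lin_mapsD(2)[OF f] g gf fg in auto)
  moreover have "compose (carrier X) (restrict g (carrier Y)) f = (\<lambda>x\<in>carrier X. x)"
    "compose (carrier Y) f (restrict g (carrier Y)) = (\<lambda>y\<in>carrier Y. y)"
    using lin_mapsD(2)[OF f] g gf fg by (auto simp: compose_def)
  ultimately show ?thesis
    using f unfolding iso_mor_def by auto
qed

lemma lin_compose: "[|umod X; f \<in> lin X Y; g \<in> lin Y Z|] ==> compose (carrier X) g f \<in> lin X Z"
  by (rule lin_maps_compose)

lemmas lin_closed = lin_mapsD(2)[of _ U]

lemma lin_TA_ext_left:
  assumes "f \<in> lin (TA (TA X Y) Z) W" "g \<in> lin (TA (TA X Y) Z) W" "umod X" "umod Y" "umod Z" "umod W"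
    "\<And>x y z. [|x \<in> carrier X; y \<in> carrier Y; z \<in> carrier Z|] ==>
      f (tp (TA X Y) Z (tp X Y x y) z) = g (tp (TA X Y) Z (tp X Y x y) z)"
  shows "f = g"
  by (rule lin_maps_eqI[OF assms(1,2)],
      rule TA_ext_left[OF assms(3-5) _ lin_mapsD(1)[OF assms(1)] lin_mapsD(1)[OF assms(2)]])
    (use assms in auto)

lemma lunit_iso: assumes [simp]: "umod X" shows "iso_mor (UMod H) (TA AM X) X (lunitA H X)"
proof (rule iso_morI[OF lunit_lin, where g = "\<lambda>x. tp AM X \<one>\<^bsub>A\<^esub> x"])
  show "tp AM X \<one>\<^bsub>A\<^esub> (lunitA H X w) = w" if "w \<in> carrier (TA AM X)" for w
  proof (rule TA_ext[where X = AM and Y = X and Z = "TA AM X" and f = "\<lambda>w. tp AM X \<one>\<^bsub>A\<^esub> (lunitA H X w)" and g = "\<lambda>w. w"])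
    show "(\<lambda>w. tp AM X \<one>\<^bsub>A\<^esub> (lunitA H X w)) \<in> ahom (TA AM X) (TA AM X)"
      by (rule ahom_compose[OF lin_mapsD(1)[OF lunit_lin] tp_ahom_right]) simp_all
    fix a x assume "a \<in> carrier AM" "x \<in> carrier X"
    then show "tp AM X \<one>\<^bsub>A\<^esub> (lunitA H X (tp AM X a x)) = tp AM X a x"
      by (simp add: lunit_tp flip: tp_balance)
  qed (use that in \<open>auto intro!: ahomI\<close>)
qed (simp_all add: lunit_tp)

lemma runit_iso: assumes [simp]: "umod X" shows "iso_mor (UMod H) (TA X AM) X (runitA H X)"
proof (rule iso_morI[OF runit_lin, where g = "\<lambda>x. tp X AM x \<one>\<^bsub>A\<^esub>"])
  show "tp X AM (runitA H X w) \<one>\<^bsub>A\<^esub> = w" if "w \<in> carrier (TA X AM)" for w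
  proof (rule TA_ext[where X = X and Y = AM and Z = "TA X AM" and f = "\<lambda>w. tp X AM (runitA H X w) \<one>\<^bsub>A\<^esub>" and g = "\<lambda>w. w"])
    show "(\<lambda>w. tp X AM (runitA H X w) \<one>\<^bsub>A\<^esub>) \<in> ahom (TA X AM) (TA X AM)"
      by (rule ahom_compose[OF lin_mapsD(1)[OF runit_lin] tp_ahom_left]) simp_all
    fix x a assume "x \<in> carrier X" "a \<in> carrier AM"
    then show "tp X AM (runitA H X (tp X AM x a)) \<one>\<^bsub>A\<^esub> = tp X AM x a"
      by (simp add: runit_tp tp_balance)
  qed (use that in \<open>auto intro!: ahomI\<close>)
qed (simp_all add: runit_tp)

text \<open>Every coherence diagram commutes on pure tensors, and \<open>U\<close>-linear maps that agree there are equal.\<close>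

theorem UMod_monoidal: "monoidal_category (UMod H)"
proof
  note mem = mem_Collect_eq
  note ml = tens_map_lin associator_lin associator_tp lin_compose lin_maps_id lunit_lin runit_lin lunit_tp runit_tp
  show "Idn (UMod H) X \<in> Mor (UMod H) X X" if "X \<in> Obj (UMod H)" for X
    using that by (simp add: lin_maps_id)
  show "Cmp (UMod H) X Y Z g f \<in> Mor (UMod H) X Z"
    if "X \<in> Obj (UMod H)" "f \<in> Mor (UMod H) X Y" "g \<in> Mor (UMod H) Y Z" for X Y Z f g
    using that by (simp add: lin_compose)
  show "Cmp (UMod H) X X Y f (Idn (UMod H) X) = f" "Cmp (UMod H) X Y Y (Idn (UMod H) Y) f = f"
    if "X \<in> Obj (UMod H)" "Y \<in> Obj (UMod H)" "f \<in> Mor (UMod H) X Y" for X Y f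
    using that by (auto intro!: lin_maps_eqI[of _ U X Y f] lin_compose lin_maps_id simp: compose_eq lin_closed)
  show "Cmp (UMod H) W Y Z h (Cmp (UMod H) W X Y g f) = Cmp (UMod H) W X Z (Cmp (UMod H) X Y Z h g) f"
    if "f \<in> Mor (UMod H) W X" for W X Y Z f g h
    using that by (auto simp: compose_def fun_eq_iff lin_closed)
  show "TO (UMod H) X Y \<in> Obj (UMod H)" if "X \<in> Obj (UMod H)" "Y \<in> Obj (UMod H)" for X Y
    using that by simp
  show "Unt (UMod H) \<in> Obj (UMod H)" by simp
  show "TM (UMod H) X X' Y Y' f g \<in> Mor (UMod H) (TO (UMod H) X Y) (TO (UMod H) X' Y')"
    if "X \<in> Obj (UMod H)" "X' \<in> Obj (UMod H)" "Y \<in> Obj (UMod H)" "Y' \<in> Obj (UMod H)"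
      "f \<in> Mor (UMod H) X X'" "g \<in> Mor (UMod H) Y Y'" for X X' Y Y' f g
    using that by (simp add: tens_map_lin)
  show "TM (UMod H) X X Y Y (Idn (UMod H) X) (Idn (UMod H) Y) = Idn (UMod H) (TO (UMod H) X Y)"
    if "X \<in> Obj (UMod H)" "Y \<in> Obj (UMod H)" for X Y
    using that by (auto intro!: lin_TA_ext[of X Y _ "TA X Y"] tens_map_lin lin_maps_id simp: tens_map_lin lin_maps_id)
  show "TM (UMod H) X X'' Y Y'' (Cmp (UMod H) X X' X'' f' f) (Cmp (UMod H) Y Y' Y'' g' g) =
      Cmp (UMod H) (TO (UMod H) X Y) (TO (UMod H) X' Y') (TO (UMod H) X'' Y'') (TM (UMod H) X' X'' Y' Y'' f' g') (TM (UMod H) X X' Y Y' f g)"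
    if "X \<in> Obj (UMod H)" "X' \<in> Obj (UMod H)" "X'' \<in> Obj (UMod H)" "Y \<in> Obj (UMod H)" "Y' \<in> Obj (UMod H)" "Y'' \<in> Obj (UMod H)"
      "f \<in> Mor (UMod H) X X'" "f' \<in> Mor (UMod H) X' X''" "g \<in> Mor (UMod H) Y Y'" "g' \<in> Mor (UMod H) Y' Y''"
    for X X' X'' Y Y' Y'' f f' g g'
  proof -
    note [simp] = that[unfolded UMod_simps mem] lin_closed[OF that(7)[unfolded UMod_simps]] lin_closed[OF that(9)[unfolded UMod_simps]]
    have c: "compose (carrier X) f' f \<in> lin X X''" "compose (carrier Y) g' g \<in> lin Y Y''"
      by (rule lin_compose[of _ _ X'] lin_compose[of _ _ Y']; simp; fail)+
    show ?thesis unfolding UMod_simps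
      by (rule lin_TA_ext[of X Y _ "TA X'' Y''"], simp, simp, (rule tens_map_lin; simp add: c),
          (rule lin_compose[of _ _ "TA X' Y'"]; simp add: ml)) (use c in \<open>simp_all add: ml compose_eq\<close>)
  qed
  show "iso_mor (UMod H) (TO (UMod H) (TO (UMod H) X Y) Z) (TO (UMod H) X (TO (UMod H) Y Z)) (Asc (UMod H) X Y Z)"
    if "X \<in> Obj (UMod H)" "Y \<in> Obj (UMod H)" "Z \<in> Obj (UMod H)" for X Y Z
    using that unfolding UMod_simps mem
    by (intro iso_morI[of _ _ _ "assoc_inv X Y Z"])
      (simp_all add: associator_lin ahom_closed[OF assoc_inv_ahom] assoc_inv_associator associator_assoc_inv)
  show "Cmp (UMod H) (TO (UMod H) (TO (UMod H) X Y) Z) (TO (UMod H) (TO (UMod H) X' Y') Z') (TO (UMod H) X' (TO (UMod H) Y' Z'))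
            (Asc (UMod H) X' Y' Z') (TM (UMod H) (TO (UMod H) X Y) (TO (UMod H) X' Y') Z Z' (TM (UMod H) X X' Y Y' f g) h) =
          Cmp (UMod H) (TO (UMod H) (TO (UMod H) X Y) Z) (TO (UMod H) X (TO (UMod H) Y Z)) (TO (UMod H) X' (TO (UMod H) Y' Z'))
            (TM (UMod H) X X' (TO (UMod H) Y Z) (TO (UMod H) Y' Z') f (TM (UMod H) Y Y' Z Z' g h)) (Asc (UMod H) X Y Z)"
    if "X \<in> Obj (UMod H)" "X' \<in> Obj (UMod H)" "Y \<in> Obj (UMod H)" "Y' \<in> Obj (UMod H)" "Z \<in> Obj (UMod H)" "Z' \<in> Obj (UMod H)"
      "f \<in> Mor (UMod H) X X'" "g \<in> Mor (UMod H) Y Y'" "h \<in> Mor (UMod H) Z Z'" for X X' Y Y' Z Z' f g h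
  proof -
    note [simp] = that[unfolded UMod_simps mem] lin_closed[OF that(7)[unfolded UMod_simps]]
      lin_closed[OF that(8)[unfolded UMod_simps]] lin_closed[OF that(9)[unfolded UMod_simps]]
    show ?thesis unfolding UMod_simps
      by (rule lin_TA_ext_left[of _ X Y Z "TA X' (TA Y' Z')"], (rule lin_compose[of _ _ "TA (TA X' Y') Z'"]; simp add: ml),
          (rule lin_compose[of _ _ "TA X (TA Y Z)"]; simp add: ml)) (simp_all add: ml compose_eq)
  qed
  show "iso_mor (UMod H) (TO (UMod H) (Unt (UMod H)) X) X (LUn (UMod H) X)" "iso_mor (UMod H) (TO (UMod H) X (Unt (UMod H))) X (RUn (UMod H) X)"
    if "X \<in> Obj (UMod H)" for X
    using that by (simp_all add: lunit_iso runit_iso)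
  show "Cmp (UMod H) (TO (UMod H) (Unt (UMod H)) X) X Y f (LUn (UMod H) X) =
          Cmp (UMod H) (TO (UMod H) (Unt (UMod H)) X) (TO (UMod H) (Unt (UMod H)) Y) Y (LUn (UMod H) Y)
            (TM (UMod H) (Unt (UMod H)) (Unt (UMod H)) X Y (Idn (UMod H) (Unt (UMod H))) f)"
    if "X \<in> Obj (UMod H)" "Y \<in> Obj (UMod H)" "f \<in> Mor (UMod H) X Y" for X Y f
  proof -
    note [simp] = that[unfolded UMod_simps mem] lin_closed[OF that(3)[unfolded UMod_simps]] lin_maps_id[OF umod_AM, unfolded AM_simps]
    show ?thesis unfolding UMod_simps
      by (rule lin_TA_ext[of AM X _ Y], simp, simp, (rule lin_compose[of _ _ X]; simp add: ml),
          (rule lin_compose[of _ _ "TA AM Y"]; simp add: ml))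
        (use that in \<open>simp_all add: ml compose_eq lin_mapsD(4)[of f U X Y]\<close>)
  qed
  show "Cmp (UMod H) (TO (UMod H) X (Unt (UMod H))) X Y f (RUn (UMod H) X) =
          Cmp (UMod H) (TO (UMod H) X (Unt (UMod H))) (TO (UMod H) Y (Unt (UMod H))) Y (RUn (UMod H) Y)
            (TM (UMod H) X Y (Unt (UMod H)) (Unt (UMod H)) f (Idn (UMod H) (Unt (UMod H))))"
    if "X \<in> Obj (UMod H)" "Y \<in> Obj (UMod H)" "f \<in> Mor (UMod H) X Y" for X Y f
  proof -
    note [simp] = that[unfolded UMod_simps mem] lin_closed[OF that(3)[unfolded UMod_simps]] lin_maps_id[OF umod_AM, unfolded AM_simps]
    show ?thesis unfolding UMod_simps
      by (rule lin_TA_ext[of X AM _ Y], simp, simp, (rule lin_compose[of _ _ X]; simp add: ml),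
          (rule lin_compose[of _ _ "TA Y AM"]; simp add: ml))
        (use that in \<open>simp_all add: ml compose_eq lin_mapsD(4)[of f U X Y]\<close>)
  qed
  show "Cmp (UMod H) (TO (UMod H) (TO (UMod H) (TO (UMod H) W X) Y) Z) (TO (UMod H) (TO (UMod H) W X) (TO (UMod H) Y Z)) (TO (UMod H) W (TO (UMod H) X (TO (UMod H) Y Z)))
            (Asc (UMod H) W X (TO (UMod H) Y Z)) (Asc (UMod H) (TO (UMod H) W X) Y Z) =
          Cmp (UMod H) (TO (UMod H) (TO (UMod H) (TO (UMod H) W X) Y) Z) (TO (UMod H) W (TO (UMod H) (TO (UMod H) X Y) Z)) (TO (UMod H) W (TO (UMod H) X (TO (UMod H) Y Z)))
            (TM (UMod H) W W (TO (UMod H) (TO (UMod H) X Y) Z) (TO (UMod H) X (TO (UMod H) Y Z)) (Idn (UMod H) W) (Asc (UMod H) X Y Z))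
            (Cmp (UMod H) (TO (UMod H) (TO (UMod H) (TO (UMod H) W X) Y) Z) (TO (UMod H) (TO (UMod H) W (TO (UMod H) X Y)) Z) (TO (UMod H) W (TO (UMod H) (TO (UMod H) X Y) Z))
              (Asc (UMod H) W (TO (UMod H) X Y) Z)
              (TM (UMod H) (TO (UMod H) (TO (UMod H) W X) Y) (TO (UMod H) W (TO (UMod H) X Y)) Z Z (Asc (UMod H) W X Y) (Idn (UMod H) Z)))"
    if "W \<in> Obj (UMod H)" "X \<in> Obj (UMod H)" "Y \<in> Obj (UMod H)" "Z \<in> Obj (UMod H)" for W X Y Z
  proof -
    note [simp] = that[unfolded UMod_simps mem]
    let ?f = "compose (carrier (TA (TA (TA W X) Y) Z)) (associatorA H W X (TA Y Z)) (associatorA H (TA W X) Y Z)"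
    let ?g = "compose (carrier (TA (TA (TA W X) Y) Z))
        (tens_mapA H W W (TA (TA X Y) Z) (TA X (TA Y Z)) (\<lambda>x\<in>carrier W. x) (associatorA H X Y Z))
        (compose (carrier (TA (TA (TA W X) Y) Z)) (associatorA H W (TA X Y) Z)
          (tens_mapA H (TA (TA W X) Y) (TA W (TA X Y)) Z Z (associatorA H W X Y) (\<lambda>x\<in>carrier Z. x)))"
    have f: "?f \<in> lin (TA (TA (TA W X) Y) Z) (TA W (TA X (TA Y Z)))"
      by (rule lin_compose[of _ _ "TA (TA W X) (TA Y Z)"]; simp add: ml)
    have g1: "compose (carrier (TA (TA (TA W X) Y) Z)) (associatorA H W (TA X Y) Z)
          (tens_mapA H (TA (TA W X) Y) (TA W (TA X Y)) Z Z (associatorA H W X Y) (\<lambda>x\<in>carrier Z. x))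
        \<in> lin (TA (TA (TA W X) Y) Z) (TA W (TA (TA X Y) Z))"
      by (rule lin_compose[of _ _ "TA (TA W (TA X Y)) Z"]; simp add: ml)
    have g: "?g \<in> lin (TA (TA (TA W X) Y) Z) (TA W (TA X (TA Y Z)))"
      by (rule lin_compose[OF _ g1]; simp add: ml)
    show ?thesis unfolding UMod_simps
    proof (rule lin_TA_ext_left[OF f g])
      fix p y z assume p: "p \<in> carrier (TA W X)" and yz: "y \<in> carrier Y" "z \<in> carrier Z"
      let ?t = "\<lambda>p. tp (TA (TA W X) Y) Z (tp (TA W X) Y p y) z"
      have t: "?t \<in> ahom (TA W X) (TA (TA (TA W X) Y) Z)"
        by (rule ahom_compose[OF tp_ahom_left tp_ahom_left]) (use yz in simp_all)
      show "?f (?t p) = ?g (?t p)"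
        by (rule TA_ext[OF _ _ _ ahom_compose[OF t lin_mapsD(1)[OF f]] ahom_compose[OF t lin_mapsD(1)[OF g]] p])
          (use yz in \<open>simp_all add: ml compose_eq\<close>)
    qed simp_all
  qed
  show "Cmp (UMod H) (TO (UMod H) (TO (UMod H) X (Unt (UMod H))) Y) (TO (UMod H) X (TO (UMod H) (Unt (UMod H)) Y)) (TO (UMod H) X Y)
            (TM (UMod H) X X (TO (UMod H) (Unt (UMod H)) Y) Y (Idn (UMod H) X) (LUn (UMod H) Y)) (Asc (UMod H) X (Unt (UMod H)) Y) =
          TM (UMod H) (TO (UMod H) X (Unt (UMod H))) X Y Y (RUn (UMod H) X) (Idn (UMod H) Y)"
    if "X \<in> Obj (UMod H)" "Y \<in> Obj (UMod H)" for X Y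
  proof -
    note [simp] = that[unfolded UMod_simps mem]
    show ?thesis unfolding UMod_simps
      by (rule lin_TA_ext_left[of _ X AM Y "TA X Y"], (rule lin_compose[of _ _ "TA X (TA AM Y)"]; simp add: ml))
        (simp_all add: ml compose_eq tp_balance)
  qed
qed

end

section \<open>Induced modules and the Galois isomorphism\<close>

context bialgebroid_setting
begin

abbreviation "Ind \<equiv> tensAop H"
abbreviation "tpo \<equiv> tpAop H"

lemma tensor_productO:
  "umod W ==> tensor_product UM W (carrier A) (\<lambda>a u. u \<cdot> t a) (\<lambda>a w. t a \<odot>\<^bsub>W\<^esub> w)"
  by (simp add: tensor_product_def tensor_product_axioms_def)

lemma TO_simps: "carrier (Ind W) = carrier (tgrpAop H W)" "add (Ind W) = add (tgrpAop H W)" "zero (Ind W) = zero (tgrpAop H W)"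
  by (simp_all add: tensAop_def)

lemma TO_hom: "ahom (Ind W) Z = ahom (tgrpAop H W) Z" "ahom Z (Ind W) = ahom Z (tgrpAop H W)"
  by (rule ahom_additive_cong; simp add: TO_simps)+

lemma UM_hom: "ahom UM Z = ahom U Z"
  by (rule ahom_additive_cong) simp_all

context
  fixes W :: "('w, 'w) module"
  assumes W [simp]: "umod W"
begin

interpretation T: tensor_product UM W "carrier A" "\<lambda>a u. u \<cdot> t a" "\<lambda>a w. t a \<odot>\<^bsub>W\<^esub> w"
  by (rule tensor_productO[OF W])

lemma TO_group [simp]: "abelian_group (Ind W)"
  using T.T_group by (rule abelian_group_additive_cong[rotated 3]) (simp_all add: TO_simps tgrpAop_def)

lemma tpo_closed [simp]: "[|u \<in> carrier U; w \<in> carrier W|] ==> tpo W u w \<in> carrier (Ind W)"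
  using T.tp_closed by (simp add: tpAop_def tclsAop_def TO_simps tgrpAop_def)

lemma tpo_bal: "balAop H W (Ind W) (tpo W)"
  using T.tp_balanced unfolding balAop_def balanced_def TO_hom tpAop_def tclsAop_def tgrpAop_def by simp

lemmas tpo_add = balAopD(4,5)[OF tpo_bal]
lemmas tpo_balance = balAopD(6)[OF tpo_bal]

lemma TO_ext:
  assumes "abelian_group Z" "f \<in> ahom (Ind W) Z" "g \<in> ahom (Ind W) Z" "q \<in> carrier (Ind W)"
    "\<And>u w. [|u \<in> carrier U; w \<in> carrier W|] ==> f (tpo W u w) = g (tpo W u w)"
  shows "f q = g q"
  using T.T_ext[of Z f g q] assms unfolding TO_hom by (simp add: TO_simps tgrpAop_def tpAop_def tclsAop_def)

lemma swO_tp: "[|abelian_group Z; balAop H W Z \<beta>; u \<in> carrier U; w \<in> carrier W|] ==> sw Z \<beta> (tpo W u w) = \<beta> u w"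
  using T.sw_tp by (simp add: tpAop_def tclsAop_def balAop_def)

lemma swO_ahom: "[|abelian_group Z; balAop H W Z \<beta>|] ==> sw Z \<beta> \<in> ahom (Ind W) Z"
  using T.sw_hom unfolding TO_hom by (simp add: tgrpAop_def balAop_def)

lemma swO_closed:
  assumes "abelian_group Z" "q \<in> carrier (Ind W)" "\<And>u w. [|u \<in> carrier U; w \<in> carrier W|] ==> \<beta> u w \<in> carrier Z"
  shows "sw Z \<beta> q \<in> carrier Z"
  using T.sw_closed[of Z q \<beta>] assms by (simp add: TO_simps tgrpAop_def)

lemma swO_cong:
  assumes "abelian_group Z" "q \<in> carrier (Ind W)" "\<And>u w. [|u \<in> carrier U; w \<in> carrier W|] ==> \<beta> u w = \<beta>' u w"
    "\<And>u w. [|u \<in> carrier U; w \<in> carrier W|] ==> \<beta>' u w \<in> carrier Z"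
  shows "sw Z \<beta> q = sw Z \<beta>' q"
  using T.sw_cong[of Z q \<beta> \<beta>'] assms by (simp add: TO_simps tgrpAop_def)

lemma hom_swO:
  assumes "abelian_group Z" "abelian_group Z'" "h \<in> ahom Z Z'" "q \<in> carrier (Ind W)"
    "\<And>u w. [|u \<in> carrier U; w \<in> carrier W|] ==> \<beta> u w \<in> carrier Z"
  shows "h (sw Z \<beta> q) = sw Z' (\<lambda>u w. h (\<beta> u w)) q"
  using T.hom_sw[of Z Z' h q \<beta>] assms by (simp add: TO_simps tgrpAop_def)

lemma swO_in_ahom:
  assumes "abelian_group Z" "abelian_group V" "q \<in> carrier (Ind W)"
    "\<And>u w. [|u \<in> carrier U; w \<in> carrier W|] ==> \<beta> u w \<in> ahom V Z"
  shows "(\<lambda>v. sw Z (\<lambda>u w. \<beta> u w v) q) \<in> ahom V Z"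
  using T.sw_in_ahom[of Z V q \<beta>] assms by (simp add: TO_simps tgrpAop_def)

lemma TO_act_bal: "u \<in> carrier U ==> balAop H W (Ind W) (\<lambda>v w. tpo W (u \<cdot> v) w)"
  by (rule balAopI) (simp_all add: tpo_add U.r_distr tpo_balance flip: U.m_assoc)

lemma TO_smult: "u \<odot>\<^bsub>Ind W\<^esub> q = sw (Ind W) (\<lambda>v w. tpo W (u \<cdot> v) w) q"
proof -
  have "u \<odot>\<^bsub>Ind W\<^esub> q = sw (tgrpAop H W) (\<lambda>v w. tpo W (u \<cdot> v) w) q"
    by (simp add: tensAop_def)
  also have "\<dots> = sw (Ind W) (\<lambda>v w. tpo W (u \<cdot> v) w) q"
    by (rule sw_additive_cong) (simp_all add: TO_simps)
  finally show ?thesis .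
qed

lemma TO_smult_tp: "[|u \<in> carrier U; v \<in> carrier U; w \<in> carrier W|] ==> u \<odot>\<^bsub>Ind W\<^esub> tpo W v w = tpo W (u \<cdot> v) w"
  by (simp add: TO_smult swO_tp TO_act_bal)

lemma umod_TO [simp]: "umod (Ind W)"
proof (rule lmoduleI)
  have h: "(\<lambda>q. u \<odot>\<^bsub>Ind W\<^esub> q) \<in> ahom (Ind W) (Ind W)" if "u \<in> carrier U" for u
    using that by (simp add: TO_smult swO_ahom TO_act_bal)
  note [simp] = ahom_closed[OF h]
  interpret T: abelian_group "Ind W" by simp
  show "u \<odot>\<^bsub>Ind W\<^esub> q \<in> carrier (Ind W)" if "u \<in> carrier U" "q \<in> carrier (Ind W)" for u q
    using that by simp
  show "u \<odot>\<^bsub>Ind W\<^esub> (q \<oplus>\<^bsub>Ind W\<^esub> q') = u \<odot>\<^bsub>Ind W\<^esub> q \<oplus>\<^bsub>Ind W\<^esub> u \<odot>\<^bsub>Ind W\<^esub> q'"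
    if "u \<in> carrier U" "q \<in> carrier (Ind W)" "q' \<in> carrier (Ind W)" for u q q'
    using that by (simp add: ahom_add[OF h])
  fix u v q assume uv: "u \<in> carrier U" "v \<in> carrier U" and q: "q \<in> carrier (Ind W)"
  show "(u \<oplus>\<^bsub>U\<^esub> v) \<odot>\<^bsub>Ind W\<^esub> q = u \<odot>\<^bsub>Ind W\<^esub> q \<oplus>\<^bsub>Ind W\<^esub> v \<odot>\<^bsub>Ind W\<^esub> q"
    by (rule TO_ext[of "Ind W" "\<lambda>q. (u \<oplus>\<^bsub>U\<^esub> v) \<odot>\<^bsub>Ind W\<^esub> q" "\<lambda>q. u \<odot>\<^bsub>Ind W\<^esub> q \<oplus>\<^bsub>Ind W\<^esub> v \<odot>\<^bsub>Ind W\<^esub> q"])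
      (use uv q in \<open>simp_all add: h ahomI ahom_add[OF h] T.a_ac TO_smult_tp U.l_distr tpo_add\<close>)
  show "(u \<cdot> v) \<odot>\<^bsub>Ind W\<^esub> q = u \<odot>\<^bsub>Ind W\<^esub> (v \<odot>\<^bsub>Ind W\<^esub> q)"
    by (rule TO_ext[of "Ind W" "\<lambda>q. (u \<cdot> v) \<odot>\<^bsub>Ind W\<^esub> q" "\<lambda>q. u \<odot>\<^bsub>Ind W\<^esub> (v \<odot>\<^bsub>Ind W\<^esub> q)"])
      (use uv q in \<open>simp_all add: h ahomI ahom_add[OF h] TO_smult_tp U.m_assoc\<close>)
next
  fix q assume q: "q \<in> carrier (Ind W)"
  have h: "(\<lambda>q. \<one>\<^sub>U \<odot>\<^bsub>Ind W\<^esub> q) \<in> ahom (Ind W) (Ind W)"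
    by (simp add: TO_smult swO_ahom TO_act_bal)
  show "\<one>\<^sub>U \<odot>\<^bsub>Ind W\<^esub> q = q"
    by (rule TO_ext[of "Ind W" "\<lambda>q. \<one>\<^sub>U \<odot>\<^bsub>Ind W\<^esub> q" "\<lambda>q. q"]) (use q h in \<open>simp_all add: ahomI TO_smult_tp\<close>)
qed (simp_all add: U.ring_axioms)

lemma lin_TO_ext:
  assumes "f \<in> lin (Ind W) Z" "g \<in> lin (Ind W) Z" "umod Z"
    "\<And>w. w \<in> carrier W ==> f (tpo W \<one>\<^sub>U w) = g (tpo W \<one>\<^sub>U w)"
  shows "f = g"
proof (rule lin_maps_eqI[OF assms(1,2)], rule TO_ext[OF _ lin_mapsD(1)[OF assms(1)] lin_mapsD(1)[OF assms(2)]])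
  fix u w assume h: "u \<in> carrier U" "w \<in> carrier W"
  then have "tpo W u w = u \<odot>\<^bsub>Ind W\<^esub> tpo W \<one>\<^sub>U w" by (simp add: TO_smult_tp)
  then show "f (tpo W u w) = g (tpo W u w)"
    using h assms(4)[of w] by (simp add: lin_mapsD(4)[OF assms(1)] lin_mapsD(4)[OF assms(2)])
qed (use assms in simp_all)

text \<open>The universal property of an induced module: a right \<open>A\<close>-linear map \<open>g\<close> on \<open>W\<close> extends to \<open>u \<otimes> w \<mapsto> u g(w)\<close>.\<close>

lemma induced_lin:
  assumes Z [simp]: "umod Z" and g: "g \<in> ahom W Z"
    and ga: "\<And>a w. [|a \<in> carrier A; w \<in> carrier W|] ==> g (t a \<odot>\<^bsub>W\<^esub> w) = t a \<odot>\<^bsub>Z\<^esub> g w"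
  shows "(\<lambda>q\<in>carrier (Ind W). sw Z (\<lambda>u w. u \<odot>\<^bsub>Z\<^esub> g w) q) \<in> lin (Ind W) Z"
    and "[|u \<in> carrier U; w \<in> carrier W|] ==> sw Z (\<lambda>u w. u \<odot>\<^bsub>Z\<^esub> g w) (tpo W u w) = u \<odot>\<^bsub>Z\<^esub> g w"
proof -
  note [simp] = ahom_closed[OF g]
  have b: "balAop H W Z (\<lambda>u w. u \<odot>\<^bsub>Z\<^esub> g w)"
    by (rule balAopI) (simp_all add: smult_l_distr smult_r_distr ahom_add[OF g] ga smult_mult)
  then show e: "[|u \<in> carrier U; w \<in> carrier W|] ==> sw Z (\<lambda>u w. u \<odot>\<^bsub>Z\<^esub> g w) (tpo W u w) = u \<odot>\<^bsub>Z\<^esub> g w" for u w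
    by (simp add: swO_tp)
  note h = swO_ahom[OF _ b, simplified]
  show "(\<lambda>q\<in>carrier (Ind W). sw Z (\<lambda>u w. u \<odot>\<^bsub>Z\<^esub> g w) q) \<in> lin (Ind W) Z"
  proof (rule lin_mapsI)
    fix u q assume u: "u \<in> carrier U" and q: "q \<in> carrier (Ind W)"
    have "sw Z (\<lambda>u w. u \<odot>\<^bsub>Z\<^esub> g w) (u \<odot>\<^bsub>Ind W\<^esub> q) = u \<odot>\<^bsub>Z\<^esub> sw Z (\<lambda>u w. u \<odot>\<^bsub>Z\<^esub> g w) q"
      by (rule TO_ext[OF _ ahom_compose[OF smult_ahom[of U] h] ahom_compose[OF h smult_ahom[of U]] q])
        (use u in \<open>simp_all add: TO_smult_tp e smult_mult\<close>)
    then show "(\<lambda>q\<in>carrier (Ind W). sw Z (\<lambda>u w. u \<odot>\<^bsub>Z\<^esub> g w) q) (u \<odot>\<^bsub>Ind W\<^esub> q)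
        = u \<odot>\<^bsub>Z\<^esub> (\<lambda>q\<in>carrier (Ind W). sw Z (\<lambda>u w. u \<odot>\<^bsub>Z\<^esub> g w) q) q"
      using u q by simp
  qed (simp_all add: ahom_restrict[OF h])
qed

end

lemmas tpUW_add = tp_add[OF umod_UM, simplified]
lemmas tpUW_balance = tp_balance[OF umod_UM, simplified]
lemmas tpoU_add = tpo_add[OF umod_UM, simplified]
lemmas tpoU_balance = tpo_balance[OF umod_UM, simplified]
lemmas swOU_closed = swO_closed[OF umod_UM, simplified]
lemmas swOU_cong = swO_cong[OF umod_UM, simplified]
lemmas swOU_in_ahom = swO_in_ahom[OF umod_UM, simplified]
lemmas hom_swOU = hom_swO[OF umod_UM, simplified]

text \<open>The map \<open>u \<otimes> w \<mapsto> u(1 \<otimes> w) = u\<^sub>(\<^sub>1\<^sub>) \<otimes> u\<^sub>(\<^sub>2\<^sub>)w\<close> from the module induced from \<open>W\<close> to the diagonal one. For \<open>W = U\<close> it is the Hopf-Galois map \<open>\<alpha>\<close>.\<close>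

definition galois :: "('w, 'w) module \<Rightarrow> 'w \<Rightarrow> 'w"
  where "galois W = (\<lambda>q\<in>carrier (Ind W). sw (TA UM W) (\<lambda>u w. u \<odot>\<^bsub>TA UM W\<^esub> tp UM W \<one>\<^sub>U w) q)"

context
  fixes W :: "('w, 'w) module"
  assumes W [simp]: "umod W"
begin

lemma tpU_ahom: "tp UM W \<one>\<^sub>U \<in> ahom W (TA UM W)"
  by (rule tp_ahom_right) simp_all

lemma galois_lin: "galois W \<in> lin (Ind W) (TA UM W)"
  unfolding galois_def by (rule induced_lin(1)[OF W _ tpU_ahom]) (simp_all add: t_tp)

lemma galois_tp: "[|u \<in> carrier U; w \<in> carrier W|] ==> galois W (tpo W u w) = u \<odot>\<^bsub>TA UM W\<^esub> tp UM W \<one>\<^sub>U w"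
  unfolding galois_def using induced_lin(2)[OF W _ tpU_ahom, of u w] by (simp add: t_tp)

lemma galois_tp_sw:
  assumes u: "u \<in> carrier U" and w: "w \<in> carrier W"
  shows "galois W (tpo W u w) = sw (TA UM W) (\<lambda>u1 u2. tp UM W u1 (u2 \<odot>\<^bsub>W\<^esub> w)) (\<Delta> u)"
  unfolding galois_tp[OF u w] using u w by (simp add: TA_smult_tp) (intro swU_cong, simp_all)

end

end

locale left_hopf_setting = bialgebroid_setting K H
  for K :: "'k ring" and H :: "('k, 'w::infinite) bialgebroid" +
  assumes hopf: "left_hopf H"
begin

lemma hopf_galois_eq: "q \<in> carrier (Ind UM) ==> hopf_galois H q = galois UM q"
  unfolding hopf_galois_def galois_def
  by simp (rule swOU_cong, simp_all, simp add: TA_smult_tp, intro swU_cong, simp_all)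

lemma galois_UM_bij: "bij_betw (galois UM) (carrier (Ind UM)) (carrier (UU H))"
  using hopf unfolding left_hopf_def by (subst (asm) bij_betw_cong[OF hopf_galois_eq])

lemma galois_UM_inj: "[|q \<in> carrier (Ind UM); q' \<in> carrier (Ind UM); galois UM q = galois UM q'|] ==> q = q'"
  using galois_UM_bij by (auto simp: bij_betw_def inj_on_def)

abbreviation "tr \<equiv> translation H"

lemma translation_eq: "tr u = the_inv_into (carrier (Ind UM)) (hopf_galois H) (tpU H u \<one>\<^sub>U)"
  by (simp add: translation_def)

lemma translation_closed [simp]: "u \<in> carrier U ==> tr u \<in> carrier (Ind UM)"
  and galois_translation: "u \<in> carrier U ==> galois UM (tr u) = tpU H u \<one>\<^sub>U"
proof -
  assume u: "u \<in> carrier U"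
  have b: "bij_betw (hopf_galois H) (carrier (Ind UM)) (carrier (UU H))"
    using hopf by (simp add: left_hopf_def)
  have c: "tpU H u \<one>\<^sub>U \<in> hopf_galois H ` carrier (Ind UM)"
    using b u by (simp add: bij_betw_def)
  show "tr u \<in> carrier (Ind UM)"
    unfolding translation_eq using b c by (intro the_inv_into_into) (auto simp: bij_betw_def)
  then show "galois UM (tr u) = tpU H u \<one>\<^sub>U"
    unfolding translation_eq using b c f_the_inv_into_f[of "hopf_galois H" "carrier (Ind UM)" "tpU H u \<one>\<^sub>U"]
    by (simp add: bij_betw_def hopf_galois_eq)
qed

text \<open>The defining property of \<open>u\<^sub>+ \<otimes> u\<^sub>-\<close>, evaluated: \<open>u\<^sub>+\<^sub>(\<^sub>1\<^sub>) \<otimes> u\<^sub>+\<^sub>(\<^sub>2\<^sub>)u\<^sub>- = u \<otimes> 1\<close>.\<close>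

lemma translation_eval:
  assumes Z: "abelian_group Z" and b: "bal UM UM Z \<beta>" and u: "u \<in> carrier U"
  shows "sw Z (\<lambda>p m. sw Z (\<lambda>p1 p2. \<beta> p1 (p2 \<cdot> m)) (\<Delta> p)) (tr u) = \<beta> u \<one>\<^sub>U"
proof -
  note [simp] = Z balUD(1)[OF b]
  have bo: "balAop H UM Z (\<lambda>p m. sw Z \<beta> (galois UM (tpo UM p m)))"
  proof -
    note h = ahom_compose[OF lin_mapsD(1)[OF galois_lin[OF umod_UM]] swU_ahom[OF Z b]]
    show ?thesis
      by (rule balAopI) (simp_all add: ahom_closed[OF h] ahom_add[OF h] tpoU_add tpoU_balance)
  qed
  have "\<beta> u \<one>\<^sub>U = sw Z \<beta> (galois UM (tr u))"
    using u by (simp add: galois_translation swU_tp b)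
  also have "\<dots> = sw Z (\<lambda>p m. sw Z \<beta> (galois UM (tpo UM p m))) (tr u)"
    by (rule TO_ext[OF umod_UM Z ahom_compose[OF lin_mapsD(1)[OF galois_lin[OF umod_UM]] swU_ahom[OF Z b]] swO_ahom[OF umod_UM Z bo]])
      (use u in \<open>simp_all add: swO_tp bo\<close>)
  also have "\<dots> = sw Z (\<lambda>p m. sw Z (\<lambda>p1 p2. \<beta> p1 (p2 \<cdot> m)) (\<Delta> p)) (tr u)"
  proof (rule swOU_cong)
    fix p m assume pm: "p \<in> carrier U" "m \<in> carrier U"
    then show "sw Z \<beta> (galois UM (tpo UM p m)) = sw Z (\<lambda>p1 p2. \<beta> p1 (p2 \<cdot> m)) (\<Delta> p)"
      apply (simp add: galois_tp_sw)
      apply (subst hom_swU[OF _ Z swU_ahom[OF Z b]])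
         apply simp_all
      apply (intro swU_cong)
         apply (simp_all add: swU_tp b)
      done
    show "sw Z (\<lambda>p1 p2. \<beta> p1 (p2 \<cdot> m)) (\<Delta> p) \<in> carrier Z"
      using pm by (intro swU_closed) simp_all
  qed (use u in simp_all)
  finally show ?thesis ..
qed

abbreviation "rmulO v \<equiv> sw (Ind UM) (\<lambda>p m. tpo UM p (m \<cdot> v))"
abbreviation "rmulA v \<equiv> sw (UU H) (\<lambda>x y. tpU H x (y \<cdot> v))"

lemma rmulO_bal: "v \<in> carrier U ==> balAop H UM (Ind UM) (\<lambda>p m. tpo UM p (m \<cdot> v))"
  by (rule balAopI) (simp_all add: tpoU_add U.l_distr tpoU_balance U.m_assoc)

lemma rmulA_bal: "v \<in> carrier U ==> bal UM UM (UU H) (\<lambda>x y. tpU H x (y \<cdot> v))"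
  by (rule balUI) (simp_all add: tpU_add U.l_distr tpU_balance U.m_assoc)

lemma galois_rmul:
  assumes v: "v \<in> carrier U" and q: "q \<in> carrier (Ind UM)"
  shows "galois UM (rmulO v q) = rmulA v (galois UM q)"
proof (rule TO_ext[OF umod_UM _ _ _ q])
  note hO = swO_ahom[OF umod_UM _ rmulO_bal[OF v], simplified]
  note hA = swU_ahom[OF _ rmulA_bal[OF v], simplified]
  note hg = lin_mapsD(1)[OF galois_lin[OF umod_UM]]
  show "(\<lambda>q. galois UM (rmulO v q)) \<in> ahom (Ind UM) (UU H)" by (rule ahom_compose[OF hO hg])
  show "(\<lambda>q. rmulA v (galois UM q)) \<in> ahom (Ind UM) (UU H)" by (rule ahom_compose[OF hg hA])
  fix p m assume "p \<in> carrier U" "m \<in> carrier UM"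
  then have pm: "p \<in> carrier U" "m \<in> carrier U" by simp_all
  have g: "galois UM (tpo UM p m) = sw (UU H) (\<lambda>p1 p2. tpU H p1 (p2 \<cdot> m)) (\<Delta> p)"
    using galois_tp_sw[of UM p m] pm by simp
  have "rmulA v (galois UM (tpo UM p m)) = sw (UU H) (\<lambda>p1 p2. rmulA v (tpU H p1 (p2 \<cdot> m))) (\<Delta> p)"
    unfolding g by (rule hom_swU[OF _ _ hA]) (use pm in simp_all)
  also have "\<dots> = galois UM (tpo UM p (m \<cdot> v))"
    using pm v by (simp add: galois_tp_sw) (intro swU_cong, simp_all add: swU_tp rmulA_bal U.m_assoc)
  finally show "galois UM (rmulO v (tpo UM p m)) = rmulA v (galois UM (tpo UM p m))"
    using pm v by (simp add: swO_tp rmulO_bal)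
qed simp

lemma rmulO_closed [simp]: "[|v \<in> carrier U; q \<in> carrier (Ind UM)|] ==> rmulO v q \<in> carrier (Ind UM)"
  by (rule ahom_closed[OF swO_ahom[OF umod_UM _ rmulO_bal]]) simp_all

lemma translation_add:
  "[|u \<in> carrier U; v \<in> carrier U|] ==> tr (u \<oplus>\<^bsub>U\<^esub> v) = tr u \<oplus>\<^bsub>Ind UM\<^esub> tr v"
  by (rule galois_UM_inj) (simp_all add: lin_mapsD(5)[OF galois_lin[OF umod_UM]] galois_translation tpU_add)

lemma translation_t: "[|a \<in> carrier A; u \<in> carrier U|] ==> tr (t a \<cdot> u) = rmulO (s a) (tr u)"
  by (rule galois_UM_inj) (simp_all add: galois_translation galois_rmul swU_tp rmulA_bal tpU_balance)

text \<open>The formula \<open>u \<otimes> w \<mapsto> u\<^sub>+ \<otimes> u\<^sub>-w\<close>. The bijectivity for \<open>W = U\<close> carries over to all \<open>W\<close> because both composites are evaluations of identities in \<open>U \<otimes> U\<close>.\<close>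

definition galois_inv :: "('w, 'w) module \<Rightarrow> 'w \<Rightarrow> 'w"
  where "galois_inv W = (\<lambda>q\<in>carrier (TA UM W). sw (Ind W) (\<lambda>u w. sw (Ind W) (\<lambda>p m. tpo W p (m \<odot>\<^bsub>W\<^esub> w)) (tr u)) q)"

context
  fixes W :: "('w, 'w) module"
  assumes W [simp]: "umod W"
begin

lemma translation_act_bal: "w \<in> carrier W ==> balAop H UM (Ind W) (\<lambda>p m. tpo W p (m \<odot>\<^bsub>W\<^esub> w))"
  by (rule balAopI) (simp_all add: tpo_add smult_l_distr tpo_balance smult_mult)

lemma galois_inv_bal: "bal UM W (Ind W) (\<lambda>u w. sw (Ind W) (\<lambda>p m. tpo W p (m \<odot>\<^bsub>W\<^esub> w)) (tr u))" (is "bal _ _ _ ?f")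
proof (rule balAI; simp)
  note h = swO_ahom[OF umod_UM _ translation_act_bal, simplified]
  show "?f u w \<in> carrier (Ind W)" if "u \<in> carrier U" "w \<in> carrier W" for u w
    using that by (intro swOU_closed) simp_all
  show "?f u (w \<oplus>\<^bsub>W\<^esub> w') = ?f u w \<oplus>\<^bsub>Ind W\<^esub> ?f u w'" if "u \<in> carrier U" "w \<in> carrier W" "w' \<in> carrier W" for u w w'
    using that by (intro ahom_add[of "?f u" W] swOU_in_ahom) (auto intro!: ahomI simp: tpo_add smult_r_distr)
  show "?f (u \<oplus>\<^bsub>U\<^esub> u') w = ?f u w \<oplus>\<^bsub>Ind W\<^esub> ?f u' w" if "u \<in> carrier U" "u' \<in> carrier U" "w \<in> carrier W" for u u' w
    using that by (simp add: translation_add ahom_add[OF h])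
  show "?f (t a \<cdot> u) w = ?f u (s a \<odot>\<^bsub>W\<^esub> w)" if a: "a \<in> carrier A" "u \<in> carrier U" "w \<in> carrier W" for a u w
  proof -
    have "?f (t a \<cdot> u) w = sw (Ind W) (\<lambda>p m. sw (Ind W) (\<lambda>p m. tpo W p (m \<odot>\<^bsub>W\<^esub> w)) (tpo UM p (m \<cdot> s a))) (tr u)"
      using a by (simp add: translation_t) (rule hom_swOU[OF _ _ h], simp_all)
    also have "\<dots> = ?f u (s a \<odot>\<^bsub>W\<^esub> w)"
      using a by (intro swOU_cong) (simp_all add: swO_tp translation_act_bal smult_mult)
    finally show ?thesis .
  qed
qed

lemma galois_inv_tp: "[|u \<in> carrier U; w \<in> carrier W|] ==> galois_inv W (tp UM W u w) = sw (Ind W) (\<lambda>p m. tpo W p (m \<odot>\<^bsub>W\<^esub> w)) (tr u)"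
  by (simp add: galois_inv_def sw_tp galois_inv_bal)

lemma galois_inv_ahom: "galois_inv W \<in> ahom (TA UM W) (Ind W)"
  unfolding galois_inv_def by (intro ahom_restrict sw_ahom galois_inv_bal) simp_all

lemma galois_galois_inv: "q \<in> carrier (TA UM W) ==> galois W (galois_inv W q) = q"
proof (rule TA_ext[of UM W "TA UM W" "\<lambda>q. galois W (galois_inv W q)" "\<lambda>q. q"])
  note hg = lin_mapsD(1)[OF galois_lin[OF W]]
  show "(\<lambda>q. galois W (galois_inv W q)) \<in> ahom (TA UM W) (TA UM W)"
    by (rule ahom_compose[OF galois_inv_ahom hg])
  fix u w assume u: "u \<in> carrier UM" and w: "w \<in> carrier W"
  let ?\<beta> = "\<lambda>x y. tp UM W x (y \<odot>\<^bsub>W\<^esub> w)"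
  have b: "bal UM UM (TA UM W) ?\<beta>"
    using w by (intro balUI) (simp_all add: tpUW_add smult_l_distr tpUW_balance smult_mult)
  have "galois W (galois_inv W (tp UM W u w)) = sw (TA UM W) (\<lambda>p m. galois W (tpo W p (m \<odot>\<^bsub>W\<^esub> w))) (tr u)"
    using u w by (simp add: galois_inv_tp) (rule hom_swOU[OF _ _ hg], simp_all)
  also have "\<dots> = sw (TA UM W) (\<lambda>p m. sw (TA UM W) (\<lambda>p1 p2. ?\<beta> p1 (p2 \<cdot> m)) (\<Delta> p)) (tr u)"
  proof (rule swOU_cong)
    fix p m assume pm: "p \<in> carrier U" "m \<in> carrier U"
    then show "galois W (tpo W p (m \<odot>\<^bsub>W\<^esub> w)) = sw (TA UM W) (\<lambda>p1 p2. ?\<beta> p1 (p2 \<cdot> m)) (\<Delta> p)"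
      using w by (simp add: galois_tp_sw) (intro swU_cong, simp_all add: smult_mult)
    show "sw (TA UM W) (\<lambda>p1 p2. ?\<beta> p1 (p2 \<cdot> m)) (\<Delta> p) \<in> carrier (TA UM W)"
      using pm w by (intro swU_closed) simp_all
  qed (use u in simp_all)
  also have "\<dots> = tp UM W u w"
    using u w translation_eval[OF _ b, of u] by simp
  finally show "galois W (galois_inv W (tp UM W u w)) = tp UM W u w" .
qed (auto intro!: ahomI)

lemma galois_inv_galois: "q \<in> carrier (Ind W) ==> galois_inv W (galois W q) = q"
proof (rule TO_ext[of W "Ind W" "\<lambda>q. galois_inv W (galois W q)" "\<lambda>q. q"])
  note hg = lin_mapsD(1)[OF galois_lin[OF W]] and hU = lin_mapsD(1)[OF galois_lin[OF umod_UM]]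
  show "(\<lambda>q. galois_inv W (galois W q)) \<in> ahom (Ind W) (Ind W)"
    by (rule ahom_compose[OF hg galois_inv_ahom])
  fix u w assume u: "u \<in> carrier U" and w: "w \<in> carrier W"
  let ?Q = "sw (Ind UM) (\<lambda>u1 u2. rmulO u2 (tr u1)) (\<Delta> u)"
  let ?X = "sw (Ind W) (\<lambda>p m. tpo W p (m \<odot>\<^bsub>W\<^esub> w))"
  note hX = swO_ahom[OF umod_UM _ translation_act_bal[OF w], simplified]
  have Qc: "?Q \<in> carrier (Ind UM)"
    by (rule swU_closed) (use u in simp_all)
  have "galois UM ?Q = sw (UU H) (\<lambda>u1 u2. galois UM (rmulO u2 (tr u1))) (\<Delta> u)"
    by (rule hom_swU[OF _ _ hU]) (use u in simp_all)
  also have "\<dots> = sw (UU H) (\<lambda>u1 u2. tpU H u1 (u2 \<cdot> \<one>\<^sub>U)) (\<Delta> u)"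
    using u by (intro swU_cong) (simp_all add: galois_rmul galois_translation swU_tp rmulA_bal)
  also have "\<dots> = galois UM (tpo UM u \<one>\<^sub>U)"
    using u by (simp add: galois_tp_sw)
  finally have Q: "?Q = tpo UM u \<one>\<^sub>U"
    using u by (intro galois_UM_inj[OF Qc]) simp_all
  have "galois_inv W (galois W (tpo W u w)) = sw (Ind W) (\<lambda>u1 u2. galois_inv W (tp UM W u1 (u2 \<odot>\<^bsub>W\<^esub> w))) (\<Delta> u)"
    unfolding galois_tp_sw[OF W u w] using u w by (intro hom_swU[OF _ _ galois_inv_ahom]) simp_all
  also have "\<dots> = sw (Ind W) (\<lambda>u1 u2. ?X (rmulO u2 (tr u1))) (\<Delta> u)"
  proof (rule swU_cong)
    fix u1 u2 assume u12: "u1 \<in> carrier U" "u2 \<in> carrier U"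
    have "?X (rmulO u2 (tr u1)) = sw (Ind W) (\<lambda>p m. ?X (tpo UM p (m \<cdot> u2))) (tr u1)"
      using u12 by (intro hom_swOU[OF _ _ hX]) simp_all
    also have "\<dots> = galois_inv W (tp UM W u1 (u2 \<odot>\<^bsub>W\<^esub> w))"
      using u12 w by (simp add: galois_inv_tp) (intro swOU_cong, simp_all add: swO_tp translation_act_bal smult_mult)
    finally show "galois_inv W (tp UM W u1 (u2 \<odot>\<^bsub>W\<^esub> w)) = ?X (rmulO u2 (tr u1))" ..
    show "?X (rmulO u2 (tr u1)) \<in> carrier (Ind W)"
      using u12 by (intro ahom_closed[OF hX]) simp_all
  qed (use u in simp_all)
  also have "\<dots> = ?X ?Q"
    using u by (intro hom_swU[OF _ _ hX, symmetric]) simp_all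
  also have "\<dots> = tpo W u w"
    using u w by (simp add: Q swO_tp translation_act_bal)
  finally show "galois_inv W (galois W (tpo W u w)) = tpo W u w" .
qed (auto intro!: ahomI)

lemma galois_inv_lin: "galois_inv W \<in> lin (TA UM W) (Ind W)"
  by (rule lin_maps_inverseI[OF galois_lin[OF W]])
    (simp_all add: ahom_closed[OF galois_inv_ahom] galois_inv_galois galois_galois_inv, simp add: galois_inv_def)

lemma galois_bij: "bij_betw (galois W) (carrier (Ind W)) (carrier (TA UM W))"
  by (rule bij_betw_byWitness[where f' = "galois_inv W"])
    (auto simp: galois_inv_galois galois_galois_inv lin_mapsD(2)[OF galois_lin[OF W]] lin_mapsD(2)[OF galois_inv_lin])

end

end

section \<open>Modules of maps\<close>

context bialgebroid_setting
begin

abbreviation "kU c \<equiv> c \<odot>\<^bsub>Tot H\<^esub> \<one>\<^bsub>Tot H\<^esub>"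

sublocale KU: Module.module K U
  using left_bialgebroid.total_algebra[OF bialgebroid] by (simp add: k_algebra_def)

sublocale KA: Module.module K A
  using left_bialgebroid.base_algebra[OF bialgebroid] by (simp add: k_algebra_def)

lemma kU_central: "[|c \<in> carrier K; u \<in> carrier U|] ==> kU c \<cdot> u = u \<cdot> kU c"
  using k_algebra.smult_mult_left[OF left_bialgebroid.total_algebra[OF bialgebroid], of c "\<one>\<^sub>U" u]
    k_algebra.smult_mult_right[OF left_bialgebroid.total_algebra[OF bialgebroid], of c u "\<one>\<^sub>U"] by simp

lemma kU_mult: "[|c \<in> carrier K; d \<in> carrier K|] ==> kU (c \<otimes>\<^bsub>K\<^esub> d) = kU c \<cdot> kU d"
  using k_algebra.smult_mult_left[OF left_bialgebroid.total_algebra[OF bialgebroid], of c "\<one>\<^sub>U" "kU d"]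
  by (simp add: KU.smult_assoc1)

lemma kU_s: "c \<in> carrier K ==> kU c = s (c \<odot>\<^bsub>A\<^esub> \<one>\<^bsub>A\<^esub>)"
  using left_bialgebroid.src_klinear[OF bialgebroid, of c "\<one>\<^bsub>A\<^esub>"] by simp

lemma kU_t: "c \<in> carrier K ==> kU c = t (c \<odot>\<^bsub>A\<^esub> \<one>\<^bsub>A\<^esub>)"
  using left_bialgebroid.tgt_klinear[OF bialgebroid, of c "\<one>\<^bsub>A\<^esub>"] by simp

lemma kU_smult_comm:
  "[|umod X; c \<in> carrier K; u \<in> carrier U; x \<in> carrier X|] ==> kU c \<odot>\<^bsub>X\<^esub> (u \<odot>\<^bsub>X\<^esub> x) = u \<odot>\<^bsub>X\<^esub> (kU c \<odot>\<^bsub>X\<^esub> x)"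
  by (simp add: kU_central flip: smult_mult)

lemma fun_module_simps [simp]:
  "carrier (fun_module H X N S) = S" "zero (fun_module H X N S) = (\<lambda>x\<in>carrier X. \<zero>\<^bsub>N\<^esub>)"
  "f \<oplus>\<^bsub>fun_module H X N S\<^esub> g = (\<lambda>x\<in>carrier X. f x \<oplus>\<^bsub>N\<^esub> g x)"
  "c \<odot>\<^bsub>fun_module H X N S\<^esub> f = (\<lambda>x\<in>carrier X. kU c \<odot>\<^bsub>N\<^esub> f x)"
  by (simp_all add: fun_module_def)

lemma fun_module_module:
  assumes N [simp]: "umod N"
    and S: "\<And>f x. [|f \<in> S; x \<in> carrier X|] ==> f x \<in> carrier N" "S \<subseteq> extensional (carrier X)"
    and "(\<lambda>x\<in>carrier X. \<zero>\<^bsub>N\<^esub>) \<in> S" "\<And>f g. [|f \<in> S; g \<in> S|] ==> (\<lambda>x\<in>carrier X. f x \<oplus>\<^bsub>N\<^esub> g x) \<in> S"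
    and "\<And>c f. [|c \<in> carrier K; f \<in> S|] ==> (\<lambda>x\<in>carrier X. kU c \<odot>\<^bsub>N\<^esub> f x) \<in> S"
  shows "Module.module K (fun_module H X N S)"
proof (rule moduleI)
  interpret N: abelian_group N by simp
  note [simp] = S(1)
  have ext: "f = g" if "f \<in> S" "g \<in> extensional (carrier X)" "\<And>x. x \<in> carrier X ==> f x = g x" for f g
    using that S(2) by (intro extensionalityI[of f "carrier X" g]) auto
  show "cring K" by (rule KU.R.is_cring)
  show "abelian_group (fun_module H X N S)"
  proof (rule abelian_groupI)
    fix f assume f: "f \<in> carrier (fun_module H X N S)"
    show "\<exists>g\<in>carrier (fun_module H X N S). g \<oplus>\<^bsub>fun_module H X N S\<^esub> f = \<zero>\<^bsub>fun_module H X N S\<^esub>"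
    proof (intro bexI)
      let ?c = "\<ominus>\<^bsub>K\<^esub> \<one>\<^bsub>K\<^esub>"
      show "(\<lambda>x\<in>carrier X. kU ?c \<odot>\<^bsub>N\<^esub> f x) \<in> carrier (fun_module H X N S)"
        using f assms by simp
      have "kU ?c \<odot>\<^bsub>N\<^esub> n \<oplus>\<^bsub>N\<^esub> n = \<zero>\<^bsub>N\<^esub>" if n: "n \<in> carrier N" for n
      proof -
        have "kU ?c \<oplus>\<^bsub>U\<^esub> \<one>\<^sub>U = \<zero>\<^bsub>U\<^esub>"
          using KU.smult_l_distr[of ?c "\<one>\<^bsub>K\<^esub>" "\<one>\<^sub>U"] by (simp add: KU.R.l_neg)
        moreover have "kU ?c \<odot>\<^bsub>N\<^esub> n \<oplus>\<^bsub>N\<^esub> n = (kU ?c \<oplus>\<^bsub>U\<^esub> \<one>\<^sub>U) \<odot>\<^bsub>N\<^esub> n"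
          using n by (simp add: smult_l_distr)
        moreover have "\<zero>\<^bsub>U\<^esub> \<odot>\<^bsub>N\<^esub> n = \<zero>\<^bsub>N\<^esub>"
          by (rule ahom_zero[OF _ _ smult_ahom_left[of U]]) (use n U.abelian_group_axioms in simp_all)
        ultimately show ?thesis by simp
      qed
      then show "(\<lambda>x\<in>carrier X. kU ?c \<odot>\<^bsub>N\<^esub> f x) \<oplus>\<^bsub>fun_module H X N S\<^esub> f = \<zero>\<^bsub>fun_module H X N S\<^esub>"
        using f by (auto simp: fun_eq_iff restrict_def)
    qed
  next
    fix f assume "f \<in> carrier (fun_module H X N S)"
    then show "\<zero>\<^bsub>fun_module H X N S\<^esub> \<oplus>\<^bsub>fun_module H X N S\<^esub> f = f"
      by (intro ext[symmetric]) auto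
  qed (use assms in \<open>auto intro!: restrict_ext simp: N.a_ac\<close>)
next
  fix f assume "f \<in> carrier (fun_module H X N S)"
  then show "\<one>\<^bsub>K\<^esub> \<odot>\<^bsub>fun_module H X N S\<^esub> f = f"
    using S by (intro extensionalityI[of _ "carrier X"]) auto
qed (use assms in \<open>auto intro!: restrict_ext simp: KU.smult_l_distr smult_l_distr smult_r_distr kU_mult smult_mult\<close>)

lemma HomU_simps [simp]:
  "carrier (HomU H N X) = lin X N" "zero (HomU H N X) = (\<lambda>x\<in>carrier X. \<zero>\<^bsub>N\<^esub>)"
  "f \<oplus>\<^bsub>HomU H N X\<^esub> g = (\<lambda>x\<in>carrier X. f x \<oplus>\<^bsub>N\<^esub> g x)"
  "c \<odot>\<^bsub>HomU H N X\<^esub> f = (\<lambda>x\<in>carrier X. kU c \<odot>\<^bsub>N\<^esub> f x)"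
  by (simp_all add: HomU_def)

lemma HomU_module:
  assumes N [simp]: "umod N" and X [simp]: "umod X"
  shows "Module.module K (HomU H N X)"
  unfolding HomU_def
proof (rule fun_module_module)
  interpret N: abelian_group N by simp
  have z: "u \<odot>\<^bsub>N\<^esub> \<zero>\<^bsub>N\<^esub> = \<zero>\<^bsub>N\<^esub>" if "u \<in> carrier U" for u
    by (rule ahom_zero[OF _ _ smult_ahom[of U]]) (use that in simp_all)
  show "(\<lambda>x\<in>carrier X. \<zero>\<^bsub>N\<^esub>) \<in> lin X N"
    by (rule lin_mapsI) (auto intro!: ahomI simp: z)
  show "(\<lambda>x\<in>carrier X. f x \<oplus>\<^bsub>N\<^esub> g x) \<in> lin X N" if "f \<in> lin X N" "g \<in> lin X N" for f g
    using lin_mapsD(2,4,5)[OF that(1)] lin_mapsD(2,4,5)[OF that(2)]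
    by (intro lin_mapsI ahomI) (auto simp: N.a_ac smult_r_distr)
  show "(\<lambda>x\<in>carrier X. kU c \<odot>\<^bsub>N\<^esub> f x) \<in> lin X N" if "c \<in> carrier K" "f \<in> lin X N" for c f
    using lin_mapsD(2,4,5)[OF that(2)] that(1)
    by (intro lin_mapsI ahomI) (auto simp: smult_r_distr kU_smult_comm)
qed (auto simp: lin_maps_def ahom_closed is_linear_def)

lemma is_linear_HomUI:
  assumes [simp]: "umod N" "umod X" "umod Y"
    and "\<And>f. f \<in> lin X N ==> T f \<in> lin Y N"
    and "\<And>f g y. [|f \<in> lin X N; g \<in> lin X N; y \<in> carrier Y|] ==> T (\<lambda>x\<in>carrier X. f x \<oplus>\<^bsub>N\<^esub> g x) y = T f y \<oplus>\<^bsub>N\<^esub> T g y"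
    and "\<And>c f y. [|c \<in> carrier K; f \<in> lin X N; y \<in> carrier Y|] ==> T (\<lambda>x\<in>carrier X. kU c \<odot>\<^bsub>N\<^esub> f x) y = kU c \<odot>\<^bsub>N\<^esub> T f y"
  shows "is_linear K (HomU H N X) (HomU H N Y) T"
proof -
  interpret X: Module.module K "HomU H N X" by (rule HomU_module) simp_all
  interpret Y: Module.module K "HomU H N Y" by (rule HomU_module) simp_all
  have eq: "h = k" if "h \<in> lin Y N" "k \<in> lin Y N" "\<And>y. y \<in> carrier Y ==> h y = k y" for h k
    using that by (rule lin_maps_eqI)
  show ?thesis
    unfolding is_linear_def
  proof (intro conjI ahomI ballI)
    fix f assume f: "f \<in> carrier (HomU H N X)"
    then show "T f \<in> carrier (HomU H N Y)" using assms by simp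
    fix g assume g: "g \<in> carrier (HomU H N X)"
    show "T (f \<oplus>\<^bsub>HomU H N X\<^esub> g) = T f \<oplus>\<^bsub>HomU H N Y\<^esub> T g"
      by (rule eq) (use assms f g X.add.m_closed[OF f g] Y.add.m_closed[of "T f" "T g"] in auto)
  next
    fix c f assume c: "c \<in> carrier K" and f: "f \<in> carrier (HomU H N X)"
    show "T (c \<odot>\<^bsub>HomU H N X\<^esub> f) = c \<odot>\<^bsub>HomU H N Y\<^esub> T f"
      by (rule eq) (use assms c f X.smult_closed[OF c f] Y.smult_closed[OF c, of "T f"] in auto)
  qed
qed

lemma precomp_lin: "[|umod X; umod Y; umod N; f \<in> lin X Y|] ==> is_linear K (HomU H N Y) (HomU H N X) (precomp X Y f)"
  by (rule is_linear_HomUI) (auto simp: precomp_def compose_eq lin_closed intro!: lin_compose)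

lemma HomU_functor: "umod N ==> contravariant_functor K (UMod H) (HomU H N) precomp"
  unfolding contravariant_functor_def
proof (intro conjI ballI)
  fix X Y Z f g \<phi> assume "f \<in> Mor (UMod H) X Y"
  then show "precomp X Z (Cmp (UMod H) X Y Z g f) \<phi> = precomp X Y f (precomp Y Z g \<phi>)"
    by (auto simp: precomp_def compose_def fun_eq_iff lin_closed)
next
  fix X \<phi> assume "X \<in> Obj (UMod H)" "\<phi> \<in> carrier (HomU H N X)"
  then show "precomp X X (Idn (UMod H) X) \<phi> = \<phi>"
    using lin_mapsD(3)[of \<phi> U X N] by (auto simp: precomp_def compose_def fun_eq_iff extensional_def)
qed (simp_all add: HomU_module precomp_lin)

end

section \<open>The trace of an anti Yetter-Drinfel'd contramodule\<close>

locale aYD_setting = left_hopf_setting K H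
  for K :: "'k ring" and H :: "('k, 'w::infinite) bialgebroid" +
  fixes M :: "('w, 'w) module" and \<gamma> :: "('w \<Rightarrow> 'w) \<Rightarrow> 'w"
  assumes aYD: "aYD_contramodule H M \<gamma>" and stable: "stable_contramodule H M \<gamma>"
begin

abbreviation "AH X \<equiv> AopHom H X M (\<lambda>m a. t a \<odot>\<^bsub>M\<^esub> m)"

lemma AHI:
  assumes "f \<in> extensional (carrier X)" "f \<in> ahom X M"
    "\<And>a x. [|a \<in> carrier A; x \<in> carrier X|] ==> f (t a \<odot>\<^bsub>X\<^esub> x) = t a \<odot>\<^bsub>M\<^esub> f x"
  shows "f \<in> AH X"
  using assms by (simp add: AopHom_def)

lemma AHD:
  assumes "f \<in> AH X"
  shows "f \<in> extensional (carrier X)" "f \<in> ahom X M" "x \<in> carrier X ==> f x \<in> carrier M"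
    "[|x \<in> carrier X; y \<in> carrier X|] ==> f (x \<oplus>\<^bsub>X\<^esub> y) = f x \<oplus>\<^bsub>M\<^esub> f y"
    "[|a \<in> carrier A; x \<in> carrier X|] ==> f (t a \<odot>\<^bsub>X\<^esub> x) = t a \<odot>\<^bsub>M\<^esub> f x"
  using assms by (simp_all add: AopHom_def hom_def Pi_def)

lemma umod_M [simp]: "umod M"
  using aYD by (simp add: aYD_contramodule_def Let_def)

sublocale M: abelian_group M by simp

lemma \<gamma>_contramodule: "contramodule H M (\<lambda>m a. t a \<odot>\<^bsub>M\<^esub> m) \<gamma>"
  using aYD by (simp add: aYD_contramodule_def Let_def)

lemma AHUI:
  assumes "\<And>u. u \<in> carrier U ==> f u \<in> carrier M"
    "\<And>u v. [|u \<in> carrier U; v \<in> carrier U|] ==> f (u \<oplus>\<^bsub>U\<^esub> v) = f u \<oplus>\<^bsub>M\<^esub> f v"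
    "\<And>a u. [|a \<in> carrier A; u \<in> carrier U|] ==> f (t a \<cdot> u) = t a \<odot>\<^bsub>M\<^esub> f u"
  shows "(\<lambda>u\<in>carrier U. f u) \<in> AH UM"
  using assms by (intro AHI ahomI) simp_all

lemma AHUD:
  assumes "f \<in> AH UM"
  shows "u \<in> carrier U ==> f u \<in> carrier M"
    "[|u \<in> carrier U; v \<in> carrier U|] ==> f (u \<oplus>\<^bsub>U\<^esub> v) = f u \<oplus>\<^bsub>M\<^esub> f v"
    "[|a \<in> carrier A; u \<in> carrier U|] ==> f (t a \<cdot> u) = t a \<odot>\<^bsub>M\<^esub> f u"
  using AHD[OF assms] by simp_all

lemma \<gamma>_closed [simp]: "f \<in> AH UM ==> \<gamma> f \<in> carrier M"
  and \<gamma>_add: "[|f \<in> AH UM; g \<in> AH UM|] ==> \<gamma> (\<lambda>u\<in>carrier U. f u \<oplus>\<^bsub>M\<^esub> g u) = \<gamma> f \<oplus>\<^bsub>M\<^esub> \<gamma> g"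
  and \<gamma>_src: "[|f \<in> AH UM; a \<in> carrier A|] ==> \<gamma> (\<lambda>u\<in>carrier U. f (s a \<cdot> u)) = t a \<odot>\<^bsub>M\<^esub> \<gamma> f"
  and \<gamma>_contraassoc: "g \<in> AH (UU H) ==>
    \<gamma> (\<lambda>u\<in>carrier U. \<gamma> (\<lambda>v\<in>carrier U. g (tpU H u v))) = \<gamma> (\<lambda>u\<in>carrier U. g (\<Delta> u))"
  using \<gamma>_contramodule by (simp_all add: contramodule_def Let_def)

lemma \<gamma>_left: "[|a \<in> carrier A; m \<in> carrier M|] ==>
    \<gamma> (\<lambda>u\<in>carrier U. t (\<epsilon> (u \<cdot> s a)) \<odot>\<^bsub>M\<^esub> m) = s a \<odot>\<^bsub>M\<^esub> m"
  and \<gamma>_aYD: "[|u \<in> carrier U; f \<in> AH UM|] ==> u \<odot>\<^bsub>M\<^esub> \<gamma> f =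
    sw M (\<lambda>u1 u2. \<gamma> (\<lambda>v\<in>carrier U.
      sw M (\<lambda>p m. p \<odot>\<^bsub>M\<^esub> f (m \<cdot> v \<cdot> u1)) (tr u2))) (\<Delta> u)"
  using aYD by (simp_all add: aYD_contramodule_def Let_def)

lemma \<gamma>_stable: "m \<in> carrier M ==> \<gamma> (\<lambda>u\<in>carrier U. u \<odot>\<^bsub>M\<^esub> m) = m"
  using stable by (simp add: stable_contramodule_def)

lemma restrict_U_cong: "(\<And>u. u \<in> carrier U ==> f u = g u) ==> restrict f (carrier U) = restrict g (carrier U)"
  by (rule restrict_ext)

lemma \<gamma>_cong: "(\<And>u. u \<in> carrier U ==> f u = g u) ==> \<gamma> (restrict f (carrier U)) = \<gamma> (restrict g (carrier U))"
  by (metis restrict_U_cong)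

lemma \<gamma>_kU:
  assumes c: "c \<in> carrier K" and f: "f \<in> AH UM"
  shows "\<gamma> (\<lambda>u\<in>carrier U. kU c \<odot>\<^bsub>M\<^esub> f u) = kU c \<odot>\<^bsub>M\<^esub> \<gamma> f"
proof -
  let ?a = "c \<odot>\<^bsub>A\<^esub> \<one>\<^bsub>A\<^esub>"
  have a: "?a \<in> carrier A" using c by simp
  have "kU c \<odot>\<^bsub>M\<^esub> \<gamma> f = \<gamma> (\<lambda>u\<in>carrier U. f (s ?a \<cdot> u))"
    using \<gamma>_src[OF f a] c by (simp add: kU_t)
  also have "\<dots> = \<gamma> (\<lambda>u\<in>carrier U. f (t ?a \<cdot> u))"
    using c by (simp flip: kU_s kU_t)
  also have "\<dots> = \<gamma> (\<lambda>u\<in>carrier U. kU c \<odot>\<^bsub>M\<^esub> f u)"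
    using c f a by (intro \<gamma>_cong) (simp add: AHUD(3) kU_t)
  finally show ?thesis ..
qed

text \<open>Both bimodule structures on \<open>M\<close> enter here: the left action on values is a contraaction of
  \<open>v \<mapsto> \<epsilon>(v s(a))\<close>, and contraassociativity moves it to the argument of \<open>f\<close>.\<close>

lemma \<gamma>_left_values:
  assumes f: "f \<in> AH UM" and a: "a \<in> carrier A"
  shows "\<gamma> (\<lambda>v\<in>carrier U. s a \<odot>\<^bsub>M\<^esub> f v) = \<gamma> (\<lambda>v\<in>carrier U. f (v \<cdot> t a))"
proof -
  note [simp] = AHUD[OF f] a
  let ?\<beta> = "\<lambda>v u. f (t (\<epsilon> (u \<cdot> s a)) \<cdot> v)"
  have b: "bal UM UM M ?\<beta>"
    by (rule balUI)
      (simp_all add: U.l_distr U.r_distr counit_add t_add smult_l_distr counit_src t_mult smult_mult U.m_assoc flip: U.m_assoc del: AHUD(3)[OF f],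
        simp_all add: smult_mult U.m_assoc counit_src t_mult)
  let ?g = "\<lambda>q\<in>carrier (UU H). sw M ?\<beta> q"
  note h = swU_ahom[OF M.abelian_group_axioms b]
  have g: "?g \<in> AH (UU H)"
  proof (rule AHI)
    show "?g (t b \<odot>\<^bsub>UU H\<^esub> q) = t b \<odot>\<^bsub>M\<^esub> ?g q" if b': "b \<in> carrier A" and q: "q \<in> carrier (UU H)" for b q
    proof -
      have "sw M ?\<beta> (t b \<odot>\<^bsub>UU H\<^esub> q) = t b \<odot>\<^bsub>M\<^esub> sw M ?\<beta> q"
        by (rule UU_ext[OF _ ahom_compose[OF smult_ahom[of U] h] ahom_compose[OF h smult_ahom[of U]] q])
          (use b' in \<open>simp_all add: t_tp swU_tp[OF _ b] counit_tgt U.m_assoc t_mult smult_mult\<close>)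
      then show ?thesis using b' q by simp
    qed
  qed (simp_all add: ahom_restrict[OF h])
  have "\<gamma> (\<lambda>v\<in>carrier U. s a \<odot>\<^bsub>M\<^esub> f v) = \<gamma> (\<lambda>v\<in>carrier U. \<gamma> (\<lambda>u\<in>carrier U. ?g (tpU H v u)))"
  proof (rule \<gamma>_cong)
    fix v assume v: "v \<in> carrier U"
    have "s a \<odot>\<^bsub>M\<^esub> f v = \<gamma> (\<lambda>u\<in>carrier U. t (\<epsilon> (u \<cdot> s a)) \<odot>\<^bsub>M\<^esub> f v)"
      using v by (simp add: \<gamma>_left)
    also have "\<dots> = \<gamma> (\<lambda>u\<in>carrier U. ?g (tpU H v u))"
      using v by (intro \<gamma>_cong) (simp add: swU_tp[OF _ b])
    finally show "s a \<odot>\<^bsub>M\<^esub> f v = \<gamma> (\<lambda>u\<in>carrier U. ?g (tpU H v u))" .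
  qed
  also have "\<dots> = \<gamma> (\<lambda>v\<in>carrier U. ?g (\<Delta> v))"
    by (rule \<gamma>_contraassoc[OF g])
  also have "\<dots> = \<gamma> (\<lambda>v\<in>carrier U. f (v \<cdot> t a))"
  proof (rule \<gamma>_cong)
    fix v assume v: "v \<in> carrier U"
    have fU: "f \<in> ahom U M" using AHD(2)[OF f] unfolding UM_hom .
    have "f (v \<cdot> t a) = f (sw U (\<lambda>u1 u2. t (\<epsilon> (u2 \<cdot> s a)) \<cdot> u1) (\<Delta> v))"
      by (subst counit_right_t[OF v a]) simp
    also have "\<dots> = sw M ?\<beta> (\<Delta> v)"
      by (rule hom_swU[OF _ _ fU]) (use v U.abelian_group_axioms in simp_all)
    finally show "?g (\<Delta> v) = f (v \<cdot> t a)" using v by simp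
  qed
  finally show ?thesis .
qed

text \<open>In \<open>p f(x \<otimes> my)\<close>, summed over \<open>p \<otimes> m = u\<^sub>+ \<otimes> u\<^sub>-\<close>, linearity turns the outer \<open>p\<close> into its diagonal
  action, and \<open>u\<^sub>+\<^sub>(\<^sub>2\<^sub>)u\<^sub>-\<close> cancels.\<close>

lemma translation_cancel:
  assumes [simp]: "umod X" "umod Y" "umod Z" and f: "f \<in> lin (TA X Y) Z" and u: "u \<in> carrier U" and x: "x \<in> carrier X" and y: "y \<in> carrier Y"
  shows "sw Z (\<lambda>p m. p \<odot>\<^bsub>Z\<^esub> f (tp X Y x (m \<odot>\<^bsub>Y\<^esub> y))) (tr u) = f (tp X Y (u \<odot>\<^bsub>X\<^esub> x) y)"
proof -
  note [simp] = lin_mapsD(2)[OF f]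
  let ?\<beta> = "\<lambda>c d. f (tp X Y (c \<odot>\<^bsub>X\<^esub> x) (d \<odot>\<^bsub>Y\<^esub> y))"
  have b: "bal UM UM Z ?\<beta>"
    using x y by (intro balUI) (simp_all add: smult_l_distr tp_add lin_mapsD(5)[OF f] smult_mult tp_balance)
  have "sw Z (\<lambda>p m. p \<odot>\<^bsub>Z\<^esub> f (tp X Y x (m \<odot>\<^bsub>Y\<^esub> y))) (tr u) = sw Z (\<lambda>p m. sw Z (\<lambda>p1 p2. ?\<beta> p1 (p2 \<cdot> m)) (\<Delta> p)) (tr u)"
  proof (rule swOU_cong)
    fix p m assume pm: "p \<in> carrier U" "m \<in> carrier U"
    show "p \<odot>\<^bsub>Z\<^esub> f (tp X Y x (m \<odot>\<^bsub>Y\<^esub> y)) = sw Z (\<lambda>p1 p2. ?\<beta> p1 (p2 \<cdot> m)) (\<Delta> p)"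
      using pm x y tp_diag[OF _ _ _ f pm(1), of x "m \<odot>\<^bsub>Y\<^esub> y"]
      by simp (intro swU_cong, simp_all add: smult_mult)
    show "sw Z (\<lambda>p1 p2. ?\<beta> p1 (p2 \<cdot> m)) (\<Delta> p) \<in> carrier Z"
      by (rule swU_closed) (use pm x y in simp_all)
  qed (use u in simp_all)
  also have "\<dots> = f (tp X Y (u \<odot>\<^bsub>X\<^esub> x) y)"
    using u x y translation_eval[OF _ b u] by simp
  finally show ?thesis .
qed

context
  fixes X Y :: "('w, 'w) module"
  assumes X [simp]: "umod X" and Y [simp]: "umod Y"
begin

lemma trace_arg:
  assumes f: "f \<in> lin (TA X Y) M" and x: "x \<in> carrier X" and y: "y \<in> carrier Y"
  shows "(\<lambda>u\<in>carrier U. f (tp X Y x (u \<odot>\<^bsub>Y\<^esub> y))) \<in> AH UM"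
proof (rule AHUI)
  fix a u assume au: "a \<in> carrier A" "u \<in> carrier U"
  then show "f (tp X Y x ((t a \<cdot> u) \<odot>\<^bsub>Y\<^esub> y)) = t a \<odot>\<^bsub>M\<^esub> f (tp X Y x (u \<odot>\<^bsub>Y\<^esub> y))"
    using x y by (simp add: smult_mult flip: lin_mapsD(4)[OF f] t_tp)
qed (use x y in \<open>simp_all add: lin_mapsD(2,5)[OF f] smult_l_distr tp_add\<close>)

lemma trace_bal:
  assumes f: "f \<in> lin (TA X Y) M"
  shows "bal Y X M (\<lambda>y x. \<gamma> (\<lambda>u\<in>carrier U. f (tp X Y x (u \<odot>\<^bsub>Y\<^esub> y))))" (is "bal _ _ _ (\<lambda>y x. \<gamma> (?h x y))")
proof (rule balAI)
  note h = trace_arg[OF f]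
  fix y x assume y: "y \<in> carrier Y" and x: "x \<in> carrier X"
  then show "\<gamma> (?h x y) \<in> carrier M" by (simp add: h)
  fix x' assume x': "x' \<in> carrier X"
  have "?h (x \<oplus>\<^bsub>X\<^esub> x') y = (\<lambda>u\<in>carrier U. ?h x y u \<oplus>\<^bsub>M\<^esub> ?h x' y u)"
    using x x' y by (intro restrict_U_cong) (simp add: tp_add lin_mapsD(5)[OF f])
  then show "\<gamma> (?h (x \<oplus>\<^bsub>X\<^esub> x') y) = \<gamma> (?h x y) \<oplus>\<^bsub>M\<^esub> \<gamma> (?h x' y)"
    using \<gamma>_add[OF h[OF x y] h[OF x' y]] by simp
next
  note h = trace_arg[OF f]
  fix y y' x assume y: "y \<in> carrier Y" "y' \<in> carrier Y" and x: "x \<in> carrier X"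
  have "?h x (y \<oplus>\<^bsub>Y\<^esub> y') = (\<lambda>u\<in>carrier U. ?h x y u \<oplus>\<^bsub>M\<^esub> ?h x y' u)"
    using x y by (intro restrict_U_cong) (simp add: tp_add smult_r_distr lin_mapsD(5)[OF f])
  then show "\<gamma> (?h x (y \<oplus>\<^bsub>Y\<^esub> y')) = \<gamma> (?h x y) \<oplus>\<^bsub>M\<^esub> \<gamma> (?h x y')"
    using \<gamma>_add[OF h[OF x y(1)] h[OF x y(2)]] by simp
next
  fix a y x assume h: "a \<in> carrier A" "y \<in> carrier Y" "x \<in> carrier X"
  have "\<gamma> (?h (s a \<odot>\<^bsub>X\<^esub> x) y) = \<gamma> (\<lambda>u\<in>carrier U. s a \<odot>\<^bsub>M\<^esub> ?h x y u)"
    using h by (intro \<gamma>_cong) (simp flip: lin_mapsD(4)[OF f] s_tp)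
  also have "\<dots> = \<gamma> (\<lambda>u\<in>carrier U. ?h x y (u \<cdot> t a))"
    by (rule \<gamma>_left_values[OF trace_arg[OF f h(3,2)] h(1)])
  also have "\<dots> = \<gamma> (?h x (t a \<odot>\<^bsub>Y\<^esub> y))"
    using h by (intro \<gamma>_cong) (simp add: smult_mult)
  finally show "\<gamma> (?h x (t a \<odot>\<^bsub>Y\<^esub> y)) = \<gamma> (?h (s a \<odot>\<^bsub>X\<^esub> x) y)" ..
qed

abbreviation "trm \<equiv> trace_map H M \<gamma> X Y"

lemma trace_tp:
  "[|f \<in> lin (TA X Y) M; x \<in> carrier X; y \<in> carrier Y|] ==>
    trm f (tp Y X y x) = \<gamma> (\<lambda>u\<in>carrier U. f (tp X Y x (u \<odot>\<^bsub>Y\<^esub> y)))"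
  by (simp add: trace_map_def sw_tp trace_bal)

text \<open>The anti Yetter-Drinfel'd condition writes the action of \<open>u\<close> on the contraaction as a contraaction of \<open>p f(x \<otimes> m v u\<^sub>(\<^sub>1\<^sub>) y)\<close>, summed over the translation \<open>p \<otimes> m\<close> of \<open>u\<^sub>(\<^sub>2\<^sub>)\<close>; there \<open>translation_cancel\<close> leaves \<open>f(u\<^sub>(\<^sub>2\<^sub>)x \<otimes> v u\<^sub>(\<^sub>1\<^sub>)y)\<close>.\<close>

lemma trace_lin:
  assumes f: "f \<in> lin (TA X Y) M"
  shows "trm f \<in> lin (TA Y X) M"
  unfolding trace_map_def
proof (rule lift_lin[OF Y X umod_M trace_bal[OF f]])
  fix u y x assume h: "u \<in> carrier U" "y \<in> carrier Y" "x \<in> carrier X"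
  note a = trace_arg[OF f h(3,2)]
  show "sw M (\<lambda>u1 u2. \<gamma> (\<lambda>v\<in>carrier U. f (tp X Y (u2 \<odot>\<^bsub>X\<^esub> x) (v \<odot>\<^bsub>Y\<^esub> (u1 \<odot>\<^bsub>Y\<^esub> y))))) (\<Delta> u) =
      u \<odot>\<^bsub>M\<^esub> \<gamma> (\<lambda>v\<in>carrier U. f (tp X Y x (v \<odot>\<^bsub>Y\<^esub> y)))"
    unfolding \<gamma>_aYD[OF h(1) a]
  proof (rule swU_cong[symmetric])
    fix u1 u2 assume u12: "u1 \<in> carrier U" "u2 \<in> carrier U"
    show "\<gamma> (\<lambda>v\<in>carrier U. sw M (\<lambda>p m. p \<odot>\<^bsub>M\<^esub> (\<lambda>u\<in>carrier U. f (tp X Y x (u \<odot>\<^bsub>Y\<^esub> y))) (m \<cdot> v \<cdot> u1)) (tr u2)) =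
        \<gamma> (\<lambda>v\<in>carrier U. f (tp X Y (u2 \<odot>\<^bsub>X\<^esub> x) (v \<odot>\<^bsub>Y\<^esub> (u1 \<odot>\<^bsub>Y\<^esub> y))))"
    proof (rule \<gamma>_cong)
      fix v assume v: "v \<in> carrier U"
      have "sw M (\<lambda>p m. p \<odot>\<^bsub>M\<^esub> (\<lambda>u\<in>carrier U. f (tp X Y x (u \<odot>\<^bsub>Y\<^esub> y))) (m \<cdot> v \<cdot> u1)) (tr u2) =
          sw M (\<lambda>p m. p \<odot>\<^bsub>M\<^esub> f (tp X Y x (m \<odot>\<^bsub>Y\<^esub> (v \<odot>\<^bsub>Y\<^esub> (u1 \<odot>\<^bsub>Y\<^esub> y))))) (tr u2)"
        using h u12 v by (intro swOU_cong) (simp_all add: smult_mult lin_mapsD(2)[OF f])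
      also have "\<dots> = f (tp X Y (u2 \<odot>\<^bsub>X\<^esub> x) (v \<odot>\<^bsub>Y\<^esub> (u1 \<odot>\<^bsub>Y\<^esub> y)))"
        using h u12 v by (intro translation_cancel[OF _ _ _ f]) simp_all
      finally show "sw M (\<lambda>p m. p \<odot>\<^bsub>M\<^esub> (\<lambda>u\<in>carrier U. f (tp X Y x (u \<odot>\<^bsub>Y\<^esub> y))) (m \<cdot> v \<cdot> u1)) (tr u2) =
          f (tp X Y (u2 \<odot>\<^bsub>X\<^esub> x) (v \<odot>\<^bsub>Y\<^esub> (u1 \<odot>\<^bsub>Y\<^esub> y)))" .
    qed
    show "\<gamma> (\<lambda>v\<in>carrier U. f (tp X Y (u2 \<odot>\<^bsub>X\<^esub> x) (v \<odot>\<^bsub>Y\<^esub> (u1 \<odot>\<^bsub>Y\<^esub> y)))) \<in> carrier M"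
      using h u12 by (simp add: trace_arg[OF f])
  qed (use h in simp_all)
qed

text \<open>Contraassociativity with the diagonal action.\<close>

lemma \<gamma>_diag:
  assumes f: "f \<in> AH (TA X Y)" and x: "x \<in> carrier X" and y: "y \<in> carrier Y"
  shows "\<gamma> (\<lambda>u\<in>carrier U. \<gamma> (\<lambda>v\<in>carrier U. f (tp X Y (u \<odot>\<^bsub>X\<^esub> x) (v \<odot>\<^bsub>Y\<^esub> y)))) =
    \<gamma> (\<lambda>u\<in>carrier U. f (u \<odot>\<^bsub>TA X Y\<^esub> tp X Y x y))"
proof -
  note fc [simp] = AHD(3)[OF f]
  let ?\<beta> = "\<lambda>c d. f (tp X Y (c \<odot>\<^bsub>X\<^esub> x) (d \<odot>\<^bsub>Y\<^esub> y))"
  have b: "bal UM UM M ?\<beta>"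
    using x y by (intro balUI) (simp_all add: smult_l_distr tp_add AHD(4)[OF f] smult_mult tp_balance)
  note h = swU_ahom[OF M.abelian_group_axioms b]
  let ?g = "\<lambda>q\<in>carrier (UU H). sw M ?\<beta> q"
  have g: "?g \<in> AH (UU H)"
  proof (rule AHI)
    show "?g (t a \<odot>\<^bsub>UU H\<^esub> q) = t a \<odot>\<^bsub>M\<^esub> ?g q" if a: "a \<in> carrier A" and q: "q \<in> carrier (UU H)" for a q
    proof -
      have "sw M ?\<beta> (t a \<odot>\<^bsub>UU H\<^esub> q) = t a \<odot>\<^bsub>M\<^esub> sw M ?\<beta> q"
        by (rule UU_ext[OF _ ahom_compose[OF smult_ahom[of U] h] ahom_compose[OF h smult_ahom[of U]] q])
          (use a x y in \<open>simp_all add: t_tp swU_tp[OF _ b] smult_mult flip: AHD(5)[OF f]\<close>)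
      then show ?thesis using a q by simp
    qed
  qed (simp_all add: ahom_restrict[OF h])
  have "\<gamma> (\<lambda>u\<in>carrier U. \<gamma> (\<lambda>v\<in>carrier U. f (tp X Y (u \<odot>\<^bsub>X\<^esub> x) (v \<odot>\<^bsub>Y\<^esub> y)))) =
      \<gamma> (\<lambda>u\<in>carrier U. \<gamma> (\<lambda>v\<in>carrier U. ?g (tpU H u v)))"
    by (intro \<gamma>_cong) (simp add: swU_tp[OF _ b])
  also have "\<dots> = \<gamma> (\<lambda>u\<in>carrier U. ?g (\<Delta> u))"
    by (rule \<gamma>_contraassoc[OF g])
  also have "\<dots> = \<gamma> (\<lambda>u\<in>carrier U. f (u \<odot>\<^bsub>TA X Y\<^esub> tp X Y x y))"
  proof (rule \<gamma>_cong)
    fix u assume u: "u \<in> carrier U"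
    have "f (u \<odot>\<^bsub>TA X Y\<^esub> tp X Y x y) = sw M ?\<beta> (\<Delta> u)"
      unfolding TA_smult_tp[OF X Y u x y] by (rule hom_swU[OF _ _ AHD(2)[OF f]]) (use u x y in simp_all)
    then show "?g (\<Delta> u) = f (u \<odot>\<^bsub>TA X Y\<^esub> tp X Y x y)" using u by simp
  qed
  finally show ?thesis .
qed

end

lemma \<gamma>_stable_lin: "[|umod Z; f \<in> lin Z M; z \<in> carrier Z|] ==> \<gamma> (\<lambda>u\<in>carrier U. f (u \<odot>\<^bsub>Z\<^esub> z)) = f z"
  using \<gamma>_stable[of "f z"] \<gamma>_cong[of "\<lambda>u. f (u \<odot>\<^bsub>Z\<^esub> z)" "\<lambda>u. u \<odot>\<^bsub>M\<^esub> f z"]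
    lin_mapsD(2,4)[of f U Z M] by simp

lemma lin_AH: "[|umod Z; f \<in> lin Z M|] ==> f \<in> AH Z"
  by (intro AHI) (simp_all add: lin_mapsD(1,3) lin_mapsD(4)[of f U Z M])

text \<open>By contraassociativity the double trace is the contraaction of \<open>f\<close> along the diagonal action of \<open>u\<close> on \<open>x \<otimes> y\<close>; as \<open>f\<close> is linear, stability removes it.\<close>

lemma trace_trace:
  assumes [simp]: "umod X" "umod Y" and f: "f \<in> lin (TA X Y) M"
  shows "trace_map H M \<gamma> Y X (trace_map H M \<gamma> X Y f) = f"
proof (rule lin_TA_ext[of X Y _ M])
  note h = trace_lin[OF _ _ f]
  show "trace_map H M \<gamma> Y X (trace_map H M \<gamma> X Y f) \<in> lin (TA X Y) M"
    by (intro trace_lin h) simp_all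
  fix x y assume xy: "x \<in> carrier X" "y \<in> carrier Y"
  have "trace_map H M \<gamma> Y X (trace_map H M \<gamma> X Y f) (tp X Y x y) =
      \<gamma> (\<lambda>u\<in>carrier U. \<gamma> (\<lambda>v\<in>carrier U. f (tp X Y (u \<odot>\<^bsub>X\<^esub> x) (v \<odot>\<^bsub>Y\<^esub> y))))"
    using xy h by (simp add: trace_tp) (intro \<gamma>_cong, simp add: trace_tp f)
  then show "trace_map H M \<gamma> Y X (trace_map H M \<gamma> X Y f) (tp X Y x y) = f (tp X Y x y)"
    using xy by (simp add: \<gamma>_diag lin_AH f) (rule \<gamma>_stable_lin[OF _ f], simp_all)
qed (simp_all add: f)

lemma trace_linear:
  assumes [simp]: "umod X" "umod Y"
  shows "is_linear K (HomU H M (TA X Y)) (HomU H M (TA Y X)) (trace_map H M \<gamma> X Y)"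
proof (rule is_linear_HomUI; simp?)
  show "trace_map H M \<gamma> X Y f \<in> lin (TA Y X) M" if "f \<in> lin (TA X Y) M" for f
    using that by (simp add: trace_lin)
  interpret P: Module.module K "HomU H M (TA X Y)" by (rule HomU_module) simp_all
  fix f w assume f: "f \<in> lin (TA X Y) M" and w: "w \<in> carrier (TA Y X)"
  { fix g assume g: "g \<in> lin (TA X Y) M"
    let ?k = "\<lambda>x\<in>carrier (TA X Y). f x \<oplus>\<^bsub>M\<^esub> g x"
    have k: "?k \<in> lin (TA X Y) M" using P.add.m_closed[of f g] f g by simp
    note l = trace_lin[OF _ _ f] trace_lin[OF _ _ g]
    show "trace_map H M \<gamma> X Y ?k w = trace_map H M \<gamma> X Y f w \<oplus>\<^bsub>M\<^esub> trace_map H M \<gamma> X Y g w"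
    proof (rule TA_ext[of Y X M, where f = "trace_map H M \<gamma> X Y ?k" and g = "\<lambda>w. trace_map H M \<gamma> X Y f w \<oplus>\<^bsub>M\<^esub> trace_map H M \<gamma> X Y g w"])
      show "trace_map H M \<gamma> X Y ?k \<in> ahom (TA Y X) M" by (rule lin_mapsD(1)[OF trace_lin]) (use k in simp_all)
      show "(\<lambda>w. trace_map H M \<gamma> X Y f w \<oplus>\<^bsub>M\<^esub> trace_map H M \<gamma> X Y g w) \<in> ahom (TA Y X) M"
        using l by (intro ahomI) (simp_all add: lin_mapsD(2)[OF l(1)] lin_mapsD(2)[OF l(2)] lin_mapsD(5)[OF l(1)] lin_mapsD(5)[OF l(2)] M.a_ac)
      fix y x assume yx: "y \<in> carrier Y" "x \<in> carrier X"
      have "trace_map H M \<gamma> X Y ?k (tp Y X y x) = \<gamma> (\<lambda>u\<in>carrier U. (\<lambda>u\<in>carrier U. f (tp X Y x (u \<odot>\<^bsub>Y\<^esub> y))) u \<oplus>\<^bsub>M\<^esub> (\<lambda>u\<in>carrier U. g (tp X Y x (u \<odot>\<^bsub>Y\<^esub> y))) u)"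
        using yx k by (simp add: trace_tp) (intro \<gamma>_cong, simp)
      then show "trace_map H M \<gamma> X Y ?k (tp Y X y x) = trace_map H M \<gamma> X Y f (tp Y X y x) \<oplus>\<^bsub>M\<^esub> trace_map H M \<gamma> X Y g (tp Y X y x)"
        using yx f g by (subst (asm) \<gamma>_add) (simp_all add: trace_arg trace_tp)
    qed (use w in simp_all) }
  { fix c assume c: "c \<in> carrier K"
    let ?k = "\<lambda>x\<in>carrier (TA X Y). kU c \<odot>\<^bsub>M\<^esub> f x"
    have k: "?k \<in> lin (TA X Y) M" using P.smult_closed[of c f] c f by simp
    note l = trace_lin[OF _ _ f]
    show "trace_map H M \<gamma> X Y ?k w = kU c \<odot>\<^bsub>M\<^esub> trace_map H M \<gamma> X Y f w"
    proof (rule TA_ext[of Y X M, where f = "trace_map H M \<gamma> X Y ?k" and g = "\<lambda>w. kU c \<odot>\<^bsub>M\<^esub> trace_map H M \<gamma> X Y f w"])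
      show "trace_map H M \<gamma> X Y ?k \<in> ahom (TA Y X) M" by (rule lin_mapsD(1)[OF trace_lin]) (use k in simp_all)
      show "(\<lambda>w. kU c \<odot>\<^bsub>M\<^esub> trace_map H M \<gamma> X Y f w) \<in> ahom (TA Y X) M"
        by (rule ahom_compose[OF lin_mapsD(1)[OF l] smult_ahom[of U]]) (use c in simp_all)
      fix y x assume yx: "y \<in> carrier Y" "x \<in> carrier X"
      have "trace_map H M \<gamma> X Y ?k (tp Y X y x) = \<gamma> (\<lambda>u\<in>carrier U. kU c \<odot>\<^bsub>M\<^esub> (\<lambda>u\<in>carrier U. f (tp X Y x (u \<odot>\<^bsub>Y\<^esub> y))) u)"
        using yx k by (simp add: trace_tp) (intro \<gamma>_cong, simp)
      then show "trace_map H M \<gamma> X Y ?k (tp Y X y x) = kU c \<odot>\<^bsub>M\<^esub> trace_map H M \<gamma> X Y f (tp Y X y x)"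
        using yx f c by (subst (asm) \<gamma>_kU) (simp_all add: trace_arg trace_tp)
    qed (use w in simp_all) }
qed

lemma trace_linear_iso:
  assumes "umod X" "umod Y"
  shows "is_linear_iso K (HomU H M (TA X Y)) (HomU H M (TA Y X)) (trace_map H M \<gamma> X Y)"
  unfolding is_linear_iso_def using assms
  by (auto intro!: trace_linear bij_betw_byWitness[where f' = "trace_map H M \<gamma> Y X"] simp: trace_trace trace_lin)

lemma trace_natural:
  assumes [simp]: "umod X" "umod X'" "umod Y" "umod Y'"
    and f: "f \<in> lin X X'" and g: "g \<in> lin Y Y'" and \<phi>: "\<phi> \<in> lin (TA X' Y') M"
  shows "trace_map H M \<gamma> X Y (precomp (TA X Y) (TA X' Y') (tens_mapA H X X' Y Y' f g) \<phi>) =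
    precomp (TA Y X) (TA Y' X') (tens_mapA H Y Y' X X' g f) (trace_map H M \<gamma> X' Y' \<phi>)"
proof (rule lin_TA_ext[of Y X _ M])
  note [simp] = f g \<phi> lin_closed[OF f] lin_closed[OF g]
  have 1: "compose (carrier (TA X Y)) \<phi> (tens_mapA H X X' Y Y' f g) \<in> lin (TA X Y) M"
    by (rule lin_compose[of _ _ "TA X' Y'"]) (simp_all add: tens_map_lin)
  then show "trace_map H M \<gamma> X Y (precomp (TA X Y) (TA X' Y') (tens_mapA H X X' Y Y' f g) \<phi>) \<in> lin (TA Y X) M"
    unfolding precomp_def by (intro trace_lin) simp_all
  show "precomp (TA Y X) (TA Y' X') (tens_mapA H Y Y' X X' g f) (trace_map H M \<gamma> X' Y' \<phi>) \<in> lin (TA Y X) M"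
    unfolding precomp_def by (rule lin_compose[of _ _ "TA Y' X'"]) (simp_all add: tens_map_lin trace_lin)
  fix y x assume "y \<in> carrier Y" "x \<in> carrier X"
  then show "trace_map H M \<gamma> X Y (precomp (TA X Y) (TA X' Y') (tens_mapA H X X' Y Y' f g) \<phi>) (tp Y X y x) =
      precomp (TA Y X) (TA Y' X') (tens_mapA H Y Y' X X' g f) (trace_map H M \<gamma> X' Y' \<phi>) (tp Y X y x)"
    using 1 by (simp add: precomp_def compose_eq tens_map_lin trace_tp)
      (intro \<gamma>_cong, simp add: compose_eq tens_map_lin lin_mapsD(4)[OF g])
qed simp_all

text \<open>Contraacting over the two factors \<open>X\<close> and \<open>Y\<close> one after the other is contraacting over \<open>X \<otimes>\<^sub>A Y\<close> with the diagonal action.\<close>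

lemma trace_hexagon:
  assumes [simp]: "umod X" "umod Y" "umod Z" and \<phi>: "\<phi> \<in> lin (TA Z (TA X Y)) M"
  shows "trace_map H M \<gamma> Z (TA X Y) \<phi> =
    precomp (TA (TA X Y) Z) (TA X (TA Y Z)) (associatorA H X Y Z)
      (trace_map H M \<gamma> (TA Y Z) X
        (precomp (TA (TA Y Z) X) (TA Y (TA Z X)) (associatorA H Y Z X)
          (trace_map H M \<gamma> (TA Z X) Y
            (precomp (TA (TA Z X) Y) (TA Z (TA X Y)) (associatorA H Z X Y) \<phi>))))"
proof -
  let ?\<omega> = "compose (carrier (TA (TA Z X) Y)) \<phi> (associatorA H Z X Y)"
  let ?\<chi> = "trace_map H M \<gamma> (TA Z X) Y ?\<omega>"
  let ?\<psi> = "compose (carrier (TA (TA Y Z) X)) ?\<chi> (associatorA H Y Z X)"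
  let ?r = "compose (carrier (TA (TA X Y) Z)) (trace_map H M \<gamma> (TA Y Z) X ?\<psi>) (associatorA H X Y Z)"
  have \<omega>: "?\<omega> \<in> lin (TA (TA Z X) Y) M"
    by (rule lin_compose[OF _ associator_lin \<phi>]) simp_all
  have \<chi>: "?\<chi> \<in> lin (TA Y (TA Z X)) M"
    using \<omega> by (intro trace_lin) simp_all
  have \<psi>: "?\<psi> \<in> lin (TA (TA Y Z) X) M"
    by (rule lin_compose[OF _ associator_lin \<chi>]) simp_all
  have r: "?r \<in> lin (TA (TA X Y) Z) M"
    by (rule lin_compose[OF _ associator_lin trace_lin]) (simp_all add: \<psi>)
  have "trace_map H M \<gamma> Z (TA X Y) \<phi> = ?r"
  proof (rule lin_TA_ext_left[OF _ r])
    show "trace_map H M \<gamma> Z (TA X Y) \<phi> \<in> lin (TA (TA X Y) Z) M"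
      using \<phi> by (intro trace_lin) simp_all
    fix x y z assume xyz: "x \<in> carrier X" "y \<in> carrier Y" "z \<in> carrier Z"
    let ?f = "\<lambda>w\<in>carrier (TA X Y). \<phi> (tp Z (TA X Y) z w)"
    have "?r (tp (TA X Y) Z (tp X Y x y) z) = \<gamma> (\<lambda>u\<in>carrier U. ?\<psi> (tp (TA Y Z) X (tp Y Z y z) (u \<odot>\<^bsub>X\<^esub> x)))"
      using xyz by (simp add: compose_eq associator_tp trace_tp \<psi>)
    also have "\<dots> = \<gamma> (\<lambda>u\<in>carrier U. \<gamma> (\<lambda>v\<in>carrier U. \<phi> (tp Z (TA X Y) z (tp X Y (u \<odot>\<^bsub>X\<^esub> x) (v \<odot>\<^bsub>Y\<^esub> y)))))"
      using xyz by (intro \<gamma>_cong) (simp add: compose_eq associator_tp trace_tp \<omega>, intro \<gamma>_cong, simp add: compose_eq associator_tp)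
    also have "\<dots> = \<gamma> (\<lambda>u\<in>carrier U. \<phi> (tp Z (TA X Y) z (u \<odot>\<^bsub>TA X Y\<^esub> tp X Y x y)))"
    proof -
      have tz: "tp Z (TA X Y) z \<in> ahom (TA X Y) (TA Z (TA X Y))"
        using xyz by (intro tp_ahom_right) simp_all
      have "?f \<in> AH (TA X Y)"
        using xyz by (intro AHI ahom_restrict ahom_compose[OF tz lin_mapsD(1)[OF \<phi>]])
          (simp_all flip: lin_mapsD(4)[OF \<phi>] t_tp)
      from \<gamma>_diag[OF _ _ this xyz(1,2)] xyz show ?thesis by (simp cong: restrict_cong)
    qed
    also have "\<dots> = trace_map H M \<gamma> Z (TA X Y) \<phi> (tp (TA X Y) Z (tp X Y x y) z)"
      using xyz by (simp add: trace_tp \<phi>)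
    finally show "trace_map H M \<gamma> Z (TA X Y) \<phi> (tp (TA X Y) Z (tp X Y x y) z) = ?r (tp (TA X Y) Z (tp X Y x y) z)" ..
  qed simp_all
  then show ?thesis by (simp add: precomp_def)
qed

end

section \<open>Cocyclic modules\<close>

text \<open>The identities for \<open>\<tau>\<delta>\<^sub>0\<close> and \<open>\<tau>\<sigma>\<^sub>0\<close> follow from the others and \<open>\<tau>\<^sup>q\<^sup>+\<^sup>1 = 1\<close>: pass \<open>\<tau>\<close> through the remaining faces or degeneracies, one index at a time, until the power is complete.\<close>

lemma cocyclic_moduleI:
  assumes cos: "cosimplicial_module K C \<delta> \<sigma>"
    and lin: "\<And>q. is_linear K (C q) (C q) (\<tau> q)"
    and \<delta>: "\<And>q i f. [|i \<le> q; f \<in> carrier (C q)|] ==> \<tau> (q + 1) (\<delta> q (Suc i) f) = \<delta> q i (\<tau> q f)"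
    and \<sigma>: "\<And>q i f. [|Suc i \<le> q; f \<in> carrier (C (q + 1))|] ==> \<tau> q (\<sigma> q (Suc i) f) = \<sigma> q i (\<tau> (q + 1) f)"
    and cyc: "\<And>q f. f \<in> carrier (C q) ==> (\<tau> q ^^ (q + 1)) f = f"
  shows "cocyclic_module K C \<delta> \<sigma> \<tau>"
proof -
  have dl: "is_linear K (C q) (C (q + 1)) (\<delta> q i)" if "i \<le> q + 1" for q i
    using cos that unfolding cosimplicial_module_def by (elim conjE) simp
  have sl: "is_linear K (C (q + 1)) (C q) (\<sigma> q j)" if "j \<le> q" for q j
    using cos that unfolding cosimplicial_module_def by (elim conjE) simp
  have dc: "\<delta> q i f \<in> carrier (C (q + 1))" if "i \<le> q + 1" "f \<in> carrier (C q)" for q i f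
    using dl[OF that(1)] that(2) unfolding is_linear_def by (auto intro: ahom_closed)
  have sc: "\<sigma> q j f \<in> carrier (C q)" if "j \<le> q" "f \<in> carrier (C (q + 1))" for q j f
    using sl[OF that(1)] that(2) unfolding is_linear_def by (auto intro: ahom_closed)
  have tc: "\<tau> q f \<in> carrier (C q)" if "f \<in> carrier (C q)" for q f
    using lin[of q] that by (auto simp: is_linear_def intro: ahom_closed)
  have tck: "(\<tau> q ^^ k) f \<in> carrier (C q)" if "f \<in> carrier (C q)" for q f k
    using that by (induction k) (auto simp: tc)
  have dk: "(\<tau> (q + 1) ^^ k) (\<delta> q (i + k) f) = \<delta> q i ((\<tau> q ^^ k) f)"
    if "i + k \<le> q + 1" "f \<in> carrier (C q)" for q i k f
    using that
  proof (induction k arbitrary: i)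
    case (Suc k)
    from Suc.IH[of "Suc i"] Suc.prems have "(\<tau> (q + 1) ^^ Suc k) (\<delta> q (i + Suc k) f) = \<tau> (q + 1) (\<delta> q (Suc i) ((\<tau> q ^^ k) f))"
      by simp
    also have "\<dots> = \<delta> q i ((\<tau> q ^^ Suc k) f)"
      using Suc.prems \<delta>[of i q "(\<tau> q ^^ k) f"] by (simp add: tck)
    finally show ?case .
  qed simp
  have sk: "(\<tau> q ^^ k) (\<sigma> q (i + k) f) = \<sigma> q i ((\<tau> (q + 1) ^^ k) f)"
    if "i + k \<le> q" "f \<in> carrier (C (q + 1))" for q i k f
    using that
  proof (induction k arbitrary: i)
    case (Suc k)
    from Suc.IH[of "Suc i"] Suc.prems have "(\<tau> q ^^ Suc k) (\<sigma> q (i + Suc k) f) = \<tau> q (\<sigma> q (Suc i) ((\<tau> (q + 1) ^^ k) f))"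
      by simp
    also have "\<dots> = \<sigma> q i ((\<tau> (q + 1) ^^ Suc k) f)"
      using Suc.prems \<sigma>[of i q "(\<tau> (q + 1) ^^ k) f"] tck[of f "q + 1" k] by simp
    finally show ?case .
  qed simp
  have d0: "\<tau> (q + 1) (\<delta> q 0 f) = \<delta> q (q + 1) f" if f: "f \<in> carrier (C q)" for q f
  proof -
    have "\<delta> q 0 f = (\<tau> (q + 1) ^^ (q + 1)) (\<delta> q (q + 1) f)"
      using dk[of 0 "q + 1" q f] f cyc[OF f] by simp
    then have "\<tau> (q + 1) (\<delta> q 0 f) = (\<tau> (q + 1) ^^ (q + 1 + 1)) (\<delta> q (q + 1) f)" by simp
    also have "\<dots> = \<delta> q (q + 1) f"
      using f by (intro cyc dc) auto
    finally show ?thesis .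
  qed
  have s0: "\<tau> q (\<sigma> q 0 f) = \<sigma> q q (\<tau> (q + 1) (\<tau> (q + 1) f))" if f: "f \<in> carrier (C (q + 1))" for q f
  proof -
    let ?g = "\<tau> (q + 1) (\<tau> (q + 1) f)"
    have g: "?g \<in> carrier (C (q + 1))" using f tc by blast
    have "(\<tau> (q + 1) ^^ q) ?g = (\<tau> (q + 1) ^^ (q + 1 + 1)) f"
      by (simp add: funpow_swap1)
    also have "\<dots> = f" using cyc[OF f] .
    finally have "\<sigma> q 0 f = (\<tau> q ^^ q) (\<sigma> q q ?g)"
      using sk[of 0 q q ?g] g by simp
    then have "\<tau> q (\<sigma> q 0 f) = (\<tau> q ^^ (q + 1)) (\<sigma> q q ?g)" by simp
    also have "\<dots> = \<sigma> q q ?g"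
      using g by (intro cyc sc) auto
    finally show ?thesis .
  qed
  have di: "\<tau> (q + 1) (\<delta> q i f) = \<delta> q (i - 1) (\<tau> q f)" if "1 \<le> i" "i \<le> q + 1" "f \<in> carrier (C q)" for q i f
    using \<delta>[of "i - 1" q f] that by simp
  have si: "\<tau> q (\<sigma> q i f) = \<sigma> q (i - 1) (\<tau> (q + 1) f)" if "1 \<le> i" "i \<le> q" "f \<in> carrier (C (q + 1))" for q i f
    using \<sigma>[of "i - 1" q f] that by simp
  show ?thesis
    unfolding cocyclic_module_def
    by (intro conjI allI impI ballI; (elim conjE)?) (rule cos lin d0 s0 di si cyc; assumption)+
qed

section \<open>The cobar tower\<close>

context bialgebroid_setting
begin

abbreviation "idm X \<equiv> (\<lambda>x\<in>carrier X. x)"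
abbreviation "ws \<equiv> words H"
abbreviation "tmap \<equiv> tens_mapA H"

text \<open>\<open>U \<otimes>\<^sub>A \<dots> \<otimes>\<^sub>A U\<close> with \<open>q + 1\<close> factors and the diagonal action. It is isomorphic to \<open>Bar\<^sub>q(U)\<close>, but its faces and the cyclic rotation do not mix the factors.\<close>

fun DD :: "nat \<Rightarrow> ('w, 'w) module" where
  "DD 0 = UM"
| "DD (Suc q) = TA UM (DD q)"

lemmas DD_Suc = DD.simps(2)
declare DD.simps(2) [simp del]

lemma umod_DD [simp]: "umod (DD q)"
  by (induction q) (simp_all add: DD_Suc)

lemma tpD_closed [simp]: "[|u \<in> carrier U; w \<in> carrier (DD q)|] ==> tp UM (DD q) u w \<in> carrier (DD (Suc q))"
  by (simp add: DD_Suc)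

lemma ws_Nil [simp]: "us \<in> ws 0 \<longleftrightarrow> us = []"
  by (auto simp: words_def)

lemma ws_Cons [simp]: "u # us \<in> ws (Suc q) \<longleftrightarrow> u \<in> carrier U \<and> us \<in> ws q"
  by (auto simp: words_def)

lemma ws_length: "us \<in> ws q ==> length us = q"
  by (simp add: words_def)

lemma ws_SucE:
  assumes "us \<in> ws (Suc q)"
  obtains u vs where "us = u # vs" "u \<in> carrier U" "vs \<in> ws q"
  using assms by (cases us) (auto simp: words_def)

lemma ws_append: "[|us \<in> ws m; vs \<in> ws n|] ==> us @ vs \<in> ws (m + n)"
  by (auto simp: words_def)

lemma ws_snoc [simp]: "us \<in> ws q ==> u \<in> carrier U ==> us @ [u] \<in> ws (Suc q)"
  by (auto simp: words_def)

fun dw :: "'w list \<Rightarrow> 'w" where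
  "dw [] = undefined"
| "dw [u] = u"
| "dw (u # v # us) = tp UM (DD (length us)) u (dw (v # us))"

lemma dw_Cons: "us \<in> ws (Suc q) ==> dw (u # us) = tp UM (DD q) u (dw us)"
  by (cases us) (auto simp: words_def)

lemma dw_closed [simp]: "us \<in> ws (Suc q) ==> dw us \<in> carrier (DD q)"
proof (induction q arbitrary: us)
  case (Suc q)
  then show ?case by (auto elim!: ws_SucE[of us] simp: dw_Cons)
qed (auto elim!: ws_SucE)

lemma DD_ext:
  assumes "abelian_group Z" "f \<in> ahom (DD q) Z" "g \<in> ahom (DD q) Z" "w \<in> carrier (DD q)"
    "\<And>us. us \<in> ws (Suc q) ==> f (dw us) = g (dw us)"
  shows "f w = g w"
  using assms(2-5)
proof (induction q arbitrary: f g w)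
  case 0
  then show ?case using 0(4)[of "[w]"] by simp
next
  case (Suc q)
  show ?case
  proof (rule TA_ext[of UM "DD q" Z f g w])
    fix u v assume u: "u \<in> carrier UM" and v: "v \<in> carrier (DD q)"
    have h: "tp UM (DD q) u \<in> ahom (DD q) (DD (Suc q))"
      using u tp_ahom_right[of UM "DD q" u] by (simp add: DD_Suc)
    show "f (tp UM (DD q) u v) = g (tp UM (DD q) u v)"
    proof (rule Suc.IH[OF ahom_compose[OF h Suc.prems(1)] ahom_compose[OF h Suc.prems(2)] v])
      fix us assume "us \<in> ws (Suc q)"
      then show "f (tp UM (DD q) u (dw us)) = g (tp UM (DD q) u (dw us))"
        using Suc.prems(4)[of "u # us"] u by (simp add: dw_Cons)
    qed
  qed (use Suc.prems assms(1) in \<open>simp_all add: DD_Suc\<close>)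
qed

lemma lin_DD_ext:
  assumes "f \<in> lin (DD q) Z" "g \<in> lin (DD q) Z" "umod Z" "\<And>us. us \<in> ws (Suc q) ==> f (dw us) = g (dw us)"
  shows "f = g"
  by (rule lin_maps_eqI[OF assms(1,2)], rule DD_ext[OF _ lin_mapsD(1)[OF assms(1)] lin_mapsD(1)[OF assms(2)]])
    (use assms in auto)

lemma idm_lin [simp]: "umod X ==> idm X \<in> lin X X" "idm U \<in> lin UM UM"
  using lin_maps_id[OF umod_UM] by (simp_all add: lin_maps_id)

lemma counit_lin: "restrict \<epsilon> (carrier U) \<in> lin UM AM"
proof (rule lin_mapsI)
  show "restrict \<epsilon> (carrier U) \<in> ahom UM AM"
    by (rule ahomI) (auto simp: counit_add)
  show "restrict \<epsilon> (carrier U) (u \<odot>\<^bsub>UM\<^esub> v) = u \<odot>\<^bsub>AM\<^esub> restrict \<epsilon> (carrier U) v" if "u \<in> carrier U" "v \<in> carrier UM" for u v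
    using that counit_mult_src[of u v] by simp
qed simp

lemma comul_lin: "restrict \<Delta> (carrier U) \<in> lin UM (UU H)"
proof (rule lin_mapsI)
  show "restrict \<Delta> (carrier U) \<in> ahom UM (UU H)"
    by (rule ahomI) (auto simp: ahom_add[OF comul_ahom])
qed (simp_all add: comul_smult)

definition face_first :: "('w, 'w) module \<Rightarrow> 'w \<Rightarrow> 'w"
  where "face_first W = compose (carrier (TA UM W)) (lunitA H W) (tmap UM AM W W (restrict \<epsilon> (carrier U)) (idm W))"

definition face_last :: "'w \<Rightarrow> 'w"
  where "face_last = compose (carrier (UU H)) (runitA H UM) (tmap UM UM UM AM (idm U) (restrict \<epsilon> (carrier U)))"

definition deg_first :: "('w, 'w) module \<Rightarrow> 'w \<Rightarrow> 'w"
  where "deg_first W = compose (carrier (TA UM W)) (associatorA H UM UM W) (tmap UM (UU H) W W (restrict \<Delta> (carrier U)) (idm W))"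

lemma face_first_lin: "umod W ==> face_first W \<in> lin (TA UM W) W"
  unfolding face_first_def by (rule lin_compose[OF _ tens_map_lin(1) lunit_lin]) (simp_all add: counit_lin)

lemma face_first_tp: "[|umod W; u \<in> carrier U; w \<in> carrier W|] ==> face_first W (tp UM W u w) = s (\<epsilon> u) \<odot>\<^bsub>W\<^esub> w"
  by (simp add: face_first_def compose_eq tens_map_lin counit_lin lunit_tp)

lemma face_last_lin: "face_last \<in> lin (UU H) UM"
  unfolding face_last_def by (rule lin_compose[OF _ tens_map_lin(1) runit_lin]) (simp_all add: counit_lin)

lemma face_last_tp: "[|u \<in> carrier U; v \<in> carrier U|] ==> face_last (tpU H u v) = t (\<epsilon> v) \<cdot> u"
  by (simp add: face_last_def compose_eq tens_map_lin counit_lin runit_tp)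

lemma deg_first_lin: "umod W ==> deg_first W \<in> lin (TA UM W) (TA UM (TA UM W))"
  unfolding deg_first_def by (rule lin_compose[OF _ tens_map_lin(1) associator_lin]) (simp_all add: comul_lin)

lemma deg_first_tp: "[|umod W; u \<in> carrier U; w \<in> carrier W|] ==>
    deg_first W (tp UM W u w) = associatorA H UM UM W (tp (UU H) W (\<Delta> u) w)"
  by (simp add: deg_first_def compose_eq tens_map_lin comul_lin)

fun face :: "nat \<Rightarrow> nat \<Rightarrow> 'w \<Rightarrow> 'w" where
  "face q 0 = face_first (DD q)"
| "face 0 (Suc i) = face_last"
| "face (Suc q) (Suc i) = tmap UM UM (DD (Suc q)) (DD q) (idm U) (face q i)"

fun deg :: "nat \<Rightarrow> nat \<Rightarrow> 'w \<Rightarrow> 'w" where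
  "deg 0 j = restrict \<Delta> (carrier U)"
| "deg (Suc q) 0 = deg_first (DD q)"
| "deg (Suc q) (Suc j) = tmap UM UM (DD q) (DD (Suc q)) (idm U) (deg q j)"

declare face.simps [simp del] deg.simps [simp del]

lemma face_lin: "face q i \<in> lin (DD (Suc q)) (DD q)"
proof (induction q i rule: face.induct)
  case (1 q)
  show ?case unfolding face.simps DD_Suc by (rule face_first_lin) simp
next
  case (2 i)
  show ?case unfolding face.simps DD.simps by (rule face_last_lin)
next
  case (3 q i)
  then show ?case unfolding face.simps DD_Suc[of "Suc q"] DD_Suc[of q]
    by (intro tens_map_lin(1)) (simp_all add: DD_Suc)
qed

lemma deg_lin: "deg q j \<in> lin (DD q) (DD (Suc q))"
proof (induction q j rule: deg.induct)
  case (1 j)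
  show ?case unfolding deg.simps DD.simps by (rule comul_lin)
next
  case (2 q)
  show ?case unfolding deg.simps DD_Suc by (rule deg_first_lin) simp
next
  case (3 q j)
  then show ?case unfolding deg.simps DD_Suc[of "Suc q"] DD_Suc[of q]
    by (intro tens_map_lin(1)) (simp_all add: DD_Suc)
qed

lemma face_tp:
  "[|u \<in> carrier U; w \<in> carrier (DD q)|] ==> face q 0 (tp UM (DD q) u w) = s (\<epsilon> u) \<odot>\<^bsub>DD q\<^esub> w"
  "[|u \<in> carrier U; v \<in> carrier U|] ==> face 0 (Suc i) (tpU H u v) = t (\<epsilon> v) \<cdot> u"
  "[|u \<in> carrier U; w \<in> carrier (DD (Suc q))|] ==> face (Suc q) (Suc i) (tp UM (DD (Suc q)) u w) = tp UM (DD q) u (face q i w)"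
  using tens_map_lin(2)[of UM UM "DD (Suc q)" "DD q" "idm U" "face q i" u w] face_lin[of q i]
  by (simp_all add: face_first_tp face_last_tp face.simps)

lemma deg_tp:
  "u \<in> carrier U ==> deg 0 j u = \<Delta> u"
  "[|u \<in> carrier U; w \<in> carrier (DD q)|] ==> deg (Suc q) 0 (tp UM (DD q) u w) = associatorA H UM UM (DD q) (tp (UU H) (DD q) (\<Delta> u) w)"
  "[|u \<in> carrier U; w \<in> carrier (DD q)|] ==> deg (Suc q) (Suc j) (tp UM (DD q) u w) = tp UM (DD (Suc q)) u (deg q j w)"
  using tens_map_lin(2)[of UM UM "DD q" "DD (Suc q)" "idm U" "deg q j" u w] deg_lin[of q j]
  by (simp_all add: deg_first_tp deg.simps)

text \<open>Moving the last tensor factor to the right of all brackets.\<close>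

fun split_last :: "nat \<Rightarrow> 'w \<Rightarrow> 'w" where
  "split_last 0 = idm (UU H)"
| "split_last (Suc q) = compose (carrier (DD (Suc (Suc q)))) (assoc_inv UM (DD q) UM)
     (tmap UM UM (DD (Suc q)) (TA (DD q) UM) (idm U) (split_last q))"

declare split_last.simps [simp del]

lemma split_last_lin: "split_last q \<in> lin (DD (Suc q)) (TA (DD q) UM)"
proof (induction q)
  case 0
  show ?case unfolding split_last.simps DD.simps by (rule lin_maps_id) simp
next
  case (Suc q)
  show ?case unfolding split_last.simps DD_Suc[of "Suc q"]
    by (rule lin_compose[OF _ tens_map_lin(1)], simp, simp, simp, simp, simp, simp, rule Suc.IH,
        simp add: DD_Suc assoc_inv_lin)
qed

lemma split_last_tp:
  "[|u \<in> carrier U; w \<in> carrier (DD (Suc q))|] ==>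
    split_last (Suc q) (tp UM (DD (Suc q)) u w) = assoc_inv UM (DD q) UM (tp UM (TA (DD q) UM) u (split_last q w))"
  using tens_map_lin(2)[of UM UM "DD (Suc q)" "TA (DD q) UM" "idm U" "split_last q" u w] split_last_lin[of q]
  by (simp add: compose_eq split_last.simps)

lemma split_last_dw: "[|us \<in> ws (Suc q); x \<in> carrier U|] ==> split_last q (dw (us @ [x])) = tp (DD q) UM (dw us) x"
proof (induction q arbitrary: us)
  case 0
  then show ?case by (auto elim!: ws_SucE simp: split_last.simps)
next
  case (Suc q)
  then obtain u vs where us: "us = u # vs" "u \<in> carrier U" "vs \<in> ws (Suc q)" by (auto elim: ws_SucE)
  then have "split_last (Suc q) (dw (us @ [x])) = assoc_inv UM (DD q) UM (tp UM (TA (DD q) UM) u (tp (DD q) UM (dw vs) x))"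
    using Suc.IH[of vs] Suc.prems dw_closed[of "vs @ [x]" "Suc q"] dw_Cons[of "vs @ [x]" "Suc q" u]
    by (simp add: split_last_tp )
  then show ?case
    using us Suc.prems by (simp add: assoc_inv_tp dw_Cons DD_Suc)
qed

text \<open>Faces and degeneracies away from the last slot commute with splitting off the last factor.\<close>

lemma split_last_face:
  "[|us \<in> ws (Suc (Suc q)); x \<in> carrier U; i \<le> Suc q|] ==>
    split_last q (face (Suc q) i (dw (us @ [x]))) = tp (DD q) UM (face q i (dw us)) x"
proof (induction i arbitrary: us q)
  case 0
  then obtain u vs where us: "us = u # vs" "u \<in> carrier U" "vs \<in> ws (Suc q)" by (auto elim: ws_SucE)
  then show ?case
    using 0 dw_closed[of "vs @ [x]" "Suc q"] dw_Cons[of "vs @ [x]" "Suc q" u] dw_closed[OF us(3)]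
    by (simp add: face_tp dw_Cons[OF us(3)] lin_mapsD(4)[OF split_last_lin] split_last_dw s_tp)
next
  case (Suc i)
  then obtain u vs where us: "us = u # vs" "u \<in> carrier U" "vs \<in> ws (Suc q)" by (auto elim: ws_SucE)
  have "split_last q (face (Suc q) (Suc i) (dw (us @ [x]))) = split_last q (tp UM (DD q) u (face q i (dw (vs @ [x]))))"
    using us Suc.prems dw_closed[of "vs @ [x]" "Suc q"] dw_Cons[of "vs @ [x]" "Suc q" u]
    by (simp add: face_tp )
  also have "\<dots> = tp (DD q) UM (face q (Suc i) (dw us)) x"
  proof (cases q)
    case 0
    then obtain b where b: "vs = [b]" "b \<in> carrier U" using us by (auto elim!: ws_SucE)
    then have "face 0 i (dw (vs @ [x])) = s (\<epsilon> b) \<cdot> x"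
      using 0 Suc.prems face_tp(1)[of b x 0] by simp
    then show ?thesis
      using 0 b us Suc.prems face_tp(2)[of u b i] by (simp add: tpU_balance split_last.simps)
  next
    case (Suc q')
    have "split_last q (tp UM (DD q) u (face q i (dw (vs @ [x])))) = assoc_inv UM (DD q') UM (tp UM (TA (DD q') UM) u (tp (DD q') UM (face q' i (dw vs)) x))"
      using us Suc Suc.prems Suc.IH[of vs q'] dw_closed[of "vs @ [x]" "Suc q"] lin_mapsD(2)[OF face_lin[of q i], of "dw (vs @ [x])"]
      by (simp add: split_last_tp )
    moreover have "face q (Suc i) (dw us) = tp UM (DD q') u (face q' i (dw vs))"
      using us Suc dw_closed[OF us(3)] by (simp add: dw_Cons[OF us(3)] face_tp(3))
    ultimately show ?thesis
      using us Suc Suc.prems lin_mapsD(2)[OF face_lin[of q' i], of "dw vs"] dw_closed[OF us(3)]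
      by (simp add: assoc_inv_tp DD_Suc)
  qed
  finally show ?case .
qed

lemma split_last_deg:
  "[|us \<in> ws (Suc q); x \<in> carrier U; j \<le> q|] ==>
    split_last (Suc q) (deg (Suc q) j (dw (us @ [x]))) = tp (DD (Suc q)) UM (deg q j (dw us)) x"
proof (induction j arbitrary: us q)
  case 0
  then obtain u vs where us: "us = u # vs" "u \<in> carrier U" "vs \<in> ws q" by (auto elim: ws_SucE)
  have vx: "vs @ [x] \<in> ws (Suc q)" using us 0 by simp
  let ?f = "\<lambda>p. split_last (Suc q) (associatorA H UM UM (DD q) (tp (UU H) (DD q) p (dw (vs @ [x]))))"
  have f: "?f \<in> ahom (UU H) (TA (DD (Suc q)) UM)"
  proof (rule ahom_compose[OF ahom_compose[OF tp_ahom_left lin_mapsD(1)[OF associator_lin]]])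
    show "split_last (Suc q) \<in> ahom (TA UM (TA UM (DD q))) (TA (DD (Suc q)) UM)"
      using lin_mapsD(1)[OF split_last_lin[of "Suc q"]] by (simp add: DD_Suc)
  qed (use dw_closed[OF vx] in simp_all)
  have fab: "?f (tpU H a b) = tp (DD (Suc q)) UM (dw (a # b # vs)) x" if "a \<in> carrier U" "b \<in> carrier U" for a b
    using split_last_dw[of "a # b # vs" "Suc q" x] that us vx 0 dw_Cons[OF vx, of b] dw_Cons[of "b # vs @ [x]" "Suc q" a]
    by (simp add: associator_tp DD_Suc[of q] dw_Cons[OF vx])
  have "split_last (Suc q) (deg (Suc q) 0 (dw (us @ [x]))) = ?f (\<Delta> u)"
    using us vx dw_Cons[OF vx, of u] by (simp add: deg_tp )
  also have "\<dots> = tp (DD (Suc q)) UM (deg q 0 (dw us)) x"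
  proof (cases q)
    case 0
    have g: "(\<lambda>p. tp (DD (Suc q)) UM p x) \<in> ahom (UU H) (TA (DD (Suc q)) UM)"
      using tp_ahom_left[of "UU H" UM x] \<open>x \<in> carrier U\<close> 0 by (simp add: DD_Suc)
    have "?f (\<Delta> u) = tp (DD (Suc q)) UM (\<Delta> u) x"
      by (rule UU_ext[OF _ f g]) (use fab us 0 \<open>x \<in> carrier U\<close> in simp_all)
    then show ?thesis using 0 us by (simp add: deg_tp)
  next
    case (Suc q')
    have g: "(\<lambda>p. tp (DD (Suc q)) UM (associatorA H UM UM (DD q') (tp (UU H) (DD q') p (dw vs))) x) \<in> ahom (UU H) (TA (DD (Suc q)) UM)"
    proof (rule ahom_compose[OF ahom_compose[OF tp_ahom_left lin_mapsD(1)[OF associator_lin]]])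
      show "(\<lambda>p. tp (DD (Suc q)) UM p x) \<in> ahom (TA UM (TA UM (DD q'))) (TA (DD (Suc q)) UM)"
        using tp_ahom_left[of "TA UM (TA UM (DD q'))" UM x] \<open>x \<in> carrier U\<close> Suc by (simp add: DD_Suc)
    qed (use us Suc in simp_all)
    have "?f (\<Delta> u) = tp (DD (Suc q)) UM (associatorA H UM UM (DD q') (tp (UU H) (DD q') (\<Delta> u) (dw vs))) x"
      by (rule UU_ext[OF _ f g])
        (use fab us Suc \<open>x \<in> carrier U\<close> ws_length[OF us(3)] in \<open>simp_all add: associator_tp dw_Cons DD_Suc\<close>)
    then show ?thesis using Suc us by (simp add: deg_tp dw_Cons )
  qed
  finally show ?case .
next
  case (Suc j)
  then obtain u vs q' where us: "us = u # vs" "u \<in> carrier U" "vs \<in> ws (Suc q')" "q = Suc q'"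
    by (cases q) (auto elim: ws_SucE)
  have vx: "vs @ [x] \<in> ws (Suc q)" using us Suc by simp
  have "split_last (Suc q) (deg (Suc q) (Suc j) (dw (us @ [x]))) =
      assoc_inv UM (DD q) UM (tp UM (TA (DD q) UM) u (split_last q (deg q j (dw (vs @ [x])))))"
    using us vx dw_Cons[OF vx, of u] dw_closed[OF vx] lin_mapsD(2)[OF deg_lin[of q j], of "dw (vs @ [x])"]
    by (simp add: deg_tp(3) split_last_tp )
  also have "\<dots> = tp (DD (Suc q)) UM (deg q (Suc j) (dw us)) x"
    using us Suc.IH[of vs q'] Suc.prems lin_mapsD(2)[OF deg_lin[of q' j], of "dw vs"]
    by (simp add: assoc_inv_tp deg_tp(3) dw_Cons DD_Suc[of "Suc q'"])
  finally show ?case .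
qed

end

lemma is_linear_compose:
  assumes "is_linear R X Y f" "is_linear R Y Z g" shows "is_linear R X Z (\<lambda>x. g (f x))"
  using assms ahom_compose[of f X Y g Z] by (auto simp: is_linear_def ahom_closed[of f X Y])

section \<open>The cyclic operator on the tower\<close>

context aYD_setting
begin

text \<open>The trace exchanges the first factor \<open>U\<close> with the rest of the tower.\<close>

fun tau :: "nat \<Rightarrow> ('w \<Rightarrow> 'w) \<Rightarrow> 'w \<Rightarrow> 'w" where
  "tau 0 F = F"
| "tau (Suc q) F = compose (carrier (DD (Suc q))) (trace_map H M \<gamma> UM (DD q) F) (split_last q)"

declare tau.simps(2) [simp del]

lemma tau_lin: "F \<in> lin (DD q) M ==> tau q F \<in> lin (DD q) M"
proof (cases q)
  case (Suc q')
  assume F: "F \<in> lin (DD q) M"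
  show ?thesis unfolding Suc tau.simps
    by (rule lin_compose[OF _ split_last_lin trace_lin]) (use F Suc in \<open>simp_all add: DD_Suc\<close>)
qed simp

lemma tau_dw:
  assumes "F \<in> lin (DD (Suc q)) M" "us \<in> ws (Suc q)" "x \<in> carrier U"
  shows "tau (Suc q) F (dw (us @ [x])) = \<gamma> (\<lambda>u\<in>carrier U. F (tp UM (DD q) x (u \<odot>\<^bsub>DD q\<^esub> dw us)))"
  using assms dw_closed[of "us @ [x]" "Suc q"]
  by (simp add: tau.simps compose_eq split_last_dw trace_tp DD_Suc)

text \<open>Rotating the first letter to the back and the trace rotation to the front cancel, by
  contraassociativity and stability.\<close>

lemma tau_rotate:
  assumes F: "F \<in> lin (DD (Suc q)) M" and us: "us \<in> ws (Suc q)" and b: "b \<in> carrier U"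
  shows "\<gamma> (\<lambda>u\<in>carrier U. tau (Suc q) F (dw (us @ [u \<cdot> b]))) = F (dw (b # us))"
proof -
  have F': "F \<in> lin (TA UM (DD q)) M" using F by (simp add: DD_Suc)
  have "\<gamma> (\<lambda>u\<in>carrier U. tau (Suc q) F (dw (us @ [u \<cdot> b]))) =
      \<gamma> (\<lambda>u\<in>carrier U. \<gamma> (\<lambda>v\<in>carrier U. F (tp UM (DD q) (u \<odot>\<^bsub>UM\<^esub> b) (v \<odot>\<^bsub>DD q\<^esub> dw us))))"
    by (rule \<gamma>_cong) (use us b in \<open>simp add: tau_dw[OF F us]\<close>)
  also have "\<dots> = F (tp UM (DD q) b (dw us))"
    using us b by (subst \<gamma>_diag[OF _ _ lin_AH[OF _ F']]) (simp_all add: \<gamma>_stable_lin[OF _ F'])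
  finally show ?thesis by (simp add: dw_Cons[OF us])
qed

fun pre :: "nat \<Rightarrow> 'w list \<Rightarrow> 'w \<Rightarrow> 'w" where
  "pre k [] w = w"
| "pre k (a # as) w = tp UM (DD (k + length as)) a (pre k as w)"

lemma pre_ahom: "set as \<subseteq> carrier U ==> pre k as \<in> ahom (DD k) (DD (k + length as))"
proof (induction as)
  case Nil
  then show ?case by (auto intro: ahomI)
next
  case (Cons a as)
  have "tp UM (DD (k + length as)) a \<in> ahom (DD (k + length as)) (DD (k + length (a # as)))"
    using tp_ahom_right[of UM "DD (k + length as)" a] Cons.prems by (simp add: DD_Suc)
  from ahom_compose[OF _ this] Cons show ?case by simp
qed

lemma pre_t: "[|set as \<subseteq> carrier U; a \<in> carrier A; w \<in> carrier (DD k)|] ==>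
    pre k as (t a \<odot>\<^bsub>DD k\<^esub> w) = t a \<odot>\<^bsub>DD (k + length as)\<^esub> pre k as w"
proof (induction as)
  case (Cons b as)
  then show ?case
    using ahom_closed[OF pre_ahom[of as k], of w] by (simp add: DD_Suc t_tp)
qed simp

lemma pre_dw: "[|as \<in> ws n; bs \<in> ws (Suc k)|] ==> pre k as (dw bs) = dw (as @ bs)"
proof (induction n arbitrary: as)
  case (Suc n)
  then obtain a vs where as: "as = a # vs" "a \<in> carrier U" "vs \<in> ws n" by (auto elim: ws_SucE)
  with Suc ws_append[of vs n bs "Suc k"] dw_Cons[of "vs @ bs" "k + n" a] show ?case
    by (simp add: ws_length ac_simps)
qed simp

lemma pre_snoc: "pre k (as @ [b]) w = pre (Suc k) as (tp UM (DD k) b w)"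
  by (induction as) simp_all

text \<open>Each further power of the cyclic operator moves one further letter by \<open>tau_rotate\<close>, so powers rotate blocks.\<close>

lemma tau_power_rotate:
  assumes "G \<in> lin (DD (Suc q)) M" "bs \<in> ws (Suc x)" "as \<in> ws n" "x + n = Suc q"
  shows "\<gamma> (\<lambda>u\<in>carrier U. (tau (Suc q) ^^ Suc x) G (pre x as (u \<odot>\<^bsub>DD x\<^esub> dw bs))) = G (dw (bs @ as))"
  using assms
proof (induction x arbitrary: G bs as n)
  case 0
  then obtain b where b: "bs = [b]" "b \<in> carrier U" by (auto elim!: ws_SucE)
  have "\<gamma> (\<lambda>u\<in>carrier U. (tau (Suc q) ^^ Suc 0) G (pre 0 as (u \<odot>\<^bsub>DD 0\<^esub> dw bs))) =
      \<gamma> (\<lambda>u\<in>carrier U. tau (Suc q) G (dw (as @ [u \<cdot> b])))"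
    using 0 b pre_dw[of as n "[_]" 0] by (intro \<gamma>_cong) simp
  also have "\<dots> = G (dw (b # as))"
    by (rule tau_rotate) (use 0 b in simp_all)
  also have "\<dots> = G (dw (bs @ as))"
    using b by simp
  finally show ?case .
next
  case (Suc x)
  then obtain b cs where b: "bs = b # cs" "b \<in> carrier U" "cs \<in> ws (Suc x)" by (auto elim: ws_SucE)
  let ?T = "(tau (Suc q) ^^ Suc (Suc x)) G"
  have T: "(tau (Suc q) ^^ k) G \<in> lin (DD (Suc q)) M" for k
    using Suc.prems by (induction k) (auto simp: tau_lin)
  have as: "set as \<subseteq> carrier U" "length as = n" using Suc.prems by (auto simp: words_def)
  have len: "Suc x + n = Suc q" using Suc.prems by simp
  have f: "(\<lambda>w\<in>carrier (TA UM (DD x)). ?T (pre (Suc x) as w)) \<in> AH (TA UM (DD x))"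
  proof (rule AHI)
    have h: "(\<lambda>w. ?T (pre (Suc x) as w)) \<in> ahom (DD (Suc x)) M"
    proof (rule ahom_compose[OF _ lin_mapsD(1)[OF T]])
      show "pre (Suc x) as \<in> ahom (DD (Suc x)) (DD (Suc q))"
        using pre_ahom[OF as(1), of "Suc x"] as(2) len by simp
    qed
    then show "(\<lambda>w\<in>carrier (TA UM (DD x)). ?T (pre (Suc x) as w)) \<in> ahom (TA UM (DD x)) M"
      by (intro ahom_restrict) (simp_all add: DD_Suc)
    fix a w assume a: "a \<in> carrier A" "w \<in> carrier (TA UM (DD x))"
    then show "(\<lambda>w\<in>carrier (TA UM (DD x)). ?T (pre (Suc x) as w)) (t a \<odot>\<^bsub>TA UM (DD x)\<^esub> w) =
        t a \<odot>\<^bsub>M\<^esub> (\<lambda>w\<in>carrier (TA UM (DD x)). ?T (pre (Suc x) as w)) w"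
      using pre_t[OF as(1) a(1), of w "Suc x"] ahom_closed[OF pre_ahom[OF as(1), of "Suc x"], of w]
        lin_mapsD(4)[OF T, of "t a" "pre (Suc x) as w" "Suc (Suc x)"] as(2) len
      by (simp add: DD_Suc[of x])
  qed simp
  have "\<gamma> (\<lambda>u\<in>carrier U. ?T (pre (Suc x) as (u \<odot>\<^bsub>DD (Suc x)\<^esub> dw bs))) =
      \<gamma> (\<lambda>u\<in>carrier U. \<gamma> (\<lambda>v\<in>carrier U. ?T (pre (Suc x) as (tp UM (DD x) (u \<cdot> b) (v \<odot>\<^bsub>DD x\<^esub> dw cs)))))"
    using \<gamma>_diag[OF umod_UM umod_DD f, of b "dw cs"] b by (simp add: dw_Cons DD_Suc cong: restrict_cong)
  also have "\<dots> = \<gamma> (\<lambda>u\<in>carrier U. tau (Suc q) G (dw ((cs @ as) @ [u \<cdot> b])))"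
  proof (rule \<gamma>_cong)
    fix u assume u: "u \<in> carrier U"
    show "\<gamma> (\<lambda>v\<in>carrier U. ?T (pre (Suc x) as (tp UM (DD x) (u \<cdot> b) (v \<odot>\<^bsub>DD x\<^esub> dw cs)))) =
        tau (Suc q) G (dw ((cs @ as) @ [u \<cdot> b]))"
      using Suc.IH[of "tau (Suc q) G" cs "as @ [u \<cdot> b]" "Suc n"] Suc.prems b u
      by (simp add: pre_snoc funpow_swap1 tau_lin del: restrict_apply)
  qed
  also have "\<dots> = G (dw (b # (cs @ as)))"
    using ws_append[OF b(3) Suc.prems(3)] len b(2) by (intro tau_rotate Suc.prems) simp_all
  finally show ?case using b by (simp del: restrict_apply)
qed

lemma tau_cyclic:
  assumes F: "F \<in> lin (DD q) M" shows "(tau q ^^ (q + 1)) F = F"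
proof (cases q)
  case 0
  then show ?thesis by simp
next
  case (Suc p)
  have T: "(tau q ^^ k) F \<in> lin (DD q) M" for k
    using F by (induction k) (auto simp: tau_lin)
  show ?thesis
  proof (rule lin_DD_ext[OF T F])
    fix us assume us: "us \<in> ws (Suc q)"
    have "(tau q ^^ (q + 1)) F (dw us) = \<gamma> (\<lambda>u\<in>carrier U. (tau q ^^ (q + 1)) F (u \<odot>\<^bsub>DD q\<^esub> dw us))"
      using us by (intro \<gamma>_stable_lin[OF _ T, symmetric]) simp_all
    also have "\<dots> = F (dw us)"
      using tau_power_rotate[of F p us q "[]" 0] F us Suc by simp
    finally show "(tau q ^^ (q + 1)) F (dw us) = F (dw us)" .
  qed simp
qed

definition dcoface :: "nat \<Rightarrow> nat \<Rightarrow> ('w \<Rightarrow> 'w) \<Rightarrow> 'w \<Rightarrow> 'w"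
  where "dcoface q i F = precomp (DD (Suc q)) (DD q) (face q i) F"

definition dcodeg :: "nat \<Rightarrow> nat \<Rightarrow> ('w \<Rightarrow> 'w) \<Rightarrow> 'w \<Rightarrow> 'w"
  where "dcodeg q j F = precomp (DD q) (DD (Suc q)) (deg q j) F"

lemma dcoface_lin: "F \<in> lin (DD q) M ==> dcoface q i F \<in> lin (DD (Suc q)) M"
  unfolding dcoface_def precomp_def by (rule lin_compose[OF _ face_lin]) simp_all

lemma dcodeg_lin: "F \<in> lin (DD (Suc q)) M ==> dcodeg q j F \<in> lin (DD q) M"
  unfolding dcodeg_def precomp_def by (rule lin_compose[OF _ deg_lin]) simp_all

lemma dcoface_eval: "w \<in> carrier (DD (Suc q)) ==> dcoface q i F w = F (face q i w)"
  by (simp add: dcoface_def precomp_def compose_eq)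

lemma dcodeg_eval: "w \<in> carrier (DD q) ==> dcodeg q j F w = F (deg q j w)"
  by (simp add: dcodeg_def precomp_def compose_eq)

lemma ws_snocE:
  assumes "us \<in> ws (Suc q)"
  obtains vs x where "us = vs @ [x]" "vs \<in> ws q" "x \<in> carrier U"
  using assms by (cases us rule: rev_cases) (auto simp: words_def)

lemma tau_dcoface:
  assumes i: "i \<le> q" and F: "F \<in> lin (DD q) M"
  shows "tau (Suc q) (dcoface q (Suc i) F) = dcoface q i (tau q F)"
proof (rule lin_DD_ext[OF tau_lin[OF dcoface_lin[OF F]] dcoface_lin[OF tau_lin[OF F]]])
  fix ws' assume "ws' \<in> ws (Suc (Suc q))"
  then obtain us x where us: "ws' = us @ [x]" "us \<in> ws (Suc q)" "x \<in> carrier U" by (rule ws_snocE)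
  have ux: "dw (us @ [x]) \<in> carrier (DD (Suc q))" using us by simp
  have "tau (Suc q) (dcoface q (Suc i) F) (dw (us @ [x])) =
      \<gamma> (\<lambda>u\<in>carrier U. F (face q (Suc i) (tp UM (DD q) x (u \<odot>\<^bsub>DD q\<^esub> dw us))))"
    unfolding tau_dw[OF dcoface_lin[OF F] us(2,3)]
    using us by (intro \<gamma>_cong) (simp add: dcoface_eval)
  also have "\<dots> = tau q F (face q i (dw (us @ [x])))"
  proof (cases q)
    case 0
    then obtain b where b: "us = [b]" "b \<in> carrier U" using us by (auto elim!: ws_SucE)
    note l = lin_mapsD(2,4)[OF F]
    have Fx: "F x \<in> carrier M" using l(1)[of x] us 0 by simp
    have "\<gamma> (\<lambda>u\<in>carrier U. F (face q (Suc i) (tp UM (DD q) x (u \<odot>\<^bsub>DD q\<^esub> dw us)))) =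
        \<gamma> (\<lambda>u\<in>carrier U. t (\<epsilon> (u \<cdot> s (\<epsilon> b))) \<odot>\<^bsub>M\<^esub> F x)"
    proof (rule \<gamma>_cong)
      fix u assume u: "u \<in> carrier U"
      show "F (face q (Suc i) (tp UM (DD q) x (u \<odot>\<^bsub>DD q\<^esub> dw us))) = t (\<epsilon> (u \<cdot> s (\<epsilon> b))) \<odot>\<^bsub>M\<^esub> F x"
        using u b us 0 l(2)[of "t (\<epsilon> (u \<cdot> s (\<epsilon> b)))" x] counit_mult_src[of u b] by (simp add: face_tp)
    qed
    also have "\<dots> = s (\<epsilon> b) \<odot>\<^bsub>M\<^esub> F x"
      using b Fx by (simp add: \<gamma>_left)
    also have "\<dots> = F (face 0 0 (dw (us @ [x])))"
      using b us 0 l(2)[of "s (\<epsilon> b)" x] face_tp(1)[of b x 0] by simp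
    finally show ?thesis using 0 i by simp
  next
    case (Suc p)
    have fu: "face p i (dw us) \<in> carrier (DD p)"
      using lin_mapsD(2)[OF face_lin[of p i], of "dw us"] us Suc by simp
    have F': "F \<in> lin (TA UM (DD p)) M" using F Suc by (simp add: DD_Suc)
    have "\<gamma> (\<lambda>u\<in>carrier U. F (face q (Suc i) (tp UM (DD q) x (u \<odot>\<^bsub>DD q\<^esub> dw us)))) =
        \<gamma> (\<lambda>u\<in>carrier U. F (tp UM (DD p) x (u \<odot>\<^bsub>DD p\<^esub> face p i (dw us))))"
      using us Suc by (intro \<gamma>_cong) (simp add: face_tp(3) lin_mapsD(4)[OF face_lin])
    also have "\<dots> = trace_map H M \<gamma> UM (DD p) F (tp (DD p) UM (face p i (dw us)) x)"
      using us Suc fu by (simp add: trace_tp F')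
    also have "\<dots> = trace_map H M \<gamma> UM (DD p) F (split_last p (face (Suc p) i (dw (us @ [x]))))"
      using us Suc i by (simp add: split_last_face)
    also have "\<dots> = tau q F (face q i (dw (us @ [x])))"
      using Suc lin_mapsD(2)[OF face_lin[of q i] ux] by (simp add: tau.simps compose_eq)
    finally show ?thesis .
  qed
  finally show "tau (Suc q) (dcoface q (Suc i) F) (dw ws') = dcoface q i (tau q F) (dw ws')"
    using us ux by (simp add: dcoface_eval)
qed simp

lemma tau_dcodeg:
  assumes i: "Suc i \<le> q" and F: "F \<in> lin (DD (Suc q)) M"
  shows "tau q (dcodeg q (Suc i) F) = dcodeg q i (tau (Suc q) F)"
proof (rule lin_DD_ext[OF tau_lin[OF dcodeg_lin[OF F]] dcodeg_lin[OF tau_lin[OF F]]])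
  obtain p where q: "q = Suc p" using i by (cases q) auto
  fix ws' assume "ws' \<in> ws (Suc q)"
  then obtain us x where us: "ws' = us @ [x]" "us \<in> ws (Suc p)" "x \<in> carrier U"
    using q by (auto elim: ws_snocE)
  have ux: "dw (us @ [x]) \<in> carrier (DD q)" using us q by simp
  have du: "deg p i (dw us) \<in> carrier (DD q)"
    using lin_mapsD(2)[OF deg_lin[of p i], of "dw us"] us q by simp
  have F': "F \<in> lin (TA UM (DD q)) M" using F by (simp add: DD_Suc)
  have "tau q (dcodeg q (Suc i) F) (dw (us @ [x])) =
      \<gamma> (\<lambda>u\<in>carrier U. F (tp UM (DD q) x (u \<odot>\<^bsub>DD q\<^esub> deg p i (dw us))))"
    unfolding q tau_dw[OF dcodeg_lin[OF F[unfolded q]] us(2,3)]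
    using us by (intro \<gamma>_cong) (simp add: dcodeg_eval deg_tp(3) lin_mapsD(4)[OF deg_lin])
  also have "\<dots> = trace_map H M \<gamma> UM (DD q) F (tp (DD q) UM (deg p i (dw us)) x)"
    using us du by (simp add: trace_tp F')
  also have "\<dots> = trace_map H M \<gamma> UM (DD q) F (split_last q (deg q i (dw (us @ [x]))))"
    using us q i by (simp add: split_last_deg)
  also have "\<dots> = dcodeg q i (tau (Suc q) F) (dw (us @ [x]))"
    using lin_mapsD(2)[OF deg_lin[of q i] ux] ux by (simp add: tau.simps compose_eq dcodeg_eval)
  finally show "tau q (dcodeg q (Suc i) F) (dw ws') = dcodeg q i (tau (Suc q) F) (dw ws')"
    using us by simp
qed simp

lemma tau_linear: "is_linear K (HomU H M (DD q)) (HomU H M (DD q)) (tau q)"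
proof (cases q)
  case 0
  interpret Z: Module.module K "HomU H M (DD 0)" by (rule HomU_module) simp_all
  show ?thesis using 0 by (auto simp: is_linear_def intro!: ahomI simp del: HomU_simps)
next
  case (Suc p)
  have l: "is_linear K (HomU H M (TA UM (DD p))) (HomU H M (TA (DD p) UM)) (trace_map H M \<gamma> UM (DD p))"
    by (rule trace_linear) simp_all
  have r: "is_linear K (HomU H M (TA (DD p) UM)) (HomU H M (DD (Suc p))) (precomp (DD (Suc p)) (TA (DD p) UM) (split_last p))"
    by (rule precomp_lin) (simp_all add: split_last_lin)
  have e: "tau q = (\<lambda>F. precomp (DD (Suc p)) (TA (DD p) UM) (split_last p) (trace_map H M \<gamma> UM (DD p) F))"
    using Suc by (auto simp: tau.simps precomp_def)
  show ?thesis
    unfolding e unfolding Suc by (rule is_linear_compose[OF l[folded DD_Suc] r])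
qed

end

section \<open>Bar words\<close>

context bialgebroid_setting
begin

lemma umod_Upow [simp]: "umod (Upow H q)"
proof (induction q)
  case (Suc q)
  then show ?case by (cases q) simp_all
qed simp

lemma word_Cons: "us \<in> ws (Suc q) ==> word H (u # us) = tpo (Upow H (Suc q)) u (word H us)"
  by (cases us) (auto simp: words_def)

lemma word_closed [simp]: "us \<in> ws q ==> word H us \<in> carrier (Upow H q)"
proof (induction q arbitrary: us)
  case (Suc q)
  then obtain u vs where us: "us = u # vs" "u \<in> carrier U" "vs \<in> ws q" by (auto elim: ws_SucE)
  show ?case
  proof (cases q)
    case (Suc p)
    then show ?thesis using us Suc.IH[of vs] word_Cons[of vs p u] by simp
  qed (use us in simp)
qed simp

lemma Upow_ext:
  assumes "abelian_group Z" "f \<in> ahom (Upow H (Suc q)) Z" "g \<in> ahom (Upow H (Suc q)) Z" "w \<in> carrier (Upow H (Suc q))"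
    "\<And>us. us \<in> ws (Suc q) ==> f (word H us) = g (word H us)"
  shows "f w = g w"
  using assms(2-5)
proof (induction q arbitrary: f g w)
  case 0
  then show ?case using 0(4)[of "[w]"] by simp
next
  case (Suc q)
  let ?W = "Upow H (Suc q)"
  show ?case
  proof (rule TO_ext[of ?W Z f g w])
    fix u v assume u: "u \<in> carrier U" and v: "v \<in> carrier ?W"
    have h: "tpo ?W u \<in> ahom ?W (Ind ?W)"
      using balAopD(2)[OF tpo_bal] u by simp
    show "f (tpo ?W u v) = g (tpo ?W u v)"
    proof (rule Suc.IH[OF ahom_compose[OF h] ahom_compose[OF h] v])
      fix us assume "us \<in> ws (Suc q)"
      then show "f (tpo ?W u (word H us)) = g (tpo ?W u (word H us))"
        using Suc.prems(4)[of "u # us"] u by (simp add: word_Cons del: Upow.simps)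
    qed (use Suc.prems in simp_all)
  qed (use Suc.prems assms(1) in simp_all)
qed

lemma smult_word: "[|u \<in> carrier U; v \<in> carrier U; vs \<in> ws q|] ==>
    u \<odot>\<^bsub>Upow H (Suc q)\<^esub> word H (v # vs) = word H ((u \<cdot> v) # vs)"
proof (cases q)
  case (Suc p)
  assume "u \<in> carrier U" "v \<in> carrier U" "vs \<in> ws q"
  then show ?thesis
    using Suc word_closed[of vs q] word_Cons[of vs p v] word_Cons[of vs p "u \<cdot> v"] by (simp add: TO_smult_tp)
qed simp

text \<open>\<open>bw [u\<^sup>0, \<dots>, u\<^sup>q] = u\<^sup>0(1 \<otimes> u\<^sup>1(1 \<otimes> \<dots>))\<close> is the image of the bar word \<open>(u\<^sup>0, \<dots>, u\<^sup>q)\<close> in the tower.\<close>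

fun bw :: "'w list \<Rightarrow> 'w" where
  "bw [] = undefined"
| "bw [u] = u"
| "bw (u # v # us) = u \<odot>\<^bsub>DD (Suc (length us))\<^esub> tp UM (DD (length us)) \<one>\<^sub>U (bw (v # us))"

lemma bw_Cons: "us \<in> ws (Suc q) ==> bw (u # us) = u \<odot>\<^bsub>DD (Suc q)\<^esub> tp UM (DD q) \<one>\<^sub>U (bw us)"
  by (cases us) (auto simp: words_def)

lemma bw_closed [simp]: "us \<in> ws (Suc q) ==> bw us \<in> carrier (DD q)"
proof (induction q arbitrary: us)
  case (Suc q)
  then show ?case by (auto elim!: ws_SucE[of us "Suc q"] simp: bw_Cons)
qed (auto elim!: ws_SucE)

lemma smult_bw: "[|u \<in> carrier U; v \<in> carrier U; vs \<in> ws q|] ==> u \<odot>\<^bsub>DD q\<^esub> bw (v # vs) = bw ((u \<cdot> v) # vs)"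
proof (cases q)
  case (Suc p)
  assume "u \<in> carrier U" "v \<in> carrier U" "vs \<in> ws q"
  then show ?thesis using Suc by (simp add: bw_Cons smult_mult)
qed simp

lemma bw_one: "us \<in> ws (Suc q) ==> bw (\<one>\<^sub>U # us) = tp UM (DD q) \<one>\<^sub>U (bw us)"
  by (simp add: bw_Cons)

subsection \<open>Faces and degeneracies in bar coordinates\<close>

text \<open>Faces and degeneracies on letters. In the last face the final letter is absorbed by its counit through \<open>t\<close>.\<close>

fun be :: "nat \<Rightarrow> 'w list \<Rightarrow> 'w list" where
  "be 0 (u # v # us) = (u \<cdot> v) # us"
| "be (Suc i) [u, v] = [u \<cdot> t (\<epsilon> v)]"
| "be (Suc i) (u # v # w # us) = u # be i (v # w # us)"
| "be i us = undefined"

fun bs :: "nat \<Rightarrow> 'w list \<Rightarrow> 'w list" where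
  "bs 0 (u # us) = u # \<one>\<^sub>U # us"
| "bs (Suc j) [u] = [u, \<one>\<^sub>U]"
| "bs (Suc j) (u # v # us) = u # bs j (v # us)"
| "bs j us = undefined"

lemma be_ws [simp]: "us \<in> ws (Suc (Suc q)) ==> be i us \<in> ws (Suc q)"
  by (induction i us arbitrary: q rule: be.induct) (auto elim!: ws_SucE[of _ "Suc _"], auto simp: words_def)

lemma bs_ws [simp]: "us \<in> ws (Suc q) ==> bs j us \<in> ws (Suc (Suc q))"
  by (induction j us arbitrary: q rule: bs.induct) (auto simp: words_def)

lemma face_bw: "us \<in> ws (Suc (Suc q)) ==> face q i (bw us) = bw (be i us)"
proof (induction q i arbitrary: us rule: face.induct)
  case (1 q)
  then obtain u v vs where us: "us = u # v # vs" "u \<in> carrier U" "v \<in> carrier U" "vs \<in> ws q"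
    by (auto elim!: ws_SucE)
  then show ?case
    using smult_bw[of u v vs q] bw_Cons[of "v # vs" q u]
    by (simp add: lin_mapsD(4)[OF face_lin] face_tp del: bw.simps)
next
  case (2 i)
  then obtain u v where us: "us = [u, v]" "u \<in> carrier U" "v \<in> carrier U"
    by (auto elim!: ws_SucE)
  then show ?case
    using bw_Cons[of "[v]" 0 u] lin_mapsD(4)[OF face_lin[of 0 "Suc i"], of u "tpU H \<one>\<^sub>U v"] face_tp(2)[of "\<one>\<^sub>U" v i]
    by (simp add: DD_Suc)
next
  case (3 q i)
  then obtain u v w vs where us: "us = u # v # w # vs" "u \<in> carrier U" "v # w # vs \<in> ws (Suc (Suc q))"
    by (auto elim!: ws_SucE)
  then show ?case
    using 3(1)[of "v # w # vs"] bw_Cons[OF us(3), of u] bw_closed[OF us(3)] bw_Cons[of "be i (v # w # vs)" q u]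
      lin_mapsD(2)[OF face_lin[of q i], of "bw (v # w # vs)"]
    by (simp add: lin_mapsD(4)[OF face_lin] face_tp(3) del: bw.simps ws_Cons)
qed

lemma deg_bw: "us \<in> ws (Suc q) ==> deg q j (bw us) = bw (bs j us)"
proof (induction q j arbitrary: us rule: deg.induct)
  case (1 j)
  then obtain u where us: "us = [u]" "u \<in> carrier U" by (auto elim!: ws_SucE)
  have "bs j [u] = [u, \<one>\<^sub>U]" by (cases j) simp_all
  then show ?case
    using us bw_Cons[of "[\<one>\<^sub>U]" 0 u] comul_smult[of u "\<one>\<^sub>U"] by (simp add: deg_tp comul_one DD_Suc)
next
  case (2 q)
  then obtain u vs where us: "us = u # vs" "u \<in> carrier U" "vs \<in> ws (Suc q)" by (auto elim: ws_SucE)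
  have "deg (Suc q) 0 (tp UM (DD q) \<one>\<^sub>U (bw vs)) = tp UM (DD (Suc q)) \<one>\<^sub>U (tp UM (DD q) \<one>\<^sub>U (bw vs))"
    using us by (simp add: deg_tp comul_one associator_tp DD_Suc)
  then show ?case
    using us bw_Cons[of "\<one>\<^sub>U # vs" "Suc q" u]
    by (simp add: bw_Cons[OF us(3)] lin_mapsD(4)[OF deg_lin])
next
  case (3 q j)
  then obtain u v vs where us: "us = u # v # vs" "u \<in> carrier U" "v # vs \<in> ws (Suc q)"
    by (auto elim!: ws_SucE)
  then show ?case
    using 3(1)[of "v # vs"] bw_Cons[OF us(3), of u] bw_closed[OF us(3)] bw_Cons[of "bs j (v # vs)" "Suc q" u]
      lin_mapsD(2)[OF deg_lin[of q j], of "bw (v # vs)"] bs_ws[OF us(3), of j]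
    by (simp add: lin_mapsD(4)[OF deg_lin] deg_tp(3) del: bw.simps ws_Cons)
qed

lemma be_be: "[|us \<in> ws (Suc (Suc (Suc q))); i < j; j \<le> q + 2|] ==> be i (be j us) = be (j - 1) (be i us)"
proof (induction q arbitrary: us i j)
  case 0
  then obtain u v w where us: "us = [u, v, w]" "u \<in> carrier U" "v \<in> carrier U" "w \<in> carrier U"
    by (auto elim!: ws_SucE)
  from 0 consider "i = 0" "j = 1" | "i = 0" "j = 2" | "i = 1" "j = 2" by fastforce
  then show ?case
    using us counit_mult_tgt[of v w] by cases (simp_all add: U.m_assoc numeral_2_eq_2)
next
  case (Suc q)
  then obtain u v w x vs where us: "us = u # v # w # x # vs" "u \<in> carrier U" "v \<in> carrier U" "w \<in> carrier U" "x \<in> carrier U" "vs \<in> ws q"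
    by (auto elim!: ws_SucE)
  show ?case
  proof (cases i)
    case 0
    obtain j' where j: "j = Suc j'" using Suc.prems by (cases j) auto
    show ?thesis
    proof (cases j')
      case (Suc k)
      then show ?thesis using us j 0 by (cases k; cases vs) (simp_all add: U.m_assoc)
    qed (use us j 0 in \<open>simp add: U.m_assoc\<close>)
  next
    case (Suc i')
    obtain j' where j: "j = Suc j'" using Suc.prems by (cases j) auto
    have v: "v # w # x # vs \<in> ws (Suc (Suc (Suc q)))" using us by simp
    have IH: "be i' (be j' (v # w # x # vs)) = be (j' - 1) (be i' (v # w # x # vs))"
      using Suc.IH[OF v, of i' j'] Suc.prems Suc j by simp
    obtain a b c where 1: "be j' (v # w # x # vs) = a # b # c"
      using be_ws[OF v, of j'] by (auto elim!: ws_SucE)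
    obtain a' b' c' where 2: "be i' (v # w # x # vs) = a' # b' # c'"
      using be_ws[OF v, of i'] by (auto elim!: ws_SucE)
    obtain k where k: "j' = Suc k" using Suc.prems Suc j by (cases j') auto
    show ?thesis using us Suc j IH 1 2 k by simp
  qed
qed

lemma bs_bs: "[|us \<in> ws (Suc q); i \<le> j; j \<le> q|] ==> bs i (bs j us) = bs (Suc j) (bs i us)"
proof (induction q arbitrary: us i j)
  case 0
  then show ?case by (auto elim!: ws_SucE)
next
  case (Suc q)
  then obtain u v vs where us: "us = u # v # vs" "u \<in> carrier U" "v # vs \<in> ws (Suc q)"
    by (auto elim!: ws_SucE)
  show ?case
  proof (cases i)
    case 0
    then show ?thesis using us by (cases j) simp_all
  next
    case (Suc i')
    then obtain j' where j: "j = Suc j'" using Suc.prems by (cases j) auto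
    obtain a b where 1: "bs j' (v # vs) = a # b" using bs_ws[OF us(3), of j'] by (auto elim!: ws_SucE)
    obtain a' b' where 2: "bs i' (v # vs) = a' # b'" using bs_ws[OF us(3), of i'] by (auto elim!: ws_SucE)
    show ?thesis using Suc.IH[OF us(3), of i' j'] Suc.prems us Suc j 1 2 by simp
  qed
qed

lemma be_bs_id: "[|us \<in> ws (Suc q); j \<le> q; i = j \<or> i = Suc j|] ==> be i (bs j us) = us"
proof (induction q arbitrary: us i j)
  case 0
  then show ?case by (auto elim!: ws_SucE)
next
  case (Suc q)
  then obtain u v vs where us: "us = u # v # vs" "u \<in> carrier U" "v \<in> carrier U" "vs \<in> ws q"
    by (auto elim!: ws_SucE)
  show ?case
  proof (cases j)
    case 0
    then show ?thesis using us Suc.prems by auto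
  next
    case (Suc j')
    then obtain i' where i: "i = Suc i'" using Suc.prems by (cases i) auto
    have v: "v # vs \<in> ws (Suc q)" using us by simp
    obtain a b c where 1: "bs j' (v # vs) = a # b # c" using bs_ws[OF v, of j'] by (auto elim!: ws_SucE)
    show ?thesis using Suc.IH[of "v # vs" j' i'] Suc.prems us Suc i 1 by simp
  qed
qed

lemma be_bs_less: "[|us \<in> ws (Suc (Suc q)); i < j; j \<le> q + 1|] ==> be i (bs j us) = bs (j - 1) (be i us)"
proof (induction q arbitrary: us i j)
  case 0
  then have "i = 0" "j = 1" by auto
  with 0 show ?case by (auto elim!: ws_SucE)
next
  case (Suc q)
  then obtain u v w vs where us: "us = u # v # w # vs" "u \<in> carrier U" "v \<in> carrier U" "w \<in> carrier U" "vs \<in> ws q"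
    by (auto elim!: ws_SucE)
  obtain j' where j: "j = Suc j'" using Suc.prems by (cases j) auto
  show ?case
  proof (cases i)
    case 0
    show ?thesis
    proof (cases j')
      case (Suc k)
      then show ?thesis using us j 0 by (cases k; cases vs) simp_all
    qed (use us j 0 in simp)
  next
    case (Suc i')
    have v: "v # w # vs \<in> ws (Suc (Suc q))" using us by simp
    obtain k where k: "j' = Suc k" using Suc.prems Suc j by (cases j') auto
    obtain a b c where 1: "bs j' (v # w # vs) = a # b # c" using bs_ws[OF v, of j'] by (auto elim!: ws_SucE)
    obtain a' b' where 2: "be i' (v # w # vs) = a' # b'" using be_ws[OF v, of i'] by (auto elim!: ws_SucE)
    show ?thesis using Suc.IH[OF v, of i' j'] Suc.prems us Suc j k 1 2 by simp
  qed
qed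

text \<open>Here the two lists may differ: \<open>(u, t(\<epsilon>(v)))\<close> and \<open>(u t(\<epsilon>(v)), 1)\<close> are equal only as bar words.\<close>

lemma be_bs_greater: "[|us \<in> ws (Suc (Suc q)); Suc j < i; i \<le> q + 2|] ==> bw (be i (bs j us)) = bw (bs j (be (i - 1) us))"
proof (induction q arbitrary: us i j)
  case 0
  then obtain u v where us: "us = [u, v]" "u \<in> carrier U" "v \<in> carrier U" by (auto elim!: ws_SucE)
  from 0 have ij: "i = 2" "j = 0" by auto
  have "bw [u, t (\<epsilon> v)] = bw [u \<cdot> t (\<epsilon> v), \<one>\<^sub>U]"
    using us by (simp add: smult_mult DD_Suc t_tp)
  then show ?case using us ij by (simp add: numeral_2_eq_2 del: bw.simps)
next
  case (Suc q)
  then obtain u v w vs where us: "us = u # v # w # vs" "u \<in> carrier U" "v \<in> carrier U" "w \<in> carrier U" "vs \<in> ws q"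
    by (auto elim!: ws_SucE)
  obtain i' where i: "i = Suc (Suc i')" using Suc.prems by (cases i; cases "i - 1") auto
  have v: "v # w # vs \<in> ws (Suc (Suc q))" using us by simp
  show ?case
  proof (cases j)
    case 0
    then show ?thesis using us i by simp
  next
    case (Suc j')
    obtain k where k: "i' = Suc k" using Suc.prems Suc i by (cases i') auto
    obtain a b c where 1: "bs j' (v # w # vs) = a # b # c" using bs_ws[OF v, of j'] by (auto elim!: ws_SucE)
    obtain a' b' where 2: "be i' (v # w # vs) = a' # b'" using be_ws[OF v, of i'] by (auto elim!: ws_SucE)
    have IH: "bw (be (Suc i') (bs j' (v # w # vs))) = bw (bs j' (be i' (v # w # vs)))"
      using Suc.IH[OF v, of j' "Suc i'"] Suc.prems Suc i by simp
    have "bw (be i (bs j us)) = bw (u # be (Suc i') (bs j' (v # w # vs)))"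
      using us Suc i 1 by simp
    also have "\<dots> = bw (u # bs j' (be i' (v # w # vs)))"
      using bw_Cons[OF be_ws[OF bs_ws[OF v]], of u "Suc i'" j'] bw_Cons[OF bs_ws[OF be_ws[OF v]], of u j' i'] IH by simp
    also have "\<dots> = bw (bs j (be (i - 1) us))"
      using us Suc i 2 k by simp
    finally show ?thesis .
  qed
qed

lemma be_middle: "[|us \<in> ws (Suc (Suc q)); i \<le> q|] ==> be i us = take i us @ [us ! i \<cdot> us ! Suc i] @ drop (i + 2) us"
proof (induction q arbitrary: us i)
  case 0
  then show ?case by (auto elim!: ws_SucE)
next
  case (Suc q)
  then obtain u v w vs where us: "us = u # v # w # vs" "v # w # vs \<in> ws (Suc (Suc q))"
    by (auto elim!: ws_SucE)
  show ?case using Suc.IH[OF us(2)] Suc.prems us(1) by (cases i) simp_all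
qed

lemma be_last: "us \<in> ws (Suc (Suc q)) ==> be (Suc q) us = take q us @ [us ! q \<cdot> t (\<epsilon> (us ! Suc q))]"
proof (induction q arbitrary: us)
  case 0
  then show ?case by (auto elim!: ws_SucE)
next
  case (Suc q)
  then obtain u v w vs where us: "us = u # v # w # vs" "v # w # vs \<in> ws (Suc (Suc q))"
    by (auto elim!: ws_SucE)
  show ?case using Suc.IH[OF us(2)] us(1) by simp
qed

lemma bs_middle: "[|us \<in> ws (Suc q); j \<le> q|] ==> bs j us = take (Suc j) us @ [\<one>\<^sub>U] @ drop (Suc j) us"
proof (induction q arbitrary: us j)
  case 0
  then show ?case by (auto elim!: ws_SucE)
next
  case (Suc q)
  then obtain u v vs where us: "us = u # v # vs" "v # vs \<in> ws (Suc q)"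
    by (auto elim!: ws_SucE)
  show ?case using Suc.IH[OF us(2)] Suc.prems us(1) by (cases j) simp_all
qed

definition ind_map :: "('w, 'w) module \<Rightarrow> ('w, 'w) module \<Rightarrow> ('w \<Rightarrow> 'w) \<Rightarrow> 'w \<Rightarrow> 'w"
  where "ind_map W W' f = (\<lambda>q\<in>carrier (Ind W). sw (Ind W') (\<lambda>u w. u \<odot>\<^bsub>Ind W'\<^esub> tpo W' \<one>\<^sub>U (f w)) q)"

lemma ind_map_lin:
  assumes [simp]: "umod W" "umod W'" and f: "f \<in> lin W W'"
  shows "ind_map W W' f \<in> lin (Ind W) (Ind W')"
    and "[|u \<in> carrier U; w \<in> carrier W|] ==> ind_map W W' f (tpo W u w) = tpo W' u (f w)"
proof -
  note [simp] = lin_mapsD(2)[OF f]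
  have h: "(\<lambda>w. tpo W' \<one>\<^sub>U (f w)) \<in> ahom W (Ind W')"
    by (rule ahom_compose[OF lin_mapsD(1)[OF f] balAopD(2)[OF tpo_bal]]) simp_all
  have t: "tpo W' \<one>\<^sub>U (f (t a \<odot>\<^bsub>W\<^esub> w)) = t a \<odot>\<^bsub>Ind W'\<^esub> tpo W' \<one>\<^sub>U (f w)" if "a \<in> carrier A" "w \<in> carrier W" for a w
    using that tpo_balance[of W' a "\<one>\<^sub>U" "f w"] by (simp add: lin_mapsD(4)[OF f] TO_smult_tp)
  show "ind_map W W' f \<in> lin (Ind W) (Ind W')"
    unfolding ind_map_def by (rule induced_lin(1)[OF _ _ h]) (use t in simp_all)
  show "[|u \<in> carrier U; w \<in> carrier W|] ==> ind_map W W' f (tpo W u w) = tpo W' u (f w)"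
    unfolding ind_map_def using induced_lin(2)[OF _ _ h] t by (simp add: TO_smult_tp)
qed

lemma ind_map_bij:
  assumes W [simp]: "umod W" "umod W'" and f: "f \<in> lin W W'" and b: "bij_betw f (carrier W) (carrier W')"
  shows "bij_betw (ind_map W W' f) (carrier (Ind W)) (carrier (Ind W'))"
proof -
  obtain g where g: "g \<in> lin W' W" and gf: "\<And>w. w \<in> carrier W ==> g (f w) = w" and fg: "\<And>w. w \<in> carrier W' ==> f (g w) = w"
  proof
    show "restrict (the_inv_into (carrier W) f) (carrier W') \<in> lin W' W"
      by (rule lin_maps_inverse[OF f b W])
    show "restrict (the_inv_into (carrier W) f) (carrier W') (f w) = w" if "w \<in> carrier W" for w
      using that b lin_mapsD(2)[OF f that] by (simp add: bij_betw_def the_inv_into_f_f)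
    show "f (restrict (the_inv_into (carrier W) f) (carrier W') w) = w" if "w \<in> carrier W'" for w
      using that b by (simp add: bij_betw_def f_the_inv_into_f)
  qed
  note F = ind_map_lin[OF W f] and G = ind_map_lin[OF W(2,1) g]
  note Fh = lin_mapsD(1)[OF F(1)] and Gh = lin_mapsD(1)[OF G(1)]
  have "ind_map W' W g (ind_map W W' f q) = q" if "q \<in> carrier (Ind W)" for q
    by (rule TO_ext[OF W(1) _ ahom_compose[OF Fh Gh], of "\<lambda>q. q"])
      (use that in \<open>simp_all add: F(2) G(2) gf lin_mapsD(2)[OF f] ahomI\<close>)
  moreover have "ind_map W W' f (ind_map W' W g q) = q" if "q \<in> carrier (Ind W')" for q
    by (rule TO_ext[OF W(2) _ ahom_compose[OF Gh Fh], of "\<lambda>q. q"])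
      (use that in \<open>simp_all add: F(2) G(2) fg lin_mapsD(2)[OF g] ahomI\<close>)
  ultimately show ?thesis
    by (intro bij_betw_byWitness[where f' = "ind_map W' W g"]) (auto simp: lin_mapsD(2)[OF F(1)] lin_mapsD(2)[OF G(1)])
qed

end

context left_hopf_setting
begin

text \<open>The isomorphism of the bar module with the tower: apply it to the tail, then the Galois map.\<close>

fun mu :: "nat \<Rightarrow> 'w \<Rightarrow> 'w" where
  "mu 0 = idm U"
| "mu (Suc q) = compose (carrier (Upow H (Suc (Suc q)))) (galois (DD q)) (ind_map (Upow H (Suc q)) (DD q) (mu q))"

declare mu.simps(2) [simp del]

lemma mu_lin: "mu q \<in> lin (Upow H (Suc q)) (DD q)"
proof (induction q)
  case 0
  show ?case using idm_lin(2) by (simp del: restrict_apply)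
next
  case (Suc q)
  show ?case unfolding mu.simps(2) DD_Suc
    by (rule lin_compose[OF umod_Upow _ galois_lin]) (use ind_map_lin(1)[OF _ _ Suc] in simp_all)
qed

lemma mu_tp:
  assumes u: "u \<in> carrier U" and w: "w \<in> carrier (Upow H (Suc q))"
  shows "mu (Suc q) (tpo (Upow H (Suc q)) u w) = u \<odot>\<^bsub>DD (Suc q)\<^esub> tp UM (DD q) \<one>\<^sub>U (mu q w)"
proof -
  have "tpo (Upow H (Suc q)) u w \<in> carrier (Upow H (Suc (Suc q)))"
    unfolding Upow.simps(3) by (rule tpo_closed[OF umod_Upow u w])
  then have "mu (Suc q) (tpo (Upow H (Suc q)) u w) = galois (DD q) (tpo (DD q) u (mu q w))"
    unfolding mu.simps(2) by (simp only: compose_eq ind_map_lin(2)[OF umod_Upow umod_DD mu_lin u w])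
  then show ?thesis
    using galois_tp[OF umod_DD u lin_mapsD(2)[OF mu_lin w]] by (simp only: DD_Suc)
qed

lemma mu_word: "us \<in> ws (Suc q) ==> mu q (word H us) = bw us"
proof (induction q arbitrary: us)
  case 0
  then show ?case by (auto elim!: ws_SucE)
next
  case (Suc q)
  then obtain u vs where us: "us = u # vs" "u \<in> carrier U" "vs \<in> ws (Suc q)" by (auto elim: ws_SucE)
  show ?case
    unfolding us(1) word_Cons[OF us(3)] mu_tp[OF us(2) word_closed[OF us(3)]] Suc.IH[OF us(3)] bw_Cons[OF us(3)] ..
qed

lemma mu_bij: "bij_betw (mu q) (carrier (Upow H (Suc q))) (carrier (DD q))"
proof (induction q)
  case 0
  have "bij_betw (idm U) (carrier U) (carrier U)"
    by (rule bij_betw_byWitness[where f' = "\<lambda>x. x"]) auto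
  then show ?case by (simp del: restrict_apply)
next
  case (Suc q)
  let ?F = "ind_map (Upow H (Suc q)) (DD q) (mu q)"
  have "bij_betw (galois (DD q) \<circ> ?F) (carrier (Ind (Upow H (Suc q)))) (carrier (DD (Suc q)))"
    unfolding DD_Suc
    by (rule bij_betw_trans[OF ind_map_bij[OF umod_Upow umod_DD mu_lin Suc] galois_bij[OF umod_DD]])
  moreover have "bij_betw (mu (Suc q)) (carrier (Ind (Upow H (Suc q)))) (carrier (DD (Suc q))) =
      bij_betw (galois (DD q) \<circ> ?F) (carrier (Ind (Upow H (Suc q)))) (carrier (DD (Suc q)))"
    by (rule bij_betw_cong) (simp add: mu.simps(2) compose_eq)
  ultimately show ?case by simp
qed

definition mu_inv :: "nat \<Rightarrow> 'w \<Rightarrow> 'w"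
  where "mu_inv q = restrict (the_inv_into (carrier (Upow H (Suc q))) (mu q)) (carrier (DD q))"

lemma mu_inv_lin: "mu_inv q \<in> lin (DD q) (Upow H (Suc q))"
  unfolding mu_inv_def by (rule lin_maps_inverse[OF mu_lin mu_bij]) simp_all

lemma mu_inv_mu: "w \<in> carrier (Upow H (Suc q)) ==> mu_inv q (mu q w) = w"
  using mu_bij[of q] lin_mapsD(2)[OF mu_lin, of w q] by (simp add: mu_inv_def bij_betw_def the_inv_into_f_f)

lemma mu_mu_inv: "w \<in> carrier (DD q) ==> mu q (mu_inv q w) = w"
  using mu_bij[of q] by (simp add: mu_inv_def bij_betw_def f_the_inv_into_f)

lemma mu_inv_bw: "us \<in> ws (Suc q) ==> mu_inv q (bw us) = word H us"
  using mu_inv_mu[of "word H us" q] by (simp add: mu_word del: Upow.simps)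

lemma bw_ext:
  assumes "abelian_group Z" "f \<in> ahom (DD q) Z" "g \<in> ahom (DD q) Z" "w \<in> carrier (DD q)"
    "\<And>us. us \<in> ws (Suc q) ==> f (bw us) = g (bw us)"
  shows "f w = g w"
proof -
  note m = lin_mapsD(1)[OF mu_lin[of q]]
  have "f (mu q (mu_inv q w)) = g (mu q (mu_inv q w))"
    by (rule Upow_ext[OF assms(1) ahom_compose[OF m assms(2)] ahom_compose[OF m assms(3)] lin_mapsD(2)[OF mu_inv_lin assms(4)]])
      (use assms(5) in \<open>simp add: mu_word\<close>)
  then show ?thesis using assms(4) by (simp add: mu_mu_inv)
qed

lemma lin_bw_ext:
  assumes "f \<in> lin (DD q) Z" "g \<in> lin (DD q) Z" "umod Z" "\<And>us. us \<in> ws (Suc q) ==> f (bw us) = g (bw us)"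
  shows "f = g"
  by (rule lin_maps_eqI[OF assms(1,2)], rule bw_ext[OF _ lin_mapsD(1)[OF assms(1)] lin_mapsD(1)[OF assms(2)]])
    (use assms in auto)

end

context aYD_setting
begin

theorem tower_cosimplicial: "cosimplicial_module K (\<lambda>q. HomU H M (DD q)) dcoface dcodeg"
proof -
  note [simp] = dcoface_lin dcodeg_lin dcoface_eval dcodeg_eval face_bw deg_bw lin_mapsD(2)[OF face_lin] lin_mapsD(2)[OF deg_lin]
  have d: "is_linear K (HomU H M (DD q)) (HomU H M (DD (q + 1))) (dcoface q i)" for q i
    using precomp_lin[OF umod_DD umod_DD umod_M face_lin[of q i]] unfolding dcoface_def[abs_def] by simp
  have s': "is_linear K (HomU H M (DD (q + 1))) (HomU H M (DD q)) (dcodeg q i)" for q i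
    using precomp_lin[OF umod_DD umod_DD umod_M deg_lin[of q i]] unfolding dcodeg_def[abs_def] by simp
  show ?thesis
    unfolding cosimplicial_module_def
  proof (intro conjI allI impI ballI)
    show "Module.module K (HomU H M (DD q))" for q by (rule HomU_module) simp_all
    show "is_linear K (HomU H M (DD q)) (HomU H M (DD (q + 1))) (dcoface q i)" for q i by (rule d)
    show "is_linear K (HomU H M (DD (q + 1))) (HomU H M (DD q)) (dcodeg q j)" for q j by (rule s')
    show "dcoface (q + 1) j (dcoface q i f) = dcoface (q + 1) i (dcoface q (j - 1) f)"
      if "i < j \<and> j \<le> q + 2" "f \<in> carrier (HomU H M (DD q))" for q i j f
      by (rule lin_bw_ext[where q = "Suc (Suc q)" and Z = M]) (use that be_be[of _ q i j] in simp_all)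
    show "dcodeg q j (dcodeg (q + 1) i f) = dcodeg q i (dcodeg (q + 1) (j + 1) f)"
      if "i \<le> j \<and> j \<le> q" "f \<in> carrier (HomU H M (DD (q + 2)))" for q i j f
      by (rule lin_bw_ext[where q = q and Z = M]) (use that bs_bs[of _ q i j] in simp_all)
    show "dcodeg q j (dcoface q i f) = f"
      if "j \<le> q \<and> (i = j \<or> i = j + 1)" "f \<in> carrier (HomU H M (DD q))" for q i j f
      by (rule lin_bw_ext[where q = q and Z = M]) (use that be_bs_id[of _ q j i] in simp_all)
    show "dcodeg (q + 1) j (dcoface (q + 1) i f) = dcoface q i (dcodeg q (j - 1) f)"
      if "i < j \<and> j \<le> q + 1" "f \<in> carrier (HomU H M (DD (q + 1)))" for q i j f
      by (rule lin_bw_ext[where q = "Suc q" and Z = M]) (use that be_bs_less[of _ q i j] in simp_all)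
    show "dcodeg (q + 1) j (dcoface (q + 1) i f) = dcoface q (i - 1) (dcodeg q j f)"
      if "j + 1 < i \<and> i \<le> q + 2" "f \<in> carrier (HomU H M (DD (q + 1)))" for q i j f
      by (rule lin_bw_ext[where q = "Suc q" and Z = M]) (use that be_bs_greater[of _ q j i] in simp_all)
  qed
qed

theorem tower_cocyclic: "cocyclic_module K (\<lambda>q. HomU H M (DD q)) dcoface dcodeg tau"
proof (rule cocyclic_moduleI[OF tower_cosimplicial tau_linear])
  show "(tau q ^^ (q + 1)) f = f" if "f \<in> carrier (HomU H M (DD q))" for q f
    using that by (intro tau_cyclic) simp
qed (simp_all add: tau_dcoface tau_dcodeg)

end

section \<open>Transport of cocyclic structures\<close>

lemma is_linear_transport:
  assumes X: "Module.module K X" and T: "is_linear K X Y T" and a: "is_linear_iso K X X' a" and b: "is_linear K Y Y' b"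
    and T': "\<And>x. x \<in> carrier X ==> T' (a x) = b (T x)"
  shows "is_linear K X' Y' T'"
proof -
  interpret X: Module.module K X by fact
  have al: "is_linear K X X' a" and im: "a ` carrier X = carrier X'"
    using a by (auto simp: is_linear_iso_def bij_betw_def)
  note ah = al[unfolded is_linear_def, THEN conjunct1] and ak = al[unfolded is_linear_def, THEN conjunct2, rule_format]
    and Th = T[unfolded is_linear_def, THEN conjunct1] and Tk = T[unfolded is_linear_def, THEN conjunct2, rule_format]
    and bh = b[unfolded is_linear_def, THEN conjunct1] and bk = b[unfolded is_linear_def, THEN conjunct2, rule_format]
  show ?thesis
    unfolding is_linear_def
  proof (intro conjI ahomI ballI)
    fix x' y' assume "x' \<in> carrier X'" "y' \<in> carrier X'"
    then obtain x y where xy: "x \<in> carrier X" "x' = a x" "y \<in> carrier X" "y' = a y" using im by blast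
    show "T' x' \<in> carrier Y'"
      using xy by (simp add: T' ahom_closed[OF bh] ahom_closed[OF Th])
    have "T' (a (x \<oplus>\<^bsub>X\<^esub> y)) = T' x' \<oplus>\<^bsub>Y'\<^esub> T' y'"
      using xy by (simp add: T' ahom_add[OF Th] ahom_add[OF bh] ahom_closed[OF Th])
    then show "T' (x' \<oplus>\<^bsub>X'\<^esub> y') = T' x' \<oplus>\<^bsub>Y'\<^esub> T' y'"
      using xy by (simp add: ahom_add[OF ah])
  next
    fix c x' assume c: "c \<in> carrier K" and "x' \<in> carrier X'"
    then obtain x where x: "x \<in> carrier X" "x' = a x" using im by blast
    have "T' (a (c \<odot>\<^bsub>X\<^esub> x)) = c \<odot>\<^bsub>Y'\<^esub> T' x'"
      using c x by (simp add: T' Tk bk ahom_closed[OF Th])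
    then show "T' (c \<odot>\<^bsub>X'\<^esub> x') = c \<odot>\<^bsub>Y'\<^esub> T' x'"
      using c x by (simp add: ak)
  qed
qed

lemma cocyclic_transport:
  assumes coc: "cocyclic_module K C \<delta> \<sigma> \<tau>" and mod: "\<And>q. Module.module K (C' q)"
    and iso: "\<And>q. is_linear_iso K (C q) (C' q) (\<Psi> q)"
    and d: "\<And>q i f. [|i \<le> q + 1; f \<in> carrier (C q)|] ==> \<delta>' q i (\<Psi> q f) = \<Psi> (q + 1) (\<delta> q i f)"
    and s: "\<And>q j f. [|j \<le> q; f \<in> carrier (C (q + 1))|] ==> \<sigma>' q j (\<Psi> (q + 1) f) = \<Psi> q (\<sigma> q j f)"
    and t: "\<And>q f. f \<in> carrier (C q) ==> \<tau>' q (\<Psi> q f) = \<Psi> q (\<tau> q f)"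
  shows "cocyclic_module K C' \<delta>' \<sigma>' \<tau>'"
proof -
  note cos = coc[unfolded cocyclic_module_def, THEN conjunct1, unfolded cosimplicial_module_def]
  note coc' = coc[unfolded cocyclic_module_def, THEN conjunct2]
  note modC = cos[THEN conjunct1, rule_format]
  note dl = cos[THEN conjunct2, THEN conjunct1, rule_format]
  note sl = cos[THEN conjunct2, THEN conjunct2, THEN conjunct1, rule_format]
  note dd = cos[THEN conjunct2, THEN conjunct2, THEN conjunct2, THEN conjunct1, rule_format]
  note ss = cos[THEN conjunct2, THEN conjunct2, THEN conjunct2, THEN conjunct2, THEN conjunct1, rule_format]
  note sd_id = cos[THEN conjunct2, THEN conjunct2, THEN conjunct2, THEN conjunct2, THEN conjunct2, THEN conjunct1, rule_format]
  note sd_lt = cos[THEN conjunct2, THEN conjunct2, THEN conjunct2, THEN conjunct2, THEN conjunct2, THEN conjunct2, THEN conjunct1, rule_format]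
  note sd_gt = cos[THEN conjunct2, THEN conjunct2, THEN conjunct2, THEN conjunct2, THEN conjunct2, THEN conjunct2, THEN conjunct2, rule_format]
  note tl = coc'[THEN conjunct1, rule_format]
  note td0 = coc'[THEN conjunct2, THEN conjunct1, rule_format]
  note td = coc'[THEN conjunct2, THEN conjunct2, THEN conjunct1, rule_format]
  note ts0 = coc'[THEN conjunct2, THEN conjunct2, THEN conjunct2, THEN conjunct1, rule_format]
  note ts = coc'[THEN conjunct2, THEN conjunct2, THEN conjunct2, THEN conjunct2, THEN conjunct1, rule_format]
  note tt = coc'[THEN conjunct2, THEN conjunct2, THEN conjunct2, THEN conjunct2, THEN conjunct2, rule_format]
  have dc: "\<delta> q i f \<in> carrier (C (q + 1))" if "i \<le> q + 1" "f \<in> carrier (C q)" for q i f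
    using dl[OF that(1)] that(2) unfolding is_linear_def by (auto intro: ahom_closed)
  have sc: "\<sigma> q j f \<in> carrier (C q)" if "j \<le> q" "f \<in> carrier (C (q + 1))" for q j f
    using sl[OF that(1)] that(2) unfolding is_linear_def by (auto intro: ahom_closed)
  have tc: "\<tau> q f \<in> carrier (C q)" if "f \<in> carrier (C q)" for q f
    using tl[of q] that unfolding is_linear_def by (auto intro: ahom_closed)
  have lin: "is_linear K (C q) (C' q) (\<Psi> q)" for q
    using iso by (simp add: is_linear_iso_def)
  have tp: "(\<tau>' q ^^ k) (\<Psi> q f) = \<Psi> q ((\<tau> q ^^ k) f) \<and> (\<tau> q ^^ k) f \<in> carrier (C q)" if "f \<in> carrier (C q)" for q k f
    using that by (induction k) (simp_all add: t tc)
  have E: "\<exists>g\<in>carrier (C q). f = \<Psi> q g" if "f \<in> carrier (C' q)" for q f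
    using that iso[of q] by (auto simp: is_linear_iso_def bij_betw_def)
  have e2: "q + 1 + 1 = q + 2" for q :: nat by simp
  have d2: "\<delta>' (q + 1) i (\<Psi> (q + 1) f) = \<Psi> (q + 2) (\<delta> (q + 1) i f)" if "i \<le> q + 2" "f \<in> carrier (C (q + 1))" for q i f
    using d[of i "q + 1" f] that unfolding e2 by blast
  have s2: "\<sigma>' (q + 1) j (\<Psi> (q + 2) f) = \<Psi> (q + 1) (\<sigma> (q + 1) j f)" if "j \<le> q + 1" "f \<in> carrier (C (q + 2))" for q j f
    using s[of j "q + 1" f] that unfolding e2 by blast
  have dc2: "\<delta> (q + 1) i f \<in> carrier (C (q + 2))" if "i \<le> q + 2" "f \<in> carrier (C (q + 1))" for q i f
    using dc[of i "q + 1" f] that unfolding e2 by blast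
  have sc2: "\<sigma> (q + 1) j f \<in> carrier (C (q + 1))" if "j \<le> q + 1" "f \<in> carrier (C (q + 2))" for q j f
    using sc[of j "q + 1" f] that unfolding e2 by blast
  show ?thesis
    unfolding cocyclic_module_def cosimplicial_module_def
  proof (intro conjI allI impI ballI; (elim conjE)?)
    show "is_linear K (C' q) (C' (q + 1)) (\<delta>' q i)" if "i \<le> q + 1" for q i
      using that by (intro is_linear_transport[OF modC dl iso lin]) (simp_all only: d)
    show "is_linear K (C' (q + 1)) (C' q) (\<sigma>' q j)" if "j \<le> q" for q j
      using that by (intro is_linear_transport[OF modC sl iso lin]) (simp_all only: s)
    show "is_linear K (C' q) (C' q) (\<tau>' q)" for q
      by (intro is_linear_transport[OF modC tl iso lin]) (simp_all only: t)
  next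
    fix q i j f assume ij: "i < j" "j \<le> q + 2" and "f \<in> carrier (C' q)"
    then obtain g where g: "g \<in> carrier (C q)" "f = \<Psi> q g" using E by blast
    have le: "i \<le> q + 1" "j - 1 \<le> q + 1" "i \<le> q + 2" using ij by auto
    show "\<delta>' (q + 1) j (\<delta>' q i f) = \<delta>' (q + 1) i (\<delta>' q (j - 1) f)"
      unfolding g(2) d[OF le(1) g(1)] d[OF le(2) g(1)] d2[OF ij(2) dc[OF le(1) g(1)]] d2[OF le(3) dc[OF le(2) g(1)]]
      using dd[of i j q g] ij g(1) by simp
  next
    fix q i j f assume ij: "i \<le> j" "j \<le> q" and "f \<in> carrier (C' (q + 2))"
    then obtain g where g: "g \<in> carrier (C (q + 2))" "f = \<Psi> (q + 2) g" using E by blast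
    have le: "i \<le> q + 1" "j + 1 \<le> q + 1" "i \<le> q" using ij by auto
    show "\<sigma>' q j (\<sigma>' (q + 1) i f) = \<sigma>' q i (\<sigma>' (q + 1) (j + 1) f)"
      unfolding g(2) s2[OF le(1) g(1)] s2[OF le(2) g(1)] s[OF ij(2) sc2[OF le(1) g(1)]] s[OF le(3) sc2[OF le(2) g(1)]]
      using ss[of i j q g] ij g(1) by simp
  next
    fix q i j f assume j: "j \<le> q" and ij: "i = j \<or> i = j + 1" and "f \<in> carrier (C' q)"
    then obtain g where g: "g \<in> carrier (C q)" "f = \<Psi> q g" using E by blast
    have le: "i \<le> q + 1" using j ij by auto
    show "\<sigma>' q j (\<delta>' q i f) = f"
      unfolding g(2) d[OF le g(1)] s[OF j dc[OF le g(1)]] using sd_id[of j q i g] j ij g(1) by simp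
  next
    fix q i j f assume ij: "i < j" "j \<le> q + 1" and "f \<in> carrier (C' (q + 1))"
    then obtain g where g: "g \<in> carrier (C (q + 1))" "f = \<Psi> (q + 1) g" using E by blast
    have le: "i \<le> q + 2" "j - 1 \<le> q" "i \<le> q + 1" using ij by auto
    show "\<sigma>' (q + 1) j (\<delta>' (q + 1) i f) = \<delta>' q i (\<sigma>' q (j - 1) f)"
      unfolding g(2) d2[OF le(1) g(1)] s2[OF ij(2) dc2[OF le(1) g(1)]] s[OF le(2) g(1)] d[OF le(3) sc[OF le(2) g(1)]]
      using sd_lt[of i j q g] ij g(1) by simp
  next
    fix q i j f assume ij: "j + 1 < i" "i \<le> q + 2" and "f \<in> carrier (C' (q + 1))"
    then obtain g where g: "g \<in> carrier (C (q + 1))" "f = \<Psi> (q + 1) g" using E by blast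
    have le: "j \<le> q + 1" "j \<le> q" "i - 1 \<le> q + 1" using ij by auto
    show "\<sigma>' (q + 1) j (\<delta>' (q + 1) i f) = \<delta>' q (i - 1) (\<sigma>' q j f)"
      unfolding g(2) d2[OF ij(2) g(1)] s2[OF le(1) dc2[OF ij(2) g(1)]] s[OF le(2) g(1)] d[OF le(3) sc[OF le(2) g(1)]]
      using sd_gt[of j i q g] ij g(1) by simp
  next
    fix q f assume "f \<in> carrier (C' q)"
    then obtain g where g: "g \<in> carrier (C q)" "f = \<Psi> q g" using E by blast
    have le: "0 \<le> q + 1" "q + 1 \<le> q + 1" by auto
    show "\<tau>' (q + 1) (\<delta>' q 0 f) = \<delta>' q (q + 1) f"
      unfolding g(2) d[OF le(1) g(1)] d[OF le(2) g(1)] t[OF dc[OF le(1) g(1)]] td0[OF g(1)] ..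
    show "(\<tau>' q ^^ (q + 1)) f = f"
      using tp[OF g(1), of "q + 1"] tt[OF g(1)] unfolding g(2) by simp
  next
    fix q i f assume i: "1 \<le> i" "i \<le> q + 1" and "f \<in> carrier (C' q)"
    then obtain g where g: "g \<in> carrier (C q)" "f = \<Psi> q g" using E by blast
    have le: "i - 1 \<le> q + 1" using i by auto
    show "\<tau>' (q + 1) (\<delta>' q i f) = \<delta>' q (i - 1) (\<tau>' q f)"
      unfolding g(2) d[OF i(2) g(1)] t[OF dc[OF i(2) g(1)]] t[OF g(1)] d[OF le tc[OF g(1)]]
      using td[of i q g] i g(1) by simp
  next
    fix q f assume "f \<in> carrier (C' (q + 1))"
    then obtain g where g: "g \<in> carrier (C (q + 1))" "f = \<Psi> (q + 1) g" using E by blast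
    have le: "0 \<le> q" "q \<le> q" by auto
    show "\<tau>' q (\<sigma>' q 0 f) = \<sigma>' q q (\<tau>' (q + 1) (\<tau>' (q + 1) f))"
      unfolding g(2) s[OF le(1) g(1)] t[OF sc[OF le(1) g(1)]] t[OF g(1)] t[OF tc[OF g(1)]] s[OF le(2) tc[OF tc[OF g(1)]]]
      using ts0[OF g(1)] by simp
  next
    fix q i f assume i: "1 \<le> i" "i \<le> q" and "f \<in> carrier (C' (q + 1))"
    then obtain g where g: "g \<in> carrier (C (q + 1))" "f = \<Psi> (q + 1) g" using E by blast
    have le: "i - 1 \<le> q" using i by auto
    show "\<tau>' q (\<sigma>' q i f) = \<sigma>' q (i - 1) (\<tau>' (q + 1) f)"
      unfolding g(2) s[OF i(2) g(1)] t[OF sc[OF i(2) g(1)]] t[OF g(1)] s[OF le tc[OF g(1)]]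
      using ts[of i q g] i g(1) by simp
  qed (rule mod)
qed

section \<open>The cochain complex\<close>

context bialgebroid_setting
begin

lemma swU_swap:
  assumes "abelian_group Z" "w \<in> carrier (UU H)" "w' \<in> carrier (UU H)"
    and "\<And>x y x' y'. [|x \<in> carrier U; y \<in> carrier U; x' \<in> carrier U; y' \<in> carrier U|] ==> \<beta> x y x' y' \<in> carrier Z"
  shows "sw Z (\<lambda>x y. sw Z (\<lambda>x' y'. \<beta> x y x' y') w') w = sw Z (\<lambda>x' y'. sw Z (\<lambda>x y. \<beta> x y x' y') w) w'"
  by (rule sw_swap[OF tensor_productA[OF umod_UM umod_UM] tensor_productA[OF umod_UM umod_UM] assms(1)])
    (use assms in \<open>simp_all add: TA_simps tgrpA_def\<close>)

lemma sw_list_closed: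
  assumes "abelian_group Z"
  shows "[|us \<in> ws n; \<And>xs ys. [|xs \<in> ws n; ys \<in> ws n|] ==> G xs ys \<in> carrier Z|] ==> sw_list H Z us G \<in> carrier Z"
proof (induction us arbitrary: n G)
  case (Cons u us)
  then obtain m where n: "n = Suc m" "u \<in> carrier U" "us \<in> ws m" by (cases n) (auto simp: words_def)
  show ?case
    unfolding sw_list.simps by (rule swU_closed[OF assms]) (use n Cons.prems(2) in \<open>auto intro!: Cons.IH[of m]\<close>)
qed auto

lemma sw_list_cong:
  assumes "abelian_group Z"
  shows "[|us \<in> ws n; \<And>xs ys. [|xs \<in> ws n; ys \<in> ws n|] ==> G xs ys = G' xs ys;
      \<And>xs ys. [|xs \<in> ws n; ys \<in> ws n|] ==> G' xs ys \<in> carrier Z|] ==> sw_list H Z us G = sw_list H Z us G'"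
proof (induction us arbitrary: n G G')
  case (Cons u us)
  then obtain m where n: "n = Suc m" "u \<in> carrier U" "us \<in> ws m" by (cases n) (auto simp: words_def)
  show ?case
    unfolding sw_list.simps
    by (rule swU_cong[OF assms]) (use n Cons.prems(2,3) in \<open>auto intro!: Cons.IH[of m] sw_list_closed[OF assms]\<close>)
qed auto

lemma hom_sw_list:
  assumes "abelian_group Z" "abelian_group Z'" "h \<in> ahom Z Z'"
  shows "[|us \<in> ws n; \<And>xs ys. [|xs \<in> ws n; ys \<in> ws n|] ==> G xs ys \<in> carrier Z|] ==>
      h (sw_list H Z us G) = sw_list H Z' us (\<lambda>xs ys. h (G xs ys))"
proof (induction us arbitrary: n G)
  case (Cons u us)
  then obtain m where n: "n = Suc m" "u \<in> carrier U" "us \<in> ws m" by (cases n) (auto simp: words_def)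
  have "h (sw_list H Z (u # us) G) = sw Z' (\<lambda>x y. h (sw_list H Z us (\<lambda>xs ys. G (x # xs) (y # ys)))) (\<Delta> u)"
    unfolding sw_list.simps
    by (rule hom_swU[OF assms]) (use n Cons.prems(2) in \<open>auto intro!: sw_list_closed[OF assms(1)]\<close>)
  also have "\<dots> = sw_list H Z' (u # us) (\<lambda>xs ys. h (G xs ys))"
    unfolding sw_list.simps
    by (rule swU_cong[OF assms(2)])
      (use n Cons.prems(2) in \<open>auto intro!: Cons.IH[of m] sw_list_closed[OF assms(2)] ahom_closed[OF assms(3)]\<close>)
  finally show ?case .
qed auto

lemma sw_list_swap:
  assumes Z: "abelian_group Z" and w: "w \<in> carrier (UU H)"
  shows "[|us \<in> ws n; \<And>x y xs ys. [|x \<in> carrier U; y \<in> carrier U; xs \<in> ws n; ys \<in> ws n|] ==> \<beta> x y xs ys \<in> carrier Z|] ==>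
    sw_list H Z us (\<lambda>xs ys. sw Z (\<lambda>x y. \<beta> x y xs ys) w) = sw Z (\<lambda>x y. sw_list H Z us (\<beta> x y)) w"
proof (induction us arbitrary: n \<beta>)
  case (Cons u us)
  then obtain m where n: "n = Suc m" "u \<in> carrier U" "us \<in> ws m" by (cases n) (auto simp: words_def)
  have "sw_list H Z (u # us) (\<lambda>xs ys. sw Z (\<lambda>x y. \<beta> x y xs ys) w) =
      sw Z (\<lambda>x' y'. sw Z (\<lambda>x y. sw_list H Z us (\<lambda>xs ys. \<beta> x y (x' # xs) (y' # ys))) w) (\<Delta> u)"
    unfolding sw_list.simps
    by (rule swU_cong[OF Z]) (use n w Cons.prems(2) in \<open>auto intro!: Cons.IH[of m] swU_closed[OF Z] sw_list_closed[OF Z]\<close>)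
  also have "\<dots> = sw Z (\<lambda>x y. sw_list H Z (u # us) (\<beta> x y)) w"
    unfolding sw_list.simps
    by (rule swU_swap[OF Z]) (use n w Cons.prems(2) in \<open>auto intro!: sw_list_closed[OF Z]\<close>)
  finally show ?case .
qed auto

lemma foldr_closed [simp]: "[|ys \<in> ws n; x \<in> carrier U|] ==> foldr (mult U) ys x \<in> carrier U"
proof (induction ys arbitrary: n)
  case (Cons y ys)
  then show ?case by (cases n) (auto simp: words_def)
qed simp

text \<open>Splitting off the last factor in bar coordinates: the letters before it leave their second
  coproduct components behind.\<close>

lemma split_last_bw:
  "[|us \<in> ws (Suc p); x \<in> carrier U|] ==> split_last p (bw (us @ [x])) =
    sw_list H (TA (DD p) UM) us (\<lambda>xs ys. tp (DD p) UM (bw xs) (foldr (mult U) ys x))"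
  and split_last_bw_one:
  "[|us \<in> ws p; x \<in> carrier U|] ==> split_last p (bw (\<one>\<^sub>U # us @ [x])) =
    sw_list H (TA (DD p) UM) us (\<lambda>xs ys. tp (DD p) UM (bw (\<one>\<^sub>U # xs)) (foldr (mult U) ys x))"
proof -
  note SL = split_last.simps(1) DD.simps(1)
  have step: "split_last (Suc p) (bw (\<one>\<^sub>U # us @ [x])) =
      sw_list H (TA (DD (Suc p)) UM) us (\<lambda>xs ys. tp (DD (Suc p)) UM (bw (\<one>\<^sub>U # xs)) (foldr (mult U) ys x))"
    if us: "us \<in> ws (Suc p)" and x: "x \<in> carrier U"
      and IH: "split_last p (bw (us @ [x])) = sw_list H (TA (DD p) UM) us (\<lambda>xs ys. tp (DD p) UM (bw xs) (foldr (mult U) ys x))"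
    for us p x
  proof -
    let ?h = "\<lambda>z. assoc_inv UM (DD p) UM (tp UM (TA (DD p) UM) \<one>\<^sub>U z)"
    have h: "?h \<in> ahom (TA (DD p) UM) (TA (DD (Suc p)) UM)"
      unfolding DD_Suc by (rule ahom_compose[OF tp_ahom_right assoc_inv_ahom]) simp_all
    have ux: "us @ [x] \<in> ws (Suc (Suc p))" using us x by simp
    have "split_last (Suc p) (bw (\<one>\<^sub>U # us @ [x])) = ?h (split_last p (bw (us @ [x])))"
      using bw_one[OF ux] bw_closed[OF ux] by (simp add: split_last_tp)
    also have "\<dots> = sw_list H (TA (DD (Suc p)) UM) us (\<lambda>xs ys. ?h (tp (DD p) UM (bw xs) (foldr (mult U) ys x)))"
      unfolding IH by (rule hom_sw_list[OF _ _ h us]) (use x in simp_all)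
    also have "\<dots> = sw_list H (TA (DD (Suc p)) UM) us (\<lambda>xs ys. tp (DD (Suc p)) UM (bw (\<one>\<^sub>U # xs)) (foldr (mult U) ys x))"
      by (rule sw_list_cong[OF _ us]) (use x in \<open>simp_all add: assoc_inv_tp bw_one DD_Suc\<close>)
    finally show ?thesis .
  qed
  have main: "us \<in> ws (Suc p) ==> x \<in> carrier U ==> split_last p (bw (us @ [x])) =
      sw_list H (TA (DD p) UM) us (\<lambda>xs ys. tp (DD p) UM (bw xs) (foldr (mult U) ys x))" for us p x
  proof (induction p arbitrary: us)
    case 0
    then obtain u where u: "us = [u]" "u \<in> carrier U" by (auto elim!: ws_SucE)
    have "split_last 0 (bw (us @ [x])) = u \<odot>\<^bsub>UU H\<^esub> tpU H \<one>\<^sub>U x"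
      using u 0 by (simp add: SL DD_Suc)
    also have "\<dots> = sw (UU H) (\<lambda>u1 u2. tpU H u1 (u2 \<cdot> x)) (\<Delta> u)"
      using u 0 by (simp add: TA_smult_tp) (intro swU_cong, simp_all)
    finally show ?case using u by simp
  next
    case (Suc p)
    then obtain u vs where us: "us = u # vs" "u \<in> carrier U" "vs \<in> ws (Suc p)" by (auto elim: ws_SucE)
    let ?Z = "TA (DD (Suc p)) UM"
    have vx: "vs @ [x] \<in> ws (Suc (Suc p))" using us Suc by simp
    have "split_last (Suc p) (bw (us @ [x])) = u \<odot>\<^bsub>?Z\<^esub> split_last (Suc p) (bw (\<one>\<^sub>U # vs @ [x]))"
      using us bw_Cons[OF vx, of u] bw_one[OF vx] bw_closed[OF vx] by (simp add: lin_mapsD(4)[OF split_last_lin])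
    also have "\<dots> = sw_list H ?Z vs (\<lambda>xs ys. u \<odot>\<^bsub>?Z\<^esub> tp (DD (Suc p)) UM (bw (\<one>\<^sub>U # xs)) (foldr (mult U) ys x))"
      unfolding step[OF us(3) Suc.prems(2) Suc.IH[OF us(3) Suc.prems(2)]]
      by (rule hom_sw_list[OF _ _ smult_ahom[of U] us(3)]) (use us Suc.prems in simp_all)
    also have "\<dots> = sw_list H ?Z vs (\<lambda>xs ys. sw ?Z (\<lambda>u1 u2. tp (DD (Suc p)) UM (bw (u1 # xs)) (u2 \<cdot> foldr (mult U) ys x)) (\<Delta> u))"
    proof (rule sw_list_cong[OF _ us(3)])
      fix xs ys assume xy: "xs \<in> ws (Suc p)" "ys \<in> ws (Suc p)"
      show "u \<odot>\<^bsub>?Z\<^esub> tp (DD (Suc p)) UM (bw (\<one>\<^sub>U # xs)) (foldr (mult U) ys x) =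
          sw ?Z (\<lambda>u1 u2. tp (DD (Suc p)) UM (bw (u1 # xs)) (u2 \<cdot> foldr (mult U) ys x)) (\<Delta> u)"
        using xy us Suc.prems by (subst TA_smult_tp) (simp_all, intro swU_cong, simp_all add: smult_bw)
      show "sw ?Z (\<lambda>u1 u2. tp (DD (Suc p)) UM (bw (u1 # xs)) (u2 \<cdot> foldr (mult U) ys x)) (\<Delta> u) \<in> carrier ?Z"
        using xy us Suc.prems by (intro swU_closed) simp_all
    qed simp
    also have "\<dots> = sw_list H ?Z us (\<lambda>xs ys. tp (DD (Suc p)) UM (bw xs) (foldr (mult U) ys x))"
      unfolding us(1) sw_list.simps foldr_Cons comp_def
      by (rule sw_list_swap[OF _ _ us(3)]) (use us Suc.prems in simp_all)
    finally show ?case .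
  qed
  show "[|us \<in> ws (Suc p); x \<in> carrier U|] ==> split_last p (bw (us @ [x])) =
      sw_list H (TA (DD p) UM) us (\<lambda>xs ys. tp (DD p) UM (bw xs) (foldr (mult U) ys x))"
    by (rule main)
  show "[|us \<in> ws p; x \<in> carrier U|] ==> split_last p (bw (\<one>\<^sub>U # us @ [x])) =
      sw_list H (TA (DD p) UM) us (\<lambda>xs ys. tp (DD p) UM (bw (\<one>\<^sub>U # xs)) (foldr (mult U) ys x))"
  proof (cases p)
    case 0
    assume "us \<in> ws p" "x \<in> carrier U"
    then show ?thesis using 0 by (simp add: SL DD_Suc)
  next
    case (Suc p')
    assume "us \<in> ws p" "x \<in> carrier U"
    then show ?thesis using step[OF _ _ main] Suc by simp
  qed
qed

end

context aYD_setting
begin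

abbreviation "PW \<equiv> Upow H"

text \<open>Restriction of a linear map on the tower to the slice \<open>1 \<otimes> w\<close>, read in bar coordinates. In degree \<open>0\<close> the slice is \<open>t(A)\<close>, since cochains are right \<open>A\<close>-linear.\<close>

fun Psi :: "nat \<Rightarrow> ('w \<Rightarrow> 'w) \<Rightarrow> 'w \<Rightarrow> 'w" where
  "Psi 0 F = (\<lambda>a\<in>carrier A. F (t a))"
| "Psi (Suc p) F = (\<lambda>w\<in>carrier (PW (Suc p)). F (tp UM (DD p) \<one>\<^sub>U (mu p w)))"

declare Psi.simps(2) [simp del]

lemma AH_ext:
  assumes f: "f \<in> AH (PW q)" and g: "g \<in> AH (PW q)" and e: "\<And>us. us \<in> ws q ==> f (word H us) = g (word H us)"
  shows "f = g"
proof (rule extensionalityI[OF AHD(1)[OF f] AHD(1)[OF g]])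
  fix w assume w: "w \<in> carrier (PW q)"
  show "f w = g w"
  proof (cases q)
    case 0
    then have "w = t w \<odot>\<^bsub>PW 0\<^esub> \<one>\<^bsub>A\<^esub>" using w by simp
    then show ?thesis
      using AHD(5)[OF f, of w "\<one>\<^bsub>A\<^esub>"] AHD(5)[OF g, of w "\<one>\<^bsub>A\<^esub>"] e[of "[]"] 0 w by simp
  next
    case (Suc p)
    show ?thesis
      using Upow_ext[OF _ AHD(2)[OF f[unfolded Suc]] AHD(2)[OF g[unfolded Suc]] w[unfolded Suc]] e Suc by simp
  qed
qed

lemma Psi_AH:
  assumes F: "F \<in> lin (DD q) M" shows "Psi q F \<in> AH (PW q)"
proof (cases q)
  case 0
  note l = lin_mapsD[OF F[unfolded 0]]
  have "Psi 0 F \<in> AH AM"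
  proof (rule AHI)
    show "Psi 0 F \<in> ahom AM M"
      by (rule ahomI) (auto simp: t_add l(5)[simplified] l(2)[simplified])
    show "Psi 0 F (t a \<odot>\<^bsub>AM\<^esub> b) = t a \<odot>\<^bsub>M\<^esub> Psi 0 F b" if "a \<in> carrier A" "b \<in> carrier AM" for a b
      using that l(4)[of "t a" "t b"] counit_tgt[of a "s b"] by (simp add: t_mult)
  qed simp
  then show ?thesis using 0 by (simp del: Psi.simps)
next
  case (Suc p)
  note F' = F[unfolded Suc DD_Suc]
  have t1: "tp UM (DD p) \<one>\<^sub>U \<in> ahom (DD p) (TA UM (DD p))" by (rule tp_ahom_right) simp_all
  have "Psi (Suc p) F \<in> AH (PW (Suc p))"
    unfolding Psi.simps(2)
  proof (rule AHI)
    show "(\<lambda>w\<in>carrier (PW (Suc p)). F (tp UM (DD p) \<one>\<^sub>U (mu p w))) \<in> ahom (PW (Suc p)) M"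
      by (rule ahom_restrict[OF ahom_compose[OF lin_mapsD(1)[OF mu_lin] ahom_compose[OF t1 lin_mapsD(1)[OF F']]]]) simp
    fix a w assume aw: "a \<in> carrier A" "w \<in> carrier (PW (Suc p))"
    have c: "t a \<odot>\<^bsub>PW (Suc p)\<^esub> w \<in> carrier (PW (Suc p))" "mu p w \<in> carrier (DD p)"
      using aw lin_mapsD(2)[OF mu_lin aw(2)] by (simp_all del: Upow.simps)
    show "(\<lambda>w\<in>carrier (PW (Suc p)). F (tp UM (DD p) \<one>\<^sub>U (mu p w))) (t a \<odot>\<^bsub>PW (Suc p)\<^esub> w) =
        t a \<odot>\<^bsub>M\<^esub> (\<lambda>w\<in>carrier (PW (Suc p)). F (tp UM (DD p) \<one>\<^sub>U (mu p w))) w"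
      using aw c by (simp add: lin_mapsD(4)[OF mu_lin] flip: lin_mapsD(4)[OF F'] t_tp del: Upow.simps)
  qed simp
  then show ?thesis using Suc by simp
qed

lemma Psi_word: "us \<in> ws q ==> Psi q F (word H us) = F (bw (\<one>\<^sub>U # us))"
proof (cases q)
  case (Suc p)
  assume "us \<in> ws q"
  then show ?thesis using Suc word_closed[of us "Suc p"] by (simp add: Psi.simps mu_word bw_one del: Upow.simps word_closed)
qed simp

text \<open>The \<open>U\<close>-linear extension \<open>u \<otimes> w \<mapsto> u f(w)\<close> of a cochain, inverse to \<open>Psi\<close> up to \<open>mu\<close>.\<close>

definition hat :: "nat \<Rightarrow> ('w \<Rightarrow> 'w) \<Rightarrow> 'w \<Rightarrow> 'w"
  where "hat q f = (case q of 0 \<Rightarrow> (\<lambda>u\<in>carrier U. u \<odot>\<^bsub>M\<^esub> f \<one>\<^bsub>A\<^esub>)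
    | Suc p \<Rightarrow> (\<lambda>x\<in>carrier (Ind (PW (Suc p))). sw M (\<lambda>u w. u \<odot>\<^bsub>M\<^esub> f w) x))"

lemma hat_lin:
  assumes f: "f \<in> AH (PW q)" shows "hat q f \<in> lin (PW (Suc q)) M"
proof (cases q)
  case 0
  have "f \<one>\<^bsub>A\<^esub> \<in> carrier M" using AHD(3)[OF f, of "\<one>\<^bsub>A\<^esub>"] 0 by simp
  then have "hat 0 f \<in> lin UM M"
    by (intro lin_mapsI ahomI) (simp_all add: hat_def smult_l_distr smult_mult)
  then show ?thesis using 0 by simp
next
  case (Suc p)
  have "hat (Suc p) f \<in> lin (Ind (PW (Suc p))) M"
    unfolding hat_def nat.case
    by (rule induced_lin(1)[OF umod_Upow umod_M AHD(2)[OF f[unfolded Suc]]]) (use AHD(5)[OF f] Suc in simp)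
  then show ?thesis using Suc by simp
qed

lemma hat_word:
  assumes f: "f \<in> AH (PW q)" and u: "u \<in> carrier U" and us: "us \<in> ws q"
  shows "hat q f (word H (u # us)) = u \<odot>\<^bsub>M\<^esub> f (word H us)"
proof (cases q)
  case 0
  then show ?thesis using u us by (simp add: hat_def)
next
  case (Suc p)
  have w: "word H us \<in> carrier (PW (Suc p))" using us Suc by (simp del: Upow.simps)
  have c: "tpo (PW (Suc p)) u (word H us) \<in> carrier (Ind (PW (Suc p)))" by (rule tpo_closed[OF umod_Upow u w])
  show ?thesis
    unfolding word_Cons[OF us[unfolded Suc]] Suc hat_def nat.case restrict_apply'[OF c]
    by (rule induced_lin(2)[OF umod_Upow umod_M AHD(2)[OF f[unfolded Suc]] _ u w]) (use AHD(5)[OF f] Suc in simp)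
qed

lemma Psi_bij: "bij_betw (Psi q) (lin (DD q) M) (AH (PW q))"
proof (rule bij_betw_byWitness[where f' = "\<lambda>f. compose (carrier (DD q)) (hat q f) (mu_inv q)"])
  have c: "compose (carrier (DD q)) (hat q f) (mu_inv q) \<in> lin (DD q) M" if "f \<in> AH (PW q)" for f
    by (rule lin_compose[OF _ mu_inv_lin hat_lin[OF that]]) simp
  have v: "compose (carrier (DD q)) (hat q f) (mu_inv q) (bw (u # us)) = u \<odot>\<^bsub>M\<^esub> f (word H us)"
    if "f \<in> AH (PW q)" "u \<in> carrier U" "us \<in> ws q" for f u us
    using that by (simp add: compose_eq mu_inv_bw hat_word)
  show "\<forall>F\<in>lin (DD q) M. compose (carrier (DD q)) (hat q (Psi q F)) (mu_inv q) = F"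
  proof
    fix F assume F: "F \<in> lin (DD q) M"
    show "compose (carrier (DD q)) (hat q (Psi q F)) (mu_inv q) = F"
    proof (rule lin_bw_ext[OF c[OF Psi_AH[OF F]] F umod_M])
      fix us assume "us \<in> ws (Suc q)"
      then obtain u vs where us: "us = u # vs" "u \<in> carrier U" "vs \<in> ws q" by (auto elim: ws_SucE)
      then have "u \<odot>\<^bsub>M\<^esub> F (bw (\<one>\<^sub>U # vs)) = F (bw (u # vs))"
        using smult_bw[of u "\<one>\<^sub>U" vs q] bw_closed[of "\<one>\<^sub>U # vs" q] by (simp flip: lin_mapsD(4)[OF F])
      then show "compose (carrier (DD q)) (hat q (Psi q F)) (mu_inv q) (bw us) = F (bw us)"
        using us by (simp add: v[OF Psi_AH[OF F]] Psi_word)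
    qed
  qed
  show "\<forall>f\<in>AH (PW q). Psi q (compose (carrier (DD q)) (hat q f) (mu_inv q)) = f"
  proof
    fix f assume f: "f \<in> AH (PW q)"
    show "Psi q (compose (carrier (DD q)) (hat q f) (mu_inv q)) = f"
    proof (rule AH_ext[OF Psi_AH[OF c[OF f]] f])
      fix us assume us: "us \<in> ws q"
      then show "Psi q (compose (carrier (DD q)) (hat q f) (mu_inv q)) (word H us) = f (word H us)"
        using AHD(3)[OF f word_closed[OF us]] by (simp add: Psi_word v[OF f])
    qed
  qed
  show "Psi q ` lin (DD q) M \<subseteq> AH (PW q)" using Psi_AH by auto
  show "(\<lambda>f. compose (carrier (DD q)) (hat q f) (mu_inv q)) ` AH (PW q) \<subseteq> lin (DD q) M" using c by auto
qed

lemma cochains_simps [simp]: "carrier (cochains H M q) = AH (PW q)"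
  "f \<oplus>\<^bsub>cochains H M q\<^esub> g = (\<lambda>x\<in>carrier (PW q). f x \<oplus>\<^bsub>M\<^esub> g x)"
  "c \<odot>\<^bsub>cochains H M q\<^esub> f = (\<lambda>x\<in>carrier (PW q). kU c \<odot>\<^bsub>M\<^esub> f x)"
  by (simp_all add: cochains_def)

lemma cochains_module: "Module.module K (cochains H M q)"
  unfolding cochains_def
proof (rule fun_module_module[OF umod_M])
  have z: "u \<odot>\<^bsub>M\<^esub> \<zero>\<^bsub>M\<^esub> = \<zero>\<^bsub>M\<^esub>" if "u \<in> carrier U" for u
    by (rule ahom_zero[OF _ _ smult_ahom[of U]]) (use that in simp_all)
  show "(\<lambda>x\<in>carrier (PW q). \<zero>\<^bsub>M\<^esub>) \<in> AH (PW q)"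
    by (rule AHI) (auto intro!: ahomI simp: z)
  show "(\<lambda>x\<in>carrier (PW q). f x \<oplus>\<^bsub>M\<^esub> g x) \<in> AH (PW q)" if "f \<in> AH (PW q)" "g \<in> AH (PW q)" for f g
    using AHD(3,4,5)[OF that(1)] AHD(3,4,5)[OF that(2)]
    by (intro AHI ahomI) (auto simp: M.a_ac smult_r_distr)
  show "(\<lambda>x\<in>carrier (PW q). kU c \<odot>\<^bsub>M\<^esub> f x) \<in> AH (PW q)" if "c \<in> carrier K" "f \<in> AH (PW q)" for c f
    using AHD(3,4,5)[OF that(2)] that(1)
    by (intro AHI ahomI) (auto simp: smult_r_distr kU_smult_comm)
qed (auto simp: AHD)

lemma Psi_linear: "is_linear_iso K (HomU H M (DD q)) (cochains H M q) (Psi q)"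
proof -
  interpret D: Module.module K "HomU H M (DD q)" by (rule HomU_module) simp_all
  interpret C: Module.module K "cochains H M q" by (rule cochains_module)
  show ?thesis
    unfolding is_linear_iso_def is_linear_def
  proof (intro conjI ahomI ballI)
    fix F assume F: "F \<in> carrier (HomU H M (DD q))"
    then show "Psi q F \<in> carrier (cochains H M q)" by (simp add: Psi_AH)
    fix G assume G: "G \<in> carrier (HomU H M (DD q))"
    have "Psi q (F \<oplus>\<^bsub>HomU H M (DD q)\<^esub> G) \<in> AH (PW q)" "Psi q F \<oplus>\<^bsub>cochains H M q\<^esub> Psi q G \<in> AH (PW q)"
      using D.add.m_closed[OF F G] C.add.m_closed[of "Psi q F" "Psi q G"] F G Psi_AH by (simp_all add: Psi_AH)
    then show "Psi q (F \<oplus>\<^bsub>HomU H M (DD q)\<^esub> G) = Psi q F \<oplus>\<^bsub>cochains H M q\<^esub> Psi q G"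
      by (rule AH_ext) (simp add: Psi_word)
  next
    fix c F assume c: "c \<in> carrier K" and F: "F \<in> carrier (HomU H M (DD q))"
    have "Psi q (c \<odot>\<^bsub>HomU H M (DD q)\<^esub> F) \<in> AH (PW q)" "c \<odot>\<^bsub>cochains H M q\<^esub> Psi q F \<in> AH (PW q)"
      using D.smult_closed[OF c F] C.smult_closed[OF c, of "Psi q F"] F by (simp_all add: Psi_AH)
    then show "Psi q (c \<odot>\<^bsub>HomU H M (DD q)\<^esub> F) = c \<odot>\<^bsub>cochains H M q\<^esub> Psi q F"
      by (rule AH_ext) (simp add: Psi_word)
  qed (use Psi_bij in simp)
qed

end

section \<open>The cocyclic structure on cochains\<close>

context aYD_setting
begin

lemma extend_words_AH:
  assumes g: "g \<in> AH (PW q)" and e: "\<And>us. us \<in> ws q ==> g (word H us) = G us"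
  shows "extend_words H (AH (PW q)) q G = g"
  unfolding extend_words_def
  by (rule the_equality) (use g e in \<open>auto intro: AH_ext\<close>)

lemma lin_words_ext:
  assumes f: "f \<in> lin (PW (Suc q)) M" and g: "g \<in> lin (PW (Suc q)) M"
    and e: "\<And>us. us \<in> ws (Suc q) ==> f (word H us) = g (word H us)"
  shows "f = g"
  by (rule lin_maps_eqI[OF f g])
    (use Upow_ext[OF _ lin_mapsD(1)[OF f] lin_mapsD(1)[OF g]] e in \<open>simp del: Upow.simps\<close>)

lemma extend_words_lin:
  assumes g: "g \<in> lin (PW (Suc q)) M" and e: "\<And>us. us \<in> ws (Suc q) ==> g (word H us) = G us"
  shows "extend_words H (lin (PW (Suc q)) M) (Suc q) G = g"
  unfolding extend_words_def
  by (rule the_equality) (use g e in \<open>auto intro: lin_words_ext\<close>)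

lemma coface_Psi:
  assumes i: "i \<le> q + 1" and F: "F \<in> lin (DD q) M"
  shows "coface H M q i (Psi q F) = Psi (q + 1) (dcoface q i F)"
  unfolding coface_def cochains_simps
proof (rule extend_words_AH)
  show "Psi (q + 1) (dcoface q i F) \<in> AH (PW (q + 1))"
    by (rule Psi_AH) (simp add: dcoface_lin F)
  fix us assume us: "us \<in> ws (q + 1)"
  then obtain u vs where uv: "us = u # vs" "u \<in> carrier U" "vs \<in> ws q" by (auto elim: ws_SucE)
  have l: "length vs = q" by (rule ws_length[OF uv(3)])
  have w1: "\<one>\<^sub>U # us \<in> ws (Suc (Suc q))" using us by simp
  have v: "Psi (q + 1) (dcoface q i F) (word H us) = F (bw (be i (\<one>\<^sub>U # us)))"
    using us by (simp add: Psi_word dcoface_eval face_bw del: DD.simps bw.simps)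
  consider (first) "i = 0" | (middle) "1 \<le> i" "i \<le> q" | (low) "i = 1" "q = 0" | (last) "i = Suc q" "1 \<le> q"
    using i by linarith
  then show "Psi (q + 1) (dcoface q i F) (word H us) =
      (if i = 0 then hd us \<odot>\<^bsub>M\<^esub> Psi q F (word H (tl us))
       else if i \<le> q then Psi q F (word H (take (i - 1) us @ [us ! (i - 1) \<cdot> us ! i] @ drop (i + 1) us))
       else if q = 0 then Psi q F (\<epsilon> (us ! 0))
       else Psi q F (word H (take (q - 1) us @ [us ! (q - 1) \<cdot> t (\<epsilon> (us ! q))])))"
  proof cases
    case first
    have "F (bw (u # vs)) = u \<odot>\<^bsub>M\<^esub> F (bw (\<one>\<^sub>U # vs))"
      using uv smult_bw[of u "\<one>\<^sub>U" vs q] bw_closed[of "\<one>\<^sub>U # vs" q] by (simp flip: lin_mapsD(4)[OF F])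
    then show ?thesis using first uv unfolding v by (simp add: Psi_word)
  next
    case middle
    then obtain i' where i': "i = Suc i'" by (cases i) auto
    let ?l = "take (i - 1) us @ [us ! (i - 1) \<cdot> us ! i] @ drop (i + 1) us"
    have b: "be i (\<one>\<^sub>U # us) = \<one>\<^sub>U # ?l"
      using be_middle[OF w1 middle(2)] i' by simp
    have "?l \<in> ws q" using be_ws[OF w1, of i] unfolding b by simp
    then show ?thesis using middle unfolding v b by (simp add: Psi_word)
  next
    case low
    then show ?thesis using uv unfolding v by simp
  next
    case last
    then obtain q' where q': "q = Suc q'" by (cases q) auto
    let ?l = "take (q - 1) us @ [us ! (q - 1) \<cdot> t (\<epsilon> (us ! q))]"
    have b: "be i (\<one>\<^sub>U # us) = \<one>\<^sub>U # ?l"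
      using be_last[OF w1] q' last by simp
    have "?l \<in> ws q" using be_ws[OF w1, of i] unfolding b by simp
    then show ?thesis using last unfolding v b by (simp add: Psi_word)
  qed
qed

lemma codegen_Psi:
  assumes j: "j \<le> q" and F: "F \<in> lin (DD (Suc q)) M"
  shows "codegen H M q j (Psi (q + 1) F) = Psi q (dcodeg q j F)"
  unfolding codegen_def cochains_simps
proof (rule extend_words_AH)
  show "Psi q (dcodeg q j F) \<in> AH (PW q)"
    by (rule Psi_AH) (simp add: dcodeg_lin F)
  fix us assume us: "us \<in> ws q"
  let ?l = "take j us @ [\<one>\<^sub>U] @ drop j us"
  have w1: "\<one>\<^sub>U # us \<in> ws (Suc q)" using us by simp
  have b: "bs j (\<one>\<^sub>U # us) = \<one>\<^sub>U # ?l"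
    using bs_middle[OF w1 j] by simp
  have "?l \<in> ws (Suc q)" using bs_ws[OF w1, of j] unfolding b by simp
  moreover have "Psi q (dcodeg q j F) (word H us) = F (bw (\<one>\<^sub>U # ?l))"
    using us w1 deg_bw[OF w1, of j] bw_closed[OF w1] unfolding b by (simp add: Psi_word dcodeg_eval del: bw.simps)
  ultimately show "Psi q (dcodeg q j F) (word H us) = Psi (q + 1) F (word H ?l)"
    by (simp add: Psi_word del: append_Cons append.simps bw.simps)
qed

text \<open>In \<open>w\<^sub>+ F(1 \<otimes> w\<^sub>-z)\<close> the two components of the translation cancel into the first factor.\<close>

lemma dot_act_Psi:
  assumes F: "F \<in> lin (DD (Suc p)) M" and w: "w \<in> carrier U" and v: "v \<in> carrier U" and xs: "xs \<in> ws p"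
  shows "dot_act H M w (Psi (Suc p) F) (v # xs) = F (tp UM (DD p) w (bw (v # xs)))"
proof -
  note F' = F[unfolded DD_Suc]
  have vx: "v # xs \<in> ws (Suc p)" using v xs by simp
  have "dot_act H M w (Psi (Suc p) F) (v # xs) =
      sw M (\<lambda>x m. x \<odot>\<^bsub>M\<^esub> F (tp UM (DD p) \<one>\<^sub>U (m \<odot>\<^bsub>DD p\<^esub> bw (v # xs)))) (tr w)"
    unfolding dot_act_def list.sel
    by (rule swOU_cong)
      (use w v xs bw_closed[OF vx] in \<open>simp_all add: Psi_word bw_one smult_bw lin_mapsD(2)[OF F'] del: bw.simps\<close>)
  also have "\<dots> = F (tp UM (DD p) w (bw (v # xs)))"
    using translation_cancel[OF umod_UM umod_DD umod_M F' w, of "\<one>\<^sub>U" "bw (v # xs)"] bw_closed[OF vx] w by simp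
  finally show ?thesis .
qed

text \<open>The trace moves the last factor \<open>y\<close> of the tower to the front. For a bar word this factor is the product of the last letter with the second coproduct components of the others, which is the argument of the dot action.\<close>

lemma tau_Psi_word:
  assumes F: "F \<in> lin (DD (Suc p)) M" and us: "us \<in> ws (Suc p)"
  shows "Psi (Suc p) (tau (Suc p) F) (word H us) = tau_value H M \<gamma> (Psi (Suc p) F) us"
proof -
  note F' = F[unfolded DD_Suc]
  obtain vs x where vx: "us = vs @ [x]" "vs \<in> ws p" "x \<in> carrier U" using ws_snocE[OF us] .
  let ?T = "trace_map H M \<gamma> UM (DD p) F"
  have T: "?T \<in> lin (TA (DD p) UM) M" by (rule trace_lin[OF umod_UM umod_DD F'])
  have w1: "\<one>\<^sub>U # us \<in> ws (Suc (Suc p))" using us by simp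
  have "Psi (Suc p) (tau (Suc p) F) (word H us) = ?T (split_last p (bw (\<one>\<^sub>U # us)))"
    unfolding Psi_word[OF us] tau.simps(2) by (rule compose_eq[OF bw_closed[OF w1]])
  also have "\<dots> = sw_list H M vs (\<lambda>xs ys. ?T (tp (DD p) UM (bw (\<one>\<^sub>U # xs)) (foldr (mult U) ys x)))"
    unfolding vx(1) split_last_bw_one[OF vx(2,3)]
    by (rule hom_sw_list[OF _ _ lin_mapsD(1)[OF T] vx(2)]) (use vx in simp_all)
  also have "\<dots> = tau_value H M \<gamma> (Psi (Suc p) F) us"
    unfolding tau_value_def vx(1) butlast_snoc last_snoc
  proof (rule sw_list_cong[OF _ vx(2)])
    fix xs ys assume xy: "xs \<in> ws p" "ys \<in> ws p"
    let ?y = "foldr (mult U) ys x"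
    have y: "?y \<in> carrier U" using xy vx by simp
    have o: "\<one>\<^sub>U # xs \<in> ws (Suc p)" using xy by simp
    have "?T (tp (DD p) UM (bw (\<one>\<^sub>U # xs)) ?y) = \<gamma> (\<lambda>u\<in>carrier U. F (tp UM (DD p) ?y (u \<odot>\<^bsub>DD p\<^esub> bw (\<one>\<^sub>U # xs))))"
      by (rule trace_tp[OF umod_UM umod_DD F']) (use y bw_closed[OF o] in simp_all)
    also have "\<dots> = \<gamma> (\<lambda>v\<in>carrier U. dot_act H M ?y (Psi (Suc p) F) (v # xs))"
      by (rule \<gamma>_cong) (use xy y in \<open>simp add: dot_act_Psi[OF F] smult_bw\<close>)
    finally show e: "?T (tp (DD p) UM (bw (\<one>\<^sub>U # xs)) ?y) = \<gamma> (\<lambda>v\<in>carrier U. dot_act H M ?y (Psi (Suc p) F) (v # xs))" .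
    show "\<gamma> (\<lambda>v\<in>carrier U. dot_act H M ?y (Psi (Suc p) F) (v # xs)) \<in> carrier M"
      unfolding e[symmetric] by (rule lin_mapsD(2)[OF T]) (use y bw_closed[OF o] in simp)
  qed simp
  finally show ?thesis .
qed

lemma cyclic_op_Psi:
  assumes F: "F \<in> lin (DD q) M"
  shows "cyclic_op H M \<gamma> q (Psi q F) = Psi q (tau q F)"
proof (cases q)
  case 0
  then show ?thesis by (simp add: cyclic_op_def del: Psi.simps)
next
  case (Suc p)
  show ?thesis
    unfolding cyclic_op_def cochains_simps
    by (use Suc in \<open>simp del: Upow.simps\<close>)
      (rule extend_words_AH, use F Suc in \<open>simp_all add: Psi_AH tau_lin tau_Psi_word del: Upow.simps\<close>)
qed

theorem cochains_cocyclic: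
  "cocyclic_module K (cochains H M) (coface H M) (codegen H M) (cyclic_op H M \<gamma>)"
  by (rule cocyclic_transport[OF tower_cocyclic cochains_module Psi_linear])
    (simp_all add: coface_Psi[simplified Suc_eq_plus1[symmetric]] codegen_Psi[unfolded Suc_eq_plus1[symmetric]] cyclic_op_Psi del: Upow.simps)

subsection \<open>The cyclic operator through the trace map\<close>

lemma mu_pull:
  "bij_betw (\<lambda>F. compose (carrier (PW (Suc q))) F (mu q)) (lin (DD q) M) (lin (PW (Suc q)) M)"
proof (rule bij_betw_byWitness[where f' = "\<lambda>g. compose (carrier (DD q)) g (mu_inv q)"])
  show "\<forall>F\<in>lin (DD q) M. compose (carrier (DD q)) (compose (carrier (PW (Suc q))) F (mu q)) (mu_inv q) = F"
  proof
    fix F assume F: "F \<in> lin (DD q) M"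
    show "compose (carrier (DD q)) (compose (carrier (PW (Suc q))) F (mu q)) (mu_inv q) = F"
      by (rule extensionalityI[OF _ lin_mapsD(3)[OF F]])
        (auto simp: compose_eq lin_mapsD(2)[OF mu_inv_lin] mu_mu_inv simp del: Upow.simps)
  qed
  show "\<forall>g\<in>lin (PW (Suc q)) M. compose (carrier (PW (Suc q))) (compose (carrier (DD q)) g (mu_inv q)) (mu q) = g"
  proof
    fix g assume g: "g \<in> lin (PW (Suc q)) M"
    show "compose (carrier (PW (Suc q))) (compose (carrier (DD q)) g (mu_inv q)) (mu q) = g"
      by (rule extensionalityI[OF _ lin_mapsD(3)[OF g]])
        (auto simp: compose_eq lin_mapsD(2)[OF mu_lin] mu_inv_mu simp del: Upow.simps)
  qed
  show "(\<lambda>F. compose (carrier (PW (Suc q))) F (mu q)) ` lin (DD q) M \<subseteq> lin (PW (Suc q)) M"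
    by (auto intro!: lin_compose[OF _ mu_lin] simp del: Upow.simps)
  show "(\<lambda>g. compose (carrier (DD q)) g (mu_inv q)) ` lin (PW (Suc q)) M \<subseteq> lin (DD q) M"
    by (auto intro!: lin_compose[OF _ mu_inv_lin] simp del: Upow.simps)
qed

lemma theta_mu:
  assumes F: "F \<in> lin (DD q) M"
  shows "theta H M q (compose (carrier (PW (Suc q))) F (mu q)) = Psi q F"
  unfolding theta_def cochains_simps
proof (rule extend_words_AH[OF Psi_AH[OF F]])
  fix us assume us: "us \<in> ws q"
  then have o: "\<one>\<^sub>U # us \<in> ws (Suc q)" by simp
  show "Psi q F (word H us) = compose (carrier (PW (Suc q))) F (mu q) (word H (\<one>\<^sub>U # us))"
    using word_closed[OF o] by (simp add: compose_eq Psi_word[OF us] mu_word[OF o] del: word.simps Upow.simps)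
qed

text \<open>Since \<open>\<theta>\<close> composed with pulling back along \<open>mu\<close> is the bijection \<open>Psi\<close>, its inverse is the pullback.\<close>

lemma theta_inv_Psi:
  assumes F: "F \<in> lin (DD q) M"
  shows "theta_inv H M q (Psi q F) = compose (carrier (PW (Suc q))) F (mu q)"
proof -
  have "inj_on (theta H M q) (lin (PW (Suc q)) M)"
  proof (rule inj_onI)
    fix g g' assume g: "g \<in> lin (PW (Suc q)) M" "g' \<in> lin (PW (Suc q)) M" "theta H M q g = theta H M q g'"
    obtain G G' where G: "G \<in> lin (DD q) M" "g = compose (carrier (PW (Suc q))) G (mu q)"
        "G' \<in> lin (DD q) M" "g' = compose (carrier (PW (Suc q))) G' (mu q)"
      using g(1,2) unfolding bij_betw_imp_surj_on[OF mu_pull, symmetric] by blast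
    have "Psi q G = Psi q G'" using g(3) unfolding G(2,4) theta_mu[OF G(1)] theta_mu[OF G(3)] .
    then show "g = g'" using Psi_bij[of q] G by (auto simp: bij_betw_def dest: inj_onD)
  qed
  moreover have "compose (carrier (PW (Suc q))) F (mu q) \<in> lin (PW (Suc q)) M"
    using mu_pull[of q] F by (auto simp: bij_betw_def simp del: Upow.simps)
  ultimately show ?thesis
    unfolding theta_inv_def HomU_simps Suc_eq_plus1[symmetric]
    by (intro the_inv_into_f_eq) (auto simp: theta_mu[OF F])
qed

text \<open>On words, \<open>\<eta>\<close> is composition with the Galois map, because \<open>U\<close> acts on bar words by multiplication into the first letter.\<close>

lemma eta_galois:
  assumes \<phi>: "\<phi> \<in> lin (TA UM (PW (Suc p))) M"
  shows "eta H M (Suc p) \<phi> = compose (carrier (PW (Suc (Suc p)))) \<phi> (galois (PW (Suc p)))"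
  unfolding eta_def HomU_simps Suc_eq_plus1[symmetric]
proof (rule extend_words_lin)
  let ?W = "PW (Suc p)"
  have W: "umod ?W" by (rule umod_Upow)
  show "compose (carrier (PW (Suc (Suc p)))) \<phi> (galois ?W) \<in> lin (PW (Suc (Suc p))) M"
    unfolding Upow.simps(3) by (rule lin_compose[OF _ galois_lin[OF W] \<phi>]) (simp del: Upow.simps)
  fix us assume "us \<in> ws (Suc (Suc p))"
  then obtain u v vs where us: "us = u # v # vs" "u \<in> carrier U" "v \<in> carrier U" "vs \<in> ws p"
    by (auto elim!: ws_SucE)
  have vv: "v # vs \<in> ws (Suc p)" using us by simp
  note wc = word_closed[OF vv]
  have tc: "tpo ?W u (word H (v # vs)) \<in> carrier (Ind ?W)" by (rule tpo_closed[OF W us(2) wc])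
  have sm: "x \<odot>\<^bsub>?W\<^esub> word H (v # vs) = word H ((x \<cdot> v) # vs)" if "x \<in> carrier U" for x
    using smult_word[OF that us(3,4)] .
  have xc: "word H ((x \<cdot> v) # vs) \<in> carrier ?W" if "x \<in> carrier U" for x
    by (rule word_closed) (use that us in simp)
  have "compose (carrier (PW (Suc (Suc p)))) \<phi> (galois ?W) (word H us) =
      \<phi> (sw (TA UM ?W) (\<lambda>x y. tp UM ?W x (y \<odot>\<^bsub>?W\<^esub> word H (v # vs))) (\<Delta> u))"
    unfolding us(1) word_Cons[OF vv] Upow.simps(3) compose_eq[OF tc] galois_tp_sw[OF W us(2) wc] ..
  also have "\<dots> = sw M (\<lambda>x y. \<phi> (tp UM ?W x (y \<odot>\<^bsub>?W\<^esub> word H (v # vs)))) (\<Delta> u)"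
    by (rule hom_swU[OF _ _ lin_mapsD(1)[OF \<phi>]]) (use us wc sm xc W in \<open>simp_all del: Upow.simps word.simps\<close>)
  also have "\<dots> = sw M (\<lambda>v1 v2. \<phi> (tp UM ?W v1 (word H ((v2 \<cdot> us ! 1) # drop 2 us)))) (\<Delta> (us ! 0))"
    unfolding us(1)
    by (simp add: del: Upow.simps word.simps, rule swU_cong) (use us sm xc W lin_mapsD(2)[OF \<phi>] in \<open>simp_all del: Upow.simps word.simps\<close>)
  finally show "compose (carrier (PW (Suc (Suc p)))) \<phi> (galois ?W) (word H us) =
      sw M (\<lambda>v1 v2. \<phi> (tp UM ?W v1 (word H ((v2 \<cdot> us ! 1) # drop 2 us)))) (\<Delta> (us ! 0))" .
qed

lemma eta_inv_mu:
  assumes F: "F \<in> lin (DD (Suc p)) M"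
  shows "eta_inv H M (Suc p) (compose (carrier (PW (Suc (Suc p)))) F (mu (Suc p))) =
    precomp (TA UM (PW (Suc p))) (TA UM (DD p)) (tmap UM UM (PW (Suc p)) (DD p) (idm U) (mu p)) F"
    (is "_ = ?\<phi>")
proof -
  let ?W = "PW (Suc p)"
  have W: "umod ?W" by (rule umod_Upow)
  have I: "idm U \<in> lin UM UM" by simp
  have tl: "tmap UM UM ?W (DD p) (idm U) (mu p) \<in> lin (TA UM ?W) (TA UM (DD p))"
    by (rule tens_map_lin(1)[OF _ _ _ _ I mu_lin]) (simp_all del: Upow.simps)
  have \<phi>: "?\<phi> \<in> lin (TA UM ?W) M"
    unfolding precomp_def by (rule lin_compose[OF _ tl F[unfolded DD_Suc]]) (simp del: Upow.simps)
  have inj: "inj_on (eta H M (Suc p)) (lin (TA UM ?W) M)"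
  proof (rule inj_onI)
    fix f g assume f: "f \<in> lin (TA UM ?W) M" and g: "g \<in> lin (TA UM ?W) M" and e: "eta H M (Suc p) f = eta H M (Suc p) g"
    show "f = g"
    proof (rule lin_maps_eqI[OF f g])
      fix w assume w: "w \<in> carrier (TA UM ?W)"
      have c: "galois_inv ?W w \<in> carrier (PW (Suc (Suc p)))"
        unfolding Upow.simps(3) by (rule lin_mapsD(2)[OF galois_inv_lin[OF W] w])
      show "f w = g w"
        using fun_cong[OF e, of "galois_inv ?W w"] unfolding eta_galois[OF f] eta_galois[OF g] compose_eq[OF c]
        unfolding galois_galois_inv[OF W w] .
    qed
  qed
  have "eta H M (Suc p) ?\<phi> = compose (carrier (PW (Suc (Suc p)))) F (mu (Suc p))"
    unfolding eta_galois[OF \<phi>] Upow.simps(3)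
  proof (rule lin_TO_ext[OF W _ _ umod_M])
    show "compose (carrier (Ind ?W)) ?\<phi> (galois ?W) \<in> lin (Ind ?W) M"
      by (rule lin_compose[OF _ galois_lin[OF W] \<phi>]) (simp del: Upow.simps)
    show "compose (carrier (Ind ?W)) F (mu (Suc p)) \<in> lin (Ind ?W) M"
      using lin_compose[OF umod_Upow mu_lin F] unfolding Upow.simps(3) .
    fix w assume w: "w \<in> carrier ?W"
    have tc: "tpo ?W \<one>\<^sub>U w \<in> carrier (Ind ?W)" by (rule tpo_closed[OF W _ w]) simp
    have c: "mu p w \<in> carrier (DD p)" by (rule lin_mapsD(2)[OF mu_lin w])
    have tc': "tp UM ?W \<one>\<^sub>U w \<in> carrier (TA UM ?W)" using W w by (simp del: Upow.simps)
    have g1: "galois ?W (tpo ?W \<one>\<^sub>U w) = tp UM ?W \<one>\<^sub>U w"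
      using galois_tp[OF W _ w, of "\<one>\<^sub>U"] W tc' by (simp del: Upow.simps)
    have m1: "mu (Suc p) (tpo ?W \<one>\<^sub>U w) = tp UM (DD p) \<one>\<^sub>U (mu p w)"
      using mu_tp[OF _ w, of "\<one>\<^sub>U"] c by (simp del: Upow.simps mu.simps)
    show "compose (carrier (Ind ?W)) ?\<phi> (galois ?W) (tpo ?W \<one>\<^sub>U w) = compose (carrier (Ind ?W)) F (mu (Suc p)) (tpo ?W \<one>\<^sub>U w)"
      unfolding compose_eq[OF tc] g1 m1 precomp_def compose_eq[OF tc']
      using tens_map_lin(2)[OF umod_UM umod_UM W umod_DD I mu_lin, of "\<one>\<^sub>U" w] w by (simp del: Upow.simps)
  qed
  then show ?thesis
    unfolding eta_inv_def HomU_simps by (intro the_inv_into_f_eq[OF inj]) (use \<phi> in auto)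
qed

text \<open>By naturality the trace may be taken on the tower; there \<open>\<chi>\<close> is composition with the splitting of the last factor, which is the definition of \<open>tau\<close>.\<close>

lemma chi_trace:
  assumes F: "F \<in> lin (DD (Suc p)) M"
  shows "chi H M (Suc p) (trace_map H M \<gamma> UM (PW (Suc p))
      (precomp (TA UM (PW (Suc p))) (TA UM (DD p)) (tmap UM UM (PW (Suc p)) (DD p) (idm U) (mu p)) F)) =
    compose (carrier (PW (Suc (Suc p)))) (tau (Suc p) F) (mu (Suc p))"
proof -
  let ?W = "PW (Suc p)" and ?T = "trace_map H M \<gamma> UM (DD p) F"
  have W: "umod ?W" by (rule umod_Upow)
  have I: "idm U \<in> lin UM UM" by simp
  note F' = F[unfolded DD_Suc]
  have T: "?T \<in> lin (TA (DD p) UM) M" by (rule trace_lin[OF umod_UM umod_DD F'])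
  have n: "trace_map H M \<gamma> UM ?W
      (precomp (TA UM ?W) (TA UM (DD p)) (tmap UM UM ?W (DD p) (idm U) (mu p)) F) =
    precomp (TA ?W UM) (TA (DD p) UM) (tmap ?W (DD p) UM UM (mu p) (idm U)) ?T" (is "_ = ?\<psi>")
    by (rule trace_natural[OF umod_UM umod_UM W umod_DD I mu_lin F'])
  have v: "?\<psi> (tp ?W UM w x) = ?T (tp (DD p) UM (mu p w) x)" if "w \<in> carrier ?W" "x \<in> carrier U" for w x
  proof -
    have tc: "tp ?W UM w x \<in> carrier (TA ?W UM)" using W that by (simp del: Upow.simps)
    show ?thesis
      unfolding precomp_def compose_eq[OF tc]
      using tens_map_lin(2)[OF W umod_DD umod_UM umod_UM mu_lin I, of w x] that by (simp del: Upow.simps)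
  qed
  show ?thesis
    unfolding n chi_def HomU_simps Suc_eq_plus1[symmetric]
  proof (rule extend_words_lin)
    show "compose (carrier (PW (Suc (Suc p)))) (tau (Suc p) F) (mu (Suc p)) \<in> lin (PW (Suc (Suc p))) M"
      by (rule lin_compose[OF umod_Upow mu_lin tau_lin[OF F]])
    fix us assume us: "us \<in> ws (Suc (Suc p))"
    obtain vs x where vx: "us = vs @ [x]" "vs \<in> ws (Suc p)" "x \<in> carrier U" using ws_snocE[OF us] .
    have "compose (carrier (PW (Suc (Suc p)))) (tau (Suc p) F) (mu (Suc p)) (word H us) = ?T (split_last p (bw us))"
      unfolding compose_eq[OF word_closed[OF us]] mu_word[OF us] tau.simps(2)
      by (rule compose_eq[OF bw_closed[OF us]])
    also have "\<dots> = sw_list H M vs (\<lambda>xs ys. ?T (tp (DD p) UM (bw xs) (foldr (mult U) ys x)))"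
      unfolding vx(1) split_last_bw[OF vx(2,3)]
      by (rule hom_sw_list[OF _ _ lin_mapsD(1)[OF T] vx(2)]) (use vx in simp_all)
    also have "\<dots> = sw_list H M (butlast us) (\<lambda>xs ys. ?\<psi> (tp ?W UM (word H xs) (foldr (mult U) ys (last us))))"
      unfolding vx(1) butlast_snoc last_snoc
    proof (rule sw_list_cong[OF _ vx(2)])
      fix xs ys assume xy: "xs \<in> ws (Suc p)" "ys \<in> ws (Suc p)"
      have y: "foldr (mult U) ys x \<in> carrier U" using xy vx by simp
      show e: "?T (tp (DD p) UM (bw xs) (foldr (mult U) ys x)) = ?\<psi> (tp ?W UM (word H xs) (foldr (mult U) ys x))"
        unfolding v[OF word_closed[OF xy(1)] y] mu_word[OF xy(1)] ..
      show "?\<psi> (tp ?W UM (word H xs) (foldr (mult U) ys x)) \<in> carrier M"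
        unfolding e[symmetric] by (rule lin_mapsD(2)[OF T]) (use y bw_closed[OF xy(1)] in simp)
    qed simp
    finally show "compose (carrier (PW (Suc (Suc p)))) (tau (Suc p) F) (mu (Suc p)) (word H us) =
        sw_list H M (butlast us) (\<lambda>xs ys. ?\<psi> (tp ?W UM (word H xs) (foldr (mult U) ys (last us))))" .
  qed
qed

theorem cyclic_op_trace:
  assumes q: "1 \<le> q" and f: "f \<in> carrier (cochains H M q)"
  shows "cyclic_op H M \<gamma> q f =
      theta H M q (chi H M q (trace_map H M \<gamma> UM (PW q) (eta_inv H M q (theta_inv H M q f))))"
    and "us \<in> ws q ==> cyclic_op H M \<gamma> q f (word H us) = tau_value H M \<gamma> f us"
proof -
  obtain p where p: "q = Suc p" using q by (cases q) auto
  obtain F where F: "F \<in> lin (DD q) M" "f = Psi q F"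
    using f Psi_bij[of q] by (auto simp: bij_betw_def simp del: Upow.simps)
  note F' = F(1)[unfolded p]
  show "cyclic_op H M \<gamma> q f =
      theta H M q (chi H M q (trace_map H M \<gamma> UM (PW q) (eta_inv H M q (theta_inv H M q f))))"
    unfolding F(2) cyclic_op_Psi[OF F(1)] unfolding p theta_inv_Psi[OF F'] eta_inv_mu[OF F'] chi_trace[OF F']
      theta_mu[OF tau_lin[OF F']] ..
  show "us \<in> ws q ==> cyclic_op H M \<gamma> q f (word H us) = tau_value H M \<gamma> f us"
    unfolding F(2) cyclic_op_Psi[OF F(1)] unfolding p by (rule tau_Psi_word[OF F'])
qed

end

section \<open>The trace functor\<close>

context aYD_setting
begin

text \<open>Here \<open>f(s(a)ux)\<close> has to be contracted in \<open>u\<close>. The left action of \<open>a\<close> on values is right multiplication of \<open>u\<close> by \<open>t(a)\<close>, and stability then evaluates at \<open>u = 1\<close>.\<close>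

lemma trace_unital:
  assumes X [simp]: "umod X" and \<phi>: "\<phi> \<in> lin X M"
  shows "trace_map H M \<gamma> AM X (precomp (TA AM X) X (lunitA H X) \<phi>) = precomp (TA X AM) X (runitA H X) \<phi>"
proof -
  let ?\<psi> = "precomp (TA AM X) X (lunitA H X) \<phi>"
  have \<psi>: "?\<psi> \<in> lin (TA AM X) M"
    unfolding precomp_def by (rule lin_compose[OF _ lunit_lin \<phi>]) simp_all
  show ?thesis
  proof (rule lin_TA_ext[of X AM _ M])
    show "trace_map H M \<gamma> AM X ?\<psi> \<in> lin (TA X AM) M"
      by (rule trace_lin[OF _ _ \<psi>]) simp_all
    show "precomp (TA X AM) X (runitA H X) \<phi> \<in> lin (TA X AM) M"
      unfolding precomp_def by (rule lin_compose[OF _ runit_lin \<phi>]) simp_all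
    fix x a assume x: "x \<in> carrier X" and "a \<in> carrier AM"
    then have a: "a \<in> carrier A" by simp
    have h: "(\<lambda>u\<in>carrier U. \<phi> (u \<odot>\<^bsub>X\<^esub> x)) \<in> AH UM"
      by (rule AHUI) (use x in \<open>simp_all add: lin_mapsD[OF \<phi>] smult_l_distr smult_mult\<close>)
    have "trace_map H M \<gamma> AM X ?\<psi> (tp X AM x a) = \<gamma> (\<lambda>u\<in>carrier U. ?\<psi> (tp AM X a (u \<odot>\<^bsub>X\<^esub> x)))"
      by (rule trace_tp[OF _ _ \<psi>]) (use x a in simp_all)
    also have "\<dots> = \<gamma> (\<lambda>u\<in>carrier U. s a \<odot>\<^bsub>M\<^esub> (\<lambda>u\<in>carrier U. \<phi> (u \<odot>\<^bsub>X\<^esub> x)) u)"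
      by (rule \<gamma>_cong) (use x a in \<open>simp add: precomp_def compose_eq lunit_tp lin_mapsD(4)[OF \<phi>]\<close>)
    also have "\<dots> = \<gamma> (\<lambda>v\<in>carrier U. (\<lambda>u\<in>carrier U. \<phi> (u \<odot>\<^bsub>X\<^esub> x)) (v \<cdot> t a))"
      by (rule \<gamma>_left_values[OF h a])
    also have "\<dots> = \<gamma> (\<lambda>v\<in>carrier U. \<phi> (v \<odot>\<^bsub>X\<^esub> (t a \<odot>\<^bsub>X\<^esub> x)))"
      by (rule \<gamma>_cong) (use x a in \<open>simp add: smult_mult\<close>)
    also have "\<dots> = \<phi> (t a \<odot>\<^bsub>X\<^esub> x)"
      by (rule \<gamma>_stable_lin[OF X \<phi>]) (use x a in simp)
    finally show "trace_map H M \<gamma> AM X ?\<psi> (tp X AM x a) = precomp (TA X AM) X (runitA H X) \<phi> (tp X AM x a)"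
      using x a by (simp add: precomp_def compose_eq runit_tp)
  qed simp_all
qed

theorem HomU_trace_functor: "trace_functor K (UMod H) (HomU H M) precomp (trace_map H M \<gamma>)"
  unfolding trace_functor_def weak_trace_functor_def UMod_simps mem_Collect_eq HomU_simps(1)
  by (intro conjI UMod_monoidal HomU_functor ballI allI impI umod_M)
    (simp_all add: trace_linear_iso trace_natural trace_hexagon trace_unital)

end

section \<open>Alternating sums\<close>

text \<open>The recursion peels off the term that a contracting homotopy turns into the identity.\<close>

fun altsum :: "('z, 'a) ring_scheme \<Rightarrow> nat \<Rightarrow> (nat \<Rightarrow> 'z) \<Rightarrow> 'z" where
  "altsum Z 0 f = f 0"
| "altsum Z (Suc n) f = f 0 \<ominus>\<^bsub>Z\<^esub> altsum Z n (\<lambda>i. f (Suc i))"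

lemma altsum_closed:
  assumes "abelian_group Z" shows "(\<And>i. i \<le> n ==> f i \<in> carrier Z) ==> altsum Z n f \<in> carrier Z"
proof (induction n arbitrary: f)
  case (Suc n)
  interpret Z: abelian_group Z by fact
  show ?case using Suc.prems[of 0] Suc.IH[of "\<lambda>i. f (Suc i)"] Suc.prems by simp
qed simp

lemma altsum_cong: "(\<And>i. i \<le> n ==> f i = g i) ==> altsum Z n f = altsum Z n g"
proof (induction n arbitrary: f g)
  case (Suc n)
  show ?case using Suc.prems[of 0] Suc.IH[of "\<lambda>i. f (Suc i)" "\<lambda>i. g (Suc i)"] Suc.prems by simp
qed simp

lemma altsum_hom:
  assumes Z: "abelian_group Z" "abelian_group Z'" and h: "h \<in> ahom Z Z'"
  shows "(\<And>i. i \<le> n ==> f i \<in> carrier Z) ==> h (altsum Z n f) = altsum Z' n (\<lambda>i. h (f i))"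
proof (induction n arbitrary: f)
  case (Suc n)
  have "altsum Z n (\<lambda>i. f (Suc i)) \<in> carrier Z"
    by (rule altsum_closed[OF Z(1)]) (use Suc.prems in simp)
  then show ?case
    using Suc.prems[of 0] Suc.IH[of "\<lambda>i. f (Suc i)"] Suc.prems by (simp add: ahom_minus[OF Z h])
qed simp

lemma (in abelian_group) finsum_minus:
  "(\<And>i. i \<le> n ==> f i \<in> carrier G) ==> (\<Oplus>i\<in>{..n::nat}. \<ominus> f i) = \<ominus> (\<Oplus>i\<in>{..n}. f i)"
proof (induction n)
  case (Suc n)
  have "f \<in> {..n} \<rightarrow> carrier G" "f \<in> {..Suc n} \<rightarrow> carrier G" "(\<lambda>i. \<ominus> f i) \<in> {..Suc n} \<rightarrow> carrier G"
    using Suc.prems by auto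
  then show ?case using Suc by (simp add: minus_add a_comm)
qed simp

lemma (in abelian_group) altsum_finsum:
  "(\<And>i. i \<le> n ==> f i \<in> carrier G) ==>
    (\<Oplus>i\<in>{..n}. add_pow G ((- 1) ^ i :: int) (f i)) = altsum G n f"
proof (induction n arbitrary: f)
  case 0
  then show ?case by simp
next
  case (Suc n)
  have c: "(\<lambda>i. add_pow G ((- 1) ^ i :: int) (f i)) \<in> {..Suc n} \<rightarrow> carrier G"
    using Suc.prems by auto
  have "(\<Oplus>i\<in>{..Suc n}. add_pow G ((- 1) ^ i :: int) (f i)) =
      (\<Oplus>i\<in>{..n}. add_pow G ((- 1) ^ Suc i :: int) (f (Suc i))) \<oplus> f 0"
    using add.finprod_Suc2[OF c] Suc.prems[of 0] by simp
  also have "(\<Oplus>i\<in>{..n}. add_pow G ((- 1) ^ Suc i :: int) (f (Suc i))) =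
      (\<Oplus>i\<in>{..n}. \<ominus> add_pow G ((- 1) ^ i :: int) (f (Suc i)))"
    by (rule add.finprod_cong') (use Suc.prems in \<open>auto simp: add.int_pow_neg\<close>)
  also have "\<dots> = \<ominus> altsum G n (\<lambda>i. f (Suc i))"
    using finsum_minus[of n "\<lambda>i. add_pow G ((- 1) ^ i :: int) (f (Suc i))"] Suc by simp
  finally show ?case
    using Suc.prems[of 0] altsum_closed[OF abelian_group_axioms, of n "\<lambda>i. f (Suc i)"] Suc.prems
    by (simp add: minus_eq a_comm)
qed

section \<open>Cohomology of homotopy equivalent complexes\<close>

lemma is_linearD:
  assumes "is_linear K X Y f"
  shows "f \<in> ahom X Y" "x \<in> carrier X ==> f x \<in> carrier Y"
    "[|c \<in> carrier K; x \<in> carrier X|] ==> f (c \<odot>\<^bsub>X\<^esub> x) = c \<odot>\<^bsub>Y\<^esub> f x"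
    "[|x \<in> carrier X; y \<in> carrier X|] ==> f (x \<oplus>\<^bsub>X\<^esub> y) = f x \<oplus>\<^bsub>Y\<^esub> f y"
  using assms by (auto simp: is_linear_def ahom_closed ahom_add)

definition boundaries :: "(nat \<Rightarrow> ('k, 'v) module) \<Rightarrow> (nat \<Rightarrow> 'v \<Rightarrow> 'v) \<Rightarrow> nat \<Rightarrow> 'v set"
  where "boundaries C d n = (case n of 0 \<Rightarrow> {\<zero>\<^bsub>C 0\<^esub>} | Suc m \<Rightarrow> d m ` carrier (C m))"

definition submodule_set :: "'k ring \<Rightarrow> ('k, 'v) module \<Rightarrow> 'v set \<Rightarrow> bool"
  where "submodule_set K X B \<longleftrightarrow> B \<subseteq> carrier X \<and> \<zero>\<^bsub>X\<^esub> \<in> B \<and> (\<forall>x\<in>B. \<forall>y\<in>B. x \<ominus>\<^bsub>X\<^esub> y \<in> B) \<and>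
    (\<forall>c\<in>carrier K. \<forall>x\<in>B. c \<odot>\<^bsub>X\<^esub> x \<in> B)"

context
  fixes K :: "'k ring" and X :: "('k, 'v) module" and B :: "'v set"
  assumes X: "Module.module K X" and B: "submodule_set K X B"
begin

interpretation X: Module.module K X by (rule X)

lemma submodule_minus: "x \<in> B ==> \<ominus>\<^bsub>X\<^esub> x \<in> B"
proof -
  assume x: "x \<in> B"
  then have "\<zero>\<^bsub>X\<^esub> \<ominus>\<^bsub>X\<^esub> x \<in> B" "x \<in> carrier X" using B by (auto simp: submodule_set_def)
  then show ?thesis by (simp add: X.minus_eq)
qed

lemma submodule_add: "[|x \<in> B; y \<in> B|] ==> x \<oplus>\<^bsub>X\<^esub> y \<in> B"
  using B submodule_minus[of y] by (force simp: submodule_set_def subset_iff X.minus_eq)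

lemma submodule_abelian_subgroup: "abelian_subgroup B X"
proof (rule abelian_subgroupI3)
  show "additive_subgroup B X"
  proof
    show "B \<subseteq> carrier (add_monoid X)" "\<one>\<^bsub>add_monoid X\<^esub> \<in> B" using B by (auto simp: submodule_set_def)
    fix x y assume x: "x \<in> B" and "y \<in> B"
    then show "x \<otimes>\<^bsub>add_monoid X\<^esub> y \<in> B" by (simp add: submodule_add)
    show "inv\<^bsub>add_monoid X\<^esub> x \<in> B" using submodule_minus[OF x] by (simp add: a_inv_def)
  qed
qed (rule X.abelian_group_axioms)

interpretation B: abelian_subgroup B X by (rule submodule_abelian_subgroup)

lemma coset_eq_iff:
  assumes "x \<in> carrier X" "y \<in> carrier X"
  shows "B +>\<^bsub>X\<^esub> x = B +>\<^bsub>X\<^esub> y \<longleftrightarrow> x \<ominus>\<^bsub>X\<^esub> y \<in> B"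
proof
  assume "B +>\<^bsub>X\<^esub> x = B +>\<^bsub>X\<^esub> y"
  then have "x \<in> B +>\<^bsub>X\<^esub> y" using B.a_rcos_self[OF assms(1)] by simp
  then obtain b where "b \<in> B" "x = b \<oplus>\<^bsub>X\<^esub> y" by (auto simp: a_r_coset_def')
  then show "x \<ominus>\<^bsub>X\<^esub> y \<in> B"
    using assms B by (simp add: X.minus_eq X.a_assoc X.r_neg submodule_set_def subset_iff)
next
  assume b: "x \<ominus>\<^bsub>X\<^esub> y \<in> B"
  have "x = (x \<ominus>\<^bsub>X\<^esub> y) \<oplus>\<^bsub>X\<^esub> y" using assms by (simp add: X.minus_eq X.a_assoc X.l_neg)
  then have "x \<in> B +>\<^bsub>X\<^esub> y" using b by (auto simp: a_r_coset_def')
  then show "B +>\<^bsub>X\<^esub> x = B +>\<^bsub>X\<^esub> y" using B.a_repr_independence'[of x y] assms by simp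
qed

lemma coset_add:
  "[|x \<in> carrier X; y \<in> carrier X|] ==> (B +>\<^bsub>X\<^esub> x) <+>\<^bsub>X\<^esub> (B +>\<^bsub>X\<^esub> y) = B +>\<^bsub>X\<^esub> (x \<oplus>\<^bsub>X\<^esub> y)"
  by (rule B.a_rcos_sum)

lemma coset_UN:
  assumes x: "x \<in> carrier X" and F: "\<And>b. b \<in> B ==> F (b \<oplus>\<^bsub>X\<^esub> x) = F x"
  shows "(\<Union>z\<in>B +>\<^bsub>X\<^esub> x. F z) = F x"
proof -
  have "(\<Union>z\<in>B +>\<^bsub>X\<^esub> x. F z) = (\<Union>b\<in>B. F (b \<oplus>\<^bsub>X\<^esub> x))" by (auto simp: a_r_coset_def')
  also have "\<dots> = (\<Union>b\<in>B. F x)" using F by simp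
  also have "\<dots> = F x" using B.zero_closed by blast
  finally show ?thesis .
qed

lemma coset_smult:
  assumes x: "x \<in> carrier X" and c: "c \<in> carrier K"
  shows "(\<Union>z\<in>B +>\<^bsub>X\<^esub> x. B +>\<^bsub>X\<^esub> (c \<odot>\<^bsub>X\<^esub> z)) = B +>\<^bsub>X\<^esub> (c \<odot>\<^bsub>X\<^esub> x)"
proof (rule coset_UN[OF x])
  fix b assume b: "b \<in> B"
  then have bc: "b \<in> carrier X" "c \<odot>\<^bsub>X\<^esub> b \<in> B" using B c by (auto simp: submodule_set_def)
  have "c \<odot>\<^bsub>X\<^esub> (b \<oplus>\<^bsub>X\<^esub> x) \<ominus>\<^bsub>X\<^esub> c \<odot>\<^bsub>X\<^esub> x = c \<odot>\<^bsub>X\<^esub> b"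
    using bc x c by (simp add: X.smult_r_distr X.minus_eq X.a_assoc X.r_neg)
  then show "B +>\<^bsub>X\<^esub> (c \<odot>\<^bsub>X\<^esub> (b \<oplus>\<^bsub>X\<^esub> x)) = B +>\<^bsub>X\<^esub> (c \<odot>\<^bsub>X\<^esub> x)"
    using bc x c by (subst coset_eq_iff) simp_all
qed

end

lemma quotient_iso:
  assumes X: "Module.module K X" and Y: "Module.module K Y"
    and B: "submodule_set K X B" and B': "submodule_set K Y B'"
    and Z: "submodule_set K X Z" and Z': "submodule_set K Y Z'"
    and f: "is_linear K X Y f" and g: "is_linear K Y X g"
    and fZ: "f ` Z \<subseteq> Z'" and gZ: "g ` Z' \<subseteq> Z" and fB: "f ` B \<subseteq> B'" and gB: "g ` B' \<subseteq> B"
    and gf: "\<And>x. x \<in> Z ==> g (f x) \<ominus>\<^bsub>X\<^esub> x \<in> B" and fg: "\<And>y. y \<in> Z' ==> f (g y) \<ominus>\<^bsub>Y\<^esub> y \<in> B'"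
  shows "modules_isomorphic K (quotient_module X Z B) (quotient_module Y Z' B')"
proof -
  interpret X: Module.module K X by fact
  interpret Y: Module.module K Y by fact
  let ?F = "\<lambda>S. \<Union>x\<in>S. B' +>\<^bsub>Y\<^esub> f x"
  have Zc: "z \<in> carrier X" if "z \<in> Z" for z using that Z by (auto simp: submodule_set_def)
  have Zc': "z \<in> carrier Y" if "z \<in> Z'" for z using that Z' by (auto simp: submodule_set_def)
  have F: "?F (B +>\<^bsub>X\<^esub> x) = B' +>\<^bsub>Y\<^esub> f x" if x: "x \<in> carrier X" for x
  proof (rule coset_UN[OF X B x])
    fix b assume b: "b \<in> B"
    then have bc: "b \<in> carrier X" "f b \<in> B'" using B fB by (auto simp: submodule_set_def)
    have "f (b \<oplus>\<^bsub>X\<^esub> x) \<ominus>\<^bsub>Y\<^esub> f x = f b"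
      using bc x by (simp add: is_linearD[OF f] Y.minus_eq Y.a_assoc Y.r_neg)
    then show "B' +>\<^bsub>Y\<^esub> f (b \<oplus>\<^bsub>X\<^esub> x) = B' +>\<^bsub>Y\<^esub> f x"
      using bc x by (subst coset_eq_iff[OF Y B']) (simp_all add: is_linearD[OF f])
  qed
  have "is_linear_iso K (quotient_module X Z B) (quotient_module Y Z' B') ?F"
    unfolding is_linear_iso_def is_linear_def
  proof (intro conjI ahomI ballI)
    fix S assume "S \<in> carrier (quotient_module X Z B)"
    then obtain x where x: "S = B +>\<^bsub>X\<^esub> x" "x \<in> Z" by (auto simp: quotient_module_def)
    then show "?F S \<in> carrier (quotient_module Y Z' B')"
      using F[OF Zc[OF x(2)]] fZ by (auto simp: quotient_module_def)
    fix S' assume "S' \<in> carrier (quotient_module X Z B)"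
    then obtain x' where x': "S' = B +>\<^bsub>X\<^esub> x'" "x' \<in> Z" by (auto simp: quotient_module_def)
    show "?F (S \<oplus>\<^bsub>quotient_module X Z B\<^esub> S') = ?F S \<oplus>\<^bsub>quotient_module Y Z' B'\<^esub> ?F S'"
      using Zc[OF x(2)] Zc[OF x'(2)]
      by (simp add: quotient_module_def x(1) x'(1) coset_add[OF X B] coset_add[OF Y B'] F is_linearD[OF f])
  next
    fix c S assume c: "c \<in> carrier K" and "S \<in> carrier (quotient_module X Z B)"
    then obtain x where x: "S = B +>\<^bsub>X\<^esub> x" "x \<in> Z" by (auto simp: quotient_module_def)
    show "?F (c \<odot>\<^bsub>quotient_module X Z B\<^esub> S) = c \<odot>\<^bsub>quotient_module Y Z' B'\<^esub> ?F S"
      using Zc[OF x(2)] c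
      by (simp add: quotient_module_def x(1) coset_smult[OF X B] coset_smult[OF Y B'] F is_linearD[OF f] del: UN_simps)
  next
    show "bij_betw ?F (carrier (quotient_module X Z B)) (carrier (quotient_module Y Z' B'))"
      unfolding bij_betw_def
    proof
      show "inj_on ?F (carrier (quotient_module X Z B))"
      proof (rule inj_onI)
        fix S S' assume "S \<in> carrier (quotient_module X Z B)" "S' \<in> carrier (quotient_module X Z B)" and e: "?F S = ?F S'"
        then obtain x x' where x: "S = B +>\<^bsub>X\<^esub> x" "x \<in> Z" "S' = B +>\<^bsub>X\<^esub> x'" "x' \<in> Z"
          by (auto simp: quotient_module_def)
        note c = Zc[OF x(2)] Zc[OF x(4)]
        let ?z = "x \<ominus>\<^bsub>X\<^esub> x'"
        have z: "?z \<in> Z" using Z x by (auto simp: submodule_set_def)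
        have "B' +>\<^bsub>Y\<^esub> f x = B' +>\<^bsub>Y\<^esub> f x'" using e unfolding x(1,3) F[OF c(1)] F[OF c(2)] .
        then have "f ?z \<in> B'"
          using c by (simp add: coset_eq_iff[OF Y B'] is_linearD[OF f]
              ahom_minus[OF X.abelian_group_axioms Y.abelian_group_axioms is_linearD(1)[OF f]])
        then have 1: "g (f ?z) \<in> B" using gB by auto
        have "?z = g (f ?z) \<ominus>\<^bsub>X\<^esub> (g (f ?z) \<ominus>\<^bsub>X\<^esub> ?z)"
          using X.r_neg1[of "g (f ?z)" ?z] X.r_neg2[of "g (f ?z)" ?z] Zc[OF z] is_linearD(2)[OF g, of "f ?z"] is_linearD(2)[OF f, of ?z]
          unfolding X.minus_eq[of "g (f ?z)"] by (simp add: X.minus_add del: X.minus_eq)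
        also have "\<dots> \<in> B" using B 1 gf[OF z] by (simp add: submodule_set_def)
        finally show "S = S'" using c x by (simp add: coset_eq_iff[OF X B])
      qed
      have "B' +>\<^bsub>Y\<^esub> y \<in> ?F ` carrier (quotient_module X Z B)" if y: "y \<in> Z'" for y
      proof -
        have "B' +>\<^bsub>Y\<^esub> f (g y) = B' +>\<^bsub>Y\<^esub> y"
          using fg[OF y] Zc'[OF y] by (subst coset_eq_iff[OF Y B']) (simp_all add: is_linearD(2)[OF f] is_linearD(2)[OF g])
        then have "B' +>\<^bsub>Y\<^esub> y = ?F (B +>\<^bsub>X\<^esub> g y)"
          using F[of "g y"] Zc'[OF y] by (simp add: is_linearD(2)[OF g])
        then show ?thesis using y gZ by (auto simp: quotient_module_def)
      qed
      moreover have "?F (B +>\<^bsub>X\<^esub> x) \<in> carrier (quotient_module Y Z' B')" if "x \<in> Z" for x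
        using that F[OF Zc[OF that]] fZ by (auto simp: quotient_module_def)
      ultimately show "?F ` carrier (quotient_module X Z B) = carrier (quotient_module Y Z' B')"
        by (auto simp: quotient_module_def)
    qed
  qed
  then show ?thesis unfolding modules_isomorphic_def by blast
qed

lemma submodule_image:
  assumes X: "Module.module K X" and Y: "Module.module K Y" and f: "is_linear K X Y f"
  shows "submodule_set K Y (f ` carrier X)" "submodule_set K X (a_kernel X Y f)"
proof -
  interpret X: Module.module K X by fact
  interpret Y: Module.module K Y by fact
  note fh = is_linearD(1)[OF f]
  note m = ahom_minus[OF X.abelian_group_axioms Y.abelian_group_axioms fh]
    and z = ahom_zero[OF X.abelian_group_axioms Y.abelian_group_axioms fh]
  show "submodule_set K Y (f ` carrier X)"
    unfolding submodule_set_def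
  proof (intro conjI ballI)
    show "\<zero>\<^bsub>Y\<^esub> \<in> f ` carrier X" by (rule image_eqI[where x = "\<zero>\<^bsub>X\<^esub>"]) (simp_all add: z)
  qed (auto simp: is_linearD[OF f] simp flip: m is_linearD(3)[OF f])
  have "c \<odot>\<^bsub>Y\<^esub> \<zero>\<^bsub>Y\<^esub> = \<zero>\<^bsub>Y\<^esub>" if "c \<in> carrier K" for c using that by (rule Y.smult_r_null)
  then show "submodule_set K X (a_kernel X Y f)"
    unfolding submodule_set_def by (auto simp: a_kernel_def' is_linearD[OF f] m z Y.minus_eq)
qed

lemma submodule_boundaries:
  assumes "\<And>n. Module.module K (C n)" "\<And>n. is_linear K (C n) (C (Suc n)) (d n)"
  shows "submodule_set K (C n) (boundaries C d n)"
proof (cases n)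
  case 0
  interpret X: Module.module K "C 0" by fact
  show ?thesis unfolding submodule_set_def using 0 by (simp add: boundaries_def X.minus_eq X.smult_r_null)
next
  case (Suc m)
  then show ?thesis using submodule_image(1)[OF assms(1,1) assms(2)] by (simp add: boundaries_def)
qed

text \<open>The condition on round trips is imposed on cocycles only; there a homotopy gives it directly.\<close>

theorem cohomology_homotopy_iso:
  fixes K :: "'k ring"
  assumes C: "\<And>n. Module.module K (C n)" "\<And>n. is_linear K (C n) (C (Suc n)) (d n)"
    and C': "\<And>n. Module.module K (C' n)" "\<And>n. is_linear K (C' n) (C' (Suc n)) (d' n)"
    and f: "\<And>n. is_linear K (C n) (C' n) (f n)" "\<And>n x. x \<in> carrier (C n) ==> d' n (f n x) = f (Suc n) (d n x)"
    and g: "\<And>n. is_linear K (C' n) (C n) (g n)" "\<And>n x. x \<in> carrier (C' n) ==> d n (g n x) = g (Suc n) (d' n x)"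
    and gf: "\<And>n x. x \<in> a_kernel (C n) (C (Suc n)) (d n) ==> g n (f n x) \<ominus>\<^bsub>C n\<^esub> x \<in> boundaries C d n"
    and fg: "\<And>n y. y \<in> a_kernel (C' n) (C' (Suc n)) (d' n) ==> f n (g n y) \<ominus>\<^bsub>C' n\<^esub> y \<in> boundaries C' d' n"
  shows "modules_isomorphic K (cohomology C d n) (cohomology C' d' n)"
  unfolding cohomology_def boundaries_def[symmetric]
proof (rule quotient_iso[OF C(1) C'(1) submodule_boundaries[where C = C and d = d, OF C] submodule_boundaries[where C = C' and d = d', OF C']
      submodule_image(2)[OF C(1) C(1) C(2)] submodule_image(2)[OF C'(1) C'(1) C'(2)] f(1) g(1) _ _ _ _ gf fg])
  have ag: "abelian_group (C n)" "abelian_group (C' n)" for n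
    using C(1) C'(1) by (simp_all add: Module.module_def)
  note z = ahom_zero[OF ag(1) ag(2) is_linearD(1)[OF f(1)]] ahom_zero[OF ag(2) ag(1) is_linearD(1)[OF g(1)]]
  show "f n ` a_kernel (C n) (C (Suc n)) (d n) \<subseteq> a_kernel (C' n) (C' (Suc n)) (d' n)"
    by (auto simp: a_kernel_def' f(2) z is_linearD(2)[OF f(1)])
  show "g n ` a_kernel (C' n) (C' (Suc n)) (d' n) \<subseteq> a_kernel (C n) (C (Suc n)) (d n)"
    by (auto simp: a_kernel_def' g(2) z is_linearD(2)[OF g(1)])
  show "f n ` boundaries C d n \<subseteq> boundaries C' d' n" "g n ` boundaries C' d' n \<subseteq> boundaries C d n"
    by (cases n; auto simp: boundaries_def z f(2)[symmetric] g(2)[symmetric] is_linearD(2)[OF f(1)] is_linearD(2)[OF g(1)])+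
qed

section \<open>Comparison of projective resolutions\<close>

lemma lin_maps_minus:
  assumes X: "lmodule R X" and Y: "lmodule R Y" and f: "f \<in> lin_maps R X Y" and g: "g \<in> lin_maps R X Y"
  shows "(\<lambda>x\<in>carrier X. f x \<ominus>\<^bsub>Y\<^esub> g x) \<in> lin_maps R X Y"
proof -
  interpret Y: abelian_group Y using Y by (rule lmodule_group)
  note c = lin_mapsD[OF f] lin_mapsD[OF g]
  have m: "u \<odot>\<^bsub>Y\<^esub> (y \<ominus>\<^bsub>Y\<^esub> y') = u \<odot>\<^bsub>Y\<^esub> y \<ominus>\<^bsub>Y\<^esub> u \<odot>\<^bsub>Y\<^esub> y'"
    if "u \<in> carrier R" "y \<in> carrier Y" "y' \<in> carrier Y" for u y y'
    using ahom_minus[OF Y.abelian_group_axioms Y.abelian_group_axioms smult_ahom[OF Y that(1)] that(2,3)] .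
  show ?thesis
  proof (intro lin_mapsI ahomI)
    fix u x assume "u \<in> carrier R" "x \<in> carrier X"
    then show "(\<lambda>x\<in>carrier X. f x \<ominus>\<^bsub>Y\<^esub> g x) (u \<odot>\<^bsub>X\<^esub> x) = u \<odot>\<^bsub>Y\<^esub> (\<lambda>x\<in>carrier X. f x \<ominus>\<^bsub>Y\<^esub> g x) x"
      using X by (simp add: smult_closed m c)
  qed (use c lmodule_group[OF X] in \<open>simp_all add: add_closed Y.minus_eq Y.minus_add Y.a_ac\<close>)
qed

lemma lmodule_kernel:
  assumes Y: "lmodule R Y" and Z: "lmodule R Z" and q: "q \<in> lin_maps R Y Z"
  shows "lmodule R (Y\<lparr>carrier := a_kernel Y Z q\<rparr>)"
proof -
  interpret Y: abelian_group Y using Y by (rule lmodule_group)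
  interpret Z: abelian_group Z using Z by (rule lmodule_group)
  note ql = lin_mapsD[OF q]
  have q0: "q \<zero>\<^bsub>Y\<^esub> = \<zero>\<^bsub>Z\<^esub>" by (rule ahom_zero[OF Y.abelian_group_axioms Z.abelian_group_axioms ql(1)])
  have qi: "q (\<ominus>\<^bsub>Y\<^esub> y) = \<ominus>\<^bsub>Z\<^esub> q y" if "y \<in> carrier Y" for y
    using ahom_minus[OF Y.abelian_group_axioms Z.abelian_group_axioms ql(1) Y.zero_closed that] that
    by (simp add: Y.minus_eq Z.minus_eq q0 ql(2))
  have z: "u \<odot>\<^bsub>Z\<^esub> \<zero>\<^bsub>Z\<^esub> = \<zero>\<^bsub>Z\<^esub>" if "u \<in> carrier R" for u
    by (rule ahom_zero[OF Z.abelian_group_axioms Z.abelian_group_axioms smult_ahom[OF Z that]])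
  show ?thesis
  proof (rule lmoduleI)
    show "abelian_group (Y\<lparr>carrier := a_kernel Y Z q\<rparr>)"
    proof (rule abelian_groupI)
      fix x assume "x \<in> carrier (Y\<lparr>carrier := a_kernel Y Z q\<rparr>)"
      then have "x \<in> carrier Y" "q x = \<zero>\<^bsub>Z\<^esub>" by (auto simp: a_kernel_def')
      then show "\<exists>y\<in>carrier (Y\<lparr>carrier := a_kernel Y Z q\<rparr>). y \<oplus>\<^bsub>Y\<lparr>carrier := a_kernel Y Z q\<rparr>\<^esub> x = \<zero>\<^bsub>Y\<lparr>carrier := a_kernel Y Z q\<rparr>\<^esub>"
        by (intro bexI[of _ "\<ominus>\<^bsub>Y\<^esub> x"]) (simp_all add: a_kernel_def' qi Y.l_neg)
    qed (auto simp: a_kernel_def' ql q0 Y.a_ac)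
  qed (use Y z in \<open>auto simp: a_kernel_def' ql lmodule.lsmult_closed lmodule.lsmult_l_distr lmodule.lsmult_r_distr
      lmodule.lsmult_assoc lmodule.lsmult_one lmodule_def\<close>)
qed

lemma projectiveD:
  fixes P X Y :: "('w, 'w) module" and R :: "('w, 'a) ring_scheme"
  assumes "projective R P" "lmodule R X" "lmodule R Y" "p \<in> lin_maps R X Y" "p ` carrier X = carrier Y" "f \<in> lin_maps R P Y"
  shows "\<exists>g\<in>lin_maps R P X. \<forall>x\<in>carrier P. p (g x) = f x"
  using assms(1) unfolding projective_def
  by (elim conjE) (erule allE[of _ X], erule allE[of _ Y], erule allE[of _ p], erule allE[of _ f], erule mp, intro conjI assms)

text \<open>By exactness \<open>h\<close> takes values in a submodule onto which \<open>p\<close> is surjective.\<close>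

lemma projective_lift_exact:
  fixes P X Y Z :: "('w, 'w) module" and R :: "('w, 'a) ring_scheme"
  assumes P: "projective R P" and X: "lmodule R X" and Y: "lmodule R Y" and Z: "lmodule R Z"
    and p: "p \<in> lin_maps R X Y" and q: "q \<in> lin_maps R Y Z"
    and ex: "a_kernel Y Z q = p ` carrier X" and h: "h \<in> lin_maps R P Y"
    and qh: "\<And>x. x \<in> carrier P ==> q (h x) = \<zero>\<^bsub>Z\<^esub>"
  shows "\<exists>k\<in>lin_maps R P X. \<forall>x\<in>carrier P. p (k x) = h x"
proof -
  let ?Y = "Y\<lparr>carrier := a_kernel Y Z q\<rparr>"
  have "lmodule R ?Y" by (rule lmodule_kernel[OF Y Z q])
  moreover have "p \<in> lin_maps R X ?Y"
    using ex by (intro lin_mapsI ahomI) (simp_all add: lin_mapsD[OF p])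
  moreover have "h \<in> lin_maps R P ?Y"
    using qh by (intro lin_mapsI ahomI) (simp_all add: lin_mapsD[OF h] a_kernel_def')
  ultimately show ?thesis
    by (intro projectiveD[OF P X]) (simp_all add: ex)
qed

context
  fixes R :: "('w, 'a) ring_scheme" and N :: "('w, 'w) module" and P d e
  assumes N: "lmodule R N" and res: "projective_resolution R N P d e"
begin

lemma res_projective: "projective R (P n)"
  and res_lmodule: "lmodule R (P n)"
  and res_d: "d n \<in> lin_maps R (P (Suc n)) (P n)"
  and res_e: "e \<in> lin_maps R (P 0) N"
  and res_surj: "e ` carrier (P 0) = carrier N"
  and res_exact0: "a_kernel (P 0) N e = d 0 ` carrier (P (Suc 0))"
  and res_exact: "a_kernel (P (Suc n)) (P n) (d n) = d (Suc n) ` carrier (P (Suc (Suc n)))"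
  using res by (auto simp: projective_resolution_def projective_def)

lemma res_ed: "x \<in> carrier (P (Suc 0)) ==> e (d 0 x) = \<zero>\<^bsub>N\<^esub>"
  using res_exact0 by (auto simp: a_kernel_def')

lemma res_dd: "x \<in> carrier (P (Suc (Suc n))) ==> d n (d (Suc n) x) = \<zero>\<^bsub>P n\<^esub>"
  using res_exact[of n] by (auto simp: a_kernel_def')

end

lemma resolution_chain_map:
  fixes R :: "('w, 'a) ring_scheme"
  assumes N: "lmodule R N" and P: "projective_resolution R N P d e" and Q: "projective_resolution R N Q \<delta> \<epsilon>"
  shows "\<exists>F. (\<forall>n. F n \<in> lin_maps R (P n) (Q n)) \<and> (\<forall>x\<in>carrier (P 0). \<epsilon> (F 0 x) = e x) \<and>
    (\<forall>n. \<forall>x\<in>carrier (P (Suc n)). \<delta> n (F (Suc n) x) = F n (d n x))"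
proof -
  note p = res_projective[OF N P] res_lmodule[OF N P] res_d[OF N P] res_e[OF N P] res_ed[OF N P] res_dd[OF N P]
  note q = res_lmodule[OF N Q] res_d[OF N Q] res_e[OF N Q] res_surj[OF N Q] res_exact0[OF N Q] res_exact[OF N Q] res_dd[OF N Q]
  \<comment> \<open>the condition that lets the next map be lifted\<close>
  let ?ok = "\<lambda>n f. f \<in> lin_maps R (P n) (Q n) \<and> (n = 0 \<longrightarrow> (\<forall>x\<in>carrier (P 0). \<epsilon> (f x) = e x)) \<and>
    (\<forall>m. n = Suc m \<longrightarrow> (\<forall>x\<in>carrier (P (Suc n)). \<delta> m (f (d n x)) = \<zero>\<^bsub>Q m\<^esub>))"
  have "\<exists>F. \<forall>n. ?ok n (F n) \<and> (\<forall>x\<in>carrier (P (Suc n)). \<delta> n (F (Suc n) x) = F n (d n x))"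
  proof (rule dependent_nat_choice)
    obtain f where "f \<in> lin_maps R (P 0) (Q 0)" "\<forall>x\<in>carrier (P 0). \<epsilon> (f x) = e x"
      using projectiveD[OF p(1) q(1) N q(3,4) p(4)] ..
    then show "\<exists>f. ?ok 0 f" by (intro exI[of _ f]) simp
  next
    fix f n assume f: "?ok n f"
    note fl = lin_mapsD[OF f[THEN conjunct1]]
    let ?h = "compose (carrier (P (Suc n))) f (d n)"
    have h: "?h \<in> lin_maps R (P (Suc n)) (Q n)"
      by (rule lin_maps_compose[OF p(3) f[THEN conjunct1] p(2)])
    have "\<exists>k\<in>lin_maps R (P (Suc n)) (Q (Suc n)). \<forall>x\<in>carrier (P (Suc n)). \<delta> n (k x) = ?h x"
    proof (cases n)
      case 0
      show ?thesis unfolding 0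
        by (rule projective_lift_exact[OF p(1) q(1,1) N q(2,3,5) h[unfolded 0]])
          (use f 0 p(5) lin_mapsD(2)[OF p(3)] in \<open>simp add: compose_eq\<close>)
    next
      case (Suc m)
      show ?thesis unfolding Suc
        by (rule projective_lift_exact[OF p(1) q(1,1,1,2,2,6) h[unfolded Suc]]) (use f Suc in \<open>simp add: compose_eq\<close>)
    qed
    then obtain k where k: "k \<in> lin_maps R (P (Suc n)) (Q (Suc n))"
        and dk: "\<And>x. x \<in> carrier (P (Suc n)) ==> \<delta> n (k x) = f (d n x)"
      by (auto simp: compose_eq)
    have f0: "f \<zero>\<^bsub>P n\<^esub> = \<zero>\<^bsub>Q n\<^esub>"
      by (rule ahom_zero[OF lmodule_group[OF p(2)] lmodule_group[OF q(1)] fl(1)])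
    have "?ok (Suc n) k"
      using k dk f0 p(6) lin_mapsD(2)[OF p(3)] by simp
    then show "\<exists>g. ?ok (Suc n) g \<and> (\<forall>x\<in>carrier (P (Suc n)). \<delta> n (g x) = f (d n x))"
      using dk by (intro exI[of _ k] conjI) simp_all
  qed
  then obtain F where "\<forall>n. ?ok n (F n) \<and> (\<forall>x\<in>carrier (P (Suc n)). \<delta> n (F (Suc n) x) = F n (d n x))" ..
  then show ?thesis by (intro exI[of _ F]) simp
qed

lemma resolution_homotopy:
  fixes R :: "('w, 'a) ring_scheme"
  assumes N: "lmodule R N" and P: "projective_resolution R N P d e" and Q: "projective_resolution R N Q \<delta> \<epsilon>"
    and h: "\<And>n. h n \<in> lin_maps R (P n) (Q n)" "\<And>x. x \<in> carrier (P 0) ==> \<epsilon> (h 0 x) = \<zero>\<^bsub>N\<^esub>"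
    "\<And>n x. x \<in> carrier (P (Suc n)) ==> \<delta> n (h (Suc n) x) = h n (d n x)"
  shows "\<exists>S. (\<forall>n. S n \<in> lin_maps R (P n) (Q (Suc n))) \<and> (\<forall>x\<in>carrier (P 0). \<delta> 0 (S 0 x) = h 0 x) \<and>
    (\<forall>n. \<forall>x\<in>carrier (P (Suc n)). \<delta> (Suc n) (S (Suc n) x) = h (Suc n) x \<ominus>\<^bsub>Q (Suc n)\<^esub> S n (d n x))"
proof -
  note p = res_projective[OF N P] res_lmodule[OF N P] res_d[OF N P] res_dd[OF N P]
  note q = res_lmodule[OF N Q] res_d[OF N Q] res_e[OF N Q] res_exact0[OF N Q] res_exact[OF N Q] res_dd[OF N Q]
  note hl = lin_mapsD[OF h(1)]
  note dl = lin_mapsD[OF p(3)] and \<delta>l = lin_mapsD[OF q(2)]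
  let ?ok = "\<lambda>n f. f \<in> lin_maps R (P n) (Q (Suc n)) \<and> (n = 0 \<longrightarrow> (\<forall>x\<in>carrier (P 0). \<delta> 0 (f x) = h 0 x)) \<and>
    (\<forall>x\<in>carrier (P (Suc n)). \<delta> n (f (d n x)) = h n (d n x))"
  have "\<exists>S. \<forall>n. ?ok n (S n) \<and> (\<forall>x\<in>carrier (P (Suc n)). \<delta> (Suc n) (S (Suc n) x) = h (Suc n) x \<ominus>\<^bsub>Q (Suc n)\<^esub> S n (d n x))"
  proof (rule dependent_nat_choice)
    obtain f where "f \<in> lin_maps R (P 0) (Q (Suc 0))" "\<forall>x\<in>carrier (P 0). \<delta> 0 (f x) = h 0 x"
      using projective_lift_exact[OF p(1) q(1,1) N q(2,3,4) h(1) h(2)] ..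
    then show "\<exists>f. ?ok 0 f" using dl(2) by (intro exI[of _ f]) simp
  next
    fix f n assume f: "?ok n f"
    note fl = lin_mapsD[OF f[THEN conjunct1]]
    interpret Qn: abelian_group "Q n" by (rule lmodule_group[OF q(1)])
    interpret QS: abelian_group "Q (Suc n)" by (rule lmodule_group[OF q(1)])
    let ?h = "\<lambda>x\<in>carrier (P (Suc n)). h (Suc n) x \<ominus>\<^bsub>Q (Suc n)\<^esub> compose (carrier (P (Suc n))) f (d n) x"
    have "compose (carrier (P (Suc n))) f (d n) \<in> lin_maps R (P (Suc n)) (Q (Suc n))"
      by (rule lin_maps_compose[OF p(3) f[THEN conjunct1] p(2)])
    then have hh: "?h \<in> lin_maps R (P (Suc n)) (Q (Suc n))"
      by (rule lin_maps_minus[OF p(2) q(1) h(1)])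
    have "\<exists>k\<in>lin_maps R (P (Suc n)) (Q (Suc (Suc n))). \<forall>x\<in>carrier (P (Suc n)). \<delta> (Suc n) (k x) = ?h x"
    proof (rule projective_lift_exact[OF p(1) q(1,1,1,2,2,5) hh])
      fix x assume x: "x \<in> carrier (P (Suc n))"
      have "\<delta> n (?h x) = \<delta> n (h (Suc n) x) \<ominus>\<^bsub>Q n\<^esub> \<delta> n (f (d n x))"
        using x ahom_minus[OF QS.abelian_group_axioms Qn.abelian_group_axioms \<delta>l(1)] hl(2) fl(2) dl(2)
        by (simp add: compose_eq)
      then show "\<delta> n (?h x) = \<zero>\<^bsub>Q n\<^esub>"
        using x f h(3) hl(2) dl(2) by (simp add: Qn.minus_eq Qn.r_neg)
    qed
    then obtain k where k: "k \<in> lin_maps R (P (Suc n)) (Q (Suc (Suc n)))"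
        and dk: "\<And>x. x \<in> carrier (P (Suc n)) ==> \<delta> (Suc n) (k x) = h (Suc n) x \<ominus>\<^bsub>Q (Suc n)\<^esub> f (d n x)"
      by (auto simp: compose_eq)
    have f0: "f \<zero>\<^bsub>P n\<^esub> = \<zero>\<^bsub>Q (Suc n)\<^esub>"
      by (rule ahom_zero[OF lmodule_group[OF p(2)] lmodule_group[OF q(1)] fl(1)])
    have "?ok (Suc n) k"
      using k dk f0 p(4) dl(2) hl(2) by (simp add: QS.minus_eq)
    then show "\<exists>g. ?ok (Suc n) g \<and> (\<forall>x\<in>carrier (P (Suc n)). \<delta> (Suc n) (g x) = h (Suc n) x \<ominus>\<^bsub>Q (Suc n)\<^esub> f (d n x))"
      using dk by (intro exI[of _ k] conjI) simp_all
  qed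
  then obtain S where "\<forall>n. ?ok n (S n) \<and> (\<forall>x\<in>carrier (P (Suc n)). \<delta> (Suc n) (S (Suc n) x) = h (Suc n) x \<ominus>\<^bsub>Q (Suc n)\<^esub> S n (d n x))" ..
  then show ?thesis by (intro exI[of _ S]) simp
qed

context bialgebroid_setting
begin

lemma HomU_minus:
  assumes N: "umod N" and X: "umod X" and f: "f \<in> lin X N" and g: "g \<in> lin X N" and x: "x \<in> carrier X"
  shows "(f \<ominus>\<^bsub>HomU H N X\<^esub> g) x = f x \<ominus>\<^bsub>N\<^esub> g x"
proof -
  interpret C: Module.module K "HomU H N X" by (rule HomU_module[OF N X])
  have "(\<lambda>f. f x) \<in> ahom (HomU H N X) N"
    by (rule ahomI) (use x in \<open>simp_all add: lin_mapsD\<close>)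
  from ahom_minus[OF C.abelian_group_axioms lmodule_group[OF N] this, of f g] f g show ?thesis by simp
qed

text \<open>Maps of resolutions over the identity are unique up to homotopy, so a round trip changes a cocycle
  by a coboundary.\<close>

lemma HomU_round_trip:
  assumes N: "umod N" and M: "umod M" and P: "projective_resolution U N P d e"
    and k: "\<And>n. k n \<in> lin (P n) (P n)" "\<And>x. x \<in> carrier (P 0) ==> e (k 0 x) = e x"
      "\<And>n x. x \<in> carrier (P (Suc n)) ==> d n (k (Suc n) x) = k n (d n x)"
    and \<phi>: "\<phi> \<in> a_kernel (HomU H M (P n)) (HomU H M (P (Suc n))) (precomp (P (Suc n)) (P n) (d n))"
  shows "precomp (P n) (P n) (k n) \<phi> \<ominus>\<^bsub>HomU H M (P n)\<^esub> \<phi> \<in>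
    boundaries (\<lambda>n. HomU H M (P n)) (\<lambda>n. precomp (P (Suc n)) (P n) (d n)) n"
proof -
  note p = res_lmodule[OF N P] res_d[OF N P] res_e[OF N P]
  note kl = lin_mapsD[OF k(1)] and dl = lin_mapsD[OF p(2)]
  interpret M: abelian_group M by (rule lmodule_group[OF M])
  interpret N: abelian_group N by (rule lmodule_group[OF N])
  have ag: "abelian_group (P n)" for n by (rule lmodule_group[OF p(1)])
  let ?h = "\<lambda>n. \<lambda>x\<in>carrier (P n). k n x \<ominus>\<^bsub>P n\<^esub> idm (P n) x"
  have h: "?h n \<in> lin (P n) (P n)" for n
    by (rule lin_maps_minus[OF p(1) p(1) k(1) lin_maps_id[OF p(1)]])
  have h0: "e (?h 0 x) = \<zero>\<^bsub>N\<^esub>" if "x \<in> carrier (P 0)" for x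
    using that ahom_minus[OF ag N.abelian_group_axioms lin_mapsD(1)[OF p(3)]] kl(2) k(2) lin_mapsD(2)[OF p(3)]
    by (simp add: N.minus_eq N.r_neg)
  have hd: "d n (?h (Suc n) x) = ?h n (d n x)" if "x \<in> carrier (P (Suc n))" for n x
    using that ahom_minus[OF ag ag dl(1)] kl(2) dl(2) k(3) by simp
  have "\<exists>S. (\<forall>n. S n \<in> lin (P n) (P (Suc n))) \<and> (\<forall>x\<in>carrier (P 0). d 0 (S 0 x) = ?h 0 x) \<and>
      (\<forall>n. \<forall>x\<in>carrier (P (Suc n)). d (Suc n) (S (Suc n) x) = ?h (Suc n) x \<ominus>\<^bsub>P (Suc n)\<^esub> S n (d n x))"
    by (rule resolution_homotopy[OF N P P h]) (use h0 hd in simp_all)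
  then obtain S where SS: "(\<forall>n. S n \<in> lin (P n) (P (Suc n))) \<and> (\<forall>x\<in>carrier (P 0). d 0 (S 0 x) = ?h 0 x) \<and>
      (\<forall>n. \<forall>x\<in>carrier (P (Suc n)). d (Suc n) (S (Suc n) x) = ?h (Suc n) x \<ominus>\<^bsub>P (Suc n)\<^esub> S n (d n x))" ..
  have S: "\<And>n. S n \<in> lin (P n) (P (Suc n))" "\<And>x. x \<in> carrier (P 0) ==> d 0 (S 0 x) = ?h 0 x"
      "\<And>n x. x \<in> carrier (P (Suc n)) ==> d (Suc n) (S (Suc n) x) = ?h (Suc n) x \<ominus>\<^bsub>P (Suc n)\<^esub> S n (d n x)"
    using SS[THEN conjunct1] SS[THEN conjunct2, THEN conjunct1] SS[THEN conjunct2, THEN conjunct2] by blast+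
  have \<phi>l: "\<phi> \<in> lin (P n) M" using \<phi> by (simp add: a_kernel_def')
  note \<phi>m = ahom_minus[OF ag M.abelian_group_axioms lin_mapsD(1)[OF \<phi>l]]
  have "precomp (P (Suc n)) (P n) (d n) \<phi> = (\<lambda>x\<in>carrier (P (Suc n)). \<zero>\<^bsub>M\<^esub>)"
    using \<phi> by (simp add: a_kernel_def')
  then have z: "\<phi> (d n x) = \<zero>\<^bsub>M\<^esub>" if "x \<in> carrier (P (Suc n))" for x
    using compose_eq[OF that, of \<phi> "d n"] that by (simp add: precomp_def)
  have r: "precomp (P n) (P n) (k n) \<phi> \<in> lin (P n) M"
    unfolding precomp_def by (rule lin_maps_compose[OF k(1) \<phi>l p(1)])
  interpret C: Module.module K "HomU H M (P n)" by (rule HomU_module[OF M p(1)])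
  let ?D = "precomp (P n) (P n) (k n) \<phi> \<ominus>\<^bsub>HomU H M (P n)\<^esub> \<phi>"
  have D: "?D \<in> lin (P n) M"
    using C.minus_closed[of "precomp (P n) (P n) (k n) \<phi>" \<phi>] r \<phi>l by simp
  have v: "?D x = \<phi> (?h n x)" if x: "x \<in> carrier (P n)" for x
    using x HomU_minus[OF M p(1) r \<phi>l x] \<phi>m kl(2) by (simp add: precomp_def compose_eq)
  show ?thesis
  proof (cases n)
    case 0
    have "?D = \<zero>\<^bsub>HomU H M (P n)\<^esub>"
    proof (rule lin_maps_eqI[OF D])
      show "\<zero>\<^bsub>HomU H M (P n)\<^esub> \<in> lin (P n) M" using C.zero_closed by simp
      fix x assume x: "x \<in> carrier (P n)"
      have "S 0 x \<in> carrier (P (Suc 0))" using x 0 lin_mapsD(2)[OF S(1)] by simp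
      then show "?D x = \<zero>\<^bsub>HomU H M (P n)\<^esub> x"
        using x v[OF x] S(2)[of x] z[of "S 0 x"] 0 by simp
    qed
    then show ?thesis using 0 by (simp add: boundaries_def)
  next
    case (Suc m)
    have b: "compose (carrier (P m)) \<phi> (S m) \<in> lin (P m) M"
      using \<phi>l unfolding Suc by (rule lin_maps_compose[OF S(1) _ p(1)])
    have "?D = precomp (P (Suc m)) (P m) (d m) (compose (carrier (P m)) \<phi> (S m))"
    proof (rule lin_maps_eqI[OF D])
      show "precomp (P (Suc m)) (P m) (d m) (compose (carrier (P m)) \<phi> (S m)) \<in> lin (P n) M"
        unfolding precomp_def Suc by (rule lin_maps_compose[OF p(2) b p(1)])
      fix x assume x: "x \<in> carrier (P n)"
      then have x': "x \<in> carrier (P (Suc m))" using Suc by simp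
      have c: "S (Suc m) x \<in> carrier (P (Suc n))" "d m x \<in> carrier (P m)" "S m (d m x) \<in> carrier (P n)"
        "?h n x \<in> carrier (P n)"
        using x x' Suc lin_mapsD(2)[OF S(1)] dl(2) lin_mapsD(2)[OF h] by auto
      have "\<zero>\<^bsub>M\<^esub> = \<phi> (?h n x) \<ominus>\<^bsub>M\<^esub> \<phi> (S m (d m x))"
        using z[OF c(1)] S(3)[OF x'] \<phi>m[OF c(4) c(3)] Suc by simp
      moreover have "\<phi> (?h n x) = (\<phi> (?h n x) \<ominus>\<^bsub>M\<^esub> \<phi> (S m (d m x))) \<oplus>\<^bsub>M\<^esub> \<phi> (S m (d m x))"
        using lin_mapsD(2)[OF \<phi>l c(3)] lin_mapsD(2)[OF \<phi>l c(4)] unfolding M.minus_eq by (simp only: M.a_assoc M.l_neg M.r_zero M.a_inv_closed)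
      ultimately have "\<phi> (?h n x) = \<phi> (S m (d m x))"
        using lin_mapsD(2)[OF \<phi>l c(3)] by (metis M.l_zero)
      then show "?D x = precomp (P (Suc m)) (P m) (d m) (compose (carrier (P m)) \<phi> (S m)) x"
        using v[OF x] x' c(2) by (simp add: precomp_def compose_eq)
    qed
    then show ?thesis using Suc b by (simp add: boundaries_def)
  qed
qed

theorem Ext_comparison:
  assumes N: "umod N" and M: "umod M"
    and P: "projective_resolution U N P d e" and Q: "projective_resolution U N Q \<delta> \<epsilon>'"
  shows "modules_isomorphic K
    (cohomology (\<lambda>n. HomU H M (P n)) (\<lambda>n. precomp (P (Suc n)) (P n) (d n)) n)
    (cohomology (\<lambda>n. HomU H M (Q n)) (\<lambda>n. precomp (Q (Suc n)) (Q n) (\<delta> n)) n)"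
proof -
  note p = res_lmodule[OF N P] res_d[OF N P]
  note q = res_lmodule[OF N Q] res_d[OF N Q]
  from resolution_chain_map[OF N P Q] obtain F where FF: "(\<forall>n. F n \<in> lin (P n) (Q n)) \<and> (\<forall>x\<in>carrier (P 0). \<epsilon>' (F 0 x) = e x) \<and>
      (\<forall>n. \<forall>x\<in>carrier (P (Suc n)). \<delta> n (F (Suc n) x) = F n (d n x))" ..
  have F: "\<And>n. F n \<in> lin (P n) (Q n)" "\<And>x. x \<in> carrier (P 0) ==> \<epsilon>' (F 0 x) = e x"
      "\<And>n x. x \<in> carrier (P (Suc n)) ==> \<delta> n (F (Suc n) x) = F n (d n x)"
    using FF by simp_all
  from resolution_chain_map[OF N Q P] obtain G where GG: "(\<forall>n. G n \<in> lin (Q n) (P n)) \<and> (\<forall>x\<in>carrier (Q 0). e (G 0 x) = \<epsilon>' x) \<and>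
      (\<forall>n. \<forall>x\<in>carrier (Q (Suc n)). d n (G (Suc n) x) = G n (\<delta> n x))" ..
  have G: "\<And>n. G n \<in> lin (Q n) (P n)" "\<And>x. x \<in> carrier (Q 0) ==> e (G 0 x) = \<epsilon>' x"
      "\<And>n x. x \<in> carrier (Q (Suc n)) ==> d n (G (Suc n) x) = G n (\<delta> n x)"
    using GG by simp_all
  note Fc = lin_mapsD(2)[OF F(1)] and Gc = lin_mapsD(2)[OF G(1)]
    and dc = lin_mapsD(2)[OF p(2)] and \<delta>c = lin_mapsD(2)[OF q(2)]
  have GF: "compose (carrier (P n)) (G n) (F n) \<in> lin (P n) (P n)" for n
    by (rule lin_maps_compose[OF F(1) G(1) p(1)])
  have FG: "compose (carrier (Q n)) (F n) (G n) \<in> lin (Q n) (Q n)" for n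
    by (rule lin_maps_compose[OF G(1) F(1) q(1)])
  show ?thesis
  proof (rule cohomology_homotopy_iso)
    show "is_linear K (HomU H M (P n)) (HomU H M (P (Suc n))) (precomp (P (Suc n)) (P n) (d n))" for n
      by (rule precomp_lin[OF p(1) p(1) M p(2)])
    show "is_linear K (HomU H M (Q n)) (HomU H M (Q (Suc n))) (precomp (Q (Suc n)) (Q n) (\<delta> n))" for n
      by (rule precomp_lin[OF q(1) q(1) M q(2)])
    show "is_linear K (HomU H M (P n)) (HomU H M (Q n)) (precomp (Q n) (P n) (G n))" for n
      by (rule precomp_lin[OF q(1) p(1) M G(1)])
    show "is_linear K (HomU H M (Q n)) (HomU H M (P n)) (precomp (P n) (Q n) (F n))" for n
      by (rule precomp_lin[OF p(1) q(1) M F(1)])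
    show "precomp (Q (Suc n)) (Q n) (\<delta> n) (precomp (Q n) (P n) (G n) \<phi>) =
        precomp (Q (Suc n)) (P (Suc n)) (G (Suc n)) (precomp (P (Suc n)) (P n) (d n) \<phi>)" for n \<phi>
      by (auto simp: precomp_def compose_def Gc \<delta>c G(3))
    show "precomp (P (Suc n)) (P n) (d n) (precomp (P n) (Q n) (F n) \<phi>) =
        precomp (P (Suc n)) (Q (Suc n)) (F (Suc n)) (precomp (Q (Suc n)) (Q n) (\<delta> n) \<phi>)" for n \<phi>
      by (auto simp: precomp_def compose_def Fc dc F(3))
    show "precomp (P n) (Q n) (F n) (precomp (Q n) (P n) (G n) \<phi>) \<ominus>\<^bsub>HomU H M (P n)\<^esub> \<phi>
        \<in> boundaries (\<lambda>n. HomU H M (P n)) (\<lambda>n. precomp (P (Suc n)) (P n) (d n)) n"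
      if "\<phi> \<in> a_kernel (HomU H M (P n)) (HomU H M (P (Suc n))) (precomp (P (Suc n)) (P n) (d n))" for n \<phi>
    proof -
      have "precomp (P n) (Q n) (F n) (precomp (Q n) (P n) (G n) \<phi>) = precomp (P n) (P n) (compose (carrier (P n)) (G n) (F n)) \<phi>"
        by (auto simp: precomp_def compose_def Fc)
      then show ?thesis
        using HomU_round_trip[OF N M P GF _ _ that] by (simp add: compose_eq Fc dc F(2,3) G(2,3))
    qed
    show "precomp (Q n) (P n) (G n) (precomp (P n) (Q n) (F n) \<phi>) \<ominus>\<^bsub>HomU H M (Q n)\<^esub> \<phi>
        \<in> boundaries (\<lambda>n. HomU H M (Q n)) (\<lambda>n. precomp (Q (Suc n)) (Q n) (\<delta> n)) n"
      if "\<phi> \<in> a_kernel (HomU H M (Q n)) (HomU H M (Q (Suc n))) (precomp (Q (Suc n)) (Q n) (\<delta> n))" for n \<phi>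
    proof -
      have "precomp (Q n) (P n) (G n) (precomp (P n) (Q n) (F n) \<phi>) = precomp (Q n) (Q n) (compose (carrier (Q n)) (F n) (G n)) \<phi>"
        by (auto simp: precomp_def compose_def Gc)
      then show ?thesis
        using HomU_round_trip[OF N M Q FG _ _ that] by (simp add: compose_eq Gc \<delta>c F(2,3) G(2,3))
    qed
  qed (rule HomU_module[OF M p(1)] HomU_module[OF M q(1)])+
qed

corollary Ext_resolution:
  assumes N: "umod N" and M: "umod M" and P: "projective_resolution U N P d e"
  shows "modules_isomorphic K
    (cohomology (\<lambda>n. HomU H M (P n)) (\<lambda>n. precomp (P (Suc n)) (P n) (d n)) n) (ExtU H N M n)"
proof -
  let ?R = "\<lambda>(P, d, e). projective_resolution U N P d e"
  obtain Q \<delta> \<epsilon>' where Q: "(SOME r. ?R r) = (Q, \<delta>, \<epsilon>')" by (metis prod_cases3)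
  have "?R (SOME r. ?R r)" by (rule someI[of ?R "(P, d, e)"]) (simp add: P)
  then have "projective_resolution U N Q \<delta> \<epsilon>'" unfolding Q by simp
  from Ext_comparison[OF N M P this] show ?thesis by (simp add: ExtU_def Q)
qed

end

section \<open>The dual basis of a projective module\<close>

lemma ahom_finsum:
  assumes Z: "abelian_group Z" "abelian_group Z'" and h: "h \<in> ahom Z Z'"
  shows "[|finite T; g \<in> T \<rightarrow> carrier Z|] ==> h (\<Oplus>\<^bsub>Z\<^esub>j\<in>T. g j) = (\<Oplus>\<^bsub>Z'\<^esub>j\<in>T. h (g j))"
proof (induction T rule: finite_induct)
  case empty
  interpret Z: abelian_group Z by fact
  interpret Z': abelian_group Z' by fact
  show ?case using ahom_zero[OF Z h] by simp
next
  case (insert x T)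
  interpret Z: abelian_group Z by fact
  interpret Z': abelian_group Z' by fact
  have "(\<lambda>j. h (g j)) \<in> insert x T \<rightarrow> carrier Z'" using insert.prems ahom_closed[OF h] by auto
  then show ?case using insert by (simp add: Pi_iff ahom_add[OF h] Z.finsum_closed)
qed

definition image_module :: "('x \<Rightarrow> 'y) \<Rightarrow> ('r, 'x) module \<Rightarrow> ('r, 'y) module"
  where "image_module J X = (let I = the_inv_into (carrier X) J in
    \<lparr>carrier = J ` carrier X, mult = undefined, one = undefined, zero = J \<zero>\<^bsub>X\<^esub>,
     add = (\<lambda>v w. J (I v \<oplus>\<^bsub>X\<^esub> I w)), smult = (\<lambda>r v. J (r \<odot>\<^bsub>X\<^esub> I v))\<rparr>)"

lemma image_module_lmodule:
  assumes X: "lmodule R X" and J: "inj_on J (carrier X)"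
  shows "lmodule R (image_module J X)"
    and "[|x \<in> carrier X; y \<in> carrier X|] ==> J x \<oplus>\<^bsub>image_module J X\<^esub> J y = J (x \<oplus>\<^bsub>X\<^esub> y)"
    and "x \<in> carrier X ==> r \<odot>\<^bsub>image_module J X\<^esub> J x = J (r \<odot>\<^bsub>X\<^esub> x)"
    and "carrier (image_module J X) = J ` carrier X"
proof -
  interpret X: abelian_group X using X by (rule lmodule_group)
  let ?Y = "image_module J X"
  show c: "carrier ?Y = J ` carrier X" by (simp add: image_module_def Let_def)
  show a: "\<And>x y. [|x \<in> carrier X; y \<in> carrier X|] ==> J x \<oplus>\<^bsub>?Y\<^esub> J y = J (x \<oplus>\<^bsub>X\<^esub> y)"
    and s: "\<And>r x. x \<in> carrier X ==> r \<odot>\<^bsub>?Y\<^esub> J x = J (r \<odot>\<^bsub>X\<^esub> x)"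
    by (simp_all add: image_module_def Let_def the_inv_into_f_f[OF J])
  have z: "\<zero>\<^bsub>?Y\<^esub> = J \<zero>\<^bsub>X\<^esub>" by (simp add: image_module_def Let_def)
  note l = lmodule.lsmult_closed[OF X] lmodule.lsmult_l_distr[OF X] lmodule.lsmult_r_distr[OF X]
    lmodule.lsmult_assoc[OF X] lmodule.lsmult_one[OF X]
  show "lmodule R ?Y"
  proof (rule lmoduleI)
    show "abelian_group ?Y"
    proof (rule abelian_groupI)
      fix x assume "x \<in> carrier ?Y"
      then obtain x' where "x' \<in> carrier X" "x = J x'" by (auto simp: c)
      then show "\<exists>y\<in>carrier ?Y. y \<oplus>\<^bsub>?Y\<^esub> x = \<zero>\<^bsub>?Y\<^esub>"
        by (intro bexI[of _ "J (\<ominus>\<^bsub>X\<^esub> x')"]) (simp_all add: a z c X.l_neg)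
    qed (auto simp: c a z X.a_ac)
    fix r r' assume "r \<in> carrier R" "r' \<in> carrier R"
    fix x assume "x \<in> carrier ?Y"
    then obtain x' where x': "x' \<in> carrier X" "x = J x'" by (auto simp: c)
    show "(r \<otimes>\<^bsub>R\<^esub> r') \<odot>\<^bsub>?Y\<^esub> x = r \<odot>\<^bsub>?Y\<^esub> (r' \<odot>\<^bsub>?Y\<^esub> x)" "(r \<oplus>\<^bsub>R\<^esub> r') \<odot>\<^bsub>?Y\<^esub> x = r \<odot>\<^bsub>?Y\<^esub> x \<oplus>\<^bsub>?Y\<^esub> r' \<odot>\<^bsub>?Y\<^esub> x"
      using x' \<open>r \<in> carrier R\<close> \<open>r' \<in> carrier R\<close> by (simp_all add: s a l)
  qed (use X in \<open>auto simp: c a s l lmodule_def\<close>)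
qed

text \<open>A finitely supported family lives in the universe as the formal sum of the pairs in its graph, the pairs with value \<open>z\<close> (the zero of the ring) left out.\<close>

definition graph_code :: "'w set \<Rightarrow> 'w \<Rightarrow> ('w::infinite \<Rightarrow> 'w) \<Rightarrow> 'w"
  where "graph_code D z c = enc (Abs_poly_mapping (\<lambda>(j, r). if j \<in> D \<and> r = c j \<and> r \<noteq> z then 1 else 0))"

lemma graph_code_inj:
  assumes c: "c \<in> extensional D" "finite {j \<in> D. c j \<noteq> z}" and c': "c' \<in> extensional D" "finite {j \<in> D. c' j \<noteq> z}"
    and e: "graph_code D z c = graph_code D z c'"
  shows "c = c'"
proof -
  let ?g = "\<lambda>c (j, r). if j \<in> D \<and> r = c j \<and> r \<noteq> z then 1 else (0::int)"
  have l: "Poly_Mapping.lookup (Abs_poly_mapping (?g c)) = ?g c" if "finite {j \<in> D. c j \<noteq> z}" for c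
  proof (rule lookup_Abs_poly_mapping)
    have "{p. ?g c p \<noteq> 0} \<subseteq> (\<lambda>j. (j, c j)) ` {j \<in> D. c j \<noteq> z}" by (auto split: if_splits)
    then show "finite {p. ?g c p \<noteq> 0}" using that by (meson finite_imageI finite_subset)
  qed
  have "Abs_poly_mapping (?g c) = Abs_poly_mapping (?g c')"
    by (rule injD[OF inj_enc e[unfolded graph_code_def]])
  from arg_cong[OF this, of Poly_Mapping.lookup] have g: "?g c = ?g c'"
    unfolding l[OF c(2)] l[OF c'(2)] .
  show ?thesis
  proof (rule extensionalityI[OF c(1) c'(1)])
    fix j assume j: "j \<in> D"
    have "?g c (j, c j) = ?g c' (j, c j)" "?g c (j, c' j) = ?g c' (j, c' j)"
      using g by (rule fun_cong)+
    then show "c j = c' j" using j by (auto split: if_splits)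
  qed
qed

text \<open>The free module on the set \<open>P\<close>: finitely supported families, as extensional functions.\<close>

definition free_module :: "('w, 'a) ring_scheme \<Rightarrow> 'w set \<Rightarrow> ('w, 'w \<Rightarrow> 'w) module"
  where "free_module R D =
    \<lparr>carrier = {c \<in> D \<rightarrow>\<^sub>E carrier R. finite {j \<in> D. c j \<noteq> \<zero>\<^bsub>R\<^esub>}}, mult = undefined, one = undefined,
     zero = (\<lambda>j\<in>D. \<zero>\<^bsub>R\<^esub>), add = (\<lambda>c c'. \<lambda>j\<in>D. c j \<oplus>\<^bsub>R\<^esub> c' j), smult = (\<lambda>r c. \<lambda>j\<in>D. r \<otimes>\<^bsub>R\<^esub> c j)\<rparr>"

lemma free_module_lmodule:
  assumes R: "ring R" shows "lmodule R (free_module R D)"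
proof -
  interpret R: ring R by fact
  let ?F = "free_module R D"
  have s: "r \<odot>\<^bsub>?F\<^esub> c \<in> carrier ?F" if "r \<in> carrier R" "c \<in> carrier ?F" for r c
    using that by (auto simp: free_module_def PiE_iff elim!: rev_finite_subset)
  have e: "c = c'" if "c \<in> carrier ?F" "c' \<in> carrier ?F" "\<And>j. j \<in> D ==> c j = c' j" for c c'
    using that by (intro PiE_ext[of c D "\<lambda>_. carrier R"]) (auto simp: free_module_def)
  have a: "c \<oplus>\<^bsub>?F\<^esub> c' \<in> carrier ?F" if "c \<in> carrier ?F" "c' \<in> carrier ?F" for c c'
  proof -
    have "finite ({j \<in> D. c j \<noteq> \<zero>\<^bsub>R\<^esub>} \<union> {j \<in> D. c' j \<noteq> \<zero>\<^bsub>R\<^esub>})"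
      using that by (simp add: free_module_def)
    then have "finite {j \<in> D. (\<lambda>j\<in>D. c j \<oplus>\<^bsub>R\<^esub> c' j) j \<noteq> \<zero>\<^bsub>R\<^esub>}"
      by (rule rev_finite_subset) auto
    then show ?thesis using that by (auto simp: free_module_def PiE_iff)
  qed
  have z: "\<zero>\<^bsub>?F\<^esub> \<in> carrier ?F" by (auto simp: free_module_def)
  have v: "(c \<oplus>\<^bsub>?F\<^esub> c') j = c j \<oplus>\<^bsub>R\<^esub> c' j" "(r \<odot>\<^bsub>?F\<^esub> c) j = r \<otimes>\<^bsub>R\<^esub> c j" "\<zero>\<^bsub>?F\<^esub> j = \<zero>\<^bsub>R\<^esub>" if "j \<in> D" for c c' r j
    using that by (simp_all add: free_module_def)
  have cc: "c j \<in> carrier R" if "c \<in> carrier ?F" "j \<in> D" for c j using that by (auto simp: free_module_def)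
  show ?thesis
  proof (rule lmoduleI[OF R])
    show "abelian_group ?F"
    proof (rule abelian_groupI)
      fix c assume c: "c \<in> carrier ?F"
      have "(\<ominus>\<^bsub>R\<^esub> \<one>\<^bsub>R\<^esub>) \<odot>\<^bsub>?F\<^esub> c \<oplus>\<^bsub>?F\<^esub> c = \<zero>\<^bsub>?F\<^esub>"
        by (rule e[OF a[OF s[OF _ c] c] z]) (use cc[OF c] in \<open>simp_all add: v R.l_minus R.l_neg\<close>)
      then show "\<exists>c'\<in>carrier ?F. c' \<oplus>\<^bsub>?F\<^esub> c = \<zero>\<^bsub>?F\<^esub>" using s[OF _ c, of "\<ominus>\<^bsub>R\<^esub> \<one>\<^bsub>R\<^esub>"] by auto
    qed (auto intro!: a z e simp: v cc R.a_ac)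
  qed (auto intro!: s a e simp: v cc R.l_distr R.r_distr R.m_assoc)
qed

text \<open>The evaluation of the free module on the elements of \<open>P\<close> is surjective, hence splits; the coordinates of the splitting are the dual functionals.\<close>

theorem projective_dual_basis:
  fixes R :: "('w::infinite, 'a) ring_scheme" and P :: "('w, 'w) module"
  assumes P: "projective R P"
  shows "\<exists>\<phi>. (\<forall>j\<in>carrier P. \<forall>x\<in>carrier P. \<phi> j x \<in> carrier R \<and> (\<forall>y\<in>carrier P. \<phi> j (x \<oplus>\<^bsub>P\<^esub> y) = \<phi> j x \<oplus>\<^bsub>R\<^esub> \<phi> j y) \<and>
      (\<forall>r\<in>carrier R. \<phi> j (r \<odot>\<^bsub>P\<^esub> x) = r \<otimes>\<^bsub>R\<^esub> \<phi> j x)) \<and>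
    (\<forall>x\<in>carrier P. finite {j \<in> carrier P. \<phi> j x \<noteq> \<zero>\<^bsub>R\<^esub>} \<and>
      (\<Oplus>\<^bsub>P\<^esub>j\<in>{j \<in> carrier P. \<phi> j x \<noteq> \<zero>\<^bsub>R\<^esub>}. \<phi> j x \<odot>\<^bsub>P\<^esub> j) = x)"
proof -
  have PM: "lmodule R P" using P by (simp add: projective_def)
  interpret P: abelian_group P using PM by (rule lmodule_group)
  interpret R: ring R using PM by (simp add: lmodule_def)
  let ?D = "carrier P" and ?F = "free_module R (carrier P)"
  let ?J = "graph_code ?D \<zero>\<^bsub>R\<^esub>"
  define I where "I = the_inv_into (carrier ?F) ?J"
  define S where "S c = {j \<in> ?D. c j \<noteq> \<zero>\<^bsub>R\<^esub>}" for c :: "'w \<Rightarrow> 'w"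
  define ev where "ev c = (\<Oplus>\<^bsub>P\<^esub>j\<in>S c. c j \<odot>\<^bsub>P\<^esub> j)" for c
  have F: "lmodule R ?F" by (rule free_module_lmodule) unfold_locales
  have inj: "inj_on ?J (carrier ?F)"
    by (rule inj_onI, rule graph_code_inj) (auto simp: free_module_def PiE_def)
  note im = image_module_lmodule[OF F inj]
  have I: "I (?J c) = c" if "c \<in> carrier ?F" for c using that by (simp add: I_def the_inv_into_f_f[OF inj])
  have cR: "c j \<in> carrier R" and cS: "finite (S c)" if "c \<in> carrier ?F" "j \<in> ?D" for c j
    using that by (auto simp: free_module_def S_def)
  note sm = lmodule.lsmult_closed[OF PM]
  have z: "\<zero>\<^bsub>R\<^esub> \<odot>\<^bsub>P\<^esub> x = \<zero>\<^bsub>P\<^esub>" if "x \<in> ?D" for x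
    by (rule ahom_zero[OF R.abelian_group_axioms P.abelian_group_axioms smult_ahom_left[OF PM that]])
  have ev: "ev c = (\<Oplus>\<^bsub>P\<^esub>j\<in>T. c j \<odot>\<^bsub>P\<^esub> j)" if "c \<in> carrier ?F" "finite T" "S c \<subseteq> T" "T \<subseteq> ?D" for c T
    unfolding ev_def
    by (rule P.add.finprod_mono_neutral_cong_left) (use that cR[OF that(1)] in \<open>auto simp: S_def z subset_iff intro!: sm\<close>)
  have evc: "ev c \<in> ?D" if "c \<in> carrier ?F" for c
    unfolding ev_def by (rule P.finsum_closed) (use cR[OF that] in \<open>auto simp: S_def intro!: sm\<close>)
  have v: "(c \<oplus>\<^bsub>?F\<^esub> c') j = c j \<oplus>\<^bsub>R\<^esub> c' j" "(r \<odot>\<^bsub>?F\<^esub> c) j = r \<otimes>\<^bsub>R\<^esub> c j" if "j \<in> ?D" for c c' r j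
    using that by (simp_all add: free_module_def)
  have ev_add: "ev (c \<oplus>\<^bsub>?F\<^esub> c') = ev c \<oplus>\<^bsub>P\<^esub> ev c'" if c: "c \<in> carrier ?F" "c' \<in> carrier ?F" for c c'
  proof (cases "?D = {}")
    case False
    let ?T = "S c \<union> S c'"
    have T: "finite ?T" "?T \<subseteq> ?D" using cS[OF c(1)] cS[OF c(2)] False by (auto simp: S_def)
    have cc: "c \<oplus>\<^bsub>?F\<^esub> c' \<in> carrier ?F" by (rule add_closed[OF lmodule_group[OF F] c])
    have "S (c \<oplus>\<^bsub>?F\<^esub> c') \<subseteq> ?T"
      by (auto simp: S_def v)
    then have "ev (c \<oplus>\<^bsub>?F\<^esub> c') = (\<Oplus>\<^bsub>P\<^esub>j\<in>?T. (c \<oplus>\<^bsub>?F\<^esub> c') j \<odot>\<^bsub>P\<^esub> j)"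
      by (rule ev[OF cc T(1) _ T(2)])
    also have "\<dots> = (\<Oplus>\<^bsub>P\<^esub>j\<in>?T. c j \<odot>\<^bsub>P\<^esub> j \<oplus>\<^bsub>P\<^esub> c' j \<odot>\<^bsub>P\<^esub> j)"
    proof (rule P.add.finprod_cong')
      fix j assume "j \<in> ?T"
      then have "j \<in> ?D" using T(2) by blast
      then show "(c \<oplus>\<^bsub>?F\<^esub> c') j \<odot>\<^bsub>P\<^esub> j = c j \<odot>\<^bsub>P\<^esub> j \<oplus>\<^bsub>P\<^esub> c' j \<odot>\<^bsub>P\<^esub> j"
        using cR[OF c(1)] cR[OF c(2)] by (simp add: v lmodule.lsmult_l_distr[OF PM])
    qed (use T(2) cR[OF c(1)] cR[OF c(2)] in \<open>auto intro!: P.add.m_closed sm\<close>)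
    also have "\<dots> = ev c \<oplus>\<^bsub>P\<^esub> ev c'"
      unfolding ev[OF c(1) T(1) Un_upper1 T(2)] ev[OF c(2) T(1) Un_upper2 T(2)]
      by (rule P.add.finprod_multf) (use T cR[OF c(1)] cR[OF c(2)] in \<open>auto intro!: sm\<close>)
    finally show ?thesis .
  qed (use P.zero_closed in simp)
  have ev_smult: "ev (r \<odot>\<^bsub>?F\<^esub> c) = r \<odot>\<^bsub>P\<^esub> ev c" if r: "r \<in> carrier R" and c: "c \<in> carrier ?F" for r c
  proof -
    have T: "finite (S c)" "S c \<subseteq> ?D" using cS[OF c P.zero_closed] by (auto simp: S_def)
    have rc: "r \<odot>\<^bsub>?F\<^esub> c \<in> carrier ?F" using r c F by (simp add: smult_closed)
    have "S (r \<odot>\<^bsub>?F\<^esub> c) \<subseteq> S c" using r by (auto simp: S_def v)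
    then have "ev (r \<odot>\<^bsub>?F\<^esub> c) = (\<Oplus>\<^bsub>P\<^esub>j\<in>S c. (r \<odot>\<^bsub>?F\<^esub> c) j \<odot>\<^bsub>P\<^esub> j)"
      by (rule ev[OF rc T(1) _ T(2)])
    also have "\<dots> = (\<Oplus>\<^bsub>P\<^esub>j\<in>S c. r \<odot>\<^bsub>P\<^esub> (c j \<odot>\<^bsub>P\<^esub> j))"
    proof (rule P.add.finprod_cong')
      fix j assume "j \<in> S c"
      then have "j \<in> ?D" using T(2) by blast
      then show "(r \<odot>\<^bsub>?F\<^esub> c) j \<odot>\<^bsub>P\<^esub> j = r \<odot>\<^bsub>P\<^esub> (c j \<odot>\<^bsub>P\<^esub> j)"
        using r cR[OF c] by (simp add: v lmodule.lsmult_assoc[OF PM])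
    qed (use T(2) r cR[OF c] in \<open>auto intro!: sm\<close>)
    also have "\<dots> = r \<odot>\<^bsub>P\<^esub> ev c"
      unfolding ev_def by (rule ahom_finsum[OF P.abelian_group_axioms P.abelian_group_axioms smult_ahom[OF PM r] T(1), symmetric]) (use cR[OF c] in \<open>auto simp: S_def intro!: sm\<close>)
    finally show ?thesis .
  qed
  have ev_surj: "\<exists>c\<in>carrier ?F. ev c = x" if x: "x \<in> ?D" for x
  proof -
    let ?c = "\<lambda>j\<in>?D. if j = x then \<one>\<^bsub>R\<^esub> else \<zero>\<^bsub>R\<^esub>"
    have S: "S ?c \<subseteq> {x}" by (auto simp: S_def)
    then have "finite (S ?c)" by (meson finite.emptyI finite.insertI finite_subset)
    then have c: "?c \<in> carrier ?F" by (auto simp: free_module_def S_def)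
    have "ev ?c = x" using ev[OF c _ S] x by (simp add: lmodule.lsmult_one[OF PM])
    then show ?thesis using c by blast
  qed
  let ?X = "image_module ?J ?F"
  let ?p = "\<lambda>v\<in>carrier ?X. ev (I v)"
  have p: "?p \<in> lin_maps R ?X P"
  proof (intro lin_mapsI ahomI)
    fix v w assume "v \<in> carrier ?X" "w \<in> carrier ?X"
    then obtain c c' where c: "c \<in> carrier ?F" "v = ?J c" "c' \<in> carrier ?F" "w = ?J c'" by (auto simp: im)
    then show "?p (v \<oplus>\<^bsub>?X\<^esub> w) = ?p v \<oplus>\<^bsub>P\<^esub> ?p w"
      using F by (simp add: im I ev_add add_closed lmodule_group)
  next
    fix r v assume r: "r \<in> carrier R" and "v \<in> carrier ?X"
    then obtain c where c: "c \<in> carrier ?F" "v = ?J c" by (auto simp: im)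
    then show "?p (r \<odot>\<^bsub>?X\<^esub> v) = r \<odot>\<^bsub>P\<^esub> ?p v"
      using F r by (simp add: im I ev_smult smult_closed)
  qed (auto simp: im I evc)
  have surj: "?p ` carrier ?X = ?D"
  proof
    show "?p ` carrier ?X \<subseteq> ?D" using lin_mapsD(2)[OF p] by blast
    show "?D \<subseteq> ?p ` carrier ?X"
    proof
      fix x assume "x \<in> ?D"
      from ev_surj[OF this] obtain c where c: "c \<in> carrier ?F" "ev c = x" ..
      then show "x \<in> ?p ` carrier ?X" by (intro image_eqI[of _ _ "?J c"]) (simp_all add: im I)
    qed
  qed
  from projectiveD[OF P im(1) PM p surj lin_maps_id[OF PM]]
  obtain \<sigma> where \<sigma>: "\<sigma> \<in> lin_maps R P ?X" and p\<sigma>: "\<forall>x\<in>?D. ?p (\<sigma> x) = (\<lambda>x\<in>?D. x) x" ..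
  note \<sigma>l = lin_mapsD[OF \<sigma>]
  have \<sigma>F: "I (\<sigma> x) \<in> carrier ?F" "?J (I (\<sigma> x)) = \<sigma> x" if "x \<in> ?D" for x
    using \<sigma>l(2)[OF that] by (auto simp: im I)
  have \<sigma>a: "I (\<sigma> (x \<oplus>\<^bsub>P\<^esub> y)) = I (\<sigma> x) \<oplus>\<^bsub>?F\<^esub> I (\<sigma> y)" if "x \<in> ?D" "y \<in> ?D" for x y
  proof -
    have "\<sigma> (x \<oplus>\<^bsub>P\<^esub> y) = ?J (I (\<sigma> x) \<oplus>\<^bsub>?F\<^esub> I (\<sigma> y))"
      using \<sigma>l(5)[OF that] im(2)[OF \<sigma>F(1)[OF that(1)] \<sigma>F(1)[OF that(2)]] unfolding \<sigma>F(2)[OF that(1)] \<sigma>F(2)[OF that(2)] by simp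
    then show ?thesis using I[OF add_closed[OF lmodule_group[OF F] \<sigma>F(1)[OF that(1)] \<sigma>F(1)[OF that(2)]]] by simp
  qed
  have \<sigma>s: "I (\<sigma> (r \<odot>\<^bsub>P\<^esub> x)) = r \<odot>\<^bsub>?F\<^esub> I (\<sigma> x)" if "r \<in> carrier R" "x \<in> ?D" for r x
  proof -
    have "\<sigma> (r \<odot>\<^bsub>P\<^esub> x) = ?J (r \<odot>\<^bsub>?F\<^esub> I (\<sigma> x))"
      using \<sigma>l(4)[OF that] im(3)[OF \<sigma>F(1)[OF that(2)], of r] unfolding \<sigma>F(2)[OF that(2)] by simp
    then show ?thesis using I[OF smult_closed[OF F that(1) \<sigma>F(1)[OF that(2)]]] by simp
  qed
  have fin: "finite {j \<in> ?D. I (\<sigma> x) j \<noteq> \<zero>\<^bsub>R\<^esub>}" if "x \<in> ?D" for x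
    using cS[OF \<sigma>F(1)[OF that] that] by (simp add: S_def)
  have sum: "(\<Oplus>\<^bsub>P\<^esub>j\<in>{j \<in> ?D. I (\<sigma> x) j \<noteq> \<zero>\<^bsub>R\<^esub>}. I (\<sigma> x) j \<odot>\<^bsub>P\<^esub> j) = x" if "x \<in> ?D" for x
    using bspec[OF p\<sigma> that] \<sigma>l(2)[OF that] that by (simp add: ev_def S_def)
  show ?thesis
    by (intro exI[of _ "\<lambda>j x. I (\<sigma> x) j"] conjI ballI)
      (simp_all add: fin sum \<sigma>a \<sigma>s v cR \<sigma>F)
qed

section \<open>Projectivity of the tower\<close>

lemma (in abelian_group) diff_zero: "x \<in> carrier G ==> x \<ominus> \<zero> = x"
proof -
  have "\<ominus> \<zero> = \<zero>" using r_neg[of \<zero>] l_zero[of "\<ominus> \<zero>"] by simp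
  moreover assume "x \<in> carrier G"
  ultimately show ?thesis by (simp add: minus_eq)
qed

context bialgebroid_setting
begin

abbreviation "Aop \<equiv> op_ring (Base H)"

definition resA :: "('w, 'w) module \<Rightarrow> ('w, 'w) module"
  where "resA W = W\<lparr>smult := (\<lambda>a w. t a \<odot>\<^bsub>W\<^esub> w)\<rparr>"

lemma resA_simps [simp]: "carrier (resA W) = carrier W" "add (resA W) = add W" "zero (resA W) = zero W"
  "a \<odot>\<^bsub>resA W\<^esub> w = t a \<odot>\<^bsub>W\<^esub> w"
  by (simp_all add: resA_def)

lemma Aop_simps [simp]: "carrier Aop = carrier A" "add Aop = add A" "zero Aop = zero A" "one Aop = one A"
  "a \<otimes>\<^bsub>Aop\<^esub> b = b \<otimes>\<^bsub>A\<^esub> a"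
  by (simp_all add: op_ring_def)

lemma Aop_ring: "ring Aop"
proof (rule ringI)
  show "abelian_group Aop"
    using A.abelian_group_axioms by (rule abelian_group_additive_cong[rotated 3]) simp_all
  show "monoid Aop" by (rule monoidI) (simp_all add: A.m_assoc)
qed (simp_all add: A.l_distr A.r_distr)

lemma resA_lmodule: "umod W ==> lmodule Aop (resA W)"
proof (rule lmoduleI[OF Aop_ring])
  assume W: "umod W"
  show "abelian_group (resA W)"
    by (rule abelian_group_additive_cong[OF _ _ _ lmodule_group[OF W]]) simp_all
qed (simp_all add: t_add t_mult smult_l_distr smult_r_distr smult_mult)

lemma resA_lin: "f \<in> lin X Y ==> f \<in> lin_maps Aop (resA X) (resA Y)"
  by (intro lin_mapsI ahomI) (simp_all add: lin_mapsD)

lemma U_right_A_resA: "U_right_A H = resA UM"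
  by (simp add: U_right_A_def resA_def regular_module_def)

text \<open>A dual basis \<open>(d\<^sub>j, \<phi>\<^sub>j)\<close> of \<open>U\<close> over \<open>A\<^sup>o\<^sup>p\<close> reduces a lifting problem on \<open>U \<otimes>\<^sub>A W\<close> to the lifting problems
  \<open>w \<mapsto> f (d\<^sub>j \<otimes> w)\<close> on \<open>W\<close>: if \<open>G\<^sub>j\<close> solves the latter, then \<open>u \<otimes> w \<mapsto> \<Sum>\<^sub>j G\<^sub>j (s (\<phi>\<^sub>j u) w)\<close> solves the former.\<close>

lemma projective_TA:
  assumes PU: "projective Aop (resA UM)" and W: "umod W" and PW: "projective Aop (resA W)"
  shows "projective Aop (resA (TA UM W))"
  unfolding projective_def
proof (intro conjI allI impI; (elim conjE)?)
  show "lmodule Aop (resA (TA UM W))" using W by (simp add: resA_lmodule)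
  fix X Y :: "('w, 'w) module" and p f
  assume X: "lmodule Aop X" and Y: "lmodule Aop Y" and p: "p \<in> lin_maps Aop X Y" and surj: "p ` carrier X = carrier Y"
    and f: "f \<in> lin_maps Aop (resA (TA UM W)) Y"
  note [simp] = W
  note fl = lin_mapsD[OF f, simplified] and pl = lin_mapsD[OF p, simplified]
  interpret X: abelian_group X using X by (rule lmodule_group)
  interpret Y: abelian_group Y using Y by (rule lmodule_group)
  obtain \<phi> where dual: "(\<forall>j\<in>carrier U. \<forall>x\<in>carrier U. \<phi> j x \<in> carrier A \<and> (\<forall>y\<in>carrier U. \<phi> j (x \<oplus>\<^bsub>U\<^esub> y) = \<phi> j x \<oplus>\<^bsub>A\<^esub> \<phi> j y) \<and>
      (\<forall>r\<in>carrier A. \<phi> j (t r \<cdot> x) = \<phi> j x \<otimes>\<^bsub>A\<^esub> r)) \<and>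
    (\<forall>x\<in>carrier U. finite {j \<in> carrier U. \<phi> j x \<noteq> \<zero>\<^bsub>A\<^esub>} \<and>
      (\<Oplus>\<^bsub>resA UM\<^esub>j\<in>{j \<in> carrier U. \<phi> j x \<noteq> \<zero>\<^bsub>A\<^esub>}. t (\<phi> j x) \<cdot> j) = x)"
    using projective_dual_basis[OF PU] by (auto simp: Bex_def)
  have \<phi>: "\<phi> j x \<in> carrier A" "y \<in> carrier U ==> \<phi> j (x \<oplus>\<^bsub>U\<^esub> y) = \<phi> j x \<oplus>\<^bsub>A\<^esub> \<phi> j y"
      "a \<in> carrier A ==> \<phi> j (t a \<cdot> x) = \<phi> j x \<otimes>\<^bsub>A\<^esub> a"
    if "j \<in> carrier U" "x \<in> carrier U" for j x y a
    using dual that by simp_all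
  define S where "S x = {j \<in> carrier U. \<phi> j x \<noteq> \<zero>\<^bsub>A\<^esub>}" for x
  have S: "finite (S x)" "(\<Oplus>\<^bsub>U\<^esub>j\<in>S x. t (\<phi> j x) \<cdot> j) = x" if "x \<in> carrier U" for x
  proof -
    show fin: "finite (S x)" using dual that unfolding S_def by simp
    have id: "(\<lambda>x. x) \<in> ahom (resA UM) U" by (rule ahomI) simp_all
    have "(\<Oplus>\<^bsub>resA UM\<^esub>j\<in>S x. t (\<phi> j x) \<cdot> j) = (\<Oplus>\<^bsub>U\<^esub>j\<in>S x. t (\<phi> j x) \<cdot> j)"
      by (rule ahom_finsum[OF lmodule_group[OF resA_lmodule[OF umod_UM]] U.abelian_group_axioms id fin])
        (use that \<phi>(1) in \<open>auto simp: S_def\<close>)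
    then show "(\<Oplus>\<^bsub>U\<^esub>j\<in>S x. t (\<phi> j x) \<cdot> j) = x"
      using dual that unfolding S_def by simp
  qed
  have SU: "S x \<subseteq> carrier U" for x by (auto simp: S_def)
  have "\<exists>g\<in>lin_maps Aop (resA W) X. \<forall>w\<in>carrier W. p (g w) = f (tp UM W j w)" if j: "j \<in> carrier U" for j
  proof -
    have "(\<lambda>w\<in>carrier W. f (tp UM W j w)) \<in> lin_maps Aop (resA W) Y"
      by (intro lin_mapsI ahomI) (use j lmodule_group[OF W] in \<open>simp_all add: fl tpUW_add add_closed flip: t_tp fl(4)\<close>)
    from projectiveD[OF PW X Y p surj this] show ?thesis by simp
  qed
  then obtain G where "\<forall>j\<in>carrier U. G j \<in> lin_maps Aop (resA W) X \<and> (\<forall>w\<in>carrier W. p (G j w) = f (tp UM W j w))"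
    using bchoice[of "carrier U" "\<lambda>j g. g \<in> lin_maps Aop (resA W) X \<and> (\<forall>w\<in>carrier W. p (g w) = f (tp UM W j w))"] by blast
  then have G: "G j \<in> lin_maps Aop (resA W) X" and pG: "w \<in> carrier W ==> p (G j w) = f (tp UM W j w)" if "j \<in> carrier U" for j w
    using that by simp_all
  note Gl = lin_mapsD[OF G, simplified]
  have G0: "G j \<zero>\<^bsub>W\<^esub> = \<zero>\<^bsub>X\<^esub>" if "j \<in> carrier U" for j
    using ahom_zero[OF lmodule_group[OF W] X.abelian_group_axioms Gl(1)[OF that]] .
  have s0: "s \<zero>\<^bsub>A\<^esub> \<odot>\<^bsub>W\<^esub> w = \<zero>\<^bsub>W\<^esub>" if "w \<in> carrier W" for w
  proof -
    have "(\<lambda>a. s a \<odot>\<^bsub>W\<^esub> w) \<in> ahom A W" using that by (intro ahomI) (simp_all add: s_add smult_l_distr)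
    from ahom_zero[OF A.abelian_group_axioms lmodule_group[OF W] this] show ?thesis .
  qed
  define \<beta> where "\<beta> u w = (\<Oplus>\<^bsub>X\<^esub>j\<in>S u. G j (s (\<phi> j u) \<odot>\<^bsub>W\<^esub> w))" for u w
  have c: "G j (s (\<phi> j u) \<odot>\<^bsub>W\<^esub> w) \<in> carrier X" if "j \<in> carrier U" "u \<in> carrier U" "w \<in> carrier W" for j u w
    using that \<phi> by (simp add: Gl)
  have \<beta>T: "\<beta> u w = (\<Oplus>\<^bsub>X\<^esub>j\<in>T. G j (s (\<phi> j u) \<odot>\<^bsub>W\<^esub> w))"
    if "u \<in> carrier U" "w \<in> carrier W" "finite T" "S u \<subseteq> T" "T \<subseteq> carrier U" for u w T
    unfolding \<beta>_def
  proof (rule X.add.finprod_mono_neutral_cong_left[OF that(3,4)])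
    fix j assume "j \<in> T - S u"
    then have "j \<in> carrier U" "\<phi> j u = \<zero>\<^bsub>A\<^esub>" using that(5) by (auto simp: S_def)
    then show "G j (s (\<phi> j u) \<odot>\<^bsub>W\<^esub> w) = \<zero>\<^bsub>X\<^esub>" using that(2) by (simp add: s0 G0)
  qed (use that c in auto)
  have \<beta>c: "\<beta> u w \<in> carrier X" if "u \<in> carrier U" "w \<in> carrier W" for u w
    unfolding \<beta>_def by (rule X.finsum_closed) (use that c SU in \<open>auto simp: subset_iff\<close>)
  have b: "bal UM W X \<beta>"
  proof (rule balAI)
    show "\<beta> u (w \<oplus>\<^bsub>W\<^esub> w') = \<beta> u w \<oplus>\<^bsub>X\<^esub> \<beta> u w'" if "u \<in> carrier UM" "w \<in> carrier W" "w' \<in> carrier W" for u w w'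
    proof -
      have u: "u \<in> carrier U" using that by simp
      have "\<beta> u (w \<oplus>\<^bsub>W\<^esub> w') = (\<Oplus>\<^bsub>X\<^esub>j\<in>S u. G j (s (\<phi> j u) \<odot>\<^bsub>W\<^esub> w) \<oplus>\<^bsub>X\<^esub> G j (s (\<phi> j u) \<odot>\<^bsub>W\<^esub> w'))"
        unfolding \<beta>_def
      proof (rule X.add.finprod_cong')
        fix j assume "j \<in> S u"
        then have "j \<in> carrier U" using SU by blast
        then show "G j (s (\<phi> j u) \<odot>\<^bsub>W\<^esub> (w \<oplus>\<^bsub>W\<^esub> w')) = G j (s (\<phi> j u) \<odot>\<^bsub>W\<^esub> w) \<oplus>\<^bsub>X\<^esub> G j (s (\<phi> j u) \<odot>\<^bsub>W\<^esub> w')"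
          using u that \<phi> by (simp add: smult_r_distr Gl)
      qed (use u that c SU in \<open>auto simp: subset_iff intro!: X.add.m_closed\<close>)
      also have "\<dots> = \<beta> u w \<oplus>\<^bsub>X\<^esub> \<beta> u w'"
        unfolding \<beta>_def by (rule X.add.finprod_multf) (use u that c SU in \<open>auto simp: subset_iff\<close>)
      finally show ?thesis .
    qed
    show "\<beta> (u \<oplus>\<^bsub>UM\<^esub> u') w = \<beta> u w \<oplus>\<^bsub>X\<^esub> \<beta> u' w" if "u \<in> carrier UM" "u' \<in> carrier UM" "w \<in> carrier W" for u u' w
    proof -
      have u: "u \<in> carrier U" "u' \<in> carrier U" using that by simp_all
      let ?T = "S u \<union> S u'"
      have T: "finite ?T" "?T \<subseteq> carrier U" using S(1) u SU by auto
      have ST: "S (u \<oplus>\<^bsub>U\<^esub> u') \<subseteq> ?T" using u by (auto simp: S_def \<phi>)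
      have "\<beta> (u \<oplus>\<^bsub>U\<^esub> u') w = (\<Oplus>\<^bsub>X\<^esub>j\<in>?T. G j (s (\<phi> j (u \<oplus>\<^bsub>U\<^esub> u')) \<odot>\<^bsub>W\<^esub> w))"
        by (rule \<beta>T[OF _ _ T(1) ST T(2)]) (use u that in simp_all)
      also have "\<dots> = (\<Oplus>\<^bsub>X\<^esub>j\<in>?T. G j (s (\<phi> j u) \<odot>\<^bsub>W\<^esub> w) \<oplus>\<^bsub>X\<^esub> G j (s (\<phi> j u') \<odot>\<^bsub>W\<^esub> w))"
      proof (rule X.add.finprod_cong')
        fix j assume "j \<in> ?T"
        then have "j \<in> carrier U" using SU by blast
        then show "G j (s (\<phi> j (u \<oplus>\<^bsub>U\<^esub> u')) \<odot>\<^bsub>W\<^esub> w) = G j (s (\<phi> j u) \<odot>\<^bsub>W\<^esub> w) \<oplus>\<^bsub>X\<^esub> G j (s (\<phi> j u') \<odot>\<^bsub>W\<^esub> w)"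
          using u that \<phi> by (simp add: s_add smult_l_distr Gl)
      qed (use u that c SU in \<open>auto simp: subset_iff intro!: X.add.m_closed\<close>)
      also have "\<dots> = \<beta> u w \<oplus>\<^bsub>X\<^esub> \<beta> u' w"
        unfolding \<beta>T[OF u(1) that(3) T(1) Un_upper1 T(2)] \<beta>T[OF u(2) that(3) T(1) Un_upper2 T(2)]
        by (rule X.add.finprod_multf) (use u that c SU in \<open>auto simp: subset_iff\<close>)
      finally show ?thesis by simp
    qed
    show "\<beta> (t a \<odot>\<^bsub>UM\<^esub> u) w = \<beta> u (s a \<odot>\<^bsub>W\<^esub> w)" if "a \<in> carrier A" "u \<in> carrier UM" "w \<in> carrier W" for a u w
    proof -
      have u: "u \<in> carrier U" using that by simp
      have ST: "S (t a \<cdot> u) \<subseteq> S u" using u that by (auto simp: S_def \<phi>)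
      have "\<beta> (t a \<cdot> u) w = (\<Oplus>\<^bsub>X\<^esub>j\<in>S u. G j (s (\<phi> j (t a \<cdot> u)) \<odot>\<^bsub>W\<^esub> w))"
        by (rule \<beta>T[OF _ _ S(1) ST SU]) (use u that in simp_all)
      also have "\<dots> = \<beta> u (s a \<odot>\<^bsub>W\<^esub> w)"
        unfolding \<beta>_def
      proof (rule X.add.finprod_cong')
        fix j assume "j \<in> S u"
        then have "j \<in> carrier U" using SU by blast
        then show "G j (s (\<phi> j (t a \<cdot> u)) \<odot>\<^bsub>W\<^esub> w) = G j (s (\<phi> j u) \<odot>\<^bsub>W\<^esub> (s a \<odot>\<^bsub>W\<^esub> w))"
          using u that \<phi> by (simp add: s_mult smult_mult)
      qed (use u that c SU in \<open>auto simp: subset_iff\<close>)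
      finally show ?thesis by simp
    qed
  qed (simp add: \<beta>c)
  let ?g = "\<lambda>q\<in>carrier (TA UM W). sw X \<beta> q"
  have g: "?g (tp UM W u w) = \<beta> u w" if "u \<in> carrier U" "w \<in> carrier W" for u w
    using that by (simp add: sw_tp[OF umod_UM W X.abelian_group_axioms b])
  have ga: "?g \<in> ahom (TA UM W) X"
    by (rule ahom_restrict[OF sw_ahom[OF umod_UM W X.abelian_group_axioms b]]) simp
  have \<beta>t: "\<beta> u (t a \<odot>\<^bsub>W\<^esub> w) = a \<odot>\<^bsub>X\<^esub> \<beta> u w" if "a \<in> carrier A" "u \<in> carrier U" "w \<in> carrier W" for a u w
  proof -
    have h: "(\<lambda>x. a \<odot>\<^bsub>X\<^esub> x) \<in> ahom X X" by (rule smult_ahom[OF X]) (use that in simp)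
    have "a \<odot>\<^bsub>X\<^esub> \<beta> u w = (\<Oplus>\<^bsub>X\<^esub>j\<in>S u. a \<odot>\<^bsub>X\<^esub> G j (s (\<phi> j u) \<odot>\<^bsub>W\<^esub> w))"
      unfolding \<beta>_def
      by (rule ahom_finsum[OF X.abelian_group_axioms X.abelian_group_axioms h S(1)]) (use that c SU in \<open>auto simp: subset_iff\<close>)
    also have "\<dots> = \<beta> u (t a \<odot>\<^bsub>W\<^esub> w)"
      unfolding \<beta>_def
    proof (rule X.add.finprod_cong')
      fix j assume "j \<in> S u"
      then have j: "j \<in> carrier U" using SU by blast
      have "s (\<phi> j u) \<odot>\<^bsub>W\<^esub> (t a \<odot>\<^bsub>W\<^esub> w) = t a \<odot>\<^bsub>W\<^esub> (s (\<phi> j u) \<odot>\<^bsub>W\<^esub> w)"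
        using j that \<phi>(1)[OF j that(2)] st_commute[of "\<phi> j u" a] by (simp flip: smult_mult)
      then show "a \<odot>\<^bsub>X\<^esub> G j (s (\<phi> j u) \<odot>\<^bsub>W\<^esub> w) = G j (s (\<phi> j u) \<odot>\<^bsub>W\<^esub> (t a \<odot>\<^bsub>W\<^esub> w))"
        using j that \<phi>(1)[OF j that(2)] by (simp add: Gl)
    qed (use that c SU in \<open>auto simp: subset_iff\<close>)
    finally show ?thesis by simp
  qed
  have gl: "?g \<in> lin_maps Aop (resA (TA UM W)) X"
  proof (rule lin_mapsI)
    show "?g \<in> ahom (resA (TA UM W)) X"
      using ga by (intro ahomI) (simp_all only: resA_simps ahom_closed ahom_add)
    fix a q assume "a \<in> carrier Aop" and q: "q \<in> carrier (resA (TA UM W))"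
    then have a: "a \<in> carrier A" by simp
    have "?g (t a \<odot>\<^bsub>TA UM W\<^esub> q) = a \<odot>\<^bsub>X\<^esub> ?g q"
    proof (rule TA_ext[where f = "\<lambda>q. ?g (t a \<odot>\<^bsub>TA UM W\<^esub> q)" and g = "\<lambda>q. a \<odot>\<^bsub>X\<^esub> ?g q", OF umod_UM W X.abelian_group_axioms])
      show "(\<lambda>q. ?g (t a \<odot>\<^bsub>TA UM W\<^esub> q)) \<in> ahom (TA UM W) X"
        by (rule ahom_compose[OF smult_ahom[of U] ga]) (use a in simp_all)
      show "(\<lambda>q. a \<odot>\<^bsub>X\<^esub> ?g q) \<in> ahom (TA UM W) X"
        by (rule ahom_compose[OF ga smult_ahom[OF X]]) (use a in simp)
      show "q \<in> carrier (TA UM W)" using q by simp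
      fix u w assume "u \<in> carrier UM" "w \<in> carrier W"
      then show "?g (t a \<odot>\<^bsub>TA UM W\<^esub> tp UM W u w) = a \<odot>\<^bsub>X\<^esub> ?g (tp UM W u w)"
        using a g[of u w] g[of u "t a \<odot>\<^bsub>W\<^esub> w"] \<beta>t[of a u w] by (simp add: t_tp)
    qed
    then show "?g (a \<odot>\<^bsub>resA (TA UM W)\<^esub> q) = a \<odot>\<^bsub>X\<^esub> ?g q" by simp
  qed simp
  have "p (?g q) = f q" if q: "q \<in> carrier (TA UM W)" for q
  proof (rule TA_ext[where f = "\<lambda>q. p (?g q)" and g = f, OF umod_UM W Y.abelian_group_axioms _ _ q])
    show "(\<lambda>q. p (?g q)) \<in> ahom (TA UM W) Y" by (rule ahom_compose[OF ga pl(1)])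
    show fa: "f \<in> ahom (TA UM W) Y" using fl(2,5) by (intro ahomI) simp_all
    fix u w assume "u \<in> carrier UM" and w: "w \<in> carrier W"
    then have u: "u \<in> carrier U" by simp
    have "p (\<beta> u w) = (\<Oplus>\<^bsub>Y\<^esub>j\<in>S u. p (G j (s (\<phi> j u) \<odot>\<^bsub>W\<^esub> w)))"
      unfolding \<beta>_def
      by (rule ahom_finsum[OF X.abelian_group_axioms Y.abelian_group_axioms pl(1) S(1)[OF u]]) (use u w c SU in \<open>auto simp: subset_iff\<close>)
    also have "\<dots> = (\<Oplus>\<^bsub>Y\<^esub>j\<in>S u. f (tp UM W (t (\<phi> j u) \<cdot> j) w))"
    proof (rule Y.add.finprod_cong')
      fix j assume "j \<in> S u"
      then have j: "j \<in> carrier U" using SU by blast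
      show "p (G j (s (\<phi> j u) \<odot>\<^bsub>W\<^esub> w)) = f (tp UM W (t (\<phi> j u) \<cdot> j) w)"
        using j u w \<phi>(1)[OF j u] by (simp add: pG tpUW_balance)
    next
      show "(\<lambda>j. f (tp UM W (t (\<phi> j u) \<cdot> j) w)) \<in> S u \<rightarrow> carrier Y"
        using u w SU \<phi>(1) by (auto simp: subset_iff intro!: fl(2))
    qed simp
    also have "\<dots> = f (tp UM W (\<Oplus>\<^bsub>U\<^esub>j\<in>S u. t (\<phi> j u) \<cdot> j) w)"
    proof (rule ahom_finsum[OF U.abelian_group_axioms Y.abelian_group_axioms _ S(1)[OF u], symmetric])
      show "(\<lambda>u. f (tp UM W u w)) \<in> ahom U Y"
        using w by (intro ahomI) (simp_all add: fl tpUW_add)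
      show "(\<lambda>j. t (\<phi> j u) \<cdot> j) \<in> S u \<rightarrow> carrier U" using u SU \<phi>(1) by (auto simp: subset_iff)
    qed
    also have "\<dots> = f (tp UM W u w)" using S(2)[OF u] by simp
    finally show "p (?g (tp UM W u w)) = f (tp UM W u w)" using g[OF u w] by simp
  qed
  then show "\<exists>g\<in>lin_maps Aop (resA (TA UM W)) X. \<forall>x\<in>carrier (resA (TA UM W)). p (g x) = f x"
    using gl by (intro bexI[of _ ?g]) simp_all
qed

lemma zero_lin: "[|umod X; umod Y|] ==> (\<lambda>x\<in>carrier X. \<zero>\<^bsub>Y\<^esub>) \<in> lin X Y"
proof -
  assume X: "umod X" and Y: "umod Y"
  interpret Y: abelian_group Y by (rule lmodule_group[OF Y])
  have "u \<odot>\<^bsub>Y\<^esub> \<zero>\<^bsub>Y\<^esub> = \<zero>\<^bsub>Y\<^esub>" if "u \<in> carrier U" for u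
    by (rule ahom_zero[OF Y.abelian_group_axioms Y.abelian_group_axioms smult_ahom[OF Y that]])
  then show ?thesis
    using X lmodule_group[OF X] by (intro lin_mapsI ahomI) (simp_all add: add_closed)
qed

lemma UM_minus_zero: "u \<in> carrier U ==> u \<ominus>\<^bsub>UM\<^esub> \<zero>\<^bsub>U\<^esub> = u"
proof -
  interpret Y: abelian_group UM by (rule lmodule_group[OF umod_UM])
  assume "u \<in> carrier U"
  then have "u \<in> carrier UM" by simp
  then have "u \<ominus>\<^bsub>UM\<^esub> \<zero>\<^bsub>UM\<^esub> = u"
    by (rule Y.diff_zero)
  then show ?thesis by simp
qed

lemma projective_UM: "projective U UM"
  unfolding projective_def
proof (intro conjI allI impI umod_UM; elim conjE)
  fix X Y :: "('w, 'w) module" and p f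
  assume X: "umod X" and Y: "umod Y" and p: "p \<in> lin X Y" and surj: "p ` carrier X = carrier Y" and f: "f \<in> lin UM Y"
  have "f \<one>\<^sub>U \<in> p ` carrier X" unfolding surj by (rule lin_mapsD(2)[OF f]) simp
  then obtain x where x: "x \<in> carrier X" "f \<one>\<^sub>U = p x" by blast
  have "(\<lambda>u\<in>carrier U. u \<odot>\<^bsub>X\<^esub> x) \<in> lin UM X"
    using X x by (intro lin_mapsI ahomI) (simp_all add: smult_l_distr smult_mult)
  moreover have "p (u \<odot>\<^bsub>X\<^esub> x) = f u" if "u \<in> carrier U" for u
    using that x lin_mapsD(4)[OF p that x(1)] lin_mapsD(4)[OF f that, of "\<one>\<^sub>U"] by simp
  ultimately show "\<exists>g\<in>lin UM X. \<forall>x\<in>carrier UM. p (g x) = f x"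
    by (intro bexI[of _ "\<lambda>u\<in>carrier U. u \<odot>\<^bsub>X\<^esub> x"]) simp_all
qed

lemma altsum_lin:
  assumes X: "umod X" and Y: "umod Y"
  shows "(\<And>i. i \<le> n ==> f i \<in> lin X Y) ==> (\<lambda>x\<in>carrier X. altsum Y n (\<lambda>i. f i x)) \<in> lin X Y"
proof (induction n arbitrary: f)
  case 0
  then have f: "f 0 \<in> lin X Y" by simp
  have "(\<lambda>x\<in>carrier X. altsum Y 0 (\<lambda>i. f i x)) = f 0"
    by (rule extensionalityI[OF _ lin_mapsD(3)[OF f]]) simp_all
  then show ?case using f by simp
next
  case (Suc n)
  have f: "f 0 \<in> lin X Y" using Suc.prems by simp
  have "(\<lambda>x\<in>carrier X. altsum Y n (\<lambda>i. f (Suc i) x)) \<in> lin X Y"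
    by (rule Suc.IH[of "\<lambda>i. f (Suc i)"]) (use Suc.prems in simp)
  from lin_maps_minus[OF X Y f this]
  show ?case by (rule back_subst[of "\<lambda>g. g \<in> lin X Y"]) (rule restrict_ext, simp)
qed

definition dif :: "nat \<Rightarrow> 'w \<Rightarrow> 'w"
  where "dif q = (\<lambda>w\<in>carrier (DD (Suc q)). altsum (DD q) (Suc q) (\<lambda>i. face q i w))"

lemma dif_lin: "dif q \<in> lin (DD (Suc q)) (DD q)"
  unfolding dif_def by (rule altsum_lin) (simp_all add: face_lin)

text \<open>Inserting \<open>1\<close> in front is a contracting homotopy (over \<open>A\<^sup>o\<^sup>p\<close>, not over \<open>U\<close>).\<close>

lemma dif_insert:
  assumes w: "w \<in> carrier (DD (Suc q))"
  shows "dif (Suc q) (tp UM (DD (Suc q)) \<one>\<^sub>U w) = w \<ominus>\<^bsub>DD (Suc q)\<^esub> tp UM (DD q) \<one>\<^sub>U (dif q w)"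
proof -
  have t1: "tp UM (DD q) \<one>\<^sub>U \<in> ahom (DD q) (DD (Suc q))"
    unfolding DD_Suc by (rule tp_ahom_right) simp_all
  have fc: "face q i w \<in> carrier (DD q)" for i using lin_mapsD(2)[OF face_lin w] .
  have "dif (Suc q) (tp UM (DD (Suc q)) \<one>\<^sub>U w) =
      w \<ominus>\<^bsub>DD (Suc q)\<^esub> altsum (DD (Suc q)) (Suc q) (\<lambda>i. tp UM (DD q) \<one>\<^sub>U (face q i w))"
    unfolding dif_def restrict_apply'[OF tpD_closed[OF U.one_closed w]] altsum.simps(2)[of _ "Suc q"]
    by (simp add: face_tp w del: altsum.simps)
  also have "altsum (DD (Suc q)) (Suc q) (\<lambda>i. tp UM (DD q) \<one>\<^sub>U (face q i w)) = tp UM (DD q) \<one>\<^sub>U (dif q w)"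
    unfolding dif_def restrict_apply'[OF w]
    by (rule altsum_hom[OF _ _ t1, symmetric]) (simp_all add: fc lmodule_group[OF umod_DD])
  finally show ?thesis .
qed

lemma dif_insert_0: "u \<in> carrier U ==> dif 0 (tpU H \<one>\<^sub>U u) = u \<ominus>\<^bsub>UM\<^esub> t (\<epsilon> u)"
  using tpD_closed[of "\<one>\<^sub>U" u 0] face_tp(1)[of "\<one>\<^sub>U" u 0] face_tp(2)[of "\<one>\<^sub>U" u 0] by (simp add: dif_def)

end

context left_hopf_setting
begin

text \<open>By the Galois isomorphism \<open>U \<otimes>\<^sub>A W\<close> is generated over \<open>U\<close> by the elements \<open>1 \<otimes> w\<close>.\<close>

lemma lin_TA_one_ext:
  assumes W: "umod W" and f: "f \<in> lin (TA UM W) Z" and g: "g \<in> lin (TA UM W) Z" and Z: "umod Z"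
    and e: "\<And>w. w \<in> carrier W ==> f (tp UM W \<one>\<^sub>U w) = g (tp UM W \<one>\<^sub>U w)"
  shows "f = g"
proof (rule lin_maps_eqI[OF f g])
  fix q assume q: "q \<in> carrier (TA UM W)"
  have c: "compose (carrier (Ind W)) h (galois W) \<in> lin (Ind W) Z" if "h \<in> lin (TA UM W) Z" for h
    by (rule lin_compose[OF _ galois_lin[OF W] that]) (simp add: W)
  have "compose (carrier (Ind W)) f (galois W) = compose (carrier (Ind W)) g (galois W)"
    by (rule lin_TO_ext[OF W c[OF f] c[OF g] Z]) (use W in \<open>simp add: compose_eq galois_tp e\<close>)
  moreover have i: "galois_inv W q \<in> carrier (Ind W)" by (rule lin_mapsD(2)[OF galois_inv_lin[OF W] q])
  ultimately show "f q = g q"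
    using compose_eq[OF i, of f "galois W"] compose_eq[OF i, of g "galois W"] galois_galois_inv[OF W q] by simp
qed

text \<open>Being induced from \<open>W\<close>, the module \<open>U \<otimes>\<^sub>A W\<close> has as linear maps to \<open>X\<close> the right \<open>A\<close>-linear maps from \<open>W\<close> to \<open>X\<close>.\<close>

lemma projective_TA_U:
  assumes W: "umod W" and PW: "projective Aop (resA W)"
  shows "projective U (TA UM W)"
  unfolding projective_def
proof (intro conjI allI impI; (elim conjE)?)
  note [simp] = W
  show "umod (TA UM W)" by simp
  fix X Y :: "('w, 'w) module" and p f
  assume X: "umod X" and Y: "umod Y" and p: "p \<in> lin X Y" and surj: "p ` carrier X = carrier Y" and f: "f \<in> lin (TA UM W) Y"
  have "(\<lambda>w\<in>carrier W. f (tp UM W \<one>\<^sub>U w)) \<in> lin_maps Aop (resA W) (resA Y)"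
    by (intro lin_mapsI ahomI)
      (use lmodule_group[OF W] in \<open>simp_all add: lin_mapsD[OF f] tpUW_add add_closed flip: t_tp lin_mapsD(4)[OF f]\<close>)
  from projectiveD[OF PW resA_lmodule[OF X] resA_lmodule[OF Y] resA_lin[OF p] _ this]
  obtain g where g: "g \<in> lin_maps Aop (resA W) (resA X)" and pg: "\<And>w. w \<in> carrier W ==> p (g w) = f (tp UM W \<one>\<^sub>U w)"
    using surj by auto
  note gl = lin_mapsD[OF g, simplified]
  have ga: "g \<in> ahom W X" using gl(2,5) by (intro ahomI) simp_all
  let ?h = "\<lambda>q\<in>carrier (Ind W). sw X (\<lambda>u w. u \<odot>\<^bsub>X\<^esub> g w) q"
  have h: "?h \<in> lin (Ind W) X" by (rule induced_lin(1)[OF W X ga]) (simp add: gl)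
  have hv: "?h (tpo W \<one>\<^sub>U w) = g w" if w: "w \<in> carrier W" for w
    using induced_lin(2)[OF W X ga gl(4) U.one_closed w] w gl(2)[OF w] X by simp
  let ?k = "compose (carrier (TA UM W)) ?h (galois_inv W)"
  have k: "?k \<in> lin (TA UM W) X" by (rule lin_compose[OF _ galois_inv_lin[OF W] h]) simp
  have "compose (carrier (TA UM W)) p ?k = f"
  proof (rule lin_TA_one_ext[OF W _ f Y])
    show "compose (carrier (TA UM W)) p ?k \<in> lin (TA UM W) Y" by (rule lin_compose[OF _ k p]) simp
    fix w assume w: "w \<in> carrier W"
    have "galois W (tpo W \<one>\<^sub>U w) = tp UM W \<one>\<^sub>U w" using w by (simp add: galois_tp)
    then have "galois_inv W (tp UM W \<one>\<^sub>U w) = tpo W \<one>\<^sub>U w"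
      using galois_inv_galois[OF W, of "tpo W \<one>\<^sub>U w"] w by simp
    then show "compose (carrier (TA UM W)) p ?k (tp UM W \<one>\<^sub>U w) = f (tp UM W \<one>\<^sub>U w)"
      using w hv[OF w] pg[OF w] by (simp add: compose_eq del: restrict_apply)
  qed
  then show "\<exists>g\<in>lin (TA UM W) X. \<forall>x\<in>carrier (TA UM W). p (g x) = f x"
    using k compose_eq[of _ "carrier (TA UM W)" p ?k] by (intro bexI[of _ ?k]) (simp_all del: restrict_apply)
qed

lemma tower_projective:
  assumes PU: "projective Aop (resA UM)"
  shows "projective Aop (resA (DD n))" "projective U (DD n)"
proof -
  show A: "projective Aop (resA (DD n))" for n
    by (induction n) (simp_all add: PU DD_Suc projective_TA)
  show "projective U (DD n)"
    by (cases n) (simp_all add: projective_UM DD_Suc projective_TA_U A)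
qed

abbreviation "aug \<equiv> restrict \<epsilon> (carrier U)"

lemma aug_dif: "w \<in> carrier (DD (Suc 0)) ==> aug (dif 0 w) = \<zero>\<^bsub>A\<^esub>"
proof -
  assume w: "w \<in> carrier (DD (Suc 0))"
  have c: "compose (carrier (UU H)) aug (dif 0) \<in> lin (UU H) AM"
    by (rule lin_compose[OF umod_TA[OF umod_UM umod_UM] dif_lin[of 0, unfolded DD_Suc DD.simps(1)] counit_lin])
  have z: "(\<lambda>x\<in>carrier (UU H). \<zero>\<^bsub>A\<^esub>) \<in> lin (UU H) AM"
    using zero_lin[OF umod_TA[OF umod_UM umod_UM] umod_AM] by simp
  have "compose (carrier (UU H)) aug (dif 0) = (\<lambda>x\<in>carrier (UU H). \<zero>\<^bsub>A\<^esub>)"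
  proof (rule lin_TA_one_ext[OF umod_UM c z umod_AM])
    fix u assume "u \<in> carrier UM"
    then have u: "u \<in> carrier U" by simp
    have e: "\<epsilon> \<in> ahom UM A" unfolding UM_hom by (rule counit_ahom)
    have "\<epsilon> (u \<ominus>\<^bsub>UM\<^esub> t (\<epsilon> u)) = \<epsilon> u \<ominus>\<^bsub>A\<^esub> \<epsilon> (t (\<epsilon> u))"
      by (rule ahom_minus[OF lmodule_group[OF umod_UM] A.abelian_group_axioms e]) (use u in simp_all)
    then have "\<epsilon> (u \<ominus>\<^bsub>UM\<^esub> t (\<epsilon> u)) = \<zero>\<^bsub>A\<^esub>"
      using u by (simp add: A.minus_eq A.r_neg)
    moreover have "u \<ominus>\<^bsub>UM\<^esub> t (\<epsilon> u) \<in> carrier U"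
      using u abelian_group.minus_closed[OF lmodule_group[OF umod_UM], of u "t (\<epsilon> u)"] by simp
    ultimately show "compose (carrier (UU H)) aug (dif 0) (tpU H \<one>\<^sub>U u) = (\<lambda>x\<in>carrier (UU H). \<zero>\<^bsub>A\<^esub>) (tpU H \<one>\<^sub>U u)"
      using u by (simp add: compose_eq dif_insert_0)
  qed
  then have "compose (carrier (UU H)) aug (dif 0) w = (\<lambda>x\<in>carrier (UU H). \<zero>\<^bsub>A\<^esub>) w" by (rule fun_cong)
  then show ?thesis using w by (simp add: compose_eq DD_Suc)
qed

text \<open>It suffices to check this on \<open>1 \<otimes> v\<close>, where the homotopy formula for \<open>dif\<close> reduces it to the preceding degree.\<close>

lemma dif_dif: "w \<in> carrier (DD (Suc (Suc q))) ==> dif q (dif (Suc q) w) = \<zero>\<^bsub>DD q\<^esub>"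
proof (induction q arbitrary: w rule: less_induct)
  case (less q)
  interpret D: abelian_group "DD q" by (rule lmodule_group[OF umod_DD])
  interpret D': abelian_group "DD (Suc q)" by (rule lmodule_group[OF umod_DD])
  let ?c = "compose (carrier (DD (Suc (Suc q)))) (dif q) (dif (Suc q))" and ?z = "\<lambda>x\<in>carrier (DD (Suc (Suc q))). \<zero>\<^bsub>DD q\<^esub>"
  have c: "?c \<in> lin (DD (Suc (Suc q))) (DD q)" by (rule lin_compose[OF _ dif_lin dif_lin]) simp
  have z: "?z \<in> lin (DD (Suc (Suc q))) (DD q)"
    by (rule zero_lin) simp_all
  have "?c = ?z"
  proof (rule lin_TA_one_ext[OF umod_DD c[unfolded DD_Suc[of "Suc q"]] z[unfolded DD_Suc[of "Suc q"]] umod_DD, folded DD_Suc])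
    fix v assume v: "v \<in> carrier (DD (Suc q))"
    have dv: "dif q v \<in> carrier (DD q)" by (rule lin_mapsD(2)[OF dif_lin v])
    have tc: "tp UM (DD q) \<one>\<^sub>U (dif q v) \<in> carrier (DD (Suc q))" using dv by simp
    have i: "dif q (tp UM (DD q) \<one>\<^sub>U (dif q v)) = dif q v"
    proof (cases q)
      case 0
      have e: "\<epsilon> (dif 0 v) = \<zero>\<^bsub>A\<^esub>" using aug_dif[of v] v dv 0 by simp
      have "t \<zero>\<^bsub>A\<^esub> = \<zero>\<^bsub>UM\<^esub>"
        using ahom_zero[OF A.abelian_group_axioms U.abelian_group_axioms, of t] by (simp add: ahomI t_add)
      then show ?thesis using 0 dv e by (simp add: dif_insert_0 UM_minus_zero)
    next
      case (Suc r)
      have "tp UM (DD r) \<one>\<^sub>U \<zero>\<^bsub>DD r\<^esub> = \<zero>\<^bsub>DD q\<^esub>"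
        unfolding Suc DD_Suc
        by (rule ahom_zero[OF _ _ tp_ahom_right]) (simp_all add: lmodule_group[OF umod_DD])
      then show ?thesis
        using dif_insert[OF dv[unfolded Suc]] less.IH[of r v] v Suc dv D.diff_zero[OF dv] by simp
    qed
    have "dif q (dif (Suc q) (tp UM (DD (Suc q)) \<one>\<^sub>U v)) = dif q v \<ominus>\<^bsub>DD q\<^esub> dif q v"
      unfolding dif_insert[OF v]
      using ahom_minus[OF D'.abelian_group_axioms D.abelian_group_axioms lin_mapsD(1)[OF dif_lin] v tc] i by simp
    then show "?c (tp UM (DD (Suc q)) \<one>\<^sub>U v) = ?z (tp UM (DD (Suc q)) \<one>\<^sub>U v)"
      using v dv by (simp add: compose_eq D.minus_eq D.r_neg)
  qed
  then have "?c w = ?z w" by (rule fun_cong)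
  then show ?case using less.prems by (simp add: compose_eq)
qed

text \<open>A cycle \<open>w\<close> is the boundary of \<open>1 \<otimes> w\<close>.\<close>

theorem tower_resolution:
  assumes PU: "projective Aop (resA UM)"
  shows "projective_resolution U AM DD dif aug"
  unfolding projective_resolution_def
proof (intro conjI allI tower_projective[OF PU] dif_lin)
  have t0: "t \<zero>\<^bsub>A\<^esub> = \<zero>\<^bsub>UM\<^esub>"
    using ahom_zero[OF A.abelian_group_axioms U.abelian_group_axioms, of t] by (simp add: ahomI t_add)
  show "aug \<in> lin (DD 0) AM" using counit_lin by simp
  show "aug ` carrier (DD 0) = carrier AM"
  proof
    show "carrier AM \<subseteq> aug ` carrier (DD 0)"
    proof
      fix a assume "a \<in> carrier AM"
      then show "a \<in> aug ` carrier (DD 0)" by (intro image_eqI[of _ _ "s a"]) simp_all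
    qed
  qed auto
  show "a_kernel (DD 0) AM aug = dif 0 ` carrier (DD (Suc 0))"
  proof (rule subset_antisym; rule subsetI)
    fix u assume "u \<in> a_kernel (DD 0) AM aug"
    then have u: "u \<in> carrier U" "\<epsilon> u = \<zero>\<^bsub>A\<^esub>" by (auto simp: a_kernel_def')
    then have "dif 0 (tpU H \<one>\<^sub>U u) = u" using t0 by (simp add: dif_insert_0 UM_minus_zero)
    then show "u \<in> dif 0 ` carrier (DD (Suc 0))"
      using u tpD_closed[of "\<one>\<^sub>U" u 0] by (intro image_eqI[of _ _ "tpU H \<one>\<^sub>U u"]) simp_all
  next
    fix u assume "u \<in> dif 0 ` carrier (DD (Suc 0))"
    then show "u \<in> a_kernel (DD 0) AM aug"
      using aug_dif lin_mapsD(2)[OF dif_lin, of _ 0] by (auto simp: a_kernel_def')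
  qed
  fix n
  show "a_kernel (DD (Suc n)) (DD n) (dif n) = dif (Suc n) ` carrier (DD (Suc (Suc n)))"
  proof (rule subset_antisym; rule subsetI)
    interpret D: abelian_group "DD (Suc n)" by (rule lmodule_group[OF umod_DD])
    fix w assume "w \<in> a_kernel (DD (Suc n)) (DD n) (dif n)"
    then have w: "w \<in> carrier (DD (Suc n))" "dif n w = \<zero>\<^bsub>DD n\<^esub>" by (auto simp: a_kernel_def')
    have "tp UM (DD n) \<one>\<^sub>U \<zero>\<^bsub>DD n\<^esub> = \<zero>\<^bsub>DD (Suc n)\<^esub>"
      unfolding DD_Suc by (rule ahom_zero[OF _ _ tp_ahom_right]) (simp_all add: lmodule_group[OF umod_DD])
    then have "dif (Suc n) (tp UM (DD (Suc n)) \<one>\<^sub>U w) = w"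
      using dif_insert[OF w(1)] w D.diff_zero by simp
    then show "w \<in> dif (Suc n) ` carrier (DD (Suc (Suc n)))"
      using w by (intro image_eqI[of _ _ "tp UM (DD (Suc n)) \<one>\<^sub>U w"]) simp_all
  next
    fix w assume "w \<in> dif (Suc n) ` carrier (DD (Suc (Suc n)))"
    then show "w \<in> a_kernel (DD (Suc n)) (DD n) (dif n)"
      using dif_dif lin_mapsD(2)[OF dif_lin] by (auto simp: a_kernel_def')
  qed
qed

end

section \<open>The cochain complex computes Ext\<close>

lemma is_linear_iso_inv:
  assumes X: "Module.module K X" and f: "is_linear_iso K X Y f"
  shows "is_linear K Y X (the_inv_into (carrier X) f)"
proof -
  have id: "is_linear K X X (\<lambda>x. x)" by (simp add: is_linear_def hom_def)
  show ?thesis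
    by (rule is_linear_transport[OF X id f id]) (use f in \<open>auto simp: is_linear_iso_def bij_betw_def the_inv_into_f_f\<close>)
qed

lemma modules_isomorphic_trans:
  "[|modules_isomorphic K X Y; modules_isomorphic K Y Z|] ==> modules_isomorphic K X Z"
  unfolding modules_isomorphic_def is_linear_iso_def
  by (blast intro: is_linear_compose bij_betw_trans[unfolded comp_def])

context aYD_setting
begin

text \<open>\<open>Psi\<close> is additive and commutes with the individual cofaces, so the alternating sum may be moved into the argument of \<open>F\<close>.\<close>

lemma differential_Psi:
  assumes F: "F \<in> lin (DD q) M"
  shows "cosimplicial_differential (cochains H M) (coface H M) q (Psi q F) =
    Psi (Suc q) (precomp (DD (Suc q)) (DD q) (dif q) F)"
proof -
  let ?C = "cochains H M (Suc q)" and ?D = "HomU H M (DD (Suc q))"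
  interpret C: Module.module K ?C by (rule cochains_module)
  interpret D: Module.module K ?D by (rule HomU_module) simp_all
  interpret M: abelian_group M by (rule lmodule_group[OF umod_M])
  have dl: "dcoface q i F \<in> lin (DD (Suc q)) M" for i by (rule dcoface_lin[OF F])
  have cf: "coface H M q i (Psi q F) = Psi (Suc q) (dcoface q i F)" if "i \<le> Suc q" for i
    using coface_Psi[OF _ F, of i] that by (simp del: Upow.simps)
  have "cosimplicial_differential (cochains H M) (coface H M) q (Psi q F) =
      altsum ?C (Suc q) (\<lambda>i. coface H M q i (Psi q F))"
    unfolding cosimplicial_differential_def Suc_eq_plus1[symmetric]
    by (rule C.altsum_finsum) (simp add: cf Psi_AH dl del: Upow.simps)
  also have "\<dots> = altsum ?C (Suc q) (\<lambda>i. Psi (Suc q) (dcoface q i F))"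
    by (rule altsum_cong) (rule cf)
  also have "\<dots> = Psi (Suc q) (altsum ?D (Suc q) (\<lambda>i. dcoface q i F))"
    using Psi_linear[of "Suc q"] unfolding is_linear_iso_def
    by (intro altsum_hom[OF D.abelian_group_axioms C.abelian_group_axioms, symmetric] is_linearD(1)) (auto simp: dl)
  also have "altsum ?D (Suc q) (\<lambda>i. dcoface q i F) = precomp (DD (Suc q)) (DD q) (dif q) F"
  proof (rule lin_maps_eqI)
    show "altsum ?D (Suc q) (\<lambda>i. dcoface q i F) \<in> lin (DD (Suc q)) M"
      using altsum_closed[OF D.abelian_group_axioms, of "Suc q" "\<lambda>i. dcoface q i F"] dl by simp
    show "precomp (DD (Suc q)) (DD q) (dif q) F \<in> lin (DD (Suc q)) M"
      unfolding precomp_def by (rule lin_compose[OF _ dif_lin F]) simp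
    fix w assume w: "w \<in> carrier (DD (Suc q))"
    have ev: "(\<lambda>f. f w) \<in> ahom ?D M" by (rule ahomI) (use w in \<open>simp_all add: lin_mapsD\<close>)
    have "altsum ?D (Suc q) (\<lambda>i. dcoface q i F) w = altsum M (Suc q) (\<lambda>i. dcoface q i F w)"
      by (rule altsum_hom[OF D.abelian_group_axioms M.abelian_group_axioms ev]) (simp add: dl)
    also have "\<dots> = altsum M (Suc q) (\<lambda>i. F (face q i w))"
      by (rule altsum_cong) (simp add: dcoface_eval w)
    also have "\<dots> = F (altsum (DD q) (Suc q) (\<lambda>i. face q i w))"
      by (rule altsum_hom[OF _ M.abelian_group_axioms lin_mapsD(1)[OF F], symmetric])
        (simp_all add: lmodule_group[OF umod_DD] lin_mapsD(2)[OF face_lin w])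
    finally show "altsum ?D (Suc q) (\<lambda>i. dcoface q i F) w = precomp (DD (Suc q)) (DD q) (dif q) F w"
      using w by (simp add: precomp_def compose_eq dif_def)
  qed
  finally show ?thesis .
qed

theorem cochains_compute_Ext:
  assumes P: "projective (op_ring A) (U_right_A H)"
  shows "modules_isomorphic K
    (cohomology (cochains H M) (cosimplicial_differential (cochains H M) (coface H M)) n) (ExtU H AM M n)"
proof (rule modules_isomorphic_trans)
  let ?C = "cochains H M" and ?D = "\<lambda>n. HomU H M (DD n)"
  let ?d = "cosimplicial_differential ?C (coface H M)" and ?\<delta> = "\<lambda>n. precomp (DD (Suc n)) (DD n) (dif n)"
  let ?\<Phi> = "\<lambda>n. the_inv_into (carrier (?D n)) (Psi n)"
  have D: "Module.module K (?D n)" for n by (rule HomU_module) simp_all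
  have \<delta>: "is_linear K (?D n) (?D (Suc n)) (?\<delta> n)" for n by (rule precomp_lin) (simp_all add: dif_lin)
  have \<Psi>: "is_linear K (?D n) (?C n) (Psi n)" for n using Psi_linear[of n] by (simp only: is_linear_iso_def)
  have \<Phi>: "is_linear K (?C n) (?D n) (?\<Phi> n)" for n by (rule is_linear_iso_inv[OF D Psi_linear])
  have d\<Psi>: "?d n (Psi n F) = Psi (Suc n) (?\<delta> n F)" if "F \<in> carrier (?D n)" for n F
    using differential_Psi[of F n] that by simp
  have d: "is_linear K (?C n) (?C (Suc n)) (?d n)" for n
    by (rule is_linear_transport[OF D[of n] \<delta>[of n] Psi_linear[of n] \<Psi>[of "Suc n"]]) (rule d\<Psi>)
  have inj: "inj_on (Psi n) (carrier (?D n))" and im: "Psi n ` carrier (?D n) = carrier (?C n)" for n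
    using Psi_linear[of n] by (auto simp: is_linear_iso_def bij_betw_def)
  have \<Phi>\<Psi>: "?\<Phi> n (Psi n F) = F" if "F \<in> carrier (?D n)" for n F by (rule the_inv_into_f_f[OF inj that])
  have \<Psi>\<Phi>: "Psi n (?\<Phi> n f) = f" if "f \<in> carrier (?C n)" for n f
    by (rule f_the_inv_into_f[OF inj]) (use that im in auto)
  show "modules_isomorphic K (cohomology ?C ?d n) (cohomology ?D ?\<delta> n)"
  proof (rule cohomology_homotopy_iso[where f = ?\<Phi> and g = Psi])
    show "?\<delta> n (?\<Phi> n f) = ?\<Phi> (Suc n) (?d n f)" if f: "f \<in> carrier (?C n)" for n f
    proof -
      have F: "?\<Phi> n f \<in> carrier (?D n)" by (rule is_linearD(2)[OF \<Phi> f])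
      show ?thesis
        using \<Phi>\<Psi>[OF is_linearD(2)[OF \<delta> F]] unfolding d\<Psi>[OF F, unfolded \<Psi>\<Phi>[OF f]] by (rule sym)
    qed
    show "Psi n (?\<Phi> n f) \<ominus>\<^bsub>?C n\<^esub> f \<in> boundaries ?C ?d n" if "f \<in> a_kernel (?C n) (?C (Suc n)) (?d n)" for n f
    proof -
      interpret C: Module.module K "?C n" by (rule cochains_module)
      have f: "f \<in> carrier (?C n)" using that unfolding a_kernel_def' by blast
      have "Psi n (?\<Phi> n f) \<ominus>\<^bsub>?C n\<^esub> f = \<zero>\<^bsub>?C n\<^esub>"
        unfolding \<Psi>\<Phi>[OF f] C.minus_eq by (rule C.r_neg[OF f])
      then show ?thesis
        using submodule_boundaries[where C = ?C and d = ?d, OF cochains_module d, of n] by (simp only: submodule_set_def simp_thms)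
    qed
    show "?\<Phi> n (Psi n F) \<ominus>\<^bsub>?D n\<^esub> F \<in> boundaries ?D ?\<delta> n" if "F \<in> a_kernel (?D n) (?D (Suc n)) (?\<delta> n)" for n F
    proof -
      interpret D: Module.module K "?D n" by (rule D)
      have F: "F \<in> carrier (?D n)" using that unfolding a_kernel_def' by blast
      have "?\<Phi> n (Psi n F) \<ominus>\<^bsub>?D n\<^esub> F = \<zero>\<^bsub>?D n\<^esub>"
        unfolding \<Phi>\<Psi>[OF F] D.minus_eq by (rule D.r_neg[OF F])
      then show ?thesis
        using submodule_boundaries[where C = ?D and d = ?\<delta>, OF D \<delta>, of n] by (simp only: submodule_set_def)
    qed
  qed (rule cochains_module d D \<delta> \<Phi> \<Psi> d\<Psi>; assumption)+
  show "modules_isomorphic K (cohomology ?D ?\<delta> n) (ExtU H AM M n)"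
    by (rule Ext_resolution[OF umod_AM umod_M tower_resolution]) (use P in \<open>simp add: U_right_A_resA\<close>)
qed

end

theorem theorem1p2:
  fixes K :: "'k ring"
    and H :: "('k, 'w::infinite) bialgebroid"
    and M :: "('w, 'w) module"
    and \<gamma> :: "('w \<Rightarrow> 'w) \<Rightarrow> 'w"
  assumes bialgebroid: "left_bialgebroid K H"
    and hopf: "left_hopf H"
    and aYD: "aYD_contramodule H M \<gamma>"
    and stable: "stable_contramodule H M \<gamma>"
  shows "trace_functor K (UMod H) (HomU H M) precomp (trace_map H M \<gamma>) \<and>
    (\<forall>X Y. lmodule (Tot H) X \<and> lmodule (Tot H) Y \<longrightarrow>
       is_linear_iso K (HomU H M (tensA H X Y)) (HomU H M (tensA H Y X)) (trace_map H M \<gamma> X Y) \<and>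
       (\<forall>f\<in>carrier (HomU H M (tensA H X Y)). \<forall>x\<in>carrier X. \<forall>y\<in>carrier Y.
          trace_map H M \<gamma> X Y f (tpA H Y X y x) =
            \<gamma> (\<lambda>u\<in>carrier (Tot H). f (tpA H X Y x (u \<odot>\<^bsub>Y\<^esub> y))))) \<and>
    (\<forall>q\<ge>1. \<forall>f\<in>carrier (cochains H M q).
       cyclic_op H M \<gamma> q f =
         theta H M q (chi H M q (trace_map H M \<gamma> (regular_module H) (Upow H q)
           (eta_inv H M q (theta_inv H M q f)))) \<and>
       (\<forall>us\<in>words H q. cyclic_op H M \<gamma> q f (word H us) = tau_value H M \<gamma> f us)) \<and>
    cocyclic_module K (cochains H M) (coface H M) (codegen H M) (cyclic_op H M \<gamma>) \<and>
    (projective (op_ring (Base H)) (U_right_A H) \<longrightarrow>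
       (\<forall>n. modules_isomorphic K
         (cohomology (cochains H M) (cosimplicial_differential (cochains H M) (coface H M)) n)
         (ExtU H (unit_module H) M n)))"
proof -
  interpret aYD_setting K H M \<gamma>
    using assms by (simp add: aYD_setting_def aYD_setting_axioms_def left_hopf_setting_def left_hopf_setting_axioms_def
        bialgebroid_setting_def)
  show ?thesis
  proof (intro conjI allI impI ballI; (elim conjE)?)
    fix X Y :: "('w, 'w) module"
    assume XY: "lmodule (Tot H) X" "lmodule (Tot H) Y"
    show "is_linear_iso K (HomU H M (tensA H X Y)) (HomU H M (tensA H Y X)) (trace_map H M \<gamma> X Y)"
      by (rule trace_linear_iso[OF XY])
    fix f x y assume "f \<in> carrier (HomU H M (tensA H X Y))" "x \<in> carrier X" "y \<in> carrier Y"
    then show "trace_map H M \<gamma> X Y f (tpA H Y X y x) = \<gamma> (\<lambda>u\<in>carrier (Tot H). f (tpA H X Y x (u \<odot>\<^bsub>Y\<^esub> y)))"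
      unfolding HomU_simps by (rule trace_tp[OF XY])
  qed (rule HomU_trace_functor cyclic_op_trace cochains_cocyclic cochains_compute_Ext; assumption)+
qed

end
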